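(* Let $k=\mathbb C$, let $\mathcal D_H$ be a left $H$-category and $M$ a right-left SAYD module over $H$. An element $\phi \in C^n_H(\mathcal{D}_H,M)$ is a coboundary (i.e. $\phi\in B^n_H(\mathcal D_H,M)$) if and only if $\phi$ is the character of an $n$-dimensional vanishing cycle $(\mathcal{S}_H,\hat{\partial}_H, \hat{\mathscr{T}}^H,\rho)$ over $\mathcal{D}_H$ with coefficients in $M$.
   Context: $k=\mathbb C$; $H$ is a Hopf algebra over $k$ with coproduct $\Delta(h)=h_1\otimes h_2$, counit $\varepsilon$, bijective antipode $S$. A semicategory is like a category but possibly without identity morphisms; a semifunctor preserves composition (not necessarily identities). A left $H$-semicategory is a small $k$-linear semicategory with each Hom a left $H$-module and $h(gf)=(h_1g)(h_2f)$; a left $H$-category is a small $k$-linear category with these properties and $h(id_X)=\varepsilon(h)id_X$. A right-left SAYD module is a right $H$-module and left $H$-comodule $M$, $m\mapsto m_{(-1)}\otimes m_{(0)}$, with $(mh)_{(-1)}\otimes(mh)_{(0)}=S(h_3)m_{(-1)}h_1\otimes m_{(0)}h_2$ and $m_{(0)}m_{(-1)}=m$. $CN_n(\mathcal D_H)=\bigoplus_{(X_0,\ldots,X_n)}Hom_{\mathcal D_H}(X_1,X_0)\otimes\ldots\otimes Hom_{\mathcal D_H}(X_0,X_n)$ with diagonal $H$-action; $C^n_H(\mathcal D_H,M)$ is the space of $k$-linear $\phi:M\otimes CN_n(\mathcal D_H)\to k$ with $\phi(mh_1\otimes S(h_2)(f^0\otimes\ldots\otimes f^n))=\varepsilon(h)\phi(m\otimes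 f^0\otimes\ldots\otimes f^n)$; $(\delta_i\phi)(m\otimes f^0\otimes\ldots\otimes f^n)=\phi(m\otimes\ldots\otimes f^if^{i+1}\otimes\ldots\otimes f^n)$ for $0\le i\le n-1$, $(\delta_n\phi)(m\otimes f^0\otimes\ldots\otimes f^n)=\phi(m_{(0)}\otimes(S^{-1}(m_{(-1)})f^n)f^0\otimes f^1\otimes\ldots\otimes f^{n-1})$, $(\tau_n\phi)(m\otimes f^0\otimes\ldots\otimes f^n)=\phi(m_{(0)}\otimes S^{-1}(m_{(-1)})f^n\otimes f^0\otimes\ldots\otimes f^{n-1})$. Hopf-cyclic cohomology is the cohomology of the complex $C^n_\lambda=\{\phi\in C^n_H(\mathcal D_H,M):\phi=(-1)^n\tau_n\phi\}$ with differential $b=\sum_{i=0}^{n+1}(-1)^i\delta_i$; $B^n_H(\mathcal D_H,M)=b(C^{n-1}_\lambda)$ (zero for $n=0$). A left DGH-semicategory $(\mathcal S_H,\hat\partial_H)$ is a left $H$-semicategory whose Homs are cochain complexes $(Hom^n_{\mathcal S_H}(X,Y),\hat\partial^n_H)_{n\ge0}$ of left $H$-modules with $H$-linear differentials, composition being additive on degrees and satisfying $\hat\partial(gf)=\hat\partial(g)f+(-1)^{\deg g}g\hat\partial(f)$. $\mathcal S^0_H$ is the left $H$-semicategory with the same objects and $Hom_{\mathcal S^0_H}=Hom^0_{\mathcal S_H}$. A closed graded $(H,M)$-trace of dimension $n$ on $\mathcal S_H$ is a collection of $k$-linear maps $\hat{\mathscr T}^H_X:M\otimes Hom^n_{\mathcal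 S_H}(X,X)\to k$ with: $\hat{\mathscr T}^H_X(mh_1\otimes S(h_2)f)=\varepsilon(h)\hat{\mathscr T}^H_X(m\otimes f)$; $\hat{\mathscr T}^H_X(m\otimes\hat\partial_H^{n-1}(f'))=0$; $\hat{\mathscr T}^H_X(m\otimes g'g)=(-1)^{ij}\hat{\mathscr T}^H_Y(m_{(0)}\otimes(S^{-1}(m_{(-1)})g)g')$ for $g\in Hom^i_{\mathcal S_H}(X,Y)$, $g'\in Hom^j_{\mathcal S_H}(Y,X)$, $i+j=n$. An $n$-dimensional cycle over $\mathcal D_H$ with coefficients in $M$ is a tuple $(\mathcal S_H,\hat\partial_H,\hat{\mathscr T}^H,\rho)$ of a left DGH-semicategory, such a trace, and an $H$-linear semifunctor $\rho:\mathcal D_H\to\mathcal S^0_H$. Its character is $\phi(m\otimes f^0\otimes\ldots\otimes f^n)=\hat{\mathscr T}^H_{\rho(X_0)}(m\otimes\rho(f^0)\hat\partial^0_H(\rho(f^1))\ldots\hat\partial^0_H(\rho(f^n)))$ for $f^0\otimes\ldots\otimes f^n\in Hom_{\mathcal D_H}(X_1,X_0)\otimes\ldots\otimes Hom_{\mathcal D_H}(X_0,X_n)$. The cycle is vanishing if $\mathcal S^0_H$ is a left $H$-category and there exist an $H$-linear semifunctor $\upsilon:\mathcal S^0_H\to\mathcal S^0_H$ with $\upsilon(X)=X$ for all objects, and a family $\eta=\{\eta(X)\}_X$ of automorphisms $\eta(X)$ of $X$ in $\mathcal S^0_H\otimes M_2(k)$ with $h(\eta(X))=\varepsilon(h)\eta(X)$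 for all $h\in H$, such that $\eta(Y)\circ(f\otimes E_{11}+\upsilon(f)\otimes E_{22})\circ\eta(X)^{-1}=\upsilon(f)\otimes E_{22}$ for all $f\in Hom_{\mathcal S^0_H}(X,Y)$. Here $\mathcal S^0_H\otimes M_2(k)$ has the same objects, $Hom(X,Y)=Hom_{\mathcal S^0_H}(X,Y)\otimes M_2(k)$, and $h(f\otimes B)=hf\otimes B$. *)

theory Defs
  imports "HOL-Analysis.Analysis" "HOL-Library.Poly_Mapping"
begin

section \<open>Complex vector spaces\<close>

class complex_vector = ab_group_add +
  fixes scaleC :: "complex \<Rightarrow> 'a \<Rightarrow> 'a" (infixr \<open>*\<^sub>C\<close> 75)
  assumes scaleC_add_right: "a *\<^sub>C (x + y) = a *\<^sub>C x + a *\<^sub>C y"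
    and scaleC_add_left: "(a + b) *\<^sub>C x = a *\<^sub>C x + b *\<^sub>C x"
    and scaleC_scaleC: "a *\<^sub>C (b *\<^sub>C x) = (a * b) *\<^sub>C x"
    and scaleC_one: "1 *\<^sub>C x = x"

interpretation complex_vector: vector_space "scaleC :: complex \<Rightarrow> 'a \<Rightarrow> 'a::complex_vector"
  by unfold_locales (rule scaleC_add_right scaleC_add_left scaleC_scaleC scaleC_one)+

class complex_algebra_1 = complex_vector + ring_1 +
  assumes mult_scaleC_left: "(a *\<^sub>C x) * y = a *\<^sub>C (x * y)"
    and mult_scaleC_right: "x * (a *\<^sub>C y) = a *\<^sub>C (x * y)"

instantiation complex :: complex_algebra_1
begin
definition scaleC_complex :: "complex \<Rightarrow> complex \<Rightarrow> complex" where
  "scaleC_complex a x = a * x"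
instance
  by standard (simp_all add: scaleC_complex_def algebra_simps)
end

instantiation vec :: (complex_vector, finite) complex_vector
begin
definition scaleC_vec :: "complex \<Rightarrow> ('a, 'b) vec \<Rightarrow> ('a, 'b) vec" where
  "scaleC_vec a x = (\<chi> i. a *\<^sub>C (x $ i))"
instance
  by standard
    (simp_all add: scaleC_vec_def vec_eq_iff scaleC_add_right scaleC_add_left scaleC_scaleC scaleC_one)
end

instantiation poly_mapping :: (type, complex_vector) complex_vector
begin
lift_definition scaleC_poly_mapping :: "complex \<Rightarrow> ('a \<Rightarrow>\<^sub>0 'b) \<Rightarrow> ('a \<Rightarrow>\<^sub>0 'b)"
  is "\<lambda>c f k. c *\<^sub>C f k"
proof -
  fix c :: complex and f :: "'a \<Rightarrow> 'b"
  assume "finite {k. f k \<noteq> 0}"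
  moreover have "{k. c *\<^sub>C f k \<noteq> 0} \<subseteq> {k. f k \<noteq> 0}" by auto
  ultimately show "finite {k. c *\<^sub>C f k \<noteq> 0}" by (rule rev_finite_subset)
qed
instance
  by standard
    (transfer, simp add: fun_eq_iff scaleC_add_right scaleC_add_left scaleC_scaleC scaleC_one)+
end

definition clinear_on :: "'a::complex_vector set \<Rightarrow> ('a \<Rightarrow> 'b::complex_vector) \<Rightarrow> bool" where
  "clinear_on A f \<longleftrightarrow>
     (\<forall>x\<in>A. \<forall>y\<in>A. f (x + y) = f x + f y) \<and> (\<forall>c. \<forall>x\<in>A. f (c *\<^sub>C x) = c *\<^sub>C f x)"

definition cbilinear_on ::
  "'a::complex_vector set \<Rightarrow> 'b::complex_vector set \<Rightarrow> ('a \<Rightarrow> 'b \<Rightarrow> 'c::complex_vector) \<Rightarrow> bool" where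
  "cbilinear_on A B f \<longleftrightarrow>
     (\<forall>a\<in>A. clinear_on B (f a)) \<and> (\<forall>b\<in>B. clinear_on A (\<lambda>a. f a b))"

section \<open>Tensor products over the complex numbers\<close>

text \<open>The free vector space on pairs, modulo the bilinearity relations.\<close>

definition tensor_relators :: "('a::complex_vector \<times> 'b::complex_vector \<Rightarrow>\<^sub>0 complex) set" where
  "tensor_relators =
     {Poly_Mapping.single (a + a', b) 1 - Poly_Mapping.single (a, b) 1 - Poly_Mapping.single (a', b) 1 | a a' b. True} \<union>
     {Poly_Mapping.single (a, b + b') 1 - Poly_Mapping.single (a, b) 1 - Poly_Mapping.single (a, b') 1 | a b b'. True} \<union>
     {Poly_Mapping.single (c *\<^sub>C a, b) 1 - c *\<^sub>C Poly_Mapping.single (a, b) 1 | c a b. True} \<union>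
     {Poly_Mapping.single (a, c *\<^sub>C b) 1 - c *\<^sub>C Poly_Mapping.single (a, b) 1 | c a b. True}"

definition tensor_eq ::
  "('a::complex_vector \<times> 'b::complex_vector \<Rightarrow>\<^sub>0 complex) \<Rightarrow> ('a \<times> 'b \<Rightarrow>\<^sub>0 complex) \<Rightarrow> bool" where
  "tensor_eq p q \<longleftrightarrow> p - q \<in> complex_vector.span tensor_relators"

lemma equivp_tensor_eq:
  "equivp (tensor_eq :: ('a::complex_vector \<times> 'b::complex_vector \<Rightarrow>\<^sub>0 complex) \<Rightarrow> _)" (is "equivp ?R")
proof (rule equivpI)
  show "reflp ?R"
    by (rule reflpI) (simp add: tensor_eq_def complex_vector.span_zero)
  show "symp ?R"
  proof (rule sympI)
    fix x y :: "'a \<times> 'b \<Rightarrow>\<^sub>0 complex"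
    assume "tensor_eq x y"
    then have "- (x - y) \<in> complex_vector.span tensor_relators"
      unfolding tensor_eq_def by (rule complex_vector.span_neg)
    then show "tensor_eq y x" by (simp add: tensor_eq_def)
  qed
  show "transp ?R"
  proof (rule transpI)
    fix x y z :: "'a \<times> 'b \<Rightarrow>\<^sub>0 complex"
    assume "tensor_eq x y" "tensor_eq y z"
    then have "(x - y) + (y - z) \<in> complex_vector.span tensor_relators"
      unfolding tensor_eq_def by (rule complex_vector.span_add)
    moreover have "(x - y) + (y - z) = x - z" by (simp add: algebra_simps)
    ultimately show "tensor_eq x z" by (simp add: tensor_eq_def)
  qed
qed

quotient_type (overloaded) ('a, 'b) tensor =
  "'a::complex_vector \<times> 'b::complex_vector \<Rightarrow>\<^sub>0 complex" / tensor_eq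
  by (rule equivp_tensor_eq)

instantiation tensor :: (complex_vector, complex_vector) complex_vector
begin

lift_definition zero_tensor :: "('a, 'b) tensor" is 0 .

lift_definition plus_tensor :: "('a, 'b) tensor \<Rightarrow> ('a, 'b) tensor \<Rightarrow> ('a, 'b) tensor" is "(+)"
proof -
  fix p p' q q' :: "'a \<times> 'b \<Rightarrow>\<^sub>0 complex"
  assume "tensor_eq p p'" "tensor_eq q q'"
  then have "(p - p') + (q - q') \<in> complex_vector.span tensor_relators"
    unfolding tensor_eq_def by (rule complex_vector.span_add)
  then show "tensor_eq (p + q) (p' + q')"
    unfolding tensor_eq_def add_diff_add .
qed

lift_definition uminus_tensor :: "('a, 'b) tensor \<Rightarrow> ('a, 'b) tensor" is uminus
proof -
  fix p p' :: "'a \<times> 'b \<Rightarrow>\<^sub>0 complex"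
  assume "tensor_eq p p'"
  then have "- (p - p') \<in> complex_vector.span tensor_relators"
    unfolding tensor_eq_def by (rule complex_vector.span_neg)
  then show "tensor_eq (- p) (- p')"
    unfolding tensor_eq_def minus_diff_minus .
qed

lift_definition minus_tensor :: "('a, 'b) tensor \<Rightarrow> ('a, 'b) tensor \<Rightarrow> ('a, 'b) tensor" is "(-)"
proof -
  fix p p' q q' :: "'a \<times> 'b \<Rightarrow>\<^sub>0 complex"
  assume "tensor_eq p p'" "tensor_eq q q'"
  then have "(p - p') - (q - q') \<in> complex_vector.span tensor_relators"
    unfolding tensor_eq_def by (rule complex_vector.span_diff)
  moreover have "(p - p') - (q - q') = (p - q) - (p' - q')" by (simp add: algebra_simps)
  ultimately show "tensor_eq (p - q) (p' - q')" by (simp add: tensor_eq_def)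
qed

lift_definition scaleC_tensor :: "complex \<Rightarrow> ('a, 'b) tensor \<Rightarrow> ('a, 'b) tensor" is "scaleC"
proof -
  fix c and p p' :: "'a \<times> 'b \<Rightarrow>\<^sub>0 complex"
  assume "tensor_eq p p'"
  then have "c *\<^sub>C (p - p') \<in> complex_vector.span tensor_relators"
    unfolding tensor_eq_def by (rule complex_vector.span_scale)
  then show "tensor_eq (c *\<^sub>C p) (c *\<^sub>C p')"
    unfolding tensor_eq_def complex_vector.scale_right_diff_distrib .
qed

instance
proof
  fix x y z :: "('a, 'b) tensor" and a b :: complex
  note refl = equivp_reflp[OF equivp_tensor_eq]
  show "x + y + z = x + (y + z)" by transfer (simp add: add.assoc refl)
  show "x + y = y + x" by transfer (simp add: add.commute refl)
  show "0 + x = x" by transfer (simp add: refl)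
  show "- x + x = 0" by transfer (simp add: refl)
  show "x - y = x + - y" by transfer (simp add: refl)
  show "a *\<^sub>C (x + y) = a *\<^sub>C x + a *\<^sub>C y" by transfer (simp add: scaleC_add_right refl)
  show "(a + b) *\<^sub>C x = a *\<^sub>C x + b *\<^sub>C x" by transfer (simp add: scaleC_add_left refl)
  show "a *\<^sub>C (b *\<^sub>C x) = (a * b) *\<^sub>C x" by transfer (simp add: scaleC_scaleC refl)
  show "1 *\<^sub>C x = x" by transfer (simp add: scaleC_one refl)
qed

end

lift_definition pure_tensor ::
  "'a::complex_vector \<Rightarrow> 'b::complex_vector \<Rightarrow> ('a, 'b) tensor" (infixl \<open>\<otimes>\<^sub>C\<close> 73)
  is "\<lambda>a b. Poly_Mapping.single (a, b) 1" .

text \<open>For subspaces \<open>A\<close> and \<open>B\<close> the canonical map from the tensor product of \<open>A\<close> and \<open>B\<close> to that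
  of the ambient spaces is injective; \<^term>\<open>tensor_space A B\<close> is its image.\<close>

definition tensor_space ::
  "'a::complex_vector set \<Rightarrow> 'b::complex_vector set \<Rightarrow> ('a, 'b) tensor set" where
  "tensor_space A B = complex_vector.span {a \<otimes>\<^sub>C b | a b. a \<in> A \<and> b \<in> B}"

text \<open>\<^term>\<open>tensor_lift_on A B f t\<close> is the value at \<open>t\<close> of the linear map on \<^term>\<open>tensor_space A B\<close>
  induced by a map \<open>f\<close> that is bilinear on \<open>A \<times> B\<close>: write \<open>t\<close> as a finite sum of \<open>a\<^sub>i \<otimes>\<^sub>C b\<^sub>i\<close> with
  \<open>a\<^sub>i \<in> A\<close> and \<open>b\<^sub>i \<in> B\<close>, and return the sum of the \<open>f a\<^sub>i b\<^sub>i\<close>. By bilinearity the result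
  does not depend on the chosen expression (see \<open>tensor_lift_on_pure\<close>).\<close>

definition free_eval :: "('a \<Rightarrow> 'b \<Rightarrow> 'c::complex_vector) \<Rightarrow> ('a \<times> 'b \<Rightarrow>\<^sub>0 complex) \<Rightarrow> 'c" where
  "free_eval f p = (\<Sum>x\<in>Poly_Mapping.keys p. Poly_Mapping.lookup p x *\<^sub>C f (fst x) (snd x))"

definition tensor_lift_on ::
  "'a::complex_vector set \<Rightarrow> 'b::complex_vector set \<Rightarrow> ('a \<Rightarrow> 'b \<Rightarrow> 'c::complex_vector) \<Rightarrow>
   ('a, 'b) tensor \<Rightarrow> 'c" where
  "tensor_lift_on A B f t =
     free_eval f (SOME p. Poly_Mapping.keys p \<subseteq> A \<times> B \<and> abs_tensor p = t)"

text \<open>Sweedler sums are written with \<open>tensor_lift\<close>: the sum of \<open>f h\<^sub>1 h\<^sub>2\<close> over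
  \<open>\<Delta>(h) = h\<^sub>1 \<otimes> h\<^sub>2\<close> is \<^term>\<open>tensor_lift f (\<Delta> h)\<close>.\<close>

abbreviation tensor_lift ::
  "('a::complex_vector \<Rightarrow> 'b::complex_vector \<Rightarrow> 'c::complex_vector) \<Rightarrow> ('a, 'b) tensor \<Rightarrow> 'c" where
  "tensor_lift \<equiv> tensor_lift_on UNIV UNIV"

lemma free_eval_add: "free_eval f (p + q) = free_eval f p + free_eval f q"
proof -
  let ?K = "Poly_Mapping.keys p \<union> Poly_Mapping.keys q"
  have ext: "free_eval f r = (\<Sum>x\<in>?K. Poly_Mapping.lookup r x *\<^sub>C f (fst x) (snd x))"
    if "Poly_Mapping.keys r \<subseteq> ?K" for r
    unfolding free_eval_def using that
    by (intro sum.mono_neutral_left) (auto simp: in_keys_iff)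
  have "Poly_Mapping.keys (p + q) \<subseteq> ?K" by (rule Poly_Mapping.keys_add)
  then show ?thesis
    by (simp add: ext lookup_add scaleC_add_left sum.distrib)
qed

lemma lookup_scaleC: "Poly_Mapping.lookup (c *\<^sub>C p) x = c *\<^sub>C Poly_Mapping.lookup p x"
  by transfer simp

lemma free_eval_scaleC: "free_eval f (c *\<^sub>C p) = c *\<^sub>C free_eval f p"
proof -
  have "Poly_Mapping.keys (c *\<^sub>C p) \<subseteq> Poly_Mapping.keys p"
    by (auto simp: in_keys_iff lookup_scaleC)
  then have "free_eval f (c *\<^sub>C p) =
      (\<Sum>x\<in>Poly_Mapping.keys p. Poly_Mapping.lookup (c *\<^sub>C p) x *\<^sub>C f (fst x) (snd x))"
    unfolding free_eval_def by (intro sum.mono_neutral_left) (auto simp: in_keys_iff)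
  then show ?thesis
    by (simp add: free_eval_def lookup_scaleC scaleC_complex_def
        complex_vector.scale_sum_right)
qed

lemma free_eval_diff: "free_eval f (p - q) = free_eval f p - free_eval f q"
proof -
  have "free_eval f (p - q) + free_eval f q = free_eval f (p - q + q)"
    by (rule free_eval_add[symmetric])
  then show ?thesis by (simp add: eq_diff_eq)
qed

lemma free_eval_single: "free_eval f (Poly_Mapping.single (a, b) 1) = f a b"
  by (simp add: free_eval_def scaleC_one)

lemma free_eval_relators:
  assumes f: "cbilinear_on UNIV UNIV f" and p: "p \<in> complex_vector.span tensor_relators"
  shows "free_eval f p = 0"
  using p
proof (induction rule: complex_vector.span_induct_alt)
  case base
  show ?case by (simp add: free_eval_def)
next
  case (step c x y)
  have "free_eval f x = 0"
    using step(1) f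
    by (auto simp: tensor_relators_def cbilinear_on_def clinear_on_def free_eval_diff
        free_eval_single free_eval_scaleC)
  then show ?case using step by (simp add: free_eval_add free_eval_scaleC)
qed

lemma free_eval_cong:
  assumes "\<And>a b. (a, b) \<in> Poly_Mapping.keys p \<Longrightarrow> f a b = g a b"
  shows "free_eval f p = free_eval g p"
  unfolding free_eval_def using assms by (intro sum.cong) auto

lemma subspace_projection:
  fixes A :: "'a::complex_vector set"
  assumes "complex_vector.subspace A"
  obtains P where "clinear_on UNIV P" "\<And>x. P x \<in> A" "\<And>x. x \<in> A \<Longrightarrow> P x = x"
proof -
  interpret vector_space_pair "scaleC :: complex \<Rightarrow> 'a \<Rightarrow> 'a" "scaleC :: complex \<Rightarrow> 'a \<Rightarrow> 'a" ..
  have "\<exists>g. range g \<subseteq> A \<and> Vector_Spaces.linear scaleC scaleC g \<and> (\<forall>v\<in>A. g (id v) = v)"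
    by (rule linear_exists_left_inverse_on)
      (use assms complex_vector.linear_id in \<open>auto simp: id_def\<close>)
  then obtain g where g: "range g \<subseteq> A" "Vector_Spaces.linear scaleC scaleC g" "\<forall>v\<in>A. g v = v"
    by auto
  show thesis
  proof
    show "clinear_on UNIV g"
      using g(2) by (simp add: clinear_on_def linear_add linear_scale)
  qed (use g in auto)
qed

lemma tensor_lift_on_abs:
  assumes A: "complex_vector.subspace A" and B: "complex_vector.subspace B"
    and f: "cbilinear_on A B f" and p: "Poly_Mapping.keys p \<subseteq> A \<times> B"
  shows "tensor_lift_on A B f (abs_tensor p) = free_eval f p"
proof -
  obtain P where P: "clinear_on UNIV P" "\<And>x. P x \<in> A" "\<And>x. x \<in> A \<Longrightarrow> P x = x"
    using subspace_projection[OF A] by blast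
  obtain Q where Q: "clinear_on UNIV Q" "\<And>x. Q x \<in> B" "\<And>x. x \<in> B \<Longrightarrow> Q x = x"
    using subspace_projection[OF B] by blast
  define g where "g = (\<lambda>a b. f (P a) (Q b))"
  have g: "cbilinear_on UNIV UNIV g"
    using f P(1,2) Q(1,2) unfolding g_def cbilinear_on_def clinear_on_def by simp
  define q where "q = (SOME q. Poly_Mapping.keys q \<subseteq> A \<times> B \<and> abs_tensor q = abs_tensor p)"
  have q: "Poly_Mapping.keys q \<subseteq> A \<times> B" "abs_tensor q = abs_tensor p"
    using someI[of "\<lambda>q. Poly_Mapping.keys q \<subseteq> A \<times> B \<and> abs_tensor q = abs_tensor p" p] p
    unfolding q_def by auto
  have "q - p \<in> complex_vector.span tensor_relators"
    using q(2) by (simp add: tensor.abs_eq_iff tensor_eq_def)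
  then have "free_eval g q = free_eval g p"
    using free_eval_relators[OF g, of "q - p"] by (simp add: free_eval_diff)
  moreover have "free_eval g r = free_eval f r" if "Poly_Mapping.keys r \<subseteq> A \<times> B" for r
    using that P(3) Q(3) by (intro free_eval_cong) (auto simp: g_def)
  ultimately have "free_eval f q = free_eval f p"
    using p q(1) by metis
  then show ?thesis
    unfolding tensor_lift_on_def q_def .
qed

lemma tensor_lift_on_pure:
  assumes "complex_vector.subspace A" "complex_vector.subspace B" "cbilinear_on A B f" "a \<in> A" "b \<in> B"
  shows "tensor_lift_on A B f (a \<otimes>\<^sub>C b) = f a b"
proof -
  have "Poly_Mapping.keys (Poly_Mapping.single (a, b) (1::complex)) \<subseteq> A \<times> B"
    using assms(4,5) by simp
  from tensor_lift_on_abs[OF assms(1-3) this] show ?thesis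
    unfolding pure_tensor.abs_eq free_eval_single .
qed

section \<open>Hopf algebras and stable anti-Yetter-Drinfeld modules\<close>

text \<open>The unit and multiplication of the Hopf algebra are those of the type \<^typ>\<open>'h\<close>.\<close>

record (overloaded) 'h hopf =
  comult :: "'h \<Rightarrow> ('h, 'h) tensor"
  counit :: "'h \<Rightarrow> complex"
  antipode :: "'h \<Rightarrow> 'h"

definition hopf_algebra :: "'h::complex_algebra_1 hopf \<Rightarrow> bool" where
  "hopf_algebra H \<longleftrightarrow>
     clinear_on UNIV (comult H) \<and> clinear_on UNIV (counit H) \<and> clinear_on UNIV (antipode H) \<and>
     (\<forall>h. tensor_lift (\<lambda>a c. tensor_lift (\<lambda>a1 a2. a1 \<otimes>\<^sub>C (a2 \<otimes>\<^sub>C c)) (comult H a)) (comult H h) =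
          tensor_lift (\<lambda>a c. a \<otimes>\<^sub>C comult H c) (comult H h)) \<and>
     (\<forall>h. tensor_lift (\<lambda>h1 h2. counit H h1 *\<^sub>C h2) (comult H h) = h) \<and>
     (\<forall>h. tensor_lift (\<lambda>h1 h2. counit H h2 *\<^sub>C h1) (comult H h) = h) \<and>
     (\<forall>a b. comult H (a * b) =
        tensor_lift (\<lambda>a1 a2. tensor_lift (\<lambda>b1 b2. (a1 * b1) \<otimes>\<^sub>C (a2 * b2)) (comult H b)) (comult H a)) \<and>
     comult H 1 = 1 \<otimes>\<^sub>C 1 \<and>
     (\<forall>a b. counit H (a * b) = counit H a * counit H b) \<and> counit H 1 = 1 \<and>
     (\<forall>h. tensor_lift (\<lambda>h1 h2. antipode H h1 * h2) (comult H h) = counit H h *\<^sub>C 1) \<and>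
     (\<forall>h. tensor_lift (\<lambda>h1 h2. h1 * antipode H h2) (comult H h) = counit H h *\<^sub>C 1)"

abbreviation antipode_inv :: "'h hopf \<Rightarrow> 'h \<Rightarrow> 'h" where
  "antipode_inv H \<equiv> inv (antipode H)"

record (overloaded) ('h, 'v) sayd =
  ract :: "'v \<Rightarrow> 'h \<Rightarrow> 'v"
  coact :: "'v \<Rightarrow> ('h, 'v) tensor"

definition sayd_module :: "'h::complex_algebra_1 hopf \<Rightarrow> ('h, 'v::complex_vector) sayd \<Rightarrow> bool" where
  "sayd_module H M \<longleftrightarrow>
     cbilinear_on UNIV UNIV (ract M) \<and>
     (\<forall>m. ract M m 1 = m) \<and> (\<forall>m a b. ract M m (a * b) = ract M (ract M m a) b) \<and>
     clinear_on UNIV (coact M) \<and>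
     (\<forall>m. tensor_lift (\<lambda>a m0. tensor_lift (\<lambda>a1 a2. a1 \<otimes>\<^sub>C (a2 \<otimes>\<^sub>C m0)) (comult H a)) (coact M m) =
          tensor_lift (\<lambda>a m0. a \<otimes>\<^sub>C coact M m0) (coact M m)) \<and>
     (\<forall>m. tensor_lift (\<lambda>a m0. counit H a *\<^sub>C m0) (coact M m) = m) \<and>
     \<comment> \<open>\<open>h\<^sub>1 \<otimes> h\<^sub>2 \<otimes> h\<^sub>3\<close> is \<open>(\<Delta> \<otimes> id)(\<Delta>(h))\<close>\<close>
     (\<forall>m h. coact M (ract M m h) =
        tensor_lift (\<lambda>h12 h3. tensor_lift (\<lambda>h1 h2.
          tensor_lift (\<lambda>a m0. (antipode H h3 * a * h1) \<otimes>\<^sub>C ract M m0 h2) (coact M m))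
            (comult H h12)) (comult H h)) \<and>
     (\<forall>m. tensor_lift (\<lambda>a m0. ract M m0 a) (coact M m) = m)"

section \<open>\<open>H\<close>-semicategories and \<open>H\<close>-categories\<close>

text \<open>All Hom spaces are subspaces of one ambient vector space \<^typ>\<open>'m\<close>, which is no restriction
  since a family of vector spaces embeds into its direct sum. They may overlap, so composition and
  action carry the objects as arguments: \<open>comp C X Y Z g f\<close> is \<open>g \<circ> f\<close> for \<open>f : X \<rightarrow> Y\<close> and
  \<open>g : Y \<rightarrow> Z\<close>, and \<open>act C X Y h f\<close> is \<open>h f\<close> for \<open>f : X \<rightarrow> Y\<close>. Values outside the Hom
  spaces are irrelevant.\<close>

record ('o, 'm, 'h) hsemicat =
  obj :: "'o set"
  hom :: "'o \<Rightarrow> 'o \<Rightarrow> 'm set"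
  comp :: "'o \<Rightarrow> 'o \<Rightarrow> 'o \<Rightarrow> 'm \<Rightarrow> 'm \<Rightarrow> 'm"
  act :: "'o \<Rightarrow> 'o \<Rightarrow> 'h \<Rightarrow> 'm \<Rightarrow> 'm"

definition left_H_semicategory ::
  "'h::complex_algebra_1 hopf \<Rightarrow> ('o, 'm::complex_vector, 'h, 'z) hsemicat_scheme \<Rightarrow> bool" where
  "left_H_semicategory H C \<longleftrightarrow>
     (\<forall>X\<in>obj C. \<forall>Y\<in>obj C. complex_vector.subspace (hom C X Y)) \<and>
     (\<forall>X\<in>obj C. \<forall>Y\<in>obj C. \<forall>Z\<in>obj C.
        (\<forall>g\<in>hom C Y Z. \<forall>f\<in>hom C X Y. comp C X Y Z g f \<in> hom C X Z) \<and>
        cbilinear_on (hom C Y Z) (hom C X Y) (comp C X Y Z)) \<and>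
     (\<forall>W\<in>obj C. \<forall>X\<in>obj C. \<forall>Y\<in>obj C. \<forall>Z\<in>obj C.
        \<forall>g\<in>hom C Y Z. \<forall>f\<in>hom C X Y. \<forall>e\<in>hom C W X.
          comp C W X Z (comp C X Y Z g f) e = comp C W Y Z g (comp C W X Y f e)) \<and>
     (\<forall>X\<in>obj C. \<forall>Y\<in>obj C.
        (\<forall>h. \<forall>f\<in>hom C X Y. act C X Y h f \<in> hom C X Y) \<and>
        cbilinear_on UNIV (hom C X Y) (act C X Y) \<and>
        (\<forall>f\<in>hom C X Y. act C X Y 1 f = f) \<and>
        (\<forall>a b. \<forall>f\<in>hom C X Y. act C X Y (a * b) f = act C X Y a (act C X Y b f))) \<and>
     (\<forall>X\<in>obj C. \<forall>Y\<in>obj C. \<forall>Z\<in>obj C. \<forall>h. \<forall>g\<in>hom C Y Z. \<forall>f\<in>hom C X Y.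
        act C X Z h (comp C X Y Z g f) =
        tensor_lift (\<lambda>h1 h2. comp C X Y Z (act C Y Z h1 g) (act C X Y h2 f)) (comult H h))"

definition is_identity :: "('o, 'm, 'h, 'z) hsemicat_scheme \<Rightarrow> 'o \<Rightarrow> 'm \<Rightarrow> bool" where
  "is_identity C X e \<longleftrightarrow> e \<in> hom C X X \<and>
     (\<forall>Y\<in>obj C. (\<forall>f\<in>hom C X Y. comp C X X Y f e = f) \<and> (\<forall>f\<in>hom C Y X. comp C Y X X e f = f))"

definition left_H_category ::
  "'h::complex_algebra_1 hopf \<Rightarrow> ('o, 'm::complex_vector, 'h, 'z) hsemicat_scheme \<Rightarrow> bool" where
  "left_H_category H C \<longleftrightarrow> left_H_semicategory H C \<and>
     (\<forall>X\<in>obj C. \<exists>e. is_identity C X e \<and> (\<forall>h. act C X X h e = counit H h *\<^sub>C e))"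

definition H_linear_semifunctor ::
  "('o, 'm::complex_vector, 'h, 'y) hsemicat_scheme \<Rightarrow> ('p, 'c::complex_vector, 'h, 'z) hsemicat_scheme \<Rightarrow>
   ('o \<Rightarrow> 'p) \<Rightarrow> ('o \<Rightarrow> 'o \<Rightarrow> 'm \<Rightarrow> 'c) \<Rightarrow> bool" where
  "H_linear_semifunctor C D Fo Fa \<longleftrightarrow>
     (\<forall>X\<in>obj C. Fo X \<in> obj D) \<and>
     (\<forall>X\<in>obj C. \<forall>Y\<in>obj C.
        (\<forall>f\<in>hom C X Y. Fa X Y f \<in> hom D (Fo X) (Fo Y)) \<and>
        clinear_on (hom C X Y) (Fa X Y) \<and>
        (\<forall>h. \<forall>f\<in>hom C X Y. Fa X Y (act C X Y h f) = act D (Fo X) (Fo Y) h (Fa X Y f))) \<and>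
     (\<forall>X\<in>obj C. \<forall>Y\<in>obj C. \<forall>Z\<in>obj C. \<forall>g\<in>hom C Y Z. \<forall>f\<in>hom C X Y.
        Fa X Z (comp C X Y Z g f) = comp D (Fo X) (Fo Y) (Fo Z) (Fa Y Z g) (Fa X Y f))"

section \<open>Hopf-cyclic cochains\<close>

text \<open>A generator \<open>f\<^sup>0 \<otimes> \<dots> \<otimes> f\<^sup>n\<close> with \<open>f\<^sup>i : X\<^sub>i\<^sub>+\<^sub>1 \<rightarrow> X\<^sub>i\<close> and \<open>X\<^sub>n\<^sub>+\<^sub>1 = X\<^sub>0\<close> is given by the lists
  \<open>Xs = [X\<^sub>0, \<dots>, X\<^sub>n]\<close> and \<open>fs = [f\<^sup>0, \<dots>, f\<^sup>n]\<close>.\<close>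

abbreviation cyc_nth :: "'o list \<Rightarrow> nat \<Rightarrow> 'o" where
  "cyc_nth Xs i \<equiv> Xs ! (i mod length Xs)"

definition cyclic_chain ::
  "('o, 'm, 'h, 'z) hsemicat_scheme \<Rightarrow> nat \<Rightarrow> 'o list \<Rightarrow> 'm list \<Rightarrow> bool" where
  "cyclic_chain D n Xs fs \<longleftrightarrow>
     length Xs = Suc n \<and> length fs = Suc n \<and> set Xs \<subseteq> obj D \<and>
     (\<forall>i\<le>n. fs ! i \<in> hom D (cyc_nth Xs (Suc i)) (cyc_nth Xs i))"

text \<open>\<open>sweedler_list H n F h\<close> is the sum of \<open>F [h\<^sub>1, \<dots>, h\<^sub>n\<^sub>+\<^sub>1]\<close>, for \<open>F\<close> multilinear.\<close>

primrec sweedler_list ::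
  "'h::complex_algebra_1 hopf \<Rightarrow> nat \<Rightarrow> ('h list \<Rightarrow> 'a::complex_vector) \<Rightarrow> 'h \<Rightarrow> 'a" where
  "sweedler_list H 0 F h = F [h]"
| "sweedler_list H (Suc n) F h =
     tensor_lift (\<lambda>h1 h2. sweedler_list H n (\<lambda>ks. F (h1 # ks)) h2) (comult H h)"

definition act_list ::
  "('o, 'm, 'h, 'z) hsemicat_scheme \<Rightarrow> 'o list \<Rightarrow> 'h list \<Rightarrow> 'm list \<Rightarrow> 'm list" where
  "act_list D Xs ks fs =
     map (\<lambda>i. act D (cyc_nth Xs (Suc i)) (cyc_nth Xs i) (ks ! i) (fs ! i)) [0..<length fs]"

text \<open>A linear functional on \<open>M \<otimes> CN\<^sub>n(D)\<close> is a family, indexed by \<open>(X\<^sub>0, \<dots>, X\<^sub>n)\<close>, of functionals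
  that are linear in \<open>m\<close> and in each \<open>f\<^sup>i\<close>: its value at \<open>m \<otimes> f\<^sup>0 \<otimes> \<dots> \<otimes> f\<^sup>n\<close> is
  \<open>\<phi> m [X\<^sub>0, \<dots>, X\<^sub>n] [f\<^sup>0, \<dots>, f\<^sup>n]\<close>. It is set to 0 off these arguments, so that equality of
  functionals is equality of functions.\<close>

type_synonym ('o, 'm, 'v) cochain = "'v \<Rightarrow> 'o list \<Rightarrow> 'm list \<Rightarrow> complex"

definition cochains ::
  "'h::complex_algebra_1 hopf \<Rightarrow> ('h, 'v::complex_vector) sayd \<Rightarrow>
   ('o, 'm::complex_vector, 'h, 'z) hsemicat_scheme \<Rightarrow> nat \<Rightarrow> ('o, 'm, 'v) cochain set" where
  "cochains H M D n = {\<phi>.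
     (\<forall>m Xs fs. \<not> cyclic_chain D n Xs fs \<longrightarrow> \<phi> m Xs fs = 0) \<and>
     (\<forall>Xs fs. cyclic_chain D n Xs fs \<longrightarrow>
        clinear_on UNIV (\<lambda>m. \<phi> m Xs fs) \<and>
        (\<forall>m. \<forall>i\<le>n. clinear_on (hom D (cyc_nth Xs (Suc i)) (cyc_nth Xs i))
                      (\<lambda>f. \<phi> m Xs (fs[i := f]))) \<and>
        (\<forall>m h. tensor_lift (\<lambda>h1 h2.
             sweedler_list H n (\<lambda>ks. \<phi> (ract M m h1) Xs (act_list D Xs ks fs)) (antipode H h2))
             (comult H h) = counit H h * \<phi> m Xs fs))}"

text \<open>\<open>face H M D n i\<close> is \<open>\<delta>\<^sub>i\<close> from degree \<open>n - 1\<close> to degree \<open>n\<close>, for \<open>n > 0\<close> and \<open>i \<le> n\<close>.\<close>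

definition face ::
  "'h::complex_algebra_1 hopf \<Rightarrow> ('h, 'v::complex_vector) sayd \<Rightarrow>
   ('o, 'm::complex_vector, 'h, 'z) hsemicat_scheme \<Rightarrow> nat \<Rightarrow> nat \<Rightarrow>
   ('o, 'm, 'v) cochain \<Rightarrow> ('o, 'm, 'v) cochain" where
  "face H M D n i \<phi> m Xs fs =
     (if \<not> cyclic_chain D n Xs fs then 0
      else if i < n then
        \<phi> m (take (Suc i) Xs @ drop (i + 2) Xs)
          (take i fs @
           [comp D (cyc_nth Xs (i + 2)) (cyc_nth Xs (i + 1)) (cyc_nth Xs i) (fs ! i) (fs ! Suc i)] @
           drop (i + 2) fs)
      else
        tensor_lift (\<lambda>a m0.
          \<phi> m0 (Xs ! n # take (n - 1) (tl Xs))
            (comp D (Xs ! 1) (Xs ! 0) (Xs ! n) (act D (Xs ! 0) (Xs ! n) (antipode_inv H a) (fs ! n)) (fs ! 0) #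
             take (n - 1) (tl fs)))
          (coact M m))"

definition cyclic_op ::
  "'h::complex_algebra_1 hopf \<Rightarrow> ('h, 'v::complex_vector) sayd \<Rightarrow>
   ('o, 'm::complex_vector, 'h, 'z) hsemicat_scheme \<Rightarrow> nat \<Rightarrow>
   ('o, 'm, 'v) cochain \<Rightarrow> ('o, 'm, 'v) cochain" where
  "cyclic_op H M D n \<phi> m Xs fs =
     (if \<not> cyclic_chain D n Xs fs then 0
      else tensor_lift (\<lambda>a m0.
        \<phi> m0 (Xs ! n # take n Xs)
          (act D (Xs ! 0) (Xs ! n) (antipode_inv H a) (fs ! n) # take n fs)) (coact M m))"

definition cyclic_cochains ::
  "'h::complex_algebra_1 hopf \<Rightarrow> ('h, 'v::complex_vector) sayd \<Rightarrow>
   ('o, 'm::complex_vector, 'h, 'z) hsemicat_scheme \<Rightarrow> nat \<Rightarrow> ('o, 'm, 'v) cochain set" where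
  "cyclic_cochains H M D n =
     {\<phi> \<in> cochains H M D n. \<phi> = (\<lambda>m Xs fs. (- 1) ^ n * cyclic_op H M D n \<phi> m Xs fs)}"

text \<open>The differential \<open>b\<close> from degree \<open>n\<close> to degree \<open>n + 1\<close>.\<close>

definition codiff ::
  "'h::complex_algebra_1 hopf \<Rightarrow> ('h, 'v::complex_vector) sayd \<Rightarrow>
   ('o, 'm::complex_vector, 'h, 'z) hsemicat_scheme \<Rightarrow> nat \<Rightarrow>
   ('o, 'm, 'v) cochain \<Rightarrow> ('o, 'm, 'v) cochain" where
  "codiff H M D n \<phi> m Xs fs = (\<Sum>i\<le>n + 1. (- 1) ^ i * face H M D (n + 1) i \<phi> m Xs fs)"

primrec coboundaries ::
  "'h::complex_algebra_1 hopf \<Rightarrow> ('h, 'v::complex_vector) sayd \<Rightarrow>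
   ('o, 'm::complex_vector, 'h, 'z) hsemicat_scheme \<Rightarrow> nat \<Rightarrow> ('o, 'm, 'v) cochain set" where
  "coboundaries H M D 0 = {\<lambda>m Xs fs. 0}"
| "coboundaries H M D (Suc n) = codiff H M D n ` cyclic_cochains H M D n"

section \<open>DG \<open>H\<close>-semicategories, cycles and characters\<close>

text \<open>The Hom spaces are the internal direct sums of their homogeneous components \<open>ghom S X Y n\<close>.\<close>

record ('p, 'c, 'h) dghsemicat = "('p, 'c, 'h) hsemicat" +
  ghom :: "'p \<Rightarrow> 'p \<Rightarrow> nat \<Rightarrow> 'c set"
  diff :: "'p \<Rightarrow> 'p \<Rightarrow> 'c \<Rightarrow> 'c"

definition internal_direct_sum :: "'c::complex_vector set \<Rightarrow> (nat \<Rightarrow> 'c set) \<Rightarrow> bool" where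
  "internal_direct_sum V G \<longleftrightarrow>
     (\<forall>n. complex_vector.subspace (G n)) \<and>
     V = complex_vector.span (\<Union>n. G n) \<and>
     (\<forall>N x. (\<forall>n\<le>N. x n \<in> G n) \<longrightarrow> (\<Sum>n\<le>N. x n) = 0 \<longrightarrow> (\<forall>n\<le>N. x n = 0))"

definition left_DGH_semicategory ::
  "'h::complex_algebra_1 hopf \<Rightarrow> ('p, 'c::complex_vector, 'h, 'z) dghsemicat_scheme \<Rightarrow> bool" where
  "left_DGH_semicategory H S \<longleftrightarrow>
     left_H_semicategory H S \<and>
     (\<forall>X\<in>obj S. \<forall>Y\<in>obj S.
        internal_direct_sum (hom S X Y) (ghom S X Y) \<and>
        (\<forall>n h. \<forall>f\<in>ghom S X Y n. act S X Y h f \<in> ghom S X Y n) \<and>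
        clinear_on (hom S X Y) (diff S X Y) \<and>
        (\<forall>n. \<forall>f\<in>ghom S X Y n. diff S X Y f \<in> ghom S X Y (Suc n)) \<and>
        (\<forall>f\<in>hom S X Y. diff S X Y (diff S X Y f) = 0) \<and>
        (\<forall>h. \<forall>f\<in>hom S X Y. diff S X Y (act S X Y h f) = act S X Y h (diff S X Y f))) \<and>
     (\<forall>X\<in>obj S. \<forall>Y\<in>obj S. \<forall>Z\<in>obj S. \<forall>i j. \<forall>g\<in>ghom S Y Z i. \<forall>f\<in>ghom S X Y j.
        comp S X Y Z g f \<in> ghom S X Z (i + j) \<and>
        diff S X Z (comp S X Y Z g f) =
          comp S X Y Z (diff S Y Z g) f + (- 1) ^ i *\<^sub>C comp S X Y Z g (diff S X Y f))"

definition degree_zero :: "('p, 'c, 'h, 'z) dghsemicat_scheme \<Rightarrow> ('p, 'c, 'h) hsemicat" where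
  "degree_zero S = \<lparr>obj = obj S, hom = (\<lambda>X Y. ghom S X Y 0), comp = comp S, act = act S\<rparr>"

text \<open>As for cochains, a functional on \<open>M \<otimes> Hom\<^sup>n(X, X)\<close> is written as a bilinear map.\<close>

definition closed_graded_trace ::
  "'h::complex_algebra_1 hopf \<Rightarrow> ('h, 'v::complex_vector) sayd \<Rightarrow>
   ('p, 'c::complex_vector, 'h, 'z) dghsemicat_scheme \<Rightarrow> nat \<Rightarrow> ('p \<Rightarrow> 'v \<Rightarrow> 'c \<Rightarrow> complex) \<Rightarrow> bool" where
  "closed_graded_trace H M S n T \<longleftrightarrow>
     (\<forall>X\<in>obj S. cbilinear_on UNIV (ghom S X X n) (T X)) \<and>
     (\<forall>X\<in>obj S. \<forall>m h. \<forall>f\<in>ghom S X X n.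
        tensor_lift (\<lambda>h1 h2. T X (ract M m h1) (act S X X (antipode H h2) f)) (comult H h) =
        counit H h * T X m f) \<and>
     (\<forall>X\<in>obj S. \<forall>m k. n = Suc k \<longrightarrow> (\<forall>f\<in>ghom S X X k. T X m (diff S X X f) = 0)) \<and>
     (\<forall>X\<in>obj S. \<forall>Y\<in>obj S. \<forall>m i j. i + j = n \<longrightarrow> (\<forall>g\<in>ghom S X Y i. \<forall>g'\<in>ghom S Y X j.
        T X m (comp S X Y X g' g) =
        (- 1) ^ (i * j) *
        tensor_lift (\<lambda>a m0. T Y m0 (comp S Y X Y (act S X Y (antipode_inv H a) g) g')) (coact M m)))"

definition is_cycle ::
  "'h::complex_algebra_1 hopf \<Rightarrow> ('h, 'v::complex_vector) sayd \<Rightarrow>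
   ('o, 'm::complex_vector, 'h, 'y) hsemicat_scheme \<Rightarrow> nat \<Rightarrow>
   ('p, 'c::complex_vector, 'h, 'z) dghsemicat_scheme \<Rightarrow> ('p \<Rightarrow> 'v \<Rightarrow> 'c \<Rightarrow> complex) \<Rightarrow>
   ('o \<Rightarrow> 'p) \<Rightarrow> ('o \<Rightarrow> 'o \<Rightarrow> 'm \<Rightarrow> 'c) \<Rightarrow> bool" where
  "is_cycle H M D n S T \<rho>o \<rho> \<longleftrightarrow>
     left_DGH_semicategory H S \<and> closed_graded_trace H M S n T \<and>
     H_linear_semifunctor D (degree_zero S) \<rho>o \<rho>"

text \<open>\<open>char_form S \<rho>o \<rho> Xs fs i\<close> is \<open>\<rho>(f\<^sup>0) \<partial>(\<rho>(f\<^sup>1)) \<dots> \<partial>(\<rho>(f\<^sup>i))\<close>, from \<open>\<rho>(X\<^sub>i\<^sub>+\<^sub>1)\<close> to \<open>\<rho>(X\<^sub>0)\<close>.\<close>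

primrec char_form ::
  "('p, 'c, 'h, 'z) dghsemicat_scheme \<Rightarrow> ('o \<Rightarrow> 'p) \<Rightarrow> ('o \<Rightarrow> 'o \<Rightarrow> 'm \<Rightarrow> 'c) \<Rightarrow>
   'o list \<Rightarrow> 'm list \<Rightarrow> nat \<Rightarrow> 'c" where
  "char_form S \<rho>o \<rho> Xs fs 0 = \<rho> (cyc_nth Xs 1) (cyc_nth Xs 0) (fs ! 0)"
| "char_form S \<rho>o \<rho> Xs fs (Suc i) =
     (let X = cyc_nth Xs (i + 2); Y = cyc_nth Xs (i + 1) in
      comp S (\<rho>o X) (\<rho>o Y) (\<rho>o (Xs ! 0))
        (char_form S \<rho>o \<rho> Xs fs i)
        (diff S (\<rho>o X) (\<rho>o Y) (\<rho> X Y (fs ! Suc i))))"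

definition character ::
  "('o, 'm, 'h, 'y) hsemicat_scheme \<Rightarrow> nat \<Rightarrow>
   ('p, 'c, 'h, 'z) dghsemicat_scheme \<Rightarrow> ('p \<Rightarrow> 'v \<Rightarrow> 'c \<Rightarrow> complex) \<Rightarrow>
   ('o \<Rightarrow> 'p) \<Rightarrow> ('o \<Rightarrow> 'o \<Rightarrow> 'm \<Rightarrow> 'c) \<Rightarrow> ('o, 'm, 'v) cochain" where
  "character D n S T \<rho>o \<rho> m Xs fs =
     (if cyclic_chain D n Xs fs then T (\<rho>o (Xs ! 0)) m (char_form S \<rho>o \<rho> Xs fs n) else 0)"

section \<open>Vanishing cycles\<close>

definition tensor_M2 ::
  "('p, 'c::complex_vector, 'h, 'z) hsemicat_scheme \<Rightarrow> ('p, ('c, complex^2^2) tensor, 'h) hsemicat" where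
  "tensor_M2 C = \<lparr>
     obj = obj C,
     hom = (\<lambda>X Y. tensor_space (hom C X Y) UNIV),
     comp = (\<lambda>X Y Z t u.
       tensor_lift_on (hom C Y Z) UNIV (\<lambda>g A.
         tensor_lift_on (hom C X Y) UNIV (\<lambda>f B. comp C X Y Z g f \<otimes>\<^sub>C (A ** B)) u) t),
     act = (\<lambda>X Y h. tensor_lift_on (hom C X Y) UNIV (\<lambda>f B. act C X Y h f \<otimes>\<^sub>C B))\<rparr>"

definition E11 :: "complex^2^2" where
  "E11 = (\<chi> i j. if i = 1 \<and> j = 1 then 1 else 0)"

definition E22 :: "complex^2^2" where
  "E22 = (\<chi> i j. if i = 2 \<and> j = 2 then 1 else 0)"

definition mutually_inverse :: "('o, 'm, 'h, 'z) hsemicat_scheme \<Rightarrow> 'o \<Rightarrow> 'm \<Rightarrow> 'm \<Rightarrow> bool" where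
  "mutually_inverse C X e e' \<longleftrightarrow> e \<in> hom C X X \<and> e' \<in> hom C X X \<and>
     is_identity C X (comp C X X X e e') \<and> is_identity C X (comp C X X X e' e)"

definition vanishing ::
  "'h::complex_algebra_1 hopf \<Rightarrow> ('p, 'c::complex_vector, 'h, 'z) dghsemicat_scheme \<Rightarrow> bool" where
  "vanishing H S \<longleftrightarrow>
     (let S0 = degree_zero S; S2 = tensor_M2 S0 in
      left_H_category H S0 \<and>
      (\<exists>\<upsilon> \<eta> \<eta>'.
         H_linear_semifunctor S0 S0 (\<lambda>X. X) \<upsilon> \<and>
         (\<forall>X\<in>obj S. mutually_inverse S2 X (\<eta> X) (\<eta>' X) \<and>
            (\<forall>h. act S2 X X h (\<eta> X) = counit H h *\<^sub>C \<eta> X)) \<and>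
         (\<forall>X\<in>obj S. \<forall>Y\<in>obj S. \<forall>f\<in>hom S0 X Y.
            comp S2 X X Y
              (comp S2 X Y Y (\<eta> Y) (f \<otimes>\<^sub>C E11 + \<upsilon> X Y f \<otimes>\<^sub>C E22)) (\<eta>' X) =
            \<upsilon> X Y f \<otimes>\<^sub>C E22)))"

text \<open>\<open>\<phi>\<close> is the character of an \<open>n\<close>-dimensional vanishing cycle. The type arguments fix the types
  \<^typ>\<open>'p\<close> of objects and \<^typ>\<open>'c\<close> of (ambient) morphisms of the cycle.\<close>

definition vanishing_cycle_character ::
  "'p itself \<Rightarrow> 'c::complex_vector itself \<Rightarrow> 'h::complex_algebra_1 hopf \<Rightarrow> ('h, 'v::complex_vector) sayd \<Rightarrow>
   ('o, 'm::complex_vector, 'h) hsemicat \<Rightarrow> nat \<Rightarrow> ('o, 'm, 'v) cochain \<Rightarrow> bool" where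
  "vanishing_cycle_character _ _ H M D n \<phi> \<longleftrightarrow>
     (\<exists>(S :: ('p, 'c, 'h) dghsemicat) T \<rho>o \<rho>.
        is_cycle H M D n S T \<rho>o \<rho> \<and> vanishing H S \<and> \<phi> = character D n S T \<rho>o \<rho>)"

text \<open>HOL cannot quantify existentially over types, so a cycle with a given character has to be
  found with morphisms in a fixed type. The following one is free on words over an alphabet of
  objects of \<open>D\<close>, morphisms of \<open>D\<close> and scalar infinite matrices; it contains a copy of every space
  spanned by a family indexed by such words, such as differential forms over matrices with
  entries in \<open>D\<close>.\<close>

type_synonym ('o, 'm) word_space = "('o + 'm + (nat \<Rightarrow> nat \<Rightarrow> complex)) list \<Rightarrow>\<^sub>0 complex"

end

theory Submission
  imports Defs "HOL-Library.Function_Algebras"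
begin

text \<open>
  Suppose a cycle vanishes by means of \<open>\<upsilon>\<close> and \<open>\<eta>\<close>. In matrices over \<open>S\<close> the functor
  \<open>f \<mapsto> \<rho>(f) \<oplus> \<upsilon>(\<rho>(f))\<close> and its conjugate \<open>0 \<oplus> \<upsilon>(\<rho>(f))\<close>, placed in two different diagonal blocks,
  are orthogonal semifunctors \<open>P\<close> and \<open>Q\<close> intertwined by an invariant \<open>E\<close>, and the rotation
  \<open>cos\<^sup>2 P + sin\<^sup>2 Q + cos sin (\<dots>)\<close> joins \<open>P\<close> to \<open>Q\<close>. Along the rotation the derivative of the
  functor is an inner derivation, and an inner derivation changes the character by the coboundary
  of the cyclic cochain that inserts \<open>dE\<close> into a form. Hence the characters of \<open>P\<close> and \<open>Q\<close> are
  cohomologous, and the difference of these characters is the character of \<open>\<rho>\<close>.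

  Conversely, let \<open>\<phi> = b \<psi>\<close>. The forms of degree \<open>i\<close> are spanned by words \<open>c \<otimes> f\<^sub>0 \<otimes> \<dots> \<otimes> f\<^sub>i\<close> with an infinite
  matrix \<open>c\<close> as coefficient, the differential is the graded commutator with an element of square
  zero, and the trace evaluates the last face of \<open>\<psi>\<close> on closed words, weighted by the trace of \<open>c\<close>.
  The matrix entries leave room for an infinite swindle, so this cycle vanishes.
\<close>

text \<open>The vanishing condition provides units only for degree zero, and an identity of
  \<open>S^0\<close> need not act as one on forms of positive degree. The argument therefore never
  conjugates forms: the relations between \<open>P\<close>, \<open>Q\<close> and \<open>E\<close>
  involve degree zero products only. Putting \<open>P\<close> and \<open>Q\<close> in different
  blocks makes \<open>- E E\<close> the identity on their images, so conjugation by
  \<open>exp(s E)\<close> becomes a trigonometric polynomial with fixed coefficients. Cochains carry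
  no topology; only scalar functions are differentiated, after a linear functional that kills the
  coboundaries has been applied. In dimension zero the trace property alone gives the result.

  For the converse, the swindle needs an identity matrix and infinite sums in degree zero, while a
  trace needs finiteness; hence the coefficients in positive degree are restricted to an ideal. The
  relations between \<open>mp\<close> and \<open>mr\<close> collapse
  \<open>\<rho>(f0) d\<rho>(f1) ...\<close> to the full word plus one word for each inner face, the
  latter ending in an identity arrow that turns the last face of \<open>\<psi>\<close> back into
  \<open>\<psi>\<close>. The trace property is checked on generators; the cyclicity of
  \<open>\<psi>\<close> enters there through the elements \<open>theta\<close>.\<close>

notation scaleC(infixr \<open>*.\<close> 75)
abbreviation(input) "Hfun == H_linear_semifunctor"
abbreviation(input) "sgl == Poly_Mapping.single"
abbreviation(input) "cbil == cbilinear_on"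
abbreviation(input) "clin == clinear_on"
abbreviation(input) "cgtrace == closed_graded_trace"
abbreviation(input) "cspan == complex_vector.span"
abbreviation(input) "csub == complex_vector.subspace"
abbreviation(input) "cnth == cyc_nth"
abbreviation(input) "cchain == cyclic_chain"
abbreviation(input) "deg0 == degree_zero"
abbreviation(input) "lDGH == left_DGH_semicategory"
abbreviation(input) "lHsemi == left_H_semicategory"
abbreviation(input) "tlift == tensor_lift"
abbreviation(input) "tlift_on == tensor_lift_on"
abbreviation(input) "tsp == tensor_space"
lemmas Hfun_def = H_linear_semifunctor_def
 and cbil_def = cbilinear_on_def
 and clin_def = clinear_on_def
 and cgtrace_def = closed_graded_trace_def
 and cscale_left_diff_distrib = complex_vector.scale_left_diff_distrib
 and cscale_minus_left = complex_vector.scale_minus_left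
 and cscale_minus_right = complex_vector.scale_minus_right
 and cscale_right_diff_distrib = complex_vector.scale_right_diff_distrib
 and cscale_sum_left = complex_vector.scale_sum_left
 and cscale_sum_right = complex_vector.scale_sum_right
 and cscale_zero_left = complex_vector.scale_zero_left
 and cscale_zero_right = complex_vector.scale_zero_right
 and cspan_add = complex_vector.span_add
 and cspan_base = complex_vector.span_base
 and cspan_induct_alt = complex_vector.span_induct_alt
 and cspan_minimal = complex_vector.span_minimal
 and cspan_mono = complex_vector.span_mono
 and cspan_scale = complex_vector.span_scale
 and cspan_superset = complex_vector.span_superset
 and cspan_zero = complex_vector.span_zero
 and csubI = complex_vector.subspaceI
 and csub_0 = complex_vector.subspace_0
 and csub_UNIV = complex_vector.subspace_UNIV
 and csub_add = complex_vector.subspace_add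
 and csub_def = complex_vector.subspace_def
 and csub_diff = complex_vector.subspace_diff
 and csub_neg = complex_vector.subspace_neg
 and csub_scale = complex_vector.subspace_scale
 and csub_span = complex_vector.subspace_span
 and csub_sum = complex_vector.subspace_sum
 and cchain_def = cyclic_chain_def
 and deg0_def = degree_zero_def
 and lDGH_def = left_DGH_semicategory_def
 and lHsemi_def = left_H_semicategory_def
 and sub_projection = subspace_projection
 and tlift_on_abs = tensor_lift_on_abs
 and tlift_on_pure = tensor_lift_on_pure
 and tsp_def = tensor_space_def

section \<open>Linear and bilinear maps\<close>

text \<open>Cochains, families of forms indexed by chains, and infinite matrices are all functions;
  the pointwise structure lets the same linear algebra serve each of them.\<close>

instantiation "fun" :: (type,complex_vector) complex_vector
begin
definition scaleC_fun :: "complex =>('a => 'b) => 'a => 'b" where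
 "scaleC_fun c f = (%x. c*.f x)"
instance
 by standard(simp_all add: scaleC_fun_def fun_eq_iff scaleC_add_right scaleC_add_left
  scaleC_scaleC scaleC_one)
end

lemma scaleC_fun_apply: "(c*.f)x = c*.f x"
 by(simp add:scaleC_fun_def)

lemma sum_fun_apply: "(\<Sum>i\<in>I. f i)x = (\<Sum>i\<in>I. f i x)"
 by(induction I rule: infinite_finite_induct) auto

lemma scaleC_vec_nth: "(c*.v)$i = c *.(v$i)"
 by(simp add:scaleC_vec_def)

lemmas scale_simps = cscale_zero_left cscale_zero_right
 cscale_minus_left cscale_minus_right scaleC_one

abbreviation lin :: "('a::complex_vector => 'b::complex_vector) => bool" where
 "lin == clin UNIV"

abbreviation bilin :: "('a::complex_vector => 'b::complex_vector => 'c::complex_vector) => bool" where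
 "bilin == cbil UNIV UNIV"

text \<open>Linearity of a Sweedler expression in one variable is proved by taking the expression
  apart with these introduction rules.\<close>

named_theorems li

lemma clinI:
 assumes "!!x y. x:A ==> y:A ==> f(x+y) = f x+f y"
  and "!!c x. x:A ==> f(c*.x) = c*.f x"
 shows "clin A f"
 using assms by(auto simp:clin_def)

lemma clin_add: "clin A f ==> x:A ==> y:A ==> f(x+y) = f x+f y"
 and clin_scale: "clin A f ==> x:A ==> f(c*.x) = c*.f x"
 by(auto simp:clin_def)

lemma cbilI:
 assumes "!!a. a:A ==> clin B(f a)" and "!!b. b:B ==> clin A(%a. f a b)"
 shows "cbil A B f"
 using assms by(auto simp:cbil_def)

lemma cbilD1: "cbil A B f ==> a:A ==> clin B(f a)"
 and cbilD2: "cbil A B f ==> b:B ==> clin A(%a. f a b)"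
 by(auto simp:cbil_def)

lemma clin_zero:
 assumes "clin A f" "csub A"
 shows "f 0 = 0"
proof -
 have "0:A" using assms(2) by(rule csub_0)
 from clin_scale[OF assms(1) this,of 0] show ?thesis by(simp add:scale_simps)
qed

lemma clin_minus:
 assumes "clin A f" "x:A"
 shows "f(- x) = - f x"
 using clin_scale[OF assms,of "-1"] by(simp add:scale_simps)

lemma clin_diff:
 assumes "clin A f" "csub A" "x:A" "y:A"
 shows "f(x-y) = f x-f y"
proof -
 have "- y:A" using assms by(simp add:csub_neg)
 thus ?thesis
  using clin_add[OF assms(1,3),of "- y"] clin_minus[OF assms(1,4)] by simp
qed

lemma clin_sum:
 assumes "clin A f" "csub A" "!!i. i:I ==> x i:A"
 shows "f(\<Sum>i\<in>I. x i) = (\<Sum>i\<in>I. f(x i))"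
 using assms(3)
 by(induction I rule: infinite_finite_induct)
  (simp_all add: clin_zero[OF assms(1,2)] clin_add[OF assms(1)]
  csub_sum[OF assms(2)])

lemma clin_subset: "clin A f ==> B \<subseteq> A ==> clin B f"
 unfolding clin_def by blast

lemma clin_cong:
 assumes "clin A f" "csub A" "!!x. x:A ==> g x = f x"
 shows "clin A g"
 using assms by(auto simp:clin_def csub_add csub_scale)

lemma clin_compose:
 assumes "clin B g" "clin A f" "!!x. x:A ==> f x:B"
 shows "clin A(%x. g(f x))"
 using assms by(auto simp:clin_def)

lemma clin_ident [li]: "clin A(%x. x)"
 by(simp add:clin_def)

lemma clin_const_zero [li]: "clin A(%x. 0)"
 by(simp add:clin_def scale_simps)

lemma clin_plus [li]:
 "clin A f ==> clin A g ==> clin A(%x. f x+g x)"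
 by(simp add:clin_def scaleC_add_right algebra_simps)

lemma clin_uminus [li]: "clin A f ==> clin A(%x. - f x)"
 by(simp add:clin_def scale_simps)

lemma clin_minus_fun [li]:
 "clin A f ==> clin A g ==> clin A(%x. f x-g x)"
 by(simp add:clin_def cscale_right_diff_distrib algebra_simps)

lemma clin_setsum [li]:
 "(!!i. i:I ==> clin A(f i)) ==> clin A(%x. \<Sum>i\<in>I. f i x)"
 by(simp add:clin_def sum.distrib cscale_sum_right)

lemma clin_scaleC [li]: "clin A f ==> clin A(%x. c*.f x)"
 by(simp add:clin_def scaleC_add_right scaleC_scaleC mult.commute)

lemma clin_scaleC_left [li]: "clin A f ==> clin A(%x. f x*.v)"
 by(simp add:clin_def scaleC_add_left scaleC_scaleC scaleC_complex_def)

lemma clin_mult_left [li]: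
 "clin A f ==> clin A(%x. f x*(a::'b::complex_algebra_1))"
 by(simp add:clin_def distrib_right mult_scaleC_left)

lemma clin_mult_right [li]:
 "clin A f ==> clin A(%x.(a::'b::complex_algebra_1) * f x)"
 by(simp add:clin_def distrib_left mult_scaleC_right)

lemma clin_if [li]:
 "(b ==> clin A f) ==>(~ b ==> clin A g) ==> clin A(%x. if b then f x else g x)"
 by(cases b) simp_all

lemma clin_funI: "(!!y. clin A(%x. f x y)) ==> clin A f"
 by(simp add:clin_def fun_eq_iff scaleC_fun_apply)

section \<open>Tensor products\<close>

lemma pure_tensor_add_left: "(a+a') \<otimes>\<^sub>C b = a \<otimes>\<^sub>C b+a' \<otimes>\<^sub>C b"
proof(transfer,unfold tensor_eq_def)
 fix a a' :: 'a and b :: 'b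
 have "sgl(a+a',b)(1::complex)-sgl(a,b) 1-sgl(a',b) 1:cspan tensor_relators"
  by(rule cspan_base) (unfold tensor_relators_def,blast)
 thus "sgl(a+a',b)(1::complex)-(sgl(a,b) 1+sgl(a',b) 1):cspan tensor_relators" by(simp add:diff_diff_add)
qed

lemma pure_tensor_add_right: "a \<otimes>\<^sub>C(b+b') = a \<otimes>\<^sub>C b+a \<otimes>\<^sub>C b'"
proof(transfer,unfold tensor_eq_def)
 fix b b' :: 'b and a :: 'a
 have "sgl(a,b+b')(1::complex)-sgl(a,b) 1-sgl(a,b') 1:cspan tensor_relators"
  by(rule cspan_base) (unfold tensor_relators_def,blast)
 thus "sgl(a,b+b')(1::complex)-(sgl(a,b) 1+sgl(a,b') 1):cspan tensor_relators" by(simp add:diff_diff_add)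
qed

lemma pure_tensor_scale_left: "(c*.a) \<otimes>\<^sub>C b = c *.(a \<otimes>\<^sub>C b)"
 by(transfer,unfold tensor_eq_def,rule cspan_base)
  (unfold tensor_relators_def,blast)

lemma pure_tensor_scale_right: "a \<otimes>\<^sub>C(c*.b) = c *.(a \<otimes>\<^sub>C b)"
 by(transfer,unfold tensor_eq_def,rule cspan_base)
  (unfold tensor_relators_def,blast)

lemma clin_pure_left [li]: "clin A f ==> clin A(%x. f x \<otimes>\<^sub>C b)"
 by(simp add:clin_def pure_tensor_add_left pure_tensor_scale_left)

lemma clin_pure_right [li]: "clin A f ==> clin A(%x. a \<otimes>\<^sub>C f x)"
 by(simp add:clin_def pure_tensor_add_right pure_tensor_scale_right)

lemma abs_tensor_add: "abs_tensor(p+q) = abs_tensor p+abs_tensor q"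
 by(simp add:plus_tensor.abs_eq)

lemma abs_tensor_scale: "abs_tensor(c*.p) = c*.abs_tensor p"
 by(simp add:scaleC_tensor.abs_eq)

lemma abs_tensor_zero: "abs_tensor 0 = 0"
 by(simp add:zero_tensor_def)

lemma abs_tensor_single: "abs_tensor(sgl(a,b)c) = c *.(a \<otimes>\<^sub>C b)"
proof -
 have "sgl(a,b)c = c*.sgl(a,b) 1"
  by(rule poly_mapping_eqI) (simp add:lookup_scaleC lookup_single scaleC_complex_def when_def)
 thus ?thesis by(simp add:abs_tensor_scale pure_tensor.abs_eq)
qed

lemma keys_scaleC: "Poly_Mapping.keys(c*.p) \<subseteq> Poly_Mapping.keys(p :: _ \<Rightarrow>\<^sub>0 complex)"
 by(auto simp:in_keys_iff lookup_scaleC)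

lemma poly_mapping_sum_singles:
 "p = (\<Sum>k\<in>Poly_Mapping.keys p. sgl k(Poly_Mapping.lookup p k))"
 by(rule poly_mapping_eqI)
  (auto simp:lookup_sum lookup_single when_def in_keys_iff sum.delta)

text \<open>Ties the span that defines \<open>tsp\<close> to the representatives among which
  \<open>tensor_lift_on\<close> chooses, so that lifts over subspaces can be computed from any
  admissible representative.\<close>

lemma tsp_rep:
 "t:tsp A B \<longleftrightarrow>(\<exists>p. Poly_Mapping.keys p \<subseteq> A\<times>B&abs_tensor p = t)"
proof
 assume "t:tsp A B"
 thus "\<exists>p. Poly_Mapping.keys p \<subseteq> A\<times>B&abs_tensor p = t"
  unfolding tsp_def
 proof(induction rule: cspan_induct_alt)
  case base
  show ?case by(intro exI[of _ 0]) (simp add:abs_tensor_zero)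
 next
  case(step c x y)
  then obtain a b p where *: "x = a \<otimes>\<^sub>C b" "a:A" "b:B" "Poly_Mapping.keys p \<subseteq> A\<times>B"
  "abs_tensor p = y" by auto
  have "Poly_Mapping.keys(sgl(a,b)c+p) \<subseteq> A\<times>B"
  using Poly_Mapping.keys_add[of "sgl(a,b)c" p] * by(auto split: if_splits)
  thus ?case
  by(intro exI[of _ "sgl(a,b)c+p"])
  (simp add:abs_tensor_add abs_tensor_single *)
 qed
next
 assume "\<exists>p. Poly_Mapping.keys p \<subseteq> A\<times>B&abs_tensor p = t"
 then obtain p where p: "Poly_Mapping.keys p \<subseteq> A\<times>B" "abs_tensor p = t" by blast
 have *: "abs_tensor(\<Sum>k\<in>K. sgl k(Poly_Mapping.lookup p k)):tsp A B"
  if "finite K" "K \<subseteq> A\<times>B" for K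
  using that
 proof(induction K rule: finite_induct)
  case empty
  show ?case by(simp add:abs_tensor_zero tsp_def cspan_zero)
 next
  case(insert k K)
  obtain a b where k: "k = (a,b)" by force
  have "a \<otimes>\<^sub>C b:tsp A B"
  unfolding tsp_def by(rule cspan_base) (use insert k in auto)
  thus ?case using insert k
  unfolding tsp_def
  by(simp add:abs_tensor_add abs_tensor_single cspan_add cspan_scale)
 qed
 show "t:tsp A B"
  using *[OF _ p(1)] p(2) poly_mapping_sum_singles[of p] by simp
qed

lemma sub_tensor_space: "csub(tsp A B)"
 unfolding tsp_def by(rule csub_span)

lemma pure_in_tensor_space: "a:A ==> b:B ==> a \<otimes>\<^sub>C b:tsp A B"
 unfolding tsp_def by(rule cspan_base) auto

lemma tsp_UNIV: "tsp UNIV UNIV = UNIV"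
proof -
 have "t:tsp UNIV UNIV" for t :: "('a::complex_vector,'b::complex_vector)tensor"
  using Quotient3_abs_rep[OF Quotient3_tensor,of t] by(auto simp:tsp_rep)
 thus ?thesis by blast
qed

text \<open>The scalars of a linear combination are absorbed into the left factor; this is why
  \<open>A\<close> has to be a subspace and why no case for scalar multiples remains.\<close>

lemma tsp_induct [consumes 2,case_names zero add]:
 assumes "t:tsp A B" "csub A"
  and "P 0"
  and "!!a b t. a:A ==> b:B ==> t:tsp A B ==> P t ==> P(a \<otimes>\<^sub>C b+t)"
 shows "P t"
proof -
 have "t:tsp A B&P t"
  using assms(1) unfolding tsp_def
 proof(induction rule: cspan_induct_alt)
  case base
  show ?case by(simp add:cspan_zero assms(3))
 next
  case(step c x y)
  then obtain a b where *: "x = a \<otimes>\<^sub>C b" "a:A" "b:B" by auto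
  have "P((c*.a) \<otimes>\<^sub>C b+y)"
  by(rule assms(4)) (use * step csub_scale[OF assms(2)] in \<open>auto simp: tsp_def\<close>)
  thus ?case
  using step by(auto simp:pure_tensor_scale_left * cspan_add
  cspan_scale cspan_base)
 qed
 thus ?thesis by simp
qed

lemma tensor_induct [case_names zero add]:
 assumes "P 0" "!!a b t. P t ==> P(a \<otimes>\<^sub>C b+t)"
 shows "P t"
 by(rule tsp_induct[of t UNIV UNIV]) (use assms in \<open>auto simp: tsp_UNIV\<close>)

lemma clin_tensor_lift_on:
 assumes "csub A" "csub B" "cbil A B f"
 shows "clin(tsp A B)(tlift_on A B f)"
proof(rule clinI)
 fix s t assume "s:tsp A B" "t:tsp A B"
 then obtain p q where pq: "Poly_Mapping.keys p \<subseteq> A\<times>B" "abs_tensor p = s"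
  "Poly_Mapping.keys q \<subseteq> A\<times>B" "abs_tensor q = t" by(auto simp:tsp_rep)
 have k: "Poly_Mapping.keys(p+q) \<subseteq> A\<times>B"
  using Poly_Mapping.keys_add[of p q] pq by auto
 show "tlift_on A B f(s+t) = tlift_on A B f s+tlift_on A B f t"
  using tlift_on_abs[OF assms k] tlift_on_abs[OF assms pq(1)]
  tlift_on_abs[OF assms pq(3)] pq
  by(simp add:abs_tensor_add free_eval_add)
next
 fix c t assume "t:tsp A B"
 then obtain p where p: "Poly_Mapping.keys p \<subseteq> A\<times>B" "abs_tensor p = t"
  by(auto simp:tsp_rep)
 have k: "Poly_Mapping.keys(c*.p) \<subseteq> A\<times>B"
  using keys_scaleC[of c p] p by blast
 show "tlift_on A B f(c*.t) = c*.tlift_on A B f t"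
  using tlift_on_abs[OF assms k] tlift_on_abs[OF assms p(1)] p
  by(simp add:abs_tensor_scale free_eval_scaleC)
qed

lemma lin_tensor_lift: "bilin f ==> lin(tlift f)"
 using clin_tensor_lift_on[of UNIV UNIV f] by(simp add:tsp_UNIV)

lemma tlift_pure: "bilin f ==> tlift f(a \<otimes>\<^sub>C b) = f a b"
 by(rule tlift_on_pure) simp_all

lemma tlift_zero: "bilin f ==> tlift f 0 = 0"
 by(rule clin_zero[OF lin_tensor_lift]) simp_all

lemma tlift_plus: "bilin f ==> tlift f(s+t) = tlift f s+tlift f t"
 using lin_tensor_lift[of f] by(simp add:clin_def)

lemmas tlift_simps = tlift_zero tlift_plus tlift_pure

lemma clin_tensor_lift_arg [li]:
 "bilin F ==> clin A f ==> clin A(%x. tlift F(f x))"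
 by(rule clin_compose[OF lin_tensor_lift]) simp_all

lemma tlift_in_subspace:
 assumes "bilin f" "csub A" "!!a b. f a b:A"
 shows "tlift f t:A"
 by(induction t rule: tensor_induct)
  (simp_all add: tlift_simps assms csub_0 csub_add)

text \<open>Compositions and actions are controlled only on Hom spaces, so the map that is moved
  inside the Sweedler sum may be linear on a subspace only.\<close>

lemma tlift_clinear_on:
 assumes "bilin f" "clin A g" "csub A" "!!a b. f a b:A"
 shows "bilin(%a b. g(f a b))" "g(tlift f t) = tlift(%a b. g(f a b))t"
proof -
 show gf: "bilin(%a b. g(f a b))"
  using assms by(auto simp:cbil_def clin_def)
 show "g(tlift f t) = tlift(%a b. g(f a b))t"
  by(induction t rule: tensor_induct)
  (simp_all add: tlift_simps gf assms(1,4) clin_zero[OF assms(2,3)]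
  clin_add[OF assms(2)] tlift_in_subspace[OF assms(1,3)])
qed

lemma tlift_lin:
 assumes "bilin f" "lin g"
 shows "g(tlift f t) = tlift(%a b. g(f a b))t"
 using tlift_clinear_on(2)[of f UNIV g] assms by simp

lemma clin_tensor_lift_fun [li]:
 assumes "!!x. x:A ==> bilin(F x)" "!!a b. clin A(%x. F x a b)" "csub A"
 shows "clin A(%x. tlift(F x)t)"
proof(induction t rule: tensor_induct)
 case zero
 show ?case
  by(rule clin_cong[OF clin_const_zero assms(3)]) (simp add:tlift_simps assms(1))
next
 case(add a b t)
 show ?case
  by(rule clin_cong[OF clin_plus[OF assms(2) add] assms(3)])
  (simp add:tlift_simps assms(1))
qed

lemma lin_tensor_lift_fun [li]:
 "(!!x. bilin(F x)) ==>(!!a b. lin(%x. F x a b)) ==> lin(%x. tlift(F x)t)"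
 by(rule clin_tensor_lift_fun) simp_all

lemma tlift_add_fun:
 "bilin f ==> bilin g ==> tlift(%a b. f a b+g a b)t = tlift f t+tlift g t"
proof(induction t rule: tensor_induct)
 case zero
 hence "bilin(%a b. f a b+g a b)" by(auto simp:cbil_def intro!:li)
 thus ?case using zero by(simp add:tlift_simps)
next
 case(add a b t)
 hence "bilin(%a b. f a b+g a b)" by(auto simp:cbil_def intro!:li)
 thus ?case using add by(simp add:tlift_simps)
qed

lemma bilin_zero: "bilin(%a b. 0)"
 by(simp add:cbil_def clin_const_zero)

lemma tlift_zero_fun: "tlift(%a b. 0)t = 0"
 by(induction t rule: tensor_induct) (simp_all add: tlift_simps bilin_zero)

lemma bilin_sum: "(!!i. i:I ==> bilin(f i)) ==> bilin(%a b. \<Sum>i\<in>I. f i a b)"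
 by(auto simp:cbil_def intro!:li)

lemma tlift_sum_fun:
 "(!!i. i:I ==> bilin(f i)) ==> tlift(%a b. \<Sum>i\<in>I. f i a b)t = (\<Sum>i\<in>I. tlift(f i)t)"
 by(induction I rule: infinite_finite_induct)
  (simp_all add: tlift_zero_fun tlift_add_fun bilin_sum)

lemma tlift_scale_fun:
 "bilin f ==> tlift(%a b. c*.f a b)t = c*.tlift f t"
 by(rule tlift_lin[symmetric]) (auto intro!:li)

lemma tlift_mult_fun:
 "bilin f ==> tlift(%a b. c * f a b)t = c * tlift f(t :: (_,_)tensor)"
 for c :: "_ :: complex_algebra_1"
 by(rule tlift_lin[symmetric]) (auto intro!:li)

text \<open>Fubini for two independent Sweedler sums, by induction on one of the two
  tensors.\<close>

lemma tlift_swap: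
 assumes "!!a b. bilin(F a b)" "!!c d. bilin(%a b. F a b c d)"
 shows "tlift(%a b. tlift(F a b)t)s = tlift(%c d. tlift(%a b. F a b c d)s)t"
proof -
 have 1: "bilin(%a b. tlift(F a b)t)" for t
  using assms by(auto simp:cbil_def intro!:lin_tensor_lift_fun)
 have 2: "bilin(%c d. tlift(%a b. F a b c d)s)" for s
  using assms by(auto simp:cbil_def intro!:lin_tensor_lift_fun)
 show ?thesis
 proof(induction s rule: tensor_induct)
  case zero
  show ?case by(simp add:tlift_simps 1 assms tlift_zero_fun)
 next
  case(add a b s)
  thus ?case
  by(simp add:tlift_simps 1 assms tlift_add_fun 2)
 qed
qed

lemma bilinI: "(!!a. lin(f a)) ==>(!!b. lin(%a. f a b)) ==> bilin f"
 by(simp add:cbil_def)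

lemma bilinD1: "bilin f ==> lin(f a)" and bilinD2: "bilin f ==> lin(%a. f a b)"
 by(simp_all add: cbil_def)

lemma lin_comp: "lin g ==> clin A f ==> clin A(%x. g(f x))"
 by(rule clin_compose[of UNIV]) simp_all

section \<open>Sweedler calculus in a Hopf algebra\<close>

text \<open>The recursion on the first slot follows that of \<open>sweedler_list\<close>, and as
  there \<open>n\<close> stands for lists of length \<open>n + 1\<close>. \<open>mlin_iff\<close> is
  the form in which all slots are alike.\<close>

primrec mlin :: "nat =>('h::complex_vector list => 'a::complex_vector) => bool" where
 "mlin 0 F \<longleftrightarrow> lin(%h. F [h])"
| "mlin(Suc n)F \<longleftrightarrow>(\<forall>h. mlin n(%ks. F(h#ks)))&(\<forall>ks. length ks = Suc n-->lin(%h. F(h#ks)))"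

lemma mlin_iff:
 "mlin n F \<longleftrightarrow>(\<forall>ks. length ks = Suc n -->(\<forall>i\<le>n. lin(%h. F(ks[i := h]))))"
proof(induction n arbitrary: F)
 case 0
 show ?case
 proof
  assume *: "mlin 0 F"
  show "\<forall>ks. length ks = Suc 0 -->(\<forall>i\<le>0. lin(%h. F(ks[i := h])))"
  using * by(auto simp:length_Suc_conv)
 next
  assume "\<forall>ks. length ks = Suc 0 -->(\<forall>i\<le>0. lin(%h. F(ks[i := h])))"
  from this[rule_format,of "[undefined]" 0] show "mlin 0 F" by simp
 qed
next
 case(Suc n)
 show ?case
 proof
  assume *: "mlin(Suc n)F"
  show "\<forall>ks. length ks = Suc(Suc n) -->(\<forall>i\<le>Suc n. lin(%h. F(ks[i := h])))"
  proof(intro allI impI)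
  fix ks :: "'a list" and i assume ks: "length ks = Suc(Suc n)" and i: "i<=Suc n"
  then obtain k ks' where k: "ks = k#ks'" "length ks' = Suc n" by(auto simp:length_Suc_conv)
  show "lin(%h. F(ks[i := h]))"
  proof(cases i)
  case 0
  thus ?thesis using * k by simp
  next
  case(Suc j)
  have "mlin n(%ks. F(k#ks))" using * by simp
  thus ?thesis using Suc.IH k i Suc by auto
  qed
  qed
 next
  assume *: "\<forall>ks. length ks = Suc(Suc n) -->(\<forall>i\<le>Suc n. lin(%h. F(ks[i := h])))"
  have "mlin n(%ks. F(h#ks))" for h
  unfolding Suc.IH using *[rule_format,of "h#ks" "Suc i" for ks i] by auto
  moreover have "lin(%h. F(h#ks))" if "length ks = Suc n" for ks
  using *[rule_format,of "undefined#ks" 0] that by simp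
  ultimately show "mlin(Suc n)F" by simp
 qed
qed

lemma mlinI: "(!!ks i. length ks = Suc n ==> i<=n ==> lin(%h. F(ks[i := h]))) ==> mlin n F"
 by(simp add:mlin_iff)

lemma mlinD: "mlin n F ==> length ks = Suc n ==> i<=n ==> lin(%h. F(ks[i := h]))"
 by(simp add:mlin_iff)

lemma mlin_cong: "(!!ks. length ks = Suc n ==> F ks = G ks) ==> mlin n F = mlin n G"
 unfolding mlin_iff by simp

lemma mlin_append_left: "mlin(Suc(i+j))F ==> length ks = Suc i ==> mlin j(%ls. F(ks@ls))"
proof(rule mlinI)
 fix ls :: "'a list" and l
 assume "mlin(Suc(i+j))F" "length ks = Suc i" "length ls = Suc j" "l<=j"
 thus "lin(%h. F(ks@ls[l := h]))"
  using mlinD[of "Suc(i+j)" F "ks@ls" "Suc i+l"] by(simp add:list_update_append)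
qed

lemma mlin_append_right: "mlin(Suc(i+j))F ==> length ls = Suc j ==> mlin i(%ks. F(ks@ls))"
proof(rule mlinI)
 fix ks :: "'a list" and l
 assume "mlin(Suc(i+j))F" "length ls = Suc j" "length ks = Suc i" "l<=i"
 thus "lin(%h. F(ks[l := h]@ls))"
  using mlinD[of "Suc(i+j)" F "ks@ls" l] by(simp add:list_update_append)
qed

lemma mlin_compose: "mlin n F ==> lin g ==> mlin n(%ks. g(F ks))"
 unfolding mlin_iff by(auto intro:lin_comp)

locale hopf =
 fixes H :: "'h::complex_algebra_1 hopf"
 assumes hopf: "hopf_algebra H" and bij_antipode: "bij(antipode H)"
begin

abbreviation "\<Delta> == comult H"
abbreviation "\<epsilon> == counit H"
abbreviation "S == antipode H"
abbreviation "S' == antipode_inv H"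

lemma lin_comult: "lin \<Delta>" and lin_counit0: "lin \<epsilon>" and lin_antipode0: "lin S"
 using hopf by(auto simp:hopf_algebra_def)

lemma S'_S: "S'(S h) = h" and S_S': "S(S' h) = h"
 using bij_antipode by(simp_all add: bij_is_inj bij_is_surj surj_f_inv_f)

lemma lin_antipode_inv0: "lin S'"
proof(rule clinI)
 fix x y and c
 have "S'(S(S' x+S' y)) = S'(x+y)"
  by(simp add:clin_add[OF lin_antipode0] S_S')
 thus "S'(x+y) = S' x+S' y" by(simp add:S'_S)
 have "S'(S(c*.S' x)) = S'(c*.x)"
  by(simp add:clin_scale[OF lin_antipode0] S_S')
 thus "S'(c*.x) = c*.S' x" by(simp add:S'_S)
qed

lemmas lin_H [li] = lin_comp[OF lin_comult] lin_comp[OF lin_counit0]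
 lin_comp[OF lin_antipode0] lin_comp[OF lin_antipode_inv0]

lemma bilin_counit1: "lin G ==> bilin(%h1 h2. \<epsilon> h1*.G h2)"
 and bilin_counit2: "lin G ==> bilin(%h1 h2. \<epsilon> h2*.G h1)"
 by(auto intro!:bilinI li)

lemma counit1: "lin G ==> tlift(%h1 h2. \<epsilon> h1*.G h2)(\<Delta> h) = G h"
proof -
 assume G: "lin G"
 have "G(tlift(%h1 h2. \<epsilon> h1*.h2)(\<Delta> h)) = tlift(%h1 h2. G(\<epsilon> h1*.h2))(\<Delta> h)"
  by(rule tlift_lin[OF bilin_counit1 G]) (rule li)
 thus ?thesis using hopf by(simp add:hopf_algebra_def clin_scale[OF G])
qed

lemma counit2: "lin G ==> tlift(%h1 h2. \<epsilon> h2*.G h1)(\<Delta> h) = G h"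
proof -
 assume G: "lin G"
 have "G(tlift(%h1 h2. \<epsilon> h2*.h1)(\<Delta> h)) = tlift(%h1 h2. G(\<epsilon> h2*.h1))(\<Delta> h)"
  by(rule tlift_lin[OF bilin_counit2 G]) (rule li)
 thus ?thesis using hopf by(simp add:hopf_algebra_def clin_scale[OF G])
qed

lemma antipode1: "lin G ==> tlift(%h1 h2. G(S h1 * h2))(\<Delta> h) = \<epsilon> h*.G 1"
proof -
 assume G: "lin G"
 have "G(tlift(%h1 h2. S h1 * h2)(\<Delta> h)) = tlift(%h1 h2. G(S h1 * h2))(\<Delta> h)"
  by(rule tlift_lin[OF _ G]) (auto intro!:bilinI li)
 thus ?thesis using hopf by(simp add:hopf_algebra_def clin_scale[OF G])
qed

lemma antipode2: "lin G ==> tlift(%h1 h2. G(h1 * S h2))(\<Delta> h) = \<epsilon> h*.G 1"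
proof -
 assume G: "lin G"
 have "G(tlift(%h1 h2. h1 * S h2)(\<Delta> h)) = tlift(%h1 h2. G(h1 * S h2))(\<Delta> h)"
  by(rule tlift_lin[OF _ G]) (auto intro!:bilinI li)
 thus ?thesis using hopf by(simp add:hopf_algebra_def clin_scale[OF G])
qed

lemma comult_one: "\<Delta> 1 = 1 \<otimes>\<^sub>C 1" and counit_one: "\<epsilon> 1 = 1" and counit_mult: "\<epsilon>(a * b) = \<epsilon> a*\<epsilon> b"
 using hopf by(auto simp:hopf_algebra_def)

lemma comult_mult:
 assumes "bilin F"
 shows "tlift F(\<Delta>(a * b)) = tlift(%a1 a2. tlift(%b1 b2. F(a1 * b1)(a2 * b2))(\<Delta> b))(\<Delta> a)"
proof -
 have b1: "bilin(%b1 b2.(a1 * b1) \<otimes>\<^sub>C(a2 * b2))" for a1 a2 :: 'h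
  by(auto intro!:bilinI li)
 have b2: "bilin(%a1 a2. tlift(%b1 b2.(a1 * b1) \<otimes>\<^sub>C(a2 * b2))(\<Delta> b))" for b :: 'h
  by(auto intro!:bilinI li)
 have "tlift F(\<Delta>(a * b)) = tlift F(tlift(%a1 a2. tlift(%b1 b2.(a1 * b1) \<otimes>\<^sub>C(a2 * b2))(\<Delta> b))(\<Delta> a))"
  using hopf by(simp add:hopf_algebra_def)
 thus ?thesis
  by(simp add:tlift_lin[OF b2 lin_tensor_lift[OF assms]]
  tlift_lin[OF b1 lin_tensor_lift[OF assms]] tlift_pure[OF assms])
qed

text \<open>The hypothesis is an equality of triple tensors, to which a trilinear functional is
  applied. With an arbitrary linear \<open>D\<close> it covers both the coproduct and the coaction
  on \<open>M\<close>.\<close>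

lemma coassoc_general:
 assumes ax: "tlift(%a c. tlift(%a1 a2. a1 \<otimes>\<^sub>C(a2 \<otimes>\<^sub>C c))(\<Delta> a))s = tlift(%a c. a \<otimes>\<^sub>C D c)s"
  and D: "lin D"
  and F: "!!a b. lin(F a b)" "!!a c. lin(%b. F a b c)" "!!b c. lin(%a. F a b c)"
 shows "tlift(%x c. tlift(%a b. F a b c)(\<Delta> x))s = tlift(%a y. tlift(%b c. F a b c)(D y))s"
proof -
 note F' = lin_comp[OF F(1)] lin_comp[OF F(2)] lin_comp[OF F(3)]
 let ?G = "tlift(%x y. tlift(%b c. F x b c)y)"
 have bF: "bilin(F x)" for x by(intro bilinI F)
 have bG: "bilin(%x y. tlift(%b c. F x b c)y)"
  by(intro bilinI li F bF)
 have b1: "bilin(%a1 a2. a1 \<otimes>\<^sub>C(a2 \<otimes>\<^sub>C c))" for c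
  by(intro bilinI li)
 have b2: "bilin(%a c. tlift(%a1 a2. a1 \<otimes>\<^sub>C(a2 \<otimes>\<^sub>C c))(\<Delta> a))"
  by(intro bilinI li)
 have b3: "bilin(%a c. a \<otimes>\<^sub>C D c)"
  by(intro bilinI li lin_comp[OF D])
 have "?G(tlift(%a c. tlift(%a1 a2. a1 \<otimes>\<^sub>C(a2 \<otimes>\<^sub>C c))(\<Delta> a))s) = tlift(%x c. tlift(%a b. F a b c)(\<Delta> x))s"
  by(simp add:tlift_lin[OF b2 lin_tensor_lift[OF bG]]
  tlift_lin[OF b1 lin_tensor_lift[OF bG]] tlift_pure[OF bG] tlift_pure[OF bF])
 moreover have "?G(tlift(%a c. a \<otimes>\<^sub>C D c)s) = tlift(%a y. tlift(%b c. F a b c)(D y))s"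
  by(simp add:tlift_lin[OF b3 lin_tensor_lift[OF bG]] tlift_pure[OF bG])
 ultimately show ?thesis by(simp add:ax)
qed

lemma coassoc:
 assumes F: "!!a b. lin(F a b)" "!!a c. lin(%b. F a b c)" "!!b c. lin(%a. F a b c)"
 shows "tlift(%x c. tlift(%a b. F a b c)(\<Delta> x))(\<Delta> h) = tlift(%a y. tlift(%b c. F a b c)(\<Delta> y))(\<Delta> h)"
 by(rule coassoc_general[OF _ lin_comult F]) (use hopf in \<open>simp add: hopf_algebra_def\<close>)

lemma counit_antipode: "\<epsilon>(S h) = \<epsilon> h"
proof -
 have "\<epsilon>(S h) = tlift(%h1 h2. \<epsilon> h2*.\<epsilon>(S h1))(\<Delta> h)"
  by(rule counit2[symmetric]) (intro li)
 also have "... = tlift(%h1 h2. \<epsilon>(S h1 * h2))(\<Delta> h)"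
  by(simp add:counit_mult scaleC_complex_def mult.commute)
 also have "... = \<epsilon> h" by(simp add:antipode1 lin_counit0 counit_one scaleC_complex_def)
 finally show ?thesis .
qed

lemma counit_antipode_inv: "\<epsilon>(S' h) = \<epsilon> h"
 using counit_antipode[of "S' h"] by(simp add:S_S')

text \<open>Uniqueness of convolution inverses: \<open>S(a1 b1) (a2 b2) (S b3 S a3)\<close>
  collapses to \<open>S b S a\<close> when the first two factors are contracted, and to
  \<open>S(a b)\<close> when first \<open>b2\<close> with \<open>S b3\<close> and then
  \<open>a2\<close> with \<open>S a3\<close> are contracted.\<close>

lemma antipode_mult: "S(a * b) = S b * S a"
proof -
 note [li] = lin_antipode0
 let ?tl = "tlift"
 let ?F = "%a1 b1 a2 b2 a3 b3. S(a1 * b1)*(a2 * b2)*(S b3 * S a3)"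
 have "S b * S a = ?tl(%x a3. ?tl(%y b3. \<epsilon> x *.(\<epsilon> y *.(S b3 * S a3)))(\<Delta> b))(\<Delta> a)"
 proof -
  have "?tl(%y b3. \<epsilon> x *.(\<epsilon> y *.(S b3 * S a3)))(\<Delta> b) = \<epsilon> x *.(S b * S a3)" for x a3
  using counit1[of "%b3. S b3 * S a3" b]
  by(subst tlift_scale_fun) (auto intro!:bilinI li)
  thus ?thesis by(simp add:counit1[of "%a3. S b * S a3"] li)
 qed
 also have "... = ?tl(%x a3. ?tl(%y b3. ?tl(%c1 c2. S c1 * c2*(S b3 * S a3))(\<Delta>(x * y)))(\<Delta> b))(\<Delta> a)"
  using antipode1[of "%z. z*(S b3 * S a3)" for b3 a3]
  by(simp add:li counit_mult scaleC_scaleC)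
 also have "... = ?tl(%x a3. ?tl(%y b3. ?tl(%a1 a2. ?tl(%b1 b2. ?F a1 b1 a2 b2 a3 b3)(\<Delta> y))(\<Delta> x))(\<Delta> b))(\<Delta> a)"
  by(subst comult_mult) (auto intro!:bilinI li)
 also have "... = ?tl(%x a3. ?tl(%a1 a2. ?tl(%y b3. ?tl(%b1 b2. ?F a1 b1 a2 b2 a3 b3)(\<Delta> y))(\<Delta> b))(\<Delta> x))(\<Delta> a)"
  by(subst tlift_swap) (auto intro!:bilinI li)
 also have "... = ?tl(%a1 x. ?tl(%a2 a3. ?tl(%y b3. ?tl(%b1 b2. ?F a1 b1 a2 b2 a3 b3)(\<Delta> y))(\<Delta> b))(\<Delta> x))(\<Delta> a)"
  by(rule coassoc) (auto intro!:bilinI li)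
 also have "... = ?tl(%a1 x. ?tl(%a2 a3. ?tl(%b1 y. ?tl(%b2 b3. ?F a1 b1 a2 b2 a3 b3)(\<Delta> y))(\<Delta> b))(\<Delta> x))(\<Delta> a)"
  by(subst coassoc) (auto intro!:bilinI li)
 also have "... = ?tl(%a1 x. ?tl(%a2 a3. ?tl(%b1 y. \<epsilon> y *.(S(a1 * b1)*(a2 * S a3)))(\<Delta> b))(\<Delta> x))(\<Delta> a)"
 proof -
  have "?tl(%b2 b3. ?F a1 b1 a2 b2 a3 b3)(\<Delta> y) = \<epsilon> y *.(S(a1 * b1)*(a2 * S a3))" for a1 b1 a2 a3 y
  using antipode2[of "%z. S(a1 * b1)*(a2*(z * S a3))" y]
  by(simp add:li mult.assoc)
  thus ?thesis by simp
 qed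
 also have "... = ?tl(%a1 x. ?tl(%a2 a3. S(a1 * b)*(a2 * S a3))(\<Delta> x))(\<Delta> a)"
  using counit2[of "%b1. S(a1 * b1)*(a2 * S a3)" for a1 a2 a3] by(simp add:li)
 also have "... = ?tl(%a1 x. \<epsilon> x*.S(a1 * b))(\<Delta> a)"
  using antipode2[of "%z. S(a1 * b) * z" for a1] by(simp add:li)
 also have "... = S(a * b)"
  using counit2[of "%a1. S(a1 * b)"] by(simp add:li)
 finally show ?thesis ..
qed

lemma antipode_inv_mult: "S'(a * b) = S' b * S' a"
 using antipode_mult[of "S' b" "S' a"] by(metis S'_S S_S')

lemma antipode_one: "S 1 = 1"
proof -
 have "tlift(%h1 h2. S h1 * h2)(\<Delta> 1) = \<epsilon> 1*.1"
  using antipode1[of "%x. x" 1] by(simp add:li)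
 moreover have "bilin(%h1 h2. S h1 * h2)" by(intro bilinI li)
 ultimately show ?thesis by(simp add:comult_one tlift_pure counit_one scaleC_one)
qed


lemma antipode_inv_one: "S' 1 = 1"
 by(metis S'_S antipode_one)

text \<open>The same convolution argument with values in the tensor square. Split \<open>h\<close>
  into \<open>x, a, b, c, d\<close> and consider the coproduct of \<open>S x\<close> times
  \<open>a S d\<close> and \<open>b S c\<close>: contracting \<open>b S c\<close> and then
  \<open>a S d\<close> leaves the coproduct of \<open>S h\<close>, contracting \<open>S x\<close>
  with the coproduct of \<open>a'\<close> leaves \<open>S d\<close> and \<open>S c\<close>.\<close>

lemma antipode_comult:
 assumes F: "bilin F"
 shows "tlift F(\<Delta>(S h)) = tlift(%h1 h2. F(S h2)(S h1))(\<Delta> h)"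
proof -
 note Fl [li] = lin_comp[OF bilinD1[OF F]] lin_comp[OF bilinD2[OF F]]
 let ?tl = "tlift"
 define K where "K = (%x a b c d. ?tl(%u v. F(u*(a * S d))(v * (b * S c)))(\<Delta>(S x)))"
 \<comment> \<open>Evaluation of \<open>L\<close> at \<open>1\<close> at the very end uses this
   bilinearity.\<close>
 have bK: "bilin(%u v. F(u * p)(v *  q))" for p q by(intro bilinI li)
 have K1 [li]: "lin f ==> lin(%z. K(f z)a b c d)" for f :: "'h => 'h" and a b c d
  unfolding K_def by(intro li bilinI)
 have K2 [li]: "lin f ==> lin(%z. K x(f z)b c d)" for f :: "'h => 'h" and x b c d
  unfolding K_def by(intro li bilinI)
 have K3 [li]: "lin f ==> lin(%z. K x a(f z)c d)" for f :: "'h => 'h" and x a c d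
  unfolding K_def by(intro li bilinI)
 have K4 [li]: "lin f ==> lin(%z. K x a b(f z)d)" for f :: "'h => 'h" and x a b d
  unfolding K_def by(intro li bilinI)
 have K5 [li]: "lin f ==> lin(%z. K x a b c(f z))" for f :: "'h => 'h" and x a b c
  unfolding K_def by(intro li bilinI)
 define A where "A = (%x p q. ?tl(%u v. F(u * p)(v *  q))(\<Delta>(S x)))"
 have A1 [li]: "lin f ==> lin(%z. A(f z)p q)" for f :: "'h => 'h" and p q
  unfolding A_def by(intro li bilinI)
 have A2 [li]: "lin f ==> lin(%z. A x(f z)q)" for f :: "'h => 'h" and x q
  unfolding A_def by(intro li bilinI)
 have A3 [li]: "lin f ==> lin(%z. A x p(f z))" for f :: "'h => 'h" and x p
  unfolding A_def by(intro li bilinI)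
 have 1: "\<epsilon> y*.A x 1 1 = ?tl(%a w. ?tl(%z d. ?tl(%b c. K x a b c d)(\<Delta> z))(\<Delta> w))(\<Delta> y)" for x y
 proof -
  have "?tl(%b c. K x a b c d)(\<Delta> z) = \<epsilon> z*.A x(a * S d) 1" for a d z
  using antipode2[of "%q. A x(a * S d)q" z] by(simp add:A_def K_def li A3[unfolded A_def])
  moreover have "?tl(%z d. \<epsilon> z*.A x(a * S d) 1)(\<Delta> w) = A x(a * S w) 1" for a w
  using counit1[of "%d. A x(a * S d) 1" w] by(simp add:li)
  moreover have "?tl(%a w. A x(a * S w) 1)(\<Delta> y) = \<epsilon> y*.A x 1 1"
  using antipode2[of "%p. A x p 1" y] by(simp add:li)
  ultimately show ?thesis by simp
 qed
 define L where "L = (%v z. ?tl(%c d. ?tl(%p q. F(p * S d)(q * S c))(\<Delta> z))(\<Delta> v))"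
 have L1 [li]: "lin f ==> lin(%z. L(f z)x)" for f :: "'h => 'h" and x
  unfolding L_def by(intro li bilinI)
 have L2 [li]: "lin f ==> lin(%z. L x(f z))" for f :: "'h => 'h" and x
  unfolding L_def by(intro li bilinI)
 have 2: "?tl(%a b. ?tl(%c d. K x a b c d)(\<Delta> v))(\<Delta> a') = L v(S x * a')" for x v a'
 proof -
  have "?tl(%a b. ?tl(%c d. K x a b c d)(\<Delta> v))(\<Delta> a') = ?tl(%c d. ?tl(%a b. K x a b c d)(\<Delta> a'))(\<Delta> v)"
  by(rule tlift_swap) (intro bilinI li)+
  also have "... = ?tl(%c d. ?tl(%p q. F(p * S d)(q * S c))(\<Delta>(S x * a')))(\<Delta> v)"
  proof -
  have "?tl(%a b. K x a b c d)(\<Delta> a') = ?tl(%p q. F(p * S d)(q * S c))(\<Delta>(S x * a'))" for c d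
  proof -
  have "?tl(%p q. F(p * S d)(q * S c))(\<Delta>(S x * a')) = ?tl(%u v. ?tl(%a b. F(u*(a * S d))(v * (b * S c)))(\<Delta> a'))(\<Delta>(S x))"
  by(subst comult_mult) (auto intro!:bilinI li simp:mult.assoc)
  also have "... = ?tl(%a b. K x a b c d)(\<Delta> a')"
  unfolding K_def by(rule tlift_swap) (intro bilinI li)+
  finally show ?thesis ..
  qed
  thus ?thesis by simp
  qed
  finally show ?thesis by(simp add:L_def)
 qed
 have "?tl F(\<Delta>(S h)) = A h 1 1" by(simp add:A_def)
 also have "... = ?tl(%x y. \<epsilon> y*.A x 1 1)(\<Delta> h)"
  using counit2[of "%x. A x 1 1" h] by(simp add:li)
 also have "... = ?tl(%x y. ?tl(%a w. ?tl(%z d. ?tl(%b c. K x a b c d)(\<Delta> z))(\<Delta> w))(\<Delta> y))(\<Delta> h)"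
  by(simp add:1)
 also have "... = ?tl(%x y. ?tl(%a w. ?tl(%b v. ?tl(%c d. K x a b c d)(\<Delta> v))(\<Delta> w))(\<Delta> y))(\<Delta> h)"
 proof -
  have "?tl(%z d. ?tl(%b c. K x a b c d)(\<Delta> z))(\<Delta> w) = ?tl(%b v. ?tl(%c d. K x a b c d)(\<Delta> v))(\<Delta> w)" for x a w
  by(rule coassoc) (intro bilinI li)+
  thus ?thesis by simp
 qed
 also have "... = ?tl(%x y. ?tl(%a' v. ?tl(%a b. ?tl(%c d. K x a b c d)(\<Delta> v))(\<Delta> a'))(\<Delta> y))(\<Delta> h)"
 proof -
  have "?tl(%a w. ?tl(%b v. ?tl(%c d. K x a b c d)(\<Delta> v))(\<Delta> w))(\<Delta> y) = ?tl(%a' v. ?tl(%a b. ?tl(%c d. K x a b c d)(\<Delta> v))(\<Delta> a'))(\<Delta> y)" for x y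
  by(rule coassoc[symmetric]) (intro bilinI li)+
  thus ?thesis by simp
 qed
 also have "... = ?tl(%x y. ?tl(%a' v. L v(S x * a'))(\<Delta> y))(\<Delta> h)"
  by(simp add:2)
 also have "... = ?tl(%g v. ?tl(%x a'. L v(S x * a'))(\<Delta> g))(\<Delta> h)"
  by(rule coassoc[symmetric]) (intro li)+
 also have "... = ?tl(%g v. \<epsilon> g*.L v 1)(\<Delta> h)"
  using antipode1[of "%z. L v z" for v] by(simp add:li)
 also have "... = L h 1"
  using counit1[of "%v. L v 1" h] by(simp add:li)
 also have "... = ?tl(%c d. F(S d)(S c))(\<Delta> h)"
  by(simp add:L_def comult_one tlift_pure bK)
 finally show ?thesis .
qed

lemma antipode_inv_comult:
 assumes F: "bilin F"
 shows "tlift F(\<Delta>(S' h)) = tlift(%h1 h2. F(S' h2)(S' h1))(\<Delta> h)"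
proof -
 note Fl [li] = lin_comp[OF bilinD1[OF F]] lin_comp[OF bilinD2[OF F]]
 have "tlift(%a b. F(S' b)(S' a))(\<Delta>(S(S' h))) = tlift F(\<Delta>(S' h))"
  by(subst antipode_comult) (auto intro!:bilinI li simp:S'_S)
 thus ?thesis by(simp add:S_S')
qed

text \<open>Apply \<open>S'\<close> to the antipode identity for \<open>h1 * S h2\<close>; being
  antimultiplicative it reverses the factors.\<close>

lemma antipode_inv1: "lin G ==> tlift(%h1 h2. G(h2 * S' h1))(\<Delta> h) = \<epsilon> h*.G 1"
 using antipode2[of "%z. G(S' z)" h]
 by(simp add:lin_comp lin_antipode_inv0 antipode_inv_mult S'_S antipode_inv_one)

section \<open>Iterated coproducts\<close>

abbreviation "sw == sweedler_list H"

lemma sw_cong: "(!!ks. length ks = Suc n ==> F ks = G ks) ==> sw n F h = sw n G h"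
proof(induction n arbitrary: F G h)
 case(Suc n)
 have "sw n(%ks. F(a#ks)) = sw n(%ks. G(a#ks))" for a
  by(rule ext,rule Suc.IH) (use Suc.prems in simp)
 thus ?case by simp
qed simp

text \<open>Linearity in \<open>h\<close> of a sum over \<open>n + 2\<close> slots needs linearity
  of the inner sum in its first slot, which acts as a parameter; so both statements go through one
  induction. The parameter has type \<open>'h\<close> here, and \<open>lin_sw_fun\<close> then
  admits any parameter space.\<close>

lemma lin_sw_aux:
 "(\<forall>F :: 'h list => 'a. mlin n F-->lin(sw n F))&(\<forall>F :: 'h => 'h list => 'a::complex_vector.(\<forall>x. mlin n(F x)) -->(\<forall>ks. length ks = Suc n-->lin(%x. F x ks)) -->(\<forall>h. lin(%x. sw n(F x)h)))"
proof(induction n)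
 case 0
 show ?case by auto
next
 case(Suc n)
 have IH1: "mlin n F ==> lin(sw n F)" for F :: "'h list => 'a" using Suc.IH by blast
 have IH2: "(!!x. mlin n(F x)) ==>(!!ks. length ks = Suc n ==> lin(%x. F x ks)) ==> lin(%x. sw n(F x)h)" for F :: "'h => 'h list => 'a" and h using Suc.IH by blast
 have bil: "bilin(%h1 h2. sw n(%ks. F(h1#ks))h2)" if "mlin(Suc n)F" for F :: "'h list => 'a"
 proof(rule bilinI)
  show "lin(sw n(%ks. F(a#ks)))" for a using that by(intro IH1) simp
  show "lin(%a. sw n(%ks. F(a#ks))b)" for b using that by(intro IH2) simp_all
 qed
 have "lin(sw(Suc n)F)" if "mlin(Suc n)F" for F :: "'h list => 'a"
 proof -
  have "sw(Suc n)F = (%h. tlift(%h1 h2. sw n(%ks. F(h1#ks))h2)(\<Delta> h))"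
  by(rule ext) simp
  thus ?thesis using clin_tensor_lift_arg[OF bil[OF that] lin_comult] by simp
 qed
 moreover have "lin(%x. sw(Suc n)(F x)h)"
  if "!!x. mlin(Suc n)(F x)" "!!ks. length ks = Suc(Suc n) ==> lin(%x. F x ks)"
  for F :: "'h => 'h list => 'a" and h
  by(simp,rule lin_tensor_lift_fun[OF bil[OF that(1)]],rule IH2)
  (use that in simp_all)
 ultimately show ?case by blast
qed

lemma lin_sw: "mlin n F ==> lin(sw n F)"
 by(rule lin_sw_aux[THEN conjunct1,rule_format])

lemma mlin_Cons: "mlin(Suc n)F ==> mlin n(%ks. F(h#ks))"
 and mlin_Cons_lin: "mlin(Suc n)F ==> length ks = Suc n ==> lin(%h. F(h#ks))"
 by simp_all

lemma lin_sw_fun: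
 "(!!x. mlin n(F x)) ==>(!!ks. length ks = Suc n ==> lin(%x. F x ks)) ==> lin(%x. sw n(F x)h)"
proof(induction n arbitrary: F h)
 case(Suc n)
 have "bilin(%h1 h2. sw n(%ks. F x(h1#ks))h2)" for x
 proof(rule bilinI)
  show "lin(sw n(%ks. F x(a#ks)))" for a by(intro lin_sw mlin_Cons Suc.prems)
  show "lin(%a. sw n(%ks. F x(a#ks))b)" for b
  by(rule lin_sw_aux[THEN conjunct2,rule_format])
  (use mlin_Cons[OF Suc.prems(1)] mlin_Cons_lin[OF Suc.prems(1)] in simp_all)
 qed
 moreover have "lin(%x. sw n(%ks. F x(a#ks))b)" for a b
  by(rule Suc.IH) (intro mlin_Cons Suc.prems,simp add:Suc.prems(2))
 ultimately show ?case by(simp add:lin_tensor_lift_fun)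
qed simp

lemma bilin_sw: "mlin(Suc n)F ==> bilin(%h1 h2. sw n(%ks. F(h1#ks))h2)"
 by(rule bilinI; (rule lin_sw | rule lin_sw_fun); simp)

lemma mlin_sw:
 assumes "mlin(Suc(i+j))F"
 shows "mlin i(%ks. sw j(%ls. F(ks@ls))h)"
proof(rule mlinI)
 fix ks :: "'h list" and l assume "length ks = Suc i" "l<=i"
 thus "lin(%x. sw j(%ls. F(ks[l := x]@ls))h)"
  using mlinD[OF assms,of "ks@ls" l for ls]
  by(intro lin_sw_fun mlin_append_left[OF assms]) (simp_all add: list_update_append)
qed

text \<open>Coassociativity lets the first coproduct be taken at any cut: the slots left of the cut
  come from \<open>h1\<close>, those right of it from \<open>h2\<close>.\<close>

lemma sw_split:
 assumes "mlin(Suc(i+j))F"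
 shows "sw(Suc(i+j))F h = tlift(%h1 h2. sw i(%ks. sw j(%ls. F(ks@ls))h2)h1)(\<Delta> h)"
 using assms
proof(induction i arbitrary: F h)
 case 0
 show ?case by simp
next
 case(Suc i)
 have m: "mlin(Suc(i+j))(%ks. F(a#ks))" for a
  using Suc.prems by simp
 let ?T = "%a b c. sw i(%ks. sw j(%ls. F(a#(ks@ls)))c)b"
 have l1: "lin(?T a b)" for a b
  by(rule lin_sw_fun[OF mlin_sw[OF m]],rule lin_sw[OF mlin_append_left[OF m]])
 have l2: "lin(%b. ?T a b c)" for a c
  by(rule lin_sw[OF mlin_sw[OF m]])
 have l3: "lin(%a. ?T a b c)" for b c
  by(rule lin_sw_fun[OF mlin_sw[OF m]],rule lin_sw_fun[OF mlin_append_left[OF m]])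
  (use Suc.prems in simp_all)
 have "sw(Suc(Suc i+j))F h = tlift(%a y. tlift(%b c. ?T a b c)(\<Delta> y))(\<Delta> h)"
  using Suc.IH[OF m] by simp
 also have "... = tlift(%x c. tlift(%a b. ?T a b c)(\<Delta> x))(\<Delta> h)"
  by(rule coassoc[symmetric]) (intro l1 l2 l3)+
 finally show ?case by simp
qed

lemma sw_snoc:
 assumes "mlin(Suc n)F"
 shows "sw(Suc n)F h = tlift(%h1 h2. sw n(%ks. F(ks@[h2]))h1)(\<Delta> h)"
 using sw_split[of n 0 F] assms by simp

lemma sw_clinear_on:
 assumes "mlin n F" "clin A g" "csub A" "!!ks. length ks = Suc n ==> F ks:A"
 shows "sw n F h:A" "g(sw n F h) = sw n(%ks. g(F ks))h"
proof -
 have "sw n F h:A&g(sw n F h) = sw n(%ks. g(F ks))h"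
  using assms(1,4)
 proof(induction n arbitrary: F h)
  case(Suc n)
  have *: "sw n(%ks. F(h1#ks))h2:A&g(sw n(%ks. F(h1#ks))h2) = sw n(%ks. g(F(h1#ks)))h2" for h1 h2
  by(rule Suc.IH) (use Suc.prems in auto)
  show ?case
  using tlift_in_subspace[OF bilin_sw[OF Suc.prems(1)] assms(3)]
  tlift_clinear_on[OF bilin_sw[OF Suc.prems(1)] assms(2,3)] * by simp
 qed simp
 thus "sw n F h:A" "g(sw n F h) = sw n(%ks. g(F ks))h" by auto
qed

lemma sw_lin: "mlin n F ==> lin g ==> g(sw n F h) = sw n(%ks. g(F ks))h"
 using sw_clinear_on(2)[of n F UNIV g] by simp

lemma sw_sum:
 "(!!i. i:I ==> mlin n(F i)) ==> sw n(%ks. \<Sum>i\<in>I. F i ks)h = (\<Sum>i\<in>I. sw n(F i)h)"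
proof(induction n arbitrary: F h)
 case(Suc n)
 hence "sw n(%ks. \<Sum>i\<in>I. F i(h1#ks))h2 = (\<Sum>i\<in>I. sw n(%ks. F i(h1#ks))h2)" for h1 h2
  by(intro Suc.IH) auto
 thus ?case using Suc.prems by(simp add:tlift_sum_fun bilin_sw)
qed simp

lemma sw_tensor_lift:
 assumes "!!a b. mlin n(G a b)" "!!ks. length ks = Suc n ==> bilin(%a b. G a b ks)"
 shows "sw n(%ks. tlift(%a b. G a b ks)s)h = tlift(%a b. sw n(G a b)h)s"
 using assms
proof(induction n arbitrary: G h)
 case(Suc n)
 have 1: "sw n(%ks. tlift(%a b. G a b(h1#ks))s)h2 = tlift(%a b. sw n(%ks. G a b(h1#ks))h2)s"
  for h1 h2
  by(rule Suc.IH) (use Suc.prems in auto)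
 have b: "bilin(%a b. sw n(%ks. G a b(h1#ks))h2)" for h1 h2
  by(rule bilinI; rule lin_sw_fun)
  (use Suc.prems in \<open>simp_all add: cbil_def\<close>)
 show ?case
  by(simp add:1,rule tlift_swap[OF b bilin_sw[OF Suc.prems(1)]])
qed simp

text \<open>Coassociativity at an inner slot. It is used where two neighbouring arrows have been
  composed, so that one slot of the action has to be split into two.\<close>

lemma sw_insert:
 assumes "mlin(Suc n)F" "i<=n"
 shows "sw(Suc n)F h = sw n(%ks. tlift(%a b. F(take i ks@a#b#drop(Suc i)ks))(\<Delta>(ks!i)))h"
 using assms
proof(induction i arbitrary: n F h)
 case 0
 show ?case
 proof(cases n)
  case 0
  thus ?thesis by simp
 next
  case(Suc n')
  have m: "mlin n'(%ks. F(a#b#ks))" for a b using 0 Suc by simp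
  have b: "bilin(%a b. F(a#b#ks))" if "length ks = Suc n'" for ks
  using 0 Suc that by(intro bilinI) simp_all
  have "sw(Suc n)F h = tlift(%a w. tlift(%b y. sw n'(%ls. F(a#b#ls))y)(\<Delta> w))(\<Delta> h)"
  by(simp add:Suc)
  also have "... = tlift(%x y. tlift(%a b. sw n'(%ls. F(a#b#ls))y)(\<Delta> x))(\<Delta> h)"
  proof(rule coassoc[symmetric])
  show "lin(%b. sw n'(%ls. F(a#b#ls))y)" for a y
  by(rule lin_sw_fun) (use 0 Suc in simp_all)
  show "lin(%a. sw n'(%ls. F(a#b#ls))y)" for b y
  by(rule lin_sw_fun) (use 0 Suc in simp_all)
  qed(rule lin_sw[OF m])
  also have "... = tlift(%x y. sw n'(%ls. tlift(%a b. F(a#b#ls))(\<Delta> x))y)(\<Delta> h)"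
  by(simp add:sw_tensor_lift[OF m b])
  finally show ?thesis by(simp add:Suc)
 qed
next
 case(Suc i)
 then obtain n' where n: "n = Suc n'" by(cases n) auto
 have "sw(Suc n')(%ks. F(h1#ks))y = sw n'(%ks. tlift(%a b. F(h1#(take i ks@a#b#drop(Suc i)ks)))(\<Delta>(ks!i)))y" for h1 y
  by(rule Suc.IH) (use Suc.prems n in auto)
 thus ?case unfolding n by simp
qed

lemma sw_one: "mlin n F ==> sw n F 1 = F(replicate(Suc n) 1)"
proof(induction n arbitrary: F)
 case(Suc n)
 thus ?case using bilin_sw[OF Suc.prems] by(simp add:comult_one tlift_pure)
qed simp

lemma map2_update_left:
 "length ks = length ls ==> map2 f(ks[i := k])ls = (map2 f ks ls)[i := f k(ls!i)]"
 by(cases "i<length ks") (auto intro!:nth_equalityI simp:nth_list_update)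

lemma map2_update_right:
 "length ks = length ls ==> map2 f ks(ls[i := l]) = (map2 f ks ls)[i := f(ks!i)l]"
 by(cases "i<length ks") (auto intro!:nth_equalityI simp:nth_list_update)

lemma mlin_map2_right:
 fixes F :: "'h list => 'a::complex_vector"
 assumes "mlin n F" "length ks = Suc n"
 shows "mlin n(%ls. F(map2 (*)ks ls))"
proof(rule mlinI)
 fix ls :: "'h list" and i assume "length ls = Suc n" "i<=n"
 thus "lin(%h. F(map2 (*)ks(ls[i := h])))"
  using assms lin_comp[OF mlinD[OF assms(1),of "map2 (*)ks ls" i],of UNIV "%h. ks!i * h"]
  by(simp add:map2_update_right li)
qed

lemma mlin_map2_left:
 fixes F :: "'h list => 'a::complex_vector"
 assumes "mlin n F" "length ls = Suc n"
 shows "mlin n(%ks. F(map2 (*)ks ls))"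
proof(rule mlinI)
 fix ks :: "'h list" and i assume "length ks = Suc n" "i<=n"
 thus "lin(%h. F(map2 (*)(ks[i := h])ls))"
  using assms lin_comp[OF mlinD[OF assms(1),of "map2 (*)ks ls" i],of UNIV "%h. h * ls!i"]
  by(simp add:map2_update_left li)
qed

text \<open>Multiplicativity of the coproduct at each level; it makes the diagonal action on words a
  module action.\<close>

lemma sw_mult:
 "mlin n F ==> sw n F(a * b) = sw n(%ks. sw n(%ls. F(map2 (*)ks ls))b)a"
proof(induction n arbitrary: F a b)
 case(Suc n)
 have m: "mlin n(%ks. F(h#ks))" for h using Suc.prems by simp
 have m2: "mlin n(%ks. sw n(%ls. F(h#map2 (*)ks ls))c)" for h c
  by(rule mlinI,rule lin_sw_fun)
  (simp_all add: mlin_map2_right[OF m] mlinD[OF mlin_map2_left[OF m]])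
 have b: "bilin(%b1 b2. sw n(%ls. F(a1 * b1#map2 (*)ks ls))b2)" if "length ks = Suc n" for ks a1
 proof(rule bilinI)
  show "lin(sw n(%ls. F(a1 * a#map2 (*)ks ls)))" for a
  by(rule lin_sw[OF mlin_map2_right[OF m that]])
  have "lin(%a. F(a1 * a#map2 (*)ks ls))" if "length ls = Suc n" for ls
  by(rule lin_comp[OF mlin_Cons_lin[OF Suc.prems]])
  (simp_all add: li that \<open>length ks = Suc n\<close>)
  thus "lin(%a. sw n(%ls. F(a1 * a#map2 (*)ks ls))b)" for b
  by(rule lin_sw_fun[OF mlin_map2_right[OF m that]])
 qed
 have "sw(Suc n)F(a * b) = tlift(%a1 a2. tlift(%b1 b2. sw n(%ks. F(a1 * b1#ks))(a2 * b2))(\<Delta> b))(\<Delta> a)"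
  by(simp add:comult_mult[OF bilin_sw[OF Suc.prems]])
 also have "... = tlift(%a1 a2. tlift(%b1 b2. sw n(%ks. sw n(%ls. F(a1 * b1#map2 (*)ks ls))b2)a2)(\<Delta> b))(\<Delta> a)"
  by(simp add:Suc.IH[OF m])
 also have "... = tlift(%a1 a2. sw n(%ks. tlift(%b1 b2. sw n(%ls. F(a1 * b1#map2 (*)ks ls))b2)(\<Delta> b))a2)(\<Delta> a)"
  by(simp add:sw_tensor_lift m2 b)
 finally show ?case by simp
qed simp

end

section \<open>Graded semicategories with a closed trace\<close>

text \<open>Only homogeneous components are mentioned. The argument never leaves them, and matrices
  over a semicategory can then be treated without describing their full Hom spaces.\<close>

locale graded_semicat = hopf H for H :: "'h::complex_algebra_1 hopf" +
 fixes C :: "('p,'c::complex_vector,'h)dghsemicat"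
 assumes sub_ghom: "X:obj C ==> Y:obj C ==> csub(ghom C X Y i)"
  and comp_in: "X:obj C ==> Y:obj C ==> Z:obj C ==> g:ghom C Y Z i ==> f:ghom C X Y j ==> comp C X Y Z g f:ghom C X Z(i+j)"
  and comp_bilin: "X:obj C ==> Y:obj C ==> Z:obj C ==> cbil(ghom C Y Z i)(ghom C X Y j)(comp C X Y Z)"
  and comp_assoc: "W:obj C ==> X:obj C ==> Y:obj C ==> Z:obj C ==> g:ghom C Y Z i ==> f:ghom C X Y j ==> e:ghom C W X k ==> comp C W X Z(comp C X Y Z g f)e = comp C W Y Z g(comp C W X Y f e)"
  and act_in: "X:obj C ==> Y:obj C ==> f:ghom C X Y i ==> act C X Y h f:ghom C X Y i"
  and act_bilin: "X:obj C ==> Y:obj C ==> cbil UNIV(ghom C X Y i)(act C X Y)"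
  and act_one: "X:obj C ==> Y:obj C ==> f:ghom C X Y i ==> act C X Y 1 f = f"
  and act_mult: "X:obj C ==> Y:obj C ==> f:ghom C X Y i ==> act C X Y(a * b)f = act C X Y a(act C X Y b f)"
  and act_comp: "X:obj C ==> Y:obj C ==> Z:obj C ==> g:ghom C Y Z i ==> f:ghom C X Y j ==> act C X Z h(comp C X Y Z g f) = tlift(%h1 h2. comp C X Y Z(act C Y Z h1 g)(act C X Y h2 f))(comult H h)"
  and diff_in: "X:obj C ==> Y:obj C ==> f:ghom C X Y i ==> diff C X Y f:ghom C X Y(Suc i)"
  and diff_lin: "X:obj C ==> Y:obj C ==> clin(ghom C X Y i)(diff C X Y)"
  and diff_diff: "X:obj C ==> Y:obj C ==> f:ghom C X Y i ==> diff C X Y(diff C X Y f) = 0"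
  and diff_act: "X:obj C ==> Y:obj C ==> f:ghom C X Y i ==> diff C X Y(act C X Y h f) = act C X Y h(diff C X Y f)"
  and leibniz: "X:obj C ==> Y:obj C ==> Z:obj C ==> g:ghom C Y Z i ==> f:ghom C X Y j ==> diff C X Z(comp C X Y Z g f) = comp C X Y Z(diff C Y Z g)f+(- 1) ^ i*.comp C X Y Z g(diff C X Y f)"
begin

lemma comp_lin_left: "X:obj C ==> Y:obj C ==> Z:obj C ==> f:ghom C X Y j ==> clin(ghom C Y Z i)(%g. comp C X Y Z g f)"
 using cbilD2[OF comp_bilin] by blast

lemma comp_lin_right: "X:obj C ==> Y:obj C ==> Z:obj C ==> g:ghom C Y Z i ==> clin(ghom C X Y j)(comp C X Y Z g)"
 using cbilD1[OF comp_bilin] by blast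

lemma act_lin_left: "X:obj C ==> Y:obj C ==> f:ghom C X Y i ==> lin(%h. act C X Y h f)"
 using cbilD2[OF act_bilin] by blast

lemma act_lin_right: "X:obj C ==> Y:obj C ==> clin(ghom C X Y i)(act C X Y h)"
 using cbilD1[OF act_bilin] by blast

lemma sub_in: "X:obj C ==> Y:obj C ==> f:ghom C X Y i ==> g:ghom C X Y i ==> f-g:ghom C X Y i"
 and add_in: "X:obj C ==> Y:obj C ==> f:ghom C X Y i ==> g:ghom C X Y i ==> f+g:ghom C X Y i"
 and scale_in: "X:obj C ==> Y:obj C ==> f:ghom C X Y i ==> c*.f:ghom C X Y i"
 and zero_in: "X:obj C ==> Y:obj C ==> 0:ghom C X Y i"
 using sub_ghom[of X Y i]
 by(auto intro:csub_diff csub_add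
  csub_scale csub_0)

lemma leibniz0: "X:obj C ==> Y:obj C ==> Z:obj C ==> g:ghom C Y Z 0 ==> f:ghom C X Y j ==> diff C X Z(comp C X Y Z g f) = comp C X Y Z(diff C Y Z g)f+comp C X Y Z g(diff C X Y f)"
 using leibniz[of X Y Z g 0 f j] by(simp add:scaleC_one)

end

section \<open>Words in the differentials of a sequence of arrows, and their faces\<close>

primrec run :: "('p,'c,'h,'z)dghsemicat_scheme => 'p =>(nat => 'p) =>(nat => 'c) => 'c => nat => nat => 'c" where
 "run C Z Y A x p 0 = x"
| "run C Z Y A x p(Suc l) = comp C(Y(Suc(p+l)))(Y(p+l))Z(run C Z Y A x p l)(diff C(Y(Suc(p+l)))(Y(p+l))(A(p+l)))"

primrec wprod :: "('p,'c,'h,'z)dghsemicat_scheme =>(nat => 'p) =>(nat => 'c) => nat => 'c" where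
 "wprod C Y B 0 = B 0"
| "wprod C Y B(Suc l) = comp C(Y(Suc(Suc l)))(Y(Suc l))(Y 0)(wprod C Y B l)(B(Suc l))"

text \<open>Sequences are indexed by all natural numbers, with \<open>A i\<close> from
  \<open>Y(Suc i)\<close> to \<open>Y i\<close>. A face is then again such a sequence, and the
  length of a word enters only through \<open>run\<close>.\<close>

definition face_obj :: "nat =>(nat => 'p) => nat => 'p" where
 "face_obj k Y i = (if i<=k then Y i else Y(Suc i))"

definition face_mor :: "('p,'c,'h,'z)dghsemicat_scheme => nat =>(nat => 'p) =>(nat => 'c) => nat => 'c" where
 "face_mor C k Y A i = (if i<k then A i else if i = k then comp C(Y(Suc(Suc k)))(Y(Suc k))(Y k)(A k)(A(Suc k))else A(Suc i))"

text \<open>The word \<open>a\<^sub>0 da\<^sub>1 \<dots> da\<^sub>i dE da\<^sub>i\<^sub>+\<^sub>1 \<dots> da\<^sub>k\<close>.\<close>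

definition ins_word :: "('p,'c,'h,'z)dghsemicat_scheme =>('p => 'c) =>(nat => 'p) =>(nat => 'c) => nat => nat => 'c" where
 "ins_word C E Y A i k = run C(Y 0)Y A(comp C(Y(Suc i))(Y(Suc i))(Y 0)(run C(Y 0)Y A(A 0)(Suc 0)i)(diff C(Y(Suc i))(Y(Suc i))(E(Y(Suc i)))))(Suc i)(k-i)"

lemma run_cong:
 assumes "!!i. p<=i ==> i<=p+l ==> Y i = Y' i" "!!i. p<=i ==> i<p+l ==> A i = A' i"
 shows "run C Z Y A x p l = run C Z Y' A' x p l"
 using assms by(induction l) simp_all

lemma run_shift:
 assumes "!!i. p<=i ==> i<=p+l ==> Y'(Suc i) = Y i" "!!i. p<=i ==> i<p+l ==> A'(Suc i) = A i"
 shows "run C Z Y' A' x(Suc p)l = run C Z Y A x p l"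
 using assms by(induction l) simp_all

lemma run_Suc: "run C Z Y A x p(Suc l) = run C Z Y A(comp C(Y(Suc p))(Y p)Z x(diff C(Y(Suc p))(Y p)(A p)))(Suc p)l"
 by(induction l) simp_all

text \<open>Composing two arrows before the stretch that \<open>run\<close> visits only shifts the
  indices of that stretch; the companion fact concerns a composition beyond it.\<close>

lemma run_face_left: "j<p ==> run C Z(face_obj j Y)(face_mor C j Y A)x p l = run C Z Y A x(Suc p)l"
 by(rule run_shift[symmetric]) (simp_all add: face_obj_def face_mor_def)

lemma run_face_right: "p+l<=j ==> run C Z(face_obj j Y)(face_mor C j Y A)x p l = run C Z Y A x p l"
 by(rule run_cong) (simp_all add: face_obj_def face_mor_def)

context graded_semicat
begin

context
 fixes Y :: "nat => 'p" and A :: "nat => 'c"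
 assumes Y [simp]: "!!i. Y i:obj C" and A [simp]: "!!i. A i:ghom C(Y(Suc i))(Y i) 0"
begin

lemma dA: "diff C(Y(Suc i))(Y i)(A i):ghom C(Y(Suc i))(Y i) 1"
 using diff_in[OF Y Y A] by simp

lemma run_in:
 assumes "Z:obj C" "x:ghom C(Y p)Z e"
 shows "run C Z Y A x p l:ghom C(Y(p+l))Z(e+l)"
proof(induction l)
 case(Suc l)
 show ?case using comp_in[OF _ _ assms(1) Suc.IH dA] by simp
qed(use assms in simp)

lemma run_in': "Z:obj C ==> x:ghom C(Y p)Z e ==> q = p+l ==> k = e+l ==> run C Z Y A x p l:ghom C(Y q)Z k"
 using run_in by blast

lemma run_lin:
 assumes "Z:obj C"
 shows "clin(ghom C(Y p)Z e)(%x. run C Z Y A x p l)"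
proof(induction l)
 case(Suc l)
 show ?case
  unfolding run.simps
  by(rule clin_compose[OF comp_lin_left[where i = "e+l",OF _ _ assms dA] Suc.IH])
  (simp_all add: run_in[OF assms])
qed(simp add:clin_ident)

lemma run_left:
 assumes "Z:obj C" "W:obj C" "x:ghom C(Y p)Z e" "y:ghom C Z W e'"
 shows "comp C(Y(p+l))Z W y(run C Z Y A x p l) = run C W Y A(comp C(Y p)Z W y x)p l"
proof(induction l)
 case(Suc l)
 thus ?case
  using comp_assoc[OF _ _ assms(1,2) assms(4) run_in[OF assms(1,3)] dA,of l] by simp
qed simp

lemma run_diff:
 assumes "Z:obj C" "x:ghom C(Y p)Z e"
 shows "diff C(Y(p+l))Z(run C Z Y A x p l) = run C Z Y A(diff C(Y p)Z x)p l"
proof(induction l)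
 case(Suc l)
 note r = run_in[OF assms,of l]
 have "comp C(Y(Suc(p+l)))(Y(p+l))Z(run C Z Y A x p l) 0 = 0"
  by(rule clin_zero[OF comp_lin_right[OF _ _ assms(1) r] sub_ghom]) simp_all
 thus ?case
  using leibniz[OF Y Y assms(1) r dA] Suc by(simp add:diff_diff[OF _ _ A] scale_simps)
qed simp

lemma face_obj_in [simp]: "face_obj j Y i:obj C"
 by(simp add:face_obj_def)

lemma face_mor_in: "face_mor C j Y A i:ghom C(face_obj j Y(Suc i))(face_obj j Y i) 0"
 using comp_in[OF Y Y Y A A,of j] by(auto simp:face_mor_def face_obj_def)

text \<open>By Leibniz each face is a sum of two words in which exactly one arrow is left
  undifferentiated. With alternating signs neighbouring faces share one of these words and cancel
  it, so only the undifferentiated arrows at the two ends survive.\<close>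

lemma telescope:
 assumes Z: "Z:obj C" and x: "x:ghom C(Y p)Z e"
 shows "(\<Sum>k\<in>{p..<p+l}.(- 1) ^ k*.run C Z(face_obj k Y)(face_mor C k Y A)x p l) = (- 1) ^ p*.run C Z Y A(comp C(Y(Suc p))(Y p)Z x(A p))(Suc p)l-(- 1) ^ (p+l)*.comp C(Y(Suc(p+l)))(Y(p+l))Z(run C Z Y A x p l)(A(p+l))"
proof(induction l)
 case 0
 show ?case by simp
next
 case(Suc l)
 let ?q = "p+l"
 let ?d = "diff C(Y(Suc(Suc ?q)))(Y(Suc ?q))(A(Suc ?q))"
 let ?R = "run C Z Y A x p l"
 let ?c = "comp C(Y(Suc(Suc ?q)))(Y(Suc ?q))Z"
 have R: "?R:ghom C(Y ?q)Z(e+l)" by(rule run_in[OF Z x])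
 have xA: "comp C(Y(Suc p))(Y p)Z x(A p):ghom C(Y(Suc p))Z e"
  using comp_in[OF _ _ Z x A] by simp
 have lin: "clin(ghom C(Y(Suc ?q))Z(e+l))(%y. ?c y ?d)"
  by(rule comp_lin_left[OF _ _ Z dA]) simp_all
 have sub: "csub(ghom C(Y(Suc ?q))Z(e+l))"
  using sub_ghom Z by simp
 have Rk: "run C Z(face_obj k Y)(face_mor C k Y A)x p l:ghom C(Y(Suc ?q))Z(e+l)" if "k:{p..<?q}" for k
  using that graded_semicat.run_in[OF graded_semicat_axioms,of "face_obj k Y" "face_mor C k Y A" Z x p e l]
  face_mor_in Z x by(simp add:face_obj_def)
 have Rk': "(- 1) ^ k*.run C Z(face_obj k Y)(face_mor C k Y A)x p l:ghom C(Y(Suc ?q))Z(e+l)"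
  if "k:{p..<?q}" for k
  using Rk[OF that] scale_in Z by simp
 have "(\<Sum>k\<in>{p..<?q}.(- 1) ^ k*.run C Z(face_obj k Y)(face_mor C k Y A)x p(Suc l)) = (\<Sum>k\<in>{p..<?q}. ?c((- 1) ^ k*.run C Z(face_obj k Y)(face_mor C k Y A)x p l) ?d)"
  by(rule sum.cong) (use clin_scale[OF lin Rk] in \<open>auto simp: face_obj_def face_mor_def\<close>)
 also have "... = ?c(\<Sum>k\<in>{p..<?q}.(- 1) ^ k*.run C Z(face_obj k Y)(face_mor C k Y A)x p l) ?d"
  by(rule clin_sum[OF lin sub,symmetric]) (rule Rk')
 also have "... = (- 1) ^ p *. ?c(run C Z Y A(comp C(Y(Suc p))(Y p)Z x(A p))(Suc p)l) ?d-(- 1) ^ ?q *. ?c(comp C(Y(Suc ?q))(Y ?q)Z ?R(A ?q)) ?d"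
 proof -
  have 1: "run C Z Y A(comp C(Y(Suc p))(Y p)Z x(A p))(Suc p)l:ghom C(Y(Suc ?q))Z(e+l)"
  using run_in[OF Z xA] by simp
  have 2: "comp C(Y(Suc ?q))(Y ?q)Z ?R(A ?q):ghom C(Y(Suc ?q))Z(e+l)"
  using comp_in[OF _ _ Z R A] by simp
  show ?thesis
  unfolding Suc.IH
  by(subst clin_diff[OF lin sub]) (simp_all add: scale_in Z 1 2 clin_scale[OF lin])
 qed
 finally have S: "(\<Sum>k\<in>{p..<?q}.(- 1) ^ k*.run C Z(face_obj k Y)(face_mor C k Y A)x p(Suc l)) = (- 1) ^ p*.run C Z Y A(comp C(Y(Suc p))(Y p)Z x(A p))(Suc p)(Suc l)-(- 1) ^ ?q *. ?c(comp C(Y(Suc ?q))(Y ?q)Z ?R(A ?q)) ?d"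
  by simp
 \<comment> \<open>The newest face gives one word that ends in an undifferentiated arrow and one
   that cancels the boundary term of the induction hypothesis.\<close>
 have L: "run C Z(face_obj ?q Y)(face_mor C ?q Y A)x p(Suc l) = comp C(Y(Suc(Suc ?q)))(Y(Suc ?q))Z(run C Z Y A x p(Suc l))(A(Suc ?q)) + ?c(comp C(Y(Suc ?q))(Y ?q)Z ?R(A ?q)) ?d"
 proof -
  have "run C Z(face_obj ?q Y)(face_mor C ?q Y A)x p(Suc l) = comp C(Y(Suc(Suc ?q)))(Y ?q)Z ?R(diff C(Y(Suc(Suc ?q)))(Y ?q)(comp C(Y(Suc(Suc ?q)))(Y(Suc ?q))(Y ?q)(A ?q)(A(Suc ?q))))"
  by(simp add:run_face_right) (simp add:face_obj_def face_mor_def)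
  also have "... = comp C(Y(Suc(Suc ?q)))(Y ?q)Z ?R(comp C(Y(Suc(Suc ?q)))(Y(Suc ?q))(Y ?q)(diff C(Y(Suc ?q))(Y ?q)(A ?q))(A(Suc ?q)))+comp C(Y(Suc(Suc ?q)))(Y ?q)Z ?R(comp C(Y(Suc(Suc ?q)))(Y(Suc ?q))(Y ?q)(A ?q) ?d)"
  proof -
  have "comp C(Y(Suc(Suc ?q)))(Y(Suc ?q))(Y ?q)(diff C(Y(Suc ?q))(Y ?q)(A ?q))(A(Suc ?q)):ghom C(Y(Suc(Suc ?q)))(Y ?q) 1"
  using comp_in[OF Y Y Y dA A] by simp
  moreover have "comp C(Y(Suc(Suc ?q)))(Y(Suc ?q))(Y ?q)(A ?q) ?d:ghom C(Y(Suc(Suc ?q)))(Y ?q) 1"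
  using comp_in[OF Y Y Y A dA] by simp
  ultimately show ?thesis
  by(simp add:leibniz0[OF Y Y Y A A] clin_add[OF comp_lin_right[OF Y Y Z R]])
  qed
  finally show ?thesis
  by(simp add:comp_assoc[OF Y Y Y Z R dA A] comp_assoc[OF Y Y Y Z R A dA])
 qed
 have "(\<Sum>k\<in>{p..<p+Suc l}.(- 1) ^ k*.run C Z(face_obj k Y)(face_mor C k Y A)x p(Suc l)) = (\<Sum>k\<in>{p..<?q}.(- 1) ^ k*.run C Z(face_obj k Y)(face_mor C k Y A)x p(Suc l))+(- 1) ^ ?q*.run C Z(face_obj ?q Y)(face_mor C ?q Y A)x p(Suc l)"
  by(simp add:sum.atLeastLessThan_Suc del:run.simps)
 thus ?case unfolding S L by(simp add:scaleC_add_right scale_simps del:run.simps)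
qed

lemma head_in: "run C(Y 0)Y A(A 0)(Suc 0)i:ghom C(Y(Suc i))(Y 0)i"
 using run_in[of "Y 0" "A 0" "Suc 0" 0 i] by simp

text \<open>The face with index 0 multiplies \<open>A 0\<close> and \<open>A 1\<close> without a
  differential and so cancels the left boundary term of \<open>telescope\<close>.\<close>

lemma head_faces:
 "(\<Sum>j\<le>i.(- 1) ^ j*.run C(Y 0)(face_obj j Y)(face_mor C j Y A)(face_mor C j Y A 0)(Suc 0)i) = (- 1) ^ i*.comp C(Y(Suc(Suc i)))(Y(Suc i))(Y 0)(run C(Y 0)Y A(A 0)(Suc 0)i)(A(Suc i))"
proof -
 have "(\<Sum>j\<le>i.(- 1) ^ j*.run C(Y 0)(face_obj j Y)(face_mor C j Y A)(face_mor C j Y A 0)(Suc 0)i) = run C(Y 0)(face_obj 0 Y)(face_mor C 0 Y A)(face_mor C 0 Y A 0)(Suc 0)i+(\<Sum>j\<in>{1..<1+i}.(- 1) ^ j*.run C(Y 0)(face_obj j Y)(face_mor C j Y A)(face_mor C j Y A 0)(Suc 0)i)"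
  by(simp add:atMost_atLeast0 sum.atLeast_Suc_atMost atLeastLessThanSuc_atLeastAtMost scaleC_one)
 also have "(\<Sum>j\<in>{1..<1+i}.(- 1) ^ j*.run C(Y 0)(face_obj j Y)(face_mor C j Y A)(face_mor C j Y A 0)(Suc 0)i) = (\<Sum>j\<in>{1..<1+i}.(- 1) ^ j*.run C(Y 0)(face_obj j Y)(face_mor C j Y A)(A 0)(Suc 0)i)"
  by(rule sum.cong) (auto simp:face_mor_def)
 also have "... = - run C(Y 0)Y A(comp C(Y 2)(Y 1)(Y 0)(A 0)(A 1)) 2 i+(- 1) ^ i*.comp C(Y(Suc(Suc i)))(Y(Suc i))(Y 0)(run C(Y 0)Y A(A 0)(Suc 0)i)(A(Suc i))"
  using telescope[of "Y 0" "A 0" "Suc 0" 0 i] by(simp add:scale_simps numeral_2_eq_2)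
 also have "run C(Y 0)(face_obj 0 Y)(face_mor C 0 Y A)(face_mor C 0 Y A 0)(Suc 0)i = run C(Y 0)Y A(comp C(Y 2)(Y 1)(Y 0)(A 0)(A 1)) 2 i"
  by(subst run_face_left) (simp_all add: face_mor_def numeral_2_eq_2)
 finally show ?thesis by simp
qed

end

end

section \<open>Inner derivations of words\<close>

lemma clin_comb:
 assumes "clin A f" "csub A" "x:A" "y:A" "z:A"
 shows "f(- x+(y-z)) = - f x+(f y-f z)"
 using assms by(simp add:clin_add[OF assms(1)] clin_diff[OF assms(1,2)]
  clin_minus[OF assms(1)] csub_neg csub_diff
  del:add_uminus_conv_diff uminus_add_conv_diff)

text \<open>The derivative of \<open>a\<^sub>0 da\<^sub>1 \<dots> da\<^sub>l\<close> along the inner derivation by \<open>E\<close>.\<close>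

definition inner_der :: "('p,'c::ab_group_add,'h,'z)dghsemicat_scheme =>('p => 'c) =>(nat => 'p) =>(nat => 'c) => nat => 'c" where
 "inner_der C E Y A i = comp C(Y(Suc i))(Y i)(Y i)(E(Y i))(A i)-comp C(Y(Suc i))(Y(Suc i))(Y i)(A i)(E(Y(Suc i)))"

primrec der_word :: "('p,'c::ab_group_add,'h,'z)dghsemicat_scheme =>('p => 'c) =>(nat => 'p) =>(nat => 'c) => nat => 'c" where
 "der_word C E Y A 0 = inner_der C E Y A 0"
| "der_word C E Y A(Suc l) = comp C(Y(Suc(Suc l)))(Y(Suc l))(Y 0)(der_word C E Y A l)(diff C(Y(Suc(Suc l)))(Y(Suc l))(A(Suc l)))+comp C(Y(Suc(Suc l)))(Y(Suc l))(Y 0)(run C(Y 0)Y A(A 0)(Suc 0)l)(diff C(Y(Suc(Suc l)))(Y(Suc l))(inner_der C E Y A(Suc l)))"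

context graded_semicat
begin

context
 fixes Y :: "nat => 'p" and A :: "nat => 'c" and E :: "'p => 'c"
 assumes Y [simp]: "!!i. Y i:obj C" and A [simp]: "!!i. A i:ghom C(Y(Suc i))(Y i) 0"
  and E [simp]: "!!X. X:obj C ==> E X:ghom C X X 0"
begin

private lemmas dA_YA = dA[of Y,OF Y A]
private lemmas run_in_YA = run_in[of Y A,OF Y A]
private lemmas run_in2_YA = run_in'[of Y A,OF Y A]
private lemmas run_lin_YA = run_lin[of Y A,OF Y A]
private lemmas run_left_YA = run_left[of Y A,OF Y A]
private lemmas head_in_YA = head_in[of Y A,OF Y A]

abbreviation "head == run C(Y 0)Y A(A 0)(Suc 0)"
abbreviation "cY i j == comp C(Y i)(Y j)(Y 0)"

lemma dE: "diff C(Y i)(Y i)(E(Y i)):ghom C(Y i)(Y i) 1"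
 using diff_in[OF Y Y E[OF Y]] by simp

lemma head_dE_in: "cY(Suc i)(Suc i)(head i)(diff C(Y(Suc i))(Y(Suc i))(E(Y(Suc i)))):ghom C(Y(Suc i))(Y 0)(Suc i)"
 using comp_in[OF Y Y Y head_in_YA dE,of i] by simp

lemma ins_word_in: "i<=k ==> ins_word C E Y A i k:ghom C(Y(Suc k))(Y 0)(Suc k)"
 unfolding ins_word_def by(rule run_in2_YA[OF Y head_dE_in]) simp_all

text \<open>The inserted \<open>dE\<close> separates the faces into two groups that telescope
  independently. The surviving terms on its two sides form the commutator of an arrow with
  \<open>dE\<close>; the only other survivor sits at the right end and will be cancelled by the last
  face.\<close>

lemma ins_faces:
 assumes i: "i<=k"
 shows "(\<Sum>j\<le>k.(- 1) ^ j*.ins_word C E(face_obj j Y)(face_mor C j Y A)i k) = (- 1) ^ i*.run C(Y 0)Y A(cY(Suc(Suc i))(Suc(Suc i))(cY(Suc(Suc i))(Suc i)(head i)(A(Suc i)))(diff C(Y(Suc(Suc i)))(Y(Suc(Suc i)))(E(Y(Suc(Suc i)))))-cY(Suc(Suc i))(Suc i)(cY(Suc i)(Suc i)(head i)(diff C(Y(Suc i))(Y(Suc i))(E(Y(Suc i)))))(A(Suc i)))(Suc(Suc i))(k-i)+(- 1) ^ k*.cY(Suc(Suc k))(Suc k)(ins_word C E Y A i k)(A(Suc k))"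
proof -
 let ?dE = "%i. diff C(Y i)(Y i)(E(Y i))"
 let ?f = "%j. ins_word C E(face_obj j Y)(face_mor C j Y A)i k"
 let ?x = "cY(Suc i)(Suc i)(head i)(?dE(Suc i))"
 let ?r = "%x. run C(Y 0)Y A x(Suc(Suc i))(k-i)"
 let ?xA = "cY(Suc(Suc i))(Suc i) ?x(A(Suc i))"
 let ?hA = "cY(Suc(Suc i))(Suc i)(head i)(A(Suc i))"
 have xA_in: "?xA:ghom C(Y(Suc(Suc i)))(Y 0)(Suc i)"
  using comp_in[OF Y Y Y head_dE_in A] by simp
 have hA_in: "?hA:ghom C(Y(Suc(Suc i)))(Y 0)i"
  using comp_in[OF Y Y Y head_in_YA A] by simp
 have hAE_in: "cY(Suc(Suc i))(Suc(Suc i)) ?hA(?dE(Suc(Suc i))):ghom C(Y(Suc(Suc i)))(Y 0)(Suc i)"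
  using comp_in[OF Y Y Y hA_in dE] by simp
 have right: "(\<Sum>j\<in>{Suc i..<Suc i+(k-i)}.(- 1) ^ j *. ?f j) = (- 1) ^ Suc i *. ?r ?xA+(- 1) ^ k*.cY(Suc(Suc k))(Suc k)(ins_word C E Y A i k)(A(Suc k))"
 proof -
  have "?f j = run C(Y 0)(face_obj j Y)(face_mor C j Y A) ?x(Suc i)(k-i)" if "Suc i<=j" for j
  proof -
  have "run C(Y 0)(face_obj j Y)(face_mor C j Y A)(A 0)(Suc 0)i = head i"
  by(rule run_face_right) (use that in simp)
  thus ?thesis using that by(simp add:ins_word_def face_obj_def face_mor_def)
  qed
  hence "(\<Sum>j\<in>{Suc i..<Suc i+(k-i)}.(- 1) ^ j *. ?f j) = (\<Sum>j\<in>{Suc i..<Suc i+(k-i)}.(- 1) ^ j*.run C(Y 0)(face_obj j Y)(face_mor C j Y A) ?x(Suc i)(k-i))"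
  by(intro sum.cong) auto
  also have "... = (- 1) ^ Suc i *. ?r ?xA-(- 1) ^ (Suc i+(k-i)) *\<^sub>C comp C(Y(Suc(Suc i+(k-i))))(Y(Suc i+(k-i)))(Y 0)(ins_word C E Y A i k)(A(Suc i+(k-i)))"
  unfolding ins_word_def by(rule telescope[of Y A,OF Y A Y head_dE_in])
  finally show ?thesis using i by(simp add:scale_simps)
 qed
 have left: "(\<Sum>j\<le>i.(- 1) ^ j *. ?f j) = (- 1) ^ i *. ?r(cY(Suc(Suc i))(Suc(Suc i)) ?hA(?dE(Suc(Suc i))))"
 proof -
  let ?h = "%j. run C(Y 0)(face_obj j Y)(face_mor C j Y A)(face_mor C j Y A 0)(Suc 0)i"
  let ?g = "%y. ?r(cY(Suc(Suc i))(Suc(Suc i))y(?dE(Suc(Suc i))))"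
  have lin: "clin(ghom C(Y(Suc(Suc i)))(Y 0)i) ?g"
  by(rule clin_compose[OF run_lin_YA[OF Y] comp_lin_left[OF Y Y Y dE]])
  (use comp_in[OF Y Y Y _ dE] in simp)
  have h_in: "?h j:ghom C(Y(Suc(Suc i)))(Y 0)i" if "j<=i" for j
  proof -
  have "run C(face_obj j Y 0)(face_obj j Y)(face_mor C j Y A)(face_mor C j Y A 0)(Suc 0)i:ghom C(face_obj j Y(Suc i))(face_obj j Y 0)i"
  using graded_semicat.head_in[OF graded_semicat_axioms,of "face_obj j Y" "face_mor C j Y A" i]
  face_mor_in[of Y A j,OF Y A] by(simp add:face_obj_def)
  thus ?thesis using that by(simp add:face_obj_def)
  qed
  have fg: "?f j = ?g(?h j)" if "j<=i" for j
  unfolding ins_word_def by(subst run_face_left) (use that in \<open>simp_all add: face_obj_def\<close>)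
  have "(\<Sum>j\<le>i.(- 1) ^ j *. ?f j) = (\<Sum>j\<le>i. ?g((- 1) ^ j *. ?h j))"
  by(rule sum.cong) (auto simp:fg clin_scale[OF lin h_in])
  also have "... = ?g(\<Sum>j\<le>i.(- 1) ^ j *. ?h j)"
  by(rule clin_sum[OF lin sub_ghom,symmetric]) (auto intro!:scale_in h_in)
  also have "... = (- 1) ^ i *. ?g ?hA"
  unfolding head_faces[of Y A,OF Y A] by(rule clin_scale[OF lin hA_in])
  finally show ?thesis .
 qed
 have "{..k} = {..i} \<union> {Suc i..<Suc i+(k-i)}" using i by auto
 hence "(\<Sum>j\<le>k.(- 1) ^ j *. ?f j) = (\<Sum>j\<le>i.(- 1) ^ j *. ?f j)+(\<Sum>j\<in>{Suc i..<Suc i+(k-i)}.(- 1) ^ j *. ?f j)"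
  by(simp only:) (rule sum.union_disjoint,auto)
 also have "... = (- 1) ^ i *. ?r(cY(Suc(Suc i))(Suc(Suc i)) ?hA(?dE(Suc(Suc i))) - ?xA)+(- 1) ^ k*.cY(Suc(Suc k))(Suc k)(ins_word C E Y A i k)(A(Suc k))"
  unfolding left right
  by(subst clin_diff[OF run_lin_YA[OF Y] sub_ghom hAE_in xA_in])
  (simp_all add: scale_simps cscale_right_diff_distrib)
 finally show ?thesis .
qed

lemma inner_der_in: "inner_der C E Y A i:ghom C(Y(Suc i))(Y i) 0"
 unfolding inner_der_def
 using comp_in[OF Y Y Y E[OF Y] A,of i] comp_in[OF Y Y Y A E[OF Y],of i] by(simp add:sub_in)

lemma der_word_in: "der_word C E Y A l:ghom C(Y(Suc l))(Y 0)l"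
proof(induction l)
 case 0
 show ?case using inner_der_in[of 0] by simp
next
 case(Suc l)
 have "diff C(Y(Suc(Suc l)))(Y(Suc l))(inner_der C E Y A(Suc l)):ghom C(Y(Suc(Suc l)))(Y(Suc l)) 1"
  using diff_in[OF Y Y inner_der_in] by simp
 from comp_in[OF Y Y Y head_in_YA this] comp_in[OF Y Y Y Suc dA_YA]
 show ?case by(simp add:add_in)
qed

lemma der_word_eq:
 "der_word C E Y A l = run C(Y 0)Y A(inner_der C E Y A 0)(Suc 0)l+(\<Sum>i<l. run C(Y 0)Y A(cY(Suc(Suc i))(Suc i)(head i)(diff C(Y(Suc(Suc i)))(Y(Suc i))(inner_der C E Y A(Suc i))))(Suc(Suc i))(l-Suc i))"
proof(induction l)
 case 0
 show ?case by simp
next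
 case(Suc l)
 let ?D = "%i. cY(Suc(Suc i))(Suc i)(head i)(diff C(Y(Suc(Suc i)))(Y(Suc i))(inner_der C E Y A(Suc i)))"
 let ?c = "%x. cY(Suc(Suc l))(Suc l)x(diff C(Y(Suc(Suc l)))(Y(Suc l))(A(Suc l)))"
 have lin: "clin(ghom C(Y(Suc l))(Y 0)l) ?c" by(rule comp_lin_left[OF Y Y Y dA_YA])
 have sub: "csub(ghom C(Y(Suc l))(Y 0)l)" by(rule sub_ghom) simp_all
 have D: "?D i:ghom C(Y(Suc(Suc i)))(Y 0)(Suc i)" for i
  using comp_in[OF Y Y Y head_in_YA diff_in[OF Y Y inner_der_in]] by simp
 have R: "run C(Y 0)Y A(?D i)(Suc(Suc i))(l-Suc i):ghom C(Y(Suc l))(Y 0)l" if "i<l" for i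
  by(rule run_in2_YA[OF Y D]) (use that in simp_all)
 have R0: "run C(Y 0)Y A(inner_der C E Y A 0)(Suc 0)l:ghom C(Y(Suc l))(Y 0)l"
  by(rule run_in2_YA[OF Y,where e = 0]) (use inner_der_in[of 0] in simp_all)
 have "der_word C E Y A(Suc l) = ?c(der_word C E Y A l) + ?D l" by simp
 also have "?c(der_word C E Y A l) = ?c(run C(Y 0)Y A(inner_der C E Y A 0)(Suc 0)l)+(\<Sum>i<l. ?c(run C(Y 0)Y A(?D i)(Suc(Suc i))(l-Suc i)))"
 proof -
  have 1: "(\<Sum>i<l. run C(Y 0)Y A(?D i)(Suc(Suc i))(l-Suc i)):ghom C(Y(Suc l))(Y 0)l"
  by(rule csub_sum[OF sub],rule R) simp
  have 2: "?c(\<Sum>i<l. run C(Y 0)Y A(?D i)(Suc(Suc i))(l-Suc i)) = (\<Sum>i<l. ?c(run C(Y 0)Y A(?D i)(Suc(Suc i))(l-Suc i)))"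
  by(rule clin_sum[OF lin sub],rule R) simp
  show ?thesis unfolding Suc.IH clin_add[OF lin R0 1] 2 ..
 qed
 also have "(\<Sum>i<l. ?c(run C(Y 0)Y A(?D i)(Suc(Suc i))(l-Suc i))) = (\<Sum>i<l. run C(Y 0)Y A(?D i)(Suc(Suc i))(Suc l-Suc i))"
 proof(rule sum.cong)
  fix i assume "i:{..<l}"
  then obtain r where r: "l = Suc(i+r)" by(auto simp:less_iff_Suc_add)
  thus "?c(run C(Y 0)Y A(?D i)(Suc(Suc i))(l-Suc i)) = run C(Y 0)Y A(?D i)(Suc(Suc i))(Suc l-Suc i)"
  by(simp add:Suc_diff_le)
 qed simp
 finally show ?case by(simp add:add.assoc)
qed

text \<open>Leibniz for the two products of \<open>E\<close> with an arrow. The commutator with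
  \<open>dE\<close> is traded for a differentiated commutator, which is a summand of
  \<open>der_word\<close>, and the commutator of \<open>E\<close> with a differential, which
  telescopes.\<close>

lemma commutator_rule:
 "comp C(Y(Suc i))(Y(Suc i))(Y i)(A i)(diff C(Y(Suc i))(Y(Suc i))(E(Y(Suc i))))-comp C(Y(Suc i))(Y i)(Y i)(diff C(Y i)(Y i)(E(Y i)))(A i) = - diff C(Y(Suc i))(Y i)(inner_der C E Y A i)+(comp C(Y(Suc i))(Y i)(Y i)(E(Y i))(diff C(Y(Suc i))(Y i)(A i))-comp C(Y(Suc i))(Y(Suc i))(Y i)(diff C(Y(Suc i))(Y i)(A i))(E(Y(Suc i))))"
proof -
 have 1: "comp C(Y(Suc i))(Y i)(Y i)(E(Y i))(A i):ghom C(Y(Suc i))(Y i) 0"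
  using comp_in[OF Y Y Y E[OF Y] A,of i] by simp
 have 2: "comp C(Y(Suc i))(Y(Suc i))(Y i)(A i)(E(Y(Suc i))):ghom C(Y(Suc i))(Y i) 0"
  using comp_in[OF Y Y Y A E[OF Y],of i] by simp
 show ?thesis
  unfolding inner_der_def clin_diff[OF diff_lin[OF Y Y] sub_ghom[OF Y Y] 1 2]
  by(simp add:leibniz0[OF Y Y Y E[OF Y] A] leibniz0[OF Y Y Y A E[OF Y]])
qed

text \<open>Let \<open>?U i\<close> be the word with \<open>E\<close> placed undifferentiated behind
  \<open>A 0 dA 1 ... dA i\<close>. By \<open>commutator_rule\<close> every summand is a term of
  \<open>- der_word\<close> plus \<open>?U i - ?U(Suc i)\<close>, and the differences
  telescope.\<close>

lemma sum_commutators: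
 "(\<Sum>i\<le>k. run C(Y 0)Y A(cY(Suc(Suc i))(Suc(Suc i))(cY(Suc(Suc i))(Suc i)(head i)(A(Suc i)))(diff C(Y(Suc(Suc i)))(Y(Suc(Suc i)))(E(Y(Suc(Suc i)))))-cY(Suc(Suc i))(Suc i)(cY(Suc i)(Suc i)(head i)(diff C(Y(Suc i))(Y(Suc i))(E(Y(Suc i)))))(A(Suc i)))(Suc(Suc i))(k-i)) = run C(Y 0)Y A(comp C(Y 1)(Y 0)(Y 0)(E(Y 0))(A 0))(Suc 0)(Suc k)-cY(Suc(Suc k))(Suc(Suc k))(head(Suc k))(E(Y(Suc(Suc k))))-der_word C E Y A(Suc k)"
proof -
 let ?dE = "%i. diff C(Y i)(Y i)(E(Y i))"
 let ?d = "%i. diff C(Y(Suc i))(Y i)(A i)"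
 let ?I = "inner_der C E Y A"
 let ?D = "%i. run C(Y 0)Y A(cY(Suc(Suc i))(Suc i)(head i)(diff C(Y(Suc(Suc i)))(Y(Suc i))(?I(Suc i))))(Suc(Suc i))(k-i)"
 let ?U = "%i. run C(Y 0)Y A(cY(Suc i)(Suc i)(head i)(E(Y(Suc i))))(Suc i)(Suc k-i)"
 let ?V = "%i. run C(Y 0)Y A(cY(Suc(Suc i))(Suc(Suc i))(cY(Suc(Suc i))(Suc i)(head i)(A(Suc i)))(?dE(Suc(Suc i)))-cY(Suc(Suc i))(Suc i)(cY(Suc i)(Suc i)(head i)(?dE(Suc i)))(A(Suc i)))(Suc(Suc i))(k-i)"
 have V: "?V i = - ?D i+(?U i - ?U(Suc i))" if "i<=k" for i
 proof -
  let ?h = "head i" and ?j = "Suc i"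
  let ?c = "cY(Suc ?j) ?j ?h"
  let ?r = "%x. run C(Y 0)Y A x(Suc ?j)(k-i)"
  have h: "?h:ghom C(Y ?j)(Y 0)i" by(rule head_in_YA)
  have lin: "clin(ghom C(Y(Suc ?j))(Y ?j) 1) ?c" by(rule comp_lin_right[OF Y Y Y h])
  have sub: "csub(ghom C(Y(Suc ?j))(Y ?j) 1)" by(rule sub_ghom) simp_all
  have lr: "clin(ghom C(Y(Suc ?j))(Y 0)(Suc i)) ?r" by(rule run_lin_YA[OF Y])
  have subr: "csub(ghom C(Y(Suc ?j))(Y 0)(Suc i))" by(rule sub_ghom) simp_all
  have m: "comp C(Y(Suc ?j))(Y(Suc ?j))(Y ?j)(A ?j)(?dE(Suc ?j)):ghom C(Y(Suc ?j))(Y ?j) 1"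
  "comp C(Y(Suc ?j))(Y ?j)(Y ?j)(?dE ?j)(A ?j):ghom C(Y(Suc ?j))(Y ?j) 1"
  "comp C(Y(Suc ?j))(Y ?j)(Y ?j)(E(Y ?j))(?d ?j):ghom C(Y(Suc ?j))(Y ?j) 1"
  "comp C(Y(Suc ?j))(Y(Suc ?j))(Y ?j)(?d ?j)(E(Y(Suc ?j))):ghom C(Y(Suc ?j))(Y ?j) 1"
  "diff C(Y(Suc ?j))(Y ?j)(?I ?j):ghom C(Y(Suc ?j))(Y ?j) 1"
  using comp_in[OF Y Y Y A dE,of ?j] comp_in[OF Y Y Y dE A,of ?j]
  comp_in[OF Y Y Y E[OF Y] dA_YA,of ?j] comp_in[OF Y Y Y dA_YA E[OF Y],of ?j] diff_in[OF Y Y inner_der_in,of ?j] by simp_all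
  have c: "?c x:ghom C(Y(Suc ?j))(Y 0)(Suc i)" if "x:ghom C(Y(Suc ?j))(Y ?j) 1" for x
  using comp_in[OF Y Y Y h that] by simp
  have "?V i = ?r(?c(comp C(Y(Suc ?j))(Y(Suc ?j))(Y ?j)(A ?j)(?dE(Suc ?j))) - ?c(comp C(Y(Suc ?j))(Y ?j)(Y ?j)(?dE ?j)(A ?j)))"
  by(simp add:comp_assoc[OF Y Y Y Y h A dE] comp_assoc[OF Y Y Y Y h dE A])
  also have "... = ?r(?c(- diff C(Y(Suc ?j))(Y ?j)(?I ?j)+(comp C(Y(Suc ?j))(Y ?j)(Y ?j)(E(Y ?j))(?d ?j)-comp C(Y(Suc ?j))(Y(Suc ?j))(Y ?j)(?d ?j)(E(Y(Suc ?j))))))"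
  unfolding clin_diff[OF lin sub m(1,2),symmetric] commutator_rule[of ?j] ..
  also have "... = ?r(- ?c(diff C(Y(Suc ?j))(Y ?j)(?I ?j))+(?c(comp C(Y(Suc ?j))(Y ?j)(Y ?j)(E(Y ?j))(?d ?j)) - ?c(comp C(Y(Suc ?j))(Y(Suc ?j))(Y ?j)(?d ?j)(E(Y(Suc ?j))))))"
  unfolding clin_comb[OF lin sub m(5,3,4)] ..
  also have "... = - ?r(?c(diff C(Y(Suc ?j))(Y ?j)(?I ?j)))+(?r(?c(comp C(Y(Suc ?j))(Y ?j)(Y ?j)(E(Y ?j))(?d ?j))) - ?r(?c(comp C(Y(Suc ?j))(Y(Suc ?j))(Y ?j)(?d ?j)(E(Y(Suc ?j))))))"
  unfolding clin_comb[OF lr subr c[OF m(5)] c[OF m(3)] c[OF m(4)]] ..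
  also have "?r(?c(comp C(Y(Suc ?j))(Y ?j)(Y ?j)(E(Y ?j))(?d ?j))) = ?U i"
  using that by(simp add:Suc_diff_le run_Suc comp_assoc[OF Y Y Y Y h E[OF Y] dA_YA] del:run.simps(2))
  also have "?r(?c(comp C(Y(Suc ?j))(Y(Suc ?j))(Y ?j)(?d ?j)(E(Y(Suc ?j))))) = ?U(Suc i)"
  using that by(simp add:comp_assoc[OF Y Y Y Y h dA_YA E[OF Y]])
  finally show ?thesis .
 qed
 have "(\<Sum>i\<le>k. ?V i) = (\<Sum>i\<le>k. - ?D i+(?U i - ?U(Suc i)))"
  by(rule sum.cong) (auto simp:V)
 also have "... = - (\<Sum>i\<le>k. ?D i)+(?U 0 - ?U(Suc k))"
  unfolding sum.distrib sum_negf using sum_telescope[of ?U k] by(simp del:run.simps)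
 also have "?U(Suc k) = cY(Suc(Suc k))(Suc(Suc k))(head(Suc k))(E(Y(Suc(Suc k))))"
  by simp
 also have "(\<Sum>i\<le>k. ?D i) = der_word C E Y A(Suc k)-run C(Y 0)Y A(?I 0)(Suc 0)(Suc k)"
  unfolding der_word_eq by(simp add:lessThan_Suc_atMost del:run.simps)
 \<comment> \<open>The first term of \<open>der_word\<close> contains the commutator of
   \<open>E\<close> with \<open>A 0\<close>. Its second half cancels \<open>?U 0\<close>, which
   leaves the word with \<open>E\<close> in front.\<close>
 also have "run C(Y 0)Y A(?I 0)(Suc 0)(Suc k) = run C(Y 0)Y A(comp C(Y 1)(Y 0)(Y 0)(E(Y 0))(A 0))(Suc 0)(Suc k) - ?U 0"
 proof -
  have m: "comp C(Y 1)(Y 0)(Y 0)(E(Y 0))(A 0):ghom C(Y 1)(Y 0) 0"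
  "comp C(Y 1)(Y 1)(Y 0)(A 0)(E(Y 1)):ghom C(Y 1)(Y 0) 0"
  using comp_in[OF Y Y Y E[OF Y] A,of 0] comp_in[OF Y Y Y A E[OF Y],of 0] by simp_all
  show ?thesis
  using clin_diff[OF run_lin_YA[OF Y] sub_ghom m,of "Suc k"]
  by(simp add:inner_der_def del:run.simps(2))
 qed
 finally show ?thesis by(simp del:run.simps)
qed

end

end

lemma ins_word_cong:
 assumes "i<=k" "!!j. j<=Suc k ==> Y j = Y' j" "!!j. j<=k ==> A j = A' j"
 shows "ins_word C E Y A i k = ins_word C E Y' A' i k"
proof -
 have "run C(Y' 0)Y A(A 0)(Suc 0)i = run C(Y' 0)Y' A'(A' 0)(Suc 0)i"
  using assms by(subst run_cong[of _ _ Y Y' A A']) auto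
 moreover have "run C(Y' 0)Y A x(Suc i)(k-i) = run C(Y' 0)Y' A' x(Suc i)(k-i)" for x
  using assms by(intro run_cong) auto
 ultimately show ?thesis using assms by(simp add:ins_word_def)
qed

lemma ins_word_Suc:
 assumes "i<=k"
 shows "ins_word C E Y A i(Suc k) = comp C(Y(Suc(Suc k)))(Y(Suc k))(Y 0)(ins_word C E Y A i k)(diff C(Y(Suc(Suc k)))(Y(Suc k))(A(Suc k)))"
proof -
 have "Suc k-i = Suc(k-i)" "Suc i+(k-i) = Suc k" using assms by simp_all
 thus ?thesis unfolding ins_word_def by(simp only: run.simps)
qed

section \<open>Products of arrows, their multilinearity, and the diagonal action on them\<close>

lemma wprod_cong:
 assumes "!!j. j<=Suc l ==> Y j = Y' j" "!!j. j<=l ==> B j = B' j"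
 shows "wprod C Y B l = wprod C Y' B' l"
 using assms by(induction l) simp_all

context graded_semicat
begin

lemma wprod_in:
 assumes "!!i. Y i:obj C" "!!i. i<=l ==> B i:ghom C(Y(Suc i))(Y i)(e i)"
 shows "wprod C Y B l:ghom C(Y(Suc l))(Y 0)(\<Sum>i\<le>l. e i)"
 using assms(2)
proof(induction l)
 case(Suc l)
 show ?case using comp_in[OF assms(1) assms(1) assms(1) Suc.IH Suc.prems[of "Suc l"]] Suc.prems by simp
qed simp

lemma wprod_lin:
 assumes Y: "!!i. Y i:obj C" and B: "!!i. i<=l ==> B i:ghom C(Y(Suc i))(Y i)(e i)"
  and i: "i<=l"
 shows "clin(ghom C(Y(Suc i))(Y i)(e i))(%x. wprod C Y(B(i := x))l)"
 using B i
proof(induction l)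
 case 0
 thus ?case by(simp add:clin_ident)
next
 case(Suc l)
 show ?case
 proof(cases "i = Suc l")
  case True
  have "wprod C Y(B(i := x))l = wprod C Y B l" for x
  by(rule wprod_cong) (use True in auto)
  thus ?thesis
  proof -
  have "wprod C Y B l:ghom C(Y(Suc l))(Y 0)(\<Sum>i\<le>l. e i)"
  by(rule wprod_in[OF Y]) (use Suc.prems in auto)
  moreover have "wprod C Y(B(i := x))(Suc l) = comp C(Y(Suc(Suc l)))(Y(Suc l))(Y 0)(wprod C Y B l)x" for x
  using True \<open>\<And>x. wprod C Y (B(i := x)) l = wprod C Y B l\<close> by(simp del:fun_upd_apply add: fun_upd_same)
  ultimately show ?thesis
  using comp_lin_right[OF Y Y Y] True by(simp del:fun_upd_apply wprod.simps)
  qed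
 next
  case False
  hence i: "i<=l" using Suc.prems by simp
  have in': "wprod C Y(B(i := x))l:ghom C(Y(Suc l))(Y 0)(\<Sum>i\<le>l. e i)"
  if "x:ghom C(Y(Suc i))(Y i)(e i)" for x
  by(rule wprod_in[OF Y]) (use that Suc.prems in auto)
  have "clin(ghom C(Y(Suc i))(Y i)(e i))(%x. comp C(Y(Suc(Suc l)))(Y(Suc l))(Y 0)(wprod C Y(B(i := x))l)(B(Suc l)))"
  by(rule clin_compose[OF comp_lin_left[OF Y Y Y Suc.prems(1)] Suc.IH in'])
  (use Suc.prems i in auto)
  thus ?thesis using False by(simp del:fun_upd_apply add: fun_upd_other)
 qed
qed

lemma mlin_wprod_act:
 assumes Y: "!!i. Y i:obj C" and B: "!!i. i<=l ==> B i:ghom C(Y(Suc i))(Y i)(e i)"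
 shows "mlin l(%ks. wprod C Y(%i. act C(Y(Suc i))(Y i)(ks!i)(B i))l)"
proof(rule mlinI)
 fix ks :: "'h list" and i assume ks: "length ks = Suc l" and i: "i<=l"
 let ?B = "%i. act C(Y(Suc i))(Y i)(ks!i)(B i)"
 have eq: "wprod C Y(%j. act C(Y(Suc j))(Y j)(ks[i := h]!j)(B j))l = wprod C Y(?B(i := act C(Y(Suc i))(Y i)h(B i)))l" for h
  by(rule wprod_cong) (use ks i in \<open>auto simp: nth_list_update\<close>)
 show "lin(%h. wprod C Y(%j. act C(Y(Suc j))(Y j)(ks[i := h]!j)(B j))l)"
 proof -
  have "clin(ghom C(Y(Suc i))(Y i)(e i))(%x. wprod C Y(?B(i := x))l)"
  by(rule wprod_lin[OF Y _ i]) (rule act_in[OF Y Y B])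
  from clin_compose[OF this act_lin_left[OF Y Y B[OF i]] act_in[OF Y Y B[OF i]]]
  show ?thesis unfolding eq .
 qed
qed

text \<open>Repeated use of \<open>act_comp\<close>. Products grow on the right, hence the iterated
  coproduct is unrolled from its last slot by \<open>sw_snoc\<close>.\<close>

lemma wprod_act:
 assumes Y: "!!i. Y i:obj C" and B: "!!i. i<=l ==> B i:ghom C(Y(Suc i))(Y i)(e i)"
 shows "act C(Y(Suc l))(Y 0)h(wprod C Y B l) = sw l(%ks. wprod C Y(%i. act C(Y(Suc i))(Y i)(ks!i)(B i))l)h"
 using B
proof(induction l arbitrary: h)
 case 0
 show ?case by simp
next
 case(Suc l)
 let ?a = "%ks i. act C(Y(Suc i))(Y i)(ks!i)(B i)"
 have Bl: "B(Suc l):ghom C(Y(Suc(Suc l)))(Y(Suc l))(e(Suc l))" using Suc.prems by simp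
 have w: "wprod C Y B l:ghom C(Y(Suc l))(Y 0)(\<Sum>i\<le>l. e i)"
  by(rule wprod_in[OF Y]) (use Suc.prems in auto)
 have ml: "mlin l(%ks. wprod C Y(?a ks)l)"
  by(rule mlin_wprod_act[where e = e,OF Y]) (use Suc.prems in auto)
 have w': "wprod C Y(?a ks)l:ghom C(Y(Suc l))(Y 0)(\<Sum>i\<le>l. e i)" for ks
  by(rule wprod_in[OF Y],rule act_in[OF Y Y]) (use Suc.prems in auto)
 have "act C(Y(Suc(Suc l)))(Y 0)h(wprod C Y B(Suc l)) = tlift(%h1 h2. comp C(Y(Suc(Suc l)))(Y(Suc l))(Y 0)(sw l(%ks. wprod C Y(?a ks)l)h1)(act C(Y(Suc(Suc l)))(Y(Suc l))h2(B(Suc l))))(\<Delta> h)"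
  using Suc by(simp add:act_comp[OF Y Y Y w Bl])
 also have "... = tlift(%h1 h2. sw l(%ks. comp C(Y(Suc(Suc l)))(Y(Suc l))(Y 0)(wprod C Y(?a ks)l)(act C(Y(Suc(Suc l)))(Y(Suc l))h2(B(Suc l))))h1)(\<Delta> h)"
  by(subst sw_clinear_on(2)[OF ml comp_lin_left[OF Y Y Y act_in[OF Y Y Bl]] sub_ghom[OF Y Y] w']) simp
 also have "... = tlift(%h1 h2. sw l(%ks. wprod C Y(?a(ks@[h2]))(Suc l))h1)(\<Delta> h)"
 proof -
  have "sw l(%ks. comp C(Y(Suc(Suc l)))(Y(Suc l))(Y 0)(wprod C Y(?a ks)l)(act C(Y(Suc(Suc l)))(Y(Suc l))h2(B(Suc l))))h1 = sw l(%ks. wprod C Y(?a(ks@[h2]))(Suc l))h1" for h1 h2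
  proof(rule sw_cong)
  fix ks :: "'h list" assume ks: "length ks = Suc l"
  have "wprod C Y(?a ks)l = wprod C Y(?a(ks@[h2]))l"
  by(rule wprod_cong) (use ks in \<open>auto simp: nth_append\<close>)
  thus "comp C(Y(Suc(Suc l)))(Y(Suc l))(Y 0)(wprod C Y(?a ks)l)(act C(Y(Suc(Suc l)))(Y(Suc l))h2(B(Suc l))) = wprod C Y(?a(ks@[h2]))(Suc l)"
  using ks by(simp add:nth_append)
  qed
  thus ?thesis by simp
 qed
 also have "... = sw(Suc l)(%ks. wprod C Y(?a ks)(Suc l))h"
  by(rule sw_snoc[symmetric],rule mlin_wprod_act[where e = e,OF Y]) (rule Suc.prems)
 finally show ?case .
qed

end

text \<open>A word with inserted \<open>dE\<close> becomes a plain product whose factor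
  \<open>j\<close> depends linearly and equivariantly on the arrow \<open>j\<close> alone; the
  conditions on a cochain can then be verified factor by factor.\<close>

definition ins_factor :: "('p,'c,'h,'z)dghsemicat_scheme =>('p => 'c) => nat => nat => 'p => 'p => 'c => 'c" where
 "ins_factor C E i j X Y f = (let g = if j = 0 then f else diff C X Y f in if j = i then comp C X X Y g(diff C X X(E X))else g)"

context graded_semicat
begin

lemma ins_word_wprod:
 assumes Y [simp]: "!!i. Y i:obj C" and A: "!!i. A i:ghom C(Y(Suc i))(Y i) 0"
  and E: "!!X. X:obj C ==> E X:ghom C X X 0" and i: "i<=k"
 shows "ins_word C E Y A i k = wprod C Y(%j. ins_factor C E i j(Y(Suc j))(Y j)(A j))k"
proof -
 let ?B = "%j. ins_factor C E i j(Y(Suc j))(Y j)(A j)"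
 let ?dE = "%i. diff C(Y i)(Y i)(E(Y i))"
 have main: "(j<i-->wprod C Y ?B j = run C(Y 0)Y A(A 0)(Suc 0)j)&(i<=j-->wprod C Y ?B j = ins_word C E Y A i j)" for j
 proof(induction j)
  case 0
  show ?case by(auto simp:ins_factor_def ins_word_def)
 next
  case(Suc j)
  consider "Suc j<i" | "Suc j = i" | "i<Suc j" by linarith
  thus ?case
  proof cases
  case 1
  thus ?thesis using Suc by(simp add:ins_factor_def)
  next
  case 2
  hence "wprod C Y ?B j = run C(Y 0)Y A(A 0)(Suc 0)j" using Suc by simp
  thus ?thesis
  using comp_assoc[OF Y Y Y Y head_in[of Y A j,OF Y A] dA[of Y A "Suc j",OF Y A] dE[of Y A E "Suc(Suc j)",OF Y A E]]
  by(simp add:2[symmetric] ins_factor_def ins_word_def)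
  next
  case 3
  hence ij: "i<=j" by simp
  hence "wprod C Y ?B j = ins_word C E Y A i j" using Suc by blast
  moreover have "?B(Suc j) = diff C(Y(Suc(Suc j)))(Y(Suc j))(A(Suc j))"
  using 3 by(simp add:ins_factor_def)
  ultimately have *: "wprod C Y ?B(Suc j) = ins_word C E Y A i(Suc j)"
  by(simp only: wprod.simps ins_word_Suc[OF ij])
  have "~ Suc j<i" using 3 by simp
  thus ?thesis unfolding * by blast
  qed
 qed
 show ?thesis by(rule main[THEN conjunct2,rule_format,OF i,symmetric])
qed

end

section \<open>Traces of words with an inserted \<open>dE\<close>: cyclic rotation and
  coboundary\<close>

locale graded_trace = graded_semicat H C
 for H :: "'h::complex_algebra_1 hopf" and C :: "('p,'c::complex_vector,'h)dghsemicat" +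
 fixes M :: "('h,'v::complex_vector)sayd" and n :: nat and T :: "'p => 'v => 'c => complex"
 assumes sayd: "sayd_module H M" and trace: "cgtrace H M C n T"
begin

lemma coact_counit:
 assumes G: "lin G"
 shows "tlift(%a m0. \<epsilon> a*.G m0)(coact M m) = G m"
proof -
 have "G(tlift(%a m0. \<epsilon> a*.m0)(coact M m)) = tlift(%a m0. G(\<epsilon> a*.m0))(coact M m)"
  by(rule tlift_lin[OF _ G]) (intro bilinI li)
 thus ?thesis using sayd by(simp add:sayd_module_def clin_scale[OF G])
qed

lemma T_lin: "X:obj C ==> clin(ghom C X X n)(T X m)"
 using trace by(simp add:cgtrace_def cbil_def)

lemma T_lin_m: "X:obj C ==> x:ghom C X X n ==> lin(%m. T X m x)"
 using trace by(simp add:cgtrace_def cbil_def)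

lemma T_inv: "X:obj C ==> f:ghom C X X n ==> tlift(%h1 h2. T X(ract M m h1)(act C X X(S h2)f))(\<Delta> h) = \<epsilon> h * T X m f"
 using trace unfolding cgtrace_def by blast

lemma T_closed: "X:obj C ==> n = Suc k ==> f:ghom C X X k ==> T X m(diff C X X f) = 0"
 using trace unfolding cgtrace_def by blast

lemma T_trace: "X:obj C ==> Y:obj C ==> i+j = n ==> g:ghom C X Y i ==> g':ghom C Y X j ==> T X m(comp C X Y X g' g) = (- 1) ^ (i * j) * tlift(%a m0. T Y m0(comp C Y X Y(act C X Y(S' a)g)g'))(coact M m)"
 using trace unfolding cgtrace_def by blast

lemma rot_bilin:
 assumes X: "X:obj C" "Y:obj C" and ij: "i+j = n" and g: "g:ghom C X Y i" and g': "g':ghom C Y X j"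
 shows "bilin(%a m0. T Y m0(comp C Y X Y(act C X Y(S' a)g)g'))"
proof(rule bilinI)
 have in': "comp C Y X Y(act C X Y h g)g':ghom C Y Y n" for h
  using comp_in[OF X(2,1,2) act_in[OF X g] g'] ij by simp
 show "lin(%m0. T Y m0(comp C Y X Y(act C X Y(S' a)g)g'))" for a
  by(rule T_lin_m[OF X(2) in'])
 have 1: "lin(%h. comp C Y X Y(act C X Y h g)g')"
  by(rule clin_compose[OF comp_lin_left[OF X(2,1,2) g'] act_lin_left[OF X g]])
  (rule act_in[OF X g])
 have 2: "lin(%h. T Y m0(comp C Y X Y(act C X Y h g)g'))" for m0
  by(rule clin_compose[OF T_lin[OF X(2)] 1 in'])
 show "lin(%a. T Y m0(comp C Y X Y(act C X Y(S' a)g)g'))" for m0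
  by(rule lin_comp[OF 2]) (intro li)
qed

text \<open>If \<open>H\<close> acts on \<open>e\<close> by the counit, the twist by
  \<open>S' a\<close> becomes a scalar and the coaction disappears by its counit axiom.\<close>

lemma T_invariant:
 assumes X: "X:obj C" and ij: "i+j = n" and e: "e:ghom C X X i" and g': "g':ghom C X X j"
  and inv: "!!h. act C X X h e = \<epsilon> h*.e"
 shows "T X m(comp C X X X g' e) = (- 1) ^ (i * j) * T X m(comp C X X X e g')"
proof -
 have in': "comp C X X X e g':ghom C X X n"
  using comp_in[OF X X X e g'] ij by simp
 have "T X m0(comp C X X X(act C X X(S' a)e)g') = \<epsilon> a*.T X m0(comp C X X X e g')" for a m0
  by(simp add:inv counit_antipode_inv clin_scale[OF comp_lin_left[OF X X X g'] e]
  clin_scale[OF T_lin[OF X] in'])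
 thus ?thesis
  using T_trace[OF X X ij e g'] coact_counit[OF T_lin_m[OF X in']] by simp
qed

text \<open>Integration by parts: the trace vanishes on the differential of \<open>g x\<close>, and
  \<open>g\<close> has degree zero.\<close>

lemma T_parts:
 assumes X: "X:obj C" "Y:obj C" and n: "n = Suc k" and g: "g:ghom C X Y 0" and x: "x:ghom C Y X k"
 shows "T Y m(comp C Y X Y(diff C X Y g)x) = - T Y m(comp C Y X Y g(diff C Y X x))"
proof -
 have 1: "comp C Y X Y(diff C X Y g)x:ghom C Y Y n"
  using comp_in[OF X(2,1,2) diff_in[OF X g] x] n by simp
 have 2: "comp C Y X Y g(diff C Y X x):ghom C Y Y n"
  using comp_in[OF X(2,1,2) g diff_in[OF X(2,1) x]] n by simp
 have "T Y m(diff C Y Y(comp C Y X Y g x)) = 0"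
  by(rule T_closed[OF X(2) n]) (use comp_in[OF X(2,1,2) g x] in simp)
 hence "T Y m(comp C Y X Y(diff C X Y g)x)+T Y m(comp C Y X Y g(diff C Y X x)) = 0"
  by(simp add:leibniz0[OF X(2,1,2) g x] clin_add[OF T_lin[OF X(2)] 1 2])
 thus ?thesis by(simp add:eq_neg_iff_add_eq_0)
qed

context
 fixes Y :: "nat => 'p" and A :: "nat => 'c" and E :: "'p => 'c" and k :: nat
 assumes Y [simp]: "!!i. Y i:obj C" and A [simp]: "!!i. A i:ghom C(Y(Suc i))(Y i) 0"
  and E [simp]: "!!X. X:obj C ==> E X:ghom C X X 0"
  and E_inv: "!!X h. X:obj C ==> act C X X h(E X) = \<epsilon> h*.E X"
  and n: "n = Suc k" and cyc: "Y(Suc k) = Y 0"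
begin

private lemmas YA = Y A
private lemmas dA_seq = dA[of Y,OF YA]
private lemmas dE_seq = dE[of Y A E,OF YA E]

text \<open>Differentiating a word turns its leading \<open>A 0\<close> into \<open>dA 0\<close> and
  leaves the closed factors alone. With \<open>B\<close> in front the result is a word of the same
  kind for the rotated sequence, with \<open>dE\<close> one place further right.\<close>

lemma rot_ins_Suc:
 assumes i: "i<k" and B: "B:ghom C(Y 0)(Y k) 0"
  and Y': "Y' 0 = Y k" "!!j. j<=k ==> Y'(Suc j) = Y j"
  and A': "A' 0 = B" "!!j. j<k ==> A'(Suc j) = A j"
 shows "comp C(Y k)(Y 0)(Y k)B(diff C(Y k)(Y 0)(ins_word C E Y A i(k-1))) = ins_word C E Y' A'(Suc i)k"
proof -
 let ?dE = "diff C(Y(Suc i))(Y(Suc i))(E(Y(Suc i)))"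
 let ?dA0 = "diff C(Y(Suc 0))(Y 0)(A 0)"
 let ?w = "comp C(Y(Suc i))(Y(Suc i))(Y 0)(run C(Y 0)Y A(A 0)(Suc 0)i) ?dE"
 have dA0: "?dA0:ghom C(Y(Suc 0))(Y 0) 1" by(rule dA_seq)
 have h: "run C(Y 0)Y A(A 0)(Suc 0)i:ghom C(Y(Suc i))(Y 0)i" by(rule head_in[of Y A i,OF YA])
 have dh: "diff C(Y(Suc i))(Y 0)(run C(Y 0)Y A(A 0)(Suc 0)i) = run C(Y 0)Y A ?dA0(Suc 0)i"
  using run_diff[of Y A "Y 0" "A 0" "Suc 0" 0 i,OF YA] by simp
 have rh: "run C(Y 0)Y A ?dA0(Suc 0)i:ghom C(Y(Suc i))(Y 0)(Suc i)"
  using run_in[of Y A "Y 0" ?dA0 "Suc 0" 1 i,OF YA Y] dA0 by simp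
 have w: "?w:ghom C(Y(Suc i))(Y 0)(Suc i)"
  by(rule head_dE_in[of Y A E i,OF YA E])
 have dw: "diff C(Y(Suc i))(Y 0) ?w = comp C(Y(Suc i))(Y(Suc i))(Y 0)(run C(Y 0)Y A ?dA0(Suc 0)i) ?dE"
  using leibniz[OF Y Y Y h dE_seq] clin_zero[OF comp_lin_right[OF Y Y Y h] sub_ghom[OF Y Y]]
  by(simp add:dh diff_diff[OF Y Y E[OF Y]] scale_simps)
 have dw_in: "diff C(Y(Suc i))(Y 0) ?w:ghom C(Y(Suc i))(Y 0)(Suc(Suc i))"
  by(rule diff_in[OF Y Y w])
 have k1: "Suc(i+(k-Suc i)) = k" using i by simp
 have "diff C(Y k)(Y 0)(ins_word C E Y A i(k-1)) = run C(Y 0)Y A(diff C(Y(Suc i))(Y 0) ?w)(Suc i)(k-Suc i)"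
  using run_diff[of Y A "Y 0" ?w "Suc i" "Suc i" "k-Suc i",OF YA Y w] k1 by(simp add:ins_word_def)
 hence "comp C(Y k)(Y 0)(Y k)B(diff C(Y k)(Y 0)(ins_word C E Y A i(k-1))) = run C(Y k)Y A(comp C(Y(Suc i))(Y 0)(Y k)B(diff C(Y(Suc i))(Y 0) ?w))(Suc i)(k-Suc i)"
  using run_left[of Y A "Y 0" "Y k" "diff C(Y(Suc i))(Y 0) ?w" "Suc i" "Suc(Suc i)" B 0 "k-Suc i",OF YA Y Y dw_in B]
  k1 by simp
 also have "comp C(Y(Suc i))(Y 0)(Y k)B(diff C(Y(Suc i))(Y 0) ?w) = comp C(Y(Suc i))(Y(Suc i))(Y k)(run C(Y k)Y A(comp C(Y(Suc 0))(Y 0)(Y k)B ?dA0)(Suc 0)i) ?dE"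
  using run_left[of Y A "Y 0" "Y k" ?dA0 "Suc 0" 1 B 0 i,OF YA Y Y dA0 B]
  by(simp add:dw comp_assoc[OF Y Y Y Y B rh dE_seq,symmetric])
 also have "run C(Y k)Y A(comp C(Y(Suc 0))(Y 0)(Y k)B ?dA0)(Suc 0)i = run C(Y k)Y' A' B(Suc 0)(Suc i)"
 proof -
  have "run C(Y k)Y' A' B(Suc 0)(Suc i) = run C(Y k)Y' A'(comp C(Y(Suc 0))(Y 0)(Y k)B ?dA0)(Suc(Suc 0))i"
  unfolding run_Suc using Y'(2)[of 0] Y'(2)[of 1] A'(2)[of 0] i by simp
  also have "... = run C(Y k)Y A(comp C(Y(Suc 0))(Y 0)(Y k)B ?dA0)(Suc 0)i"
  by(rule run_shift) (use i Y' A' in auto)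
  finally show ?thesis ..
 qed
 also have "run C(Y k)Y A(comp C(Y(Suc i))(Y(Suc i))(Y k)(run C(Y k)Y' A' B(Suc 0)(Suc i)) ?dE)(Suc i)(k-Suc i) = run C(Y k)Y' A'(comp C(Y(Suc i))(Y(Suc i))(Y k)(run C(Y k)Y' A' B(Suc 0)(Suc i)) ?dE)(Suc(Suc i))(k-Suc i)"
  by(rule run_shift[symmetric]) (use i Y' A' in auto)
 also have "... = ins_word C E Y' A'(Suc i)k"
  using Y' A' i Y'(2)[of "Suc i"] by(simp add:ins_word_def del:run.simps)
 finally show ?thesis .
qed

lemma rot_ins_0:
 assumes B: "B:ghom C(Y 0)(Y k) 0"
  and Y': "Y' 0 = Y k" "!!j. j<=k ==> Y'(Suc j) = Y j"
  and A': "A' 0 = B" "!!j. j<k ==> A'(Suc j) = A j"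
 shows "comp C(Y k)(Y 0)(Y k)B(run C(Y 0)Y A(diff C(Y 0)(Y 0)(E(Y 0))) 0 k) = ins_word C E Y' A' 0 k"
proof -
 let ?dE = "diff C(Y 0)(Y 0)(E(Y 0))"
 have "comp C(Y k)(Y 0)(Y k)B(run C(Y 0)Y A ?dE 0 k) = run C(Y k)Y A(comp C(Y 0)(Y 0)(Y k)B ?dE) 0 k"
  using run_left[of Y A "Y 0" "Y k" ?dE 0 1 B 0 k,OF YA Y Y dE_seq B] by simp
 also have "... = run C(Y k)Y' A'(comp C(Y 0)(Y 0)(Y k)B ?dE)(Suc 0)k"
  by(rule run_shift[symmetric]) (use Y' A' in auto)
 also have "... = ins_word C E Y' A' 0 k"
  using Y' A' Y'(2)[of 0] by(simp add:ins_word_def)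
 finally show ?thesis .
qed

text \<open>The last factor is carried to the front by the trace property and freed of its
  differential by parts. This sends the word with \<open>dE\<close> at place \<open>i\<close> to the
  rotated word with \<open>dE\<close> at place \<open>i + 1\<close>, and the last place to place 0;
  the alternating signs turn the sum into its rotation times \<open>(- 1) ^ k\<close>.\<close>

lemma rotate_ins:
 assumes Y': "Y' 0 = Y k" "!!j. j<=k ==> Y'(Suc j) = Y j"
  and A': "!!a. A' a 0 = act C(Y 0)(Y k)(S' a)(A k)" "!!a j. j<k ==> A' a(Suc j) = A j"
 shows "(\<Sum>i\<le>k.(- 1) ^ i * T(Y 0)m(ins_word C E Y A i k)) = (- 1) ^ k * tlift(%a m0. \<Sum>i\<le>k.(- 1) ^ i * T(Y k)m0(ins_word C E Y'(A' a)i k))(coact M m)"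
proof -
 have Ak: "A k:ghom C(Y 0)(Y k) 0" using A[of k] cyc by simp
 have dAk: "diff C(Y 0)(Y k)(A k):ghom C(Y 0)(Y k) 1" using diff_in[OF Y Y Ak] by simp
 have Bin: "act C(Y 0)(Y k)(S' a)(A k):ghom C(Y 0)(Y k) 0" for a by(rule act_in[OF Y Y Ak])
 have R1: "comp C(Y k)(Y 0)(Y k)(act C(Y 0)(Y k)(S' a)(A k))(diff C(Y k)(Y 0)(ins_word C E Y A i(k-1))) = ins_word C E Y'(A' a)(Suc i)k" if "i<k" for i a
  by(rule rot_ins_Suc[OF that Bin]) (simp_all add: Y' A')
 have R0: "comp C(Y k)(Y 0)(Y k)(act C(Y 0)(Y k)(S' a)(A k))(run C(Y 0)Y A(diff C(Y 0)(Y 0)(E(Y 0))) 0 k) = ins_word C E Y'(A' a) 0 k" for a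
  by(rule rot_ins_0[OF Bin]) (simp_all add: Y' A')
 let ?t = "%i. tlift(%a m0. T(Y k)m0(ins_word C E Y'(A' a)i k))(coact M m)"
 have part: "tlift(%a m0. T(Y k)m0(comp C(Y k)(Y 0)(Y k)(act C(Y 0)(Y k)(S' a)(diff C(Y 0)(Y k)(A k)))x))(coact M m) = - tlift(%a m0. T(Y k)m0(comp C(Y k)(Y 0)(Y k)(act C(Y 0)(Y k)(S' a)(A k))(diff C(Y k)(Y 0)x)))(coact M m)"
  if x: "x:ghom C(Y k)(Y 0)k" for x
 proof -
  have b: "bilin(%a m0. T(Y k)m0(comp C(Y k)(Y 0)(Y k)(act C(Y 0)(Y k)(S' a)(A k))(diff C(Y k)(Y 0)x)))"
  by(rule rot_bilin[OF Y Y _ Ak diff_in[OF Y Y x]]) (use n in simp)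
  have "lin(%x::complex. - x)" by(intro li)
  from tlift_lin[OF b this] show ?thesis
  by(simp add:diff_act[OF Y Y Ak,symmetric] T_parts[OF Y Y n Bin x])
 qed
 \<comment> \<open>Here the last factor is \<open>dA k\<close>, so one rotation and one integration
   by parts suffice.\<close>
 have C1: "T(Y 0)m(ins_word C E Y A i k) = (- 1) ^ Suc k * ?t(Suc i)" if i: "i<k" for i
 proof -
  let ?x = "ins_word C E Y A i(k-1)"
  have x: "?x:ghom C(Y k)(Y 0)k"
  using ins_word_in[of Y A E i "k-1",OF YA E] i by simp
  have "ins_word C E Y A i k = comp C(Y 0)(Y k)(Y 0) ?x(diff C(Y 0)(Y k)(A k))"
  proof -
  obtain k' where "k = Suc k'" using i by(cases k) auto
  thus ?thesis using ins_word_Suc[of i k' C E Y A] i cyc by simp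
  qed
  hence "T(Y 0)m(ins_word C E Y A i k) = (- 1) ^ (1 * k) * tlift(%a m0. T(Y k)m0(comp C(Y k)(Y 0)(Y k)(act C(Y 0)(Y k)(S' a)(diff C(Y 0)(Y k)(A k))) ?x))(coact M m)"
  using T_trace[OF Y Y _ dAk x,of m] n by simp
  also have "... = (- 1) ^ Suc k * tlift(%a m0. T(Y k)m0(comp C(Y k)(Y 0)(Y k)(act C(Y 0)(Y k)(S' a)(A k))(diff C(Y k)(Y 0) ?x)))(coact M m)"
  unfolding part[OF x] by simp
  also have "... = (- 1) ^ Suc k * ?t(Suc i)"
  unfolding R1[OF i] ..
  finally show ?thesis .
 qed
 \<comment> \<open>Here the last factor is \<open>dE\<close>. It is brought to the front without a
   twist because \<open>E\<close> is invariant, and only then \<open>dA k\<close> is carried round;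
   two rotations and two integrations by parts leave the sign 1.\<close>
 have C2: "T(Y 0)m(ins_word C E Y A k k) = ?t 0"
 proof -
  let ?h = "run C(Y 0)Y A(A 0)(Suc 0)k"
  let ?dE = "diff C(Y 0)(Y 0)(E(Y 0))"
  let ?x = "run C(Y 0)Y A(E(Y 0)) 0 k"
  have h: "?h:ghom C(Y 0)(Y 0)k" using head_in[of Y A k,OF YA] cyc by simp
  have x: "?x:ghom C(Y k)(Y 0)k" using run_in[of Y A "Y 0" "E(Y 0)" 0 0 k,OF YA] by simp
  have dE_inv: "act C(Y 0)(Y 0)h ?dE = \<epsilon> h *. ?dE" for h
  by(simp add:diff_act[OF Y Y E[OF Y],symmetric] E_inv clin_scale[OF diff_lin[OF Y Y] E[OF Y]])
  have "T(Y 0)m(ins_word C E Y A k k) = T(Y 0)m(comp C(Y 0)(Y 0)(Y 0) ?h ?dE)"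
  using cyc by(simp add:ins_word_def)
  also have "... = (- 1) ^ (1 * k) * T(Y 0)m(comp C(Y 0)(Y 0)(Y 0) ?dE ?h)"
  by(rule T_invariant[OF Y _ dE_seq h dE_inv]) (use n in simp)
  also have "... = (- 1) ^ Suc k * T(Y 0)m(comp C(Y 0)(Y 0)(Y 0)(E(Y 0))(diff C(Y 0)(Y 0) ?h))"
  by(simp add:T_parts[OF Y Y n E[OF Y] h])
  also have "comp C(Y 0)(Y 0)(Y 0)(E(Y 0))(diff C(Y 0)(Y 0) ?h) = run C(Y 0)Y A(E(Y 0)) 0(Suc k)"
  proof -
  have "diff C(Y 0)(Y 0) ?h = run C(Y 0)Y A(diff C(Y(Suc 0))(Y 0)(A 0))(Suc 0)k"
  using run_diff[of Y A "Y 0" "A 0" "Suc 0" 0 k,OF YA] cyc by simp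
  thus ?thesis
  using run_left[of Y A "Y 0" "Y 0" "diff C(Y(Suc 0))(Y 0)(A 0)" "Suc 0" 1 "E(Y 0)" 0 k,OF YA Y Y dA_seq] cyc
  by(simp add:run_Suc del:run.simps)
  qed
  also have "... = comp C(Y 0)(Y k)(Y 0) ?x(diff C(Y 0)(Y k)(A k))"
  using cyc by simp
  also have "T(Y 0)m ... = (- 1) ^ (1 * k) * tlift(%a m0. T(Y k)m0(comp C(Y k)(Y 0)(Y k)(act C(Y 0)(Y k)(S' a)(diff C(Y 0)(Y k)(A k))) ?x))(coact M m)"
  by(rule T_trace[OF Y Y _ dAk x,of m]) (use n in simp)
  also have "... = (- 1) ^ Suc k * tlift(%a m0. T(Y k)m0(comp C(Y k)(Y 0)(Y k)(act C(Y 0)(Y k)(S' a)(A k))(diff C(Y k)(Y 0) ?x)))(coact M m)"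
  unfolding part[OF x] by simp
  also have "diff C(Y k)(Y 0) ?x = run C(Y 0)Y A ?dE 0 k"
  using run_diff[of Y A "Y 0" "E(Y 0)" 0 0 k,OF YA] by simp
  also have "(- 1) ^ Suc k*((- 1) ^ Suc k * tlift(%a m0. T(Y k)m0(comp C(Y k)(Y 0)(Y k)(act C(Y 0)(Y k)(S' a)(A k))(run C(Y 0)Y A ?dE 0 k)))(coact M m)) = ?t 0"
  unfolding R0 by(simp add:power_add[symmetric] mult.assoc[symmetric])
  finally show ?thesis .
 qed
 have bil: "bilin(%a m0. T(Y k)m0(ins_word C E Y'(A' a)i k))" if "i<=k" for i
 proof(cases i)
  case 0
  have "bilin(%a m0. T(Y k)m0(comp C(Y k)(Y 0)(Y k)(act C(Y 0)(Y k)(S' a)(A k))(run C(Y 0)Y A(diff C(Y 0)(Y 0)(E(Y 0))) 0 k)))"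
  by(rule rot_bilin[OF Y Y _ Ak,where j = n]) (use run_in[of Y A "Y 0" _ 0 1 k,OF YA Y dE_seq] n in simp_all)
  thus ?thesis unfolding R0 0 .
 next
  case(Suc j)
  hence j: "j<k" using that by simp
  have "ins_word C E Y A j(k-1):ghom C(Y k)(Y 0)k"
  using ins_word_in[of Y A E j "k-1",OF YA E] j by simp
  hence "bilin(%a m0. T(Y k)m0(comp C(Y k)(Y 0)(Y k)(act C(Y 0)(Y k)(S' a)(A k))(diff C(Y k)(Y 0)(ins_word C E Y A j(k-1)))))"
  by(intro rot_bilin[OF Y Y _ Ak diff_in[OF Y Y]]) (use n in simp_all)
  thus ?thesis unfolding R1[OF j] Suc .
 qed
 have bil': "bilin(%a m0.(- 1) ^ i * T(Y k)m0(ins_word C E Y'(A' a)i k))" if "i:{..k}" for i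
  using bil[of i] that by(auto simp:cbil_def intro!:clin_mult_right)
 have "tlift(%a m0. \<Sum>i\<le>k.(- 1) ^ i * T(Y k)m0(ins_word C E Y'(A' a)i k))(coact M m) = (\<Sum>i\<le>k.(- 1) ^ i * ?t i)"
  by(subst tlift_sum_fun,erule bil')
  (auto intro!:sum.cong tlift_mult_fun bil)
 also have "... = ?t 0+(\<Sum>i<k.(- 1) ^ Suc i * ?t(Suc i))"
  by(simp add:sum.atMost_shift)
 finally have R: "tlift(%a m0. \<Sum>i\<le>k.(- 1) ^ i * T(Y k)m0(ins_word C E Y'(A' a)i k))(coact M m) = ?t 0+(\<Sum>i<k.(- 1) ^ Suc i * ?t(Suc i))" .
 have "(\<Sum>i\<le>k.(- 1) ^ i * T(Y 0)m(ins_word C E Y A i k)) = (\<Sum>i<k.(- 1) ^ i*((- 1) ^ Suc k * ?t(Suc i)))+(- 1) ^ k * ?t 0"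
  by(simp add:lessThan_Suc_atMost[symmetric] C1 C2)
 also have "... = (- 1) ^ k*(?t 0+(\<Sum>i<k.(- 1) ^ Suc i * ?t(Suc i)))"
  by(simp add:distrib_left sum_distrib_left algebra_simps)
 finally show ?thesis unfolding R .
qed

end

end

context graded_trace
begin

text \<open>The inner faces yield, by \<open>ins_faces\<close>, the commutators and one right end
  term for each place; the last face cancels these end terms. \<open>sum_commutators\<close> turns
  what remains into \<open>- der_word\<close> and a commutator with \<open>E\<close>, on which the
  trace vanishes.\<close>

lemma codiff_seq:
 fixes Y :: "nat => 'p" and A :: "nat => 'c" and E :: "'p => 'c" and k :: nat
 assumes Y [simp]: "!!i. Y i:obj C" and A [simp]: "!!i. A i:ghom C(Y(Suc i))(Y i) 0"
  and E [simp]: "!!X. X:obj C ==> E X:ghom C X X 0"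
  and E_inv: "!!X h. X:obj C ==> act C X X h(E X) = \<epsilon> h*.E X"
  and n: "n = Suc k" and cyc: "Y(Suc(Suc k)) = Y 0"
  and Y': "Y' 0 = Y(Suc k)" "!!j. j<=k ==> Y'(Suc j) = Y(Suc j)"
  and A': "!!a. A' a 0 = comp C(Y(Suc 0))(Y 0)(Y(Suc k))(act C(Y 0)(Y(Suc k))(S' a)(A(Suc k)))(A 0)"
  "!!a j. j<k ==> A' a(Suc j) = A(Suc j)"
 shows "(\<Sum>j\<le>k.(- 1) ^ j*(\<Sum>i\<le>k.(- 1) ^ i * T(Y 0)m(ins_word C E(face_obj j Y)(face_mor C j Y A)i k)))+(- 1) ^ Suc k * tlift(%a m0. \<Sum>i\<le>k.(- 1) ^ i * T(Y(Suc k))m0(ins_word C E Y'(A' a)i k))(coact M m) = - T(Y 0)m(der_word C E Y A(Suc k))"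
proof -
 note YA = Y A and YAE = Y A E
 let ?Z = "Y 0" and ?q = "Y(Suc k)"
 let ?B = "%a. act C ?Z ?q(S' a)(A(Suc k))"
 let ?w = "%i. ins_word C E Y A i k"
 have Ak: "A(Suc k):ghom C ?Z ?q 0" using A[of "Suc k"] cyc by simp
 have w: "?w i:ghom C ?q ?Z(Suc k)" if "i<=k" for i
  using ins_word_in[of Y A E i k,OF YAE that] .
 \<comment> \<open>The last face multiplies the twisted last arrow into \<open>A 0\<close>; since
   \<open>run\<close> works from the left this is the whole word multiplied by the twisted arrow in
   front.\<close>
 have last: "ins_word C E Y'(A' a)i k = comp C ?q ?Z ?q(?B a)(?w i)" if i: "i<=k" for a i
 proof -
  let ?dE = "diff C(Y(Suc i))(Y(Suc i))(E(Y(Suc i)))"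
  have B: "?B a:ghom C ?Z ?q 0" by(rule act_in[OF Y Y Ak])
  have h: "run C ?Z Y A(A 0)(Suc 0)i:ghom C(Y(Suc i)) ?Z i" by(rule head_in[of Y A i,OF YA])
  have dE: "?dE:ghom C(Y(Suc i))(Y(Suc i)) 1" by(rule dE[of Y A E,OF YAE])
  have hE: "comp C(Y(Suc i))(Y(Suc i)) ?Z(run C ?Z Y A(A 0)(Suc 0)i) ?dE:ghom C(Y(Suc i)) ?Z(Suc i)"
  by(rule head_dE_in[of Y A E i,OF YAE])
  have A1: "A' a j = A j" if "Suc 0<=j" "j<=k" for j using A'(2)[of "j-1"] that by(cases j) auto
  have Y1: "Y' j = Y j" if "Suc 0<=j" "j<=Suc k" for j using Y'(2)[of "j-1"] that by(cases j) auto
  have "ins_word C E Y'(A' a)i k = run C ?q Y'(A' a)(comp C(Y(Suc i))(Y(Suc i)) ?q(run C ?q Y'(A' a)(A' a 0)(Suc 0)i) ?dE)(Suc i)(k-i)"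
  using Y1[of "Suc i"] i Y'(1) by(simp add:ins_word_def)
  also have "... = run C ?q Y A(comp C(Y(Suc i))(Y(Suc i)) ?q(run C ?q Y'(A' a)(A' a 0)(Suc 0)i) ?dE)(Suc i)(k-i)"
  by(rule run_cong) (use i A1 Y1 in auto)
  also have "run C ?q Y'(A' a)(A' a 0)(Suc 0)i = run C ?q Y A(A' a 0)(Suc 0)i"
  by(rule run_cong) (use i A1 Y1 in auto)
  also have "... = comp C(Y(Suc i)) ?Z ?q(?B a)(run C ?Z Y A(A 0)(Suc 0)i)"
  using run_left[of Y A ?Z ?q "A 0" "Suc 0" 0 "?B a" 0 i,OF YA Y Y A B] A'(1) by simp
  also have "run C ?q Y A(comp C(Y(Suc i))(Y(Suc i)) ?q(comp C(Y(Suc i)) ?Z ?q(?B a)(run C ?Z Y A(A 0)(Suc 0)i)) ?dE)(Suc i)(k-i) = comp C ?q ?Z ?q(?B a)(?w i)"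
  using run_left[of Y A ?Z ?q _ "Suc i" "Suc i" "?B a" 0 "k-i",OF YA Y Y hE B] i
  by(simp add:comp_assoc[OF Y Y Y Y B h dE] ins_word_def)
  finally show ?thesis .
 qed
 have bil: "bilin(%a m0. T ?q m0(ins_word C E Y'(A' a)i k))" if i: "i<=k" for i
  unfolding last[OF i] by(rule rot_bilin[OF Y Y _ Ak w[OF i]]) (use n in simp)
 have bil': "bilin(%a m0.(- 1) ^ i * T ?q m0(ins_word C E Y'(A' a)i k))" if "i:{..k}" for i
  using bil[of i] that by(auto simp:cbil_def intro!:clin_mult_right)
 have tr: "tlift(%a m0. T ?q m0(ins_word C E Y'(A' a)i k))(coact M m) = T ?Z m(comp C ?Z ?q ?Z(?w i)(A(Suc k)))"
  if i: "i<=k" for i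
  unfolding last[OF i] using T_trace[OF Y Y _ Ak w[OF i],of m] n by simp
 have R: "tlift(%a m0. \<Sum>i\<le>k.(- 1) ^ i * T ?q m0(ins_word C E Y'(A' a)i k))(coact M m) = (\<Sum>i\<le>k.(- 1) ^ i * T ?Z m(comp C ?Z ?q ?Z(?w i)(A(Suc k))))"
  by(subst tlift_sum_fun,erule bil')
  (auto intro!:sum.cong simp:tlift_mult_fun[OF bil] tr)
 let ?V = "%i. run C(Y 0)Y A(comp C(Y(Suc(Suc i)))(Y(Suc(Suc i))) ?Z(comp C(Y(Suc(Suc i)))(Y(Suc i)) ?Z(run C ?Z Y A(A 0)(Suc 0)i)(A(Suc i)))(diff C(Y(Suc(Suc i)))(Y(Suc(Suc i)))(E(Y(Suc(Suc i)))))-comp C(Y(Suc(Suc i)))(Y(Suc i)) ?Z(comp C(Y(Suc i))(Y(Suc i)) ?Z(run C ?Z Y A(A 0)(Suc 0)i)(diff C(Y(Suc i))(Y(Suc i))(E(Y(Suc i)))))(A(Suc i)))(Suc(Suc i))(k-i)"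
 have V: "?V i:ghom C ?Z ?Z n" if i: "i<=k" for i
 proof -
  have h: "run C ?Z Y A(A 0)(Suc 0)i:ghom C(Y(Suc i)) ?Z i" by(rule head_in[of Y A i,OF YA])
  have dE: "diff C(Y j)(Y j)(E(Y j)):ghom C(Y j)(Y j) 1" for j by(rule dE[of Y A E,OF YAE])
  have hE: "comp C(Y(Suc i))(Y(Suc i)) ?Z(run C ?Z Y A(A 0)(Suc 0)i)(diff C(Y(Suc i))(Y(Suc i))(E(Y(Suc i)))):ghom C(Y(Suc i)) ?Z(Suc i)"
  by(rule head_dE_in[of Y A E i,OF YAE])
  have "?V i:ghom C(Y(Suc(Suc k))) ?Z(Suc k)"
  proof(rule run_in'[of Y A,OF YA Y])
  show "comp C(Y(Suc(Suc i)))(Y(Suc(Suc i))) ?Z(comp C(Y(Suc(Suc i)))(Y(Suc i)) ?Z(run C ?Z Y A(A 0)(Suc 0)i)(A(Suc i)))(diff C(Y(Suc(Suc i)))(Y(Suc(Suc i)))(E(Y(Suc(Suc i)))))-comp C(Y(Suc(Suc i)))(Y(Suc i)) ?Z(comp C(Y(Suc i))(Y(Suc i)) ?Z(run C ?Z Y A(A 0)(Suc 0)i)(diff C(Y(Suc i))(Y(Suc i))(E(Y(Suc i)))))(A(Suc i)):ghom C(Y(Suc(Suc i))) ?Z(Suc i)"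
  using comp_in[OF Y Y Y comp_in[OF Y Y Y h A] dE] comp_in[OF Y Y Y hE A]
  by(intro sub_in Y) simp_all
  qed(use i in simp_all)
  thus ?thesis using cyc n by simp
 qed
 have wA: "comp C ?Z ?q ?Z(?w i)(A(Suc k)):ghom C ?Z ?Z n" if "i<=k" for i
  using comp_in[OF Y Y Y w[OF that] Ak] n by simp
 have wf: "ins_word C E(face_obj j Y)(face_mor C j Y A)i k:ghom C ?Z ?Z n" if "i<=k" "j<=k" for i j
 proof -
  have "ins_word C E(face_obj j Y)(face_mor C j Y A)i k:ghom C(face_obj j Y(Suc k))(face_obj j Y 0)(Suc k)"
  by(rule ins_word_in[of "face_obj j Y" "face_mor C j Y A" E i k])
  (simp_all add: face_obj_def[of j Y] face_mor_in[of Y A,OF YA,unfolded face_obj_def] that)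
  thus ?thesis using that cyc n by(simp add:face_obj_def)
 qed
 have TZ: "clin(ghom C ?Z ?Z n)(T ?Z m)" by(rule T_lin[OF Y])
 have sub: "csub(ghom C ?Z ?Z n)" by(rule sub_ghom[OF Y Y])
 have sc: "c*.x:ghom C ?Z ?Z n" if "x:ghom C ?Z ?Z n" for c x by(rule scale_in[OF Y Y that])
 have F: "(\<Sum>j\<le>k.(- 1) ^ j * T ?Z m(ins_word C E(face_obj j Y)(face_mor C j Y A)i k)) = (- 1) ^ i * T ?Z m(?V i)+(- 1) ^ k * T ?Z m(comp C ?Z ?q ?Z(?w i)(A(Suc k)))" if i: "i<=k" for i
 proof -
  have "(\<Sum>j\<le>k.(- 1) ^ j * T ?Z m(ins_word C E(face_obj j Y)(face_mor C j Y A)i k)) = (\<Sum>j\<le>k. T ?Z m((- 1) ^ j*.ins_word C E(face_obj j Y)(face_mor C j Y A)i k))"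
  by(rule sum.cong) (auto simp:clin_scale[OF TZ wf[OF i]] scaleC_complex_def)
  also have "... = T ?Z m(\<Sum>j\<le>k.(- 1) ^ j*.ins_word C E(face_obj j Y)(face_mor C j Y A)i k)"
  by(rule clin_sum[OF TZ sub,symmetric]) (auto intro!:sc wf i)
  also have "... = T ?Z m((- 1) ^ i *. ?V i+(- 1) ^ k*.comp C ?Z ?q ?Z(?w i)(A(Suc k)))"
  using ins_faces[of Y A E i k,OF YAE i] unfolding cyc by(rule arg_cong)
  also have "... = (- 1) ^ i * T ?Z m(?V i)+(- 1) ^ k * T ?Z m(comp C ?Z ?q ?Z(?w i)(A(Suc k)))"
  unfolding clin_add[OF TZ sc[OF V[OF i]] sc[OF wA[OF i]]] clin_scale[OF TZ V[OF i]]
  clin_scale[OF TZ wA[OF i]] scaleC_complex_def ..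
  finally show ?thesis .
 qed
 have "(\<Sum>j\<le>k.(- 1) ^ j*(\<Sum>i\<le>k.(- 1) ^ i * T ?Z m(ins_word C E(face_obj j Y)(face_mor C j Y A)i k))) = (\<Sum>i\<le>k.(- 1) ^ i*(\<Sum>j\<le>k.(- 1) ^ j * T ?Z m(ins_word C E(face_obj j Y)(face_mor C j Y A)i k)))"
  unfolding sum_distrib_left by(subst sum.swap) (simp add:mult.left_commute)
 also have "... = (\<Sum>i\<le>k. T ?Z m(?V i)+(- 1) ^ k*((- 1) ^ i * T ?Z m(comp C ?Z ?q ?Z(?w i)(A(Suc k)))))"
  by(rule sum.cong) (auto simp:F distrib_left mult.assoc[symmetric] power_add[symmetric] add.commute[of _ k])
 also have "... = T ?Z m(\<Sum>i\<le>k. ?V i)+(- 1) ^ k*(\<Sum>i\<le>k.(- 1) ^ i * T ?Z m(comp C ?Z ?q ?Z(?w i)(A(Suc k))))"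
 proof -
  have "T ?Z m(\<Sum>i\<le>k. ?V i) = (\<Sum>i\<le>k. T ?Z m(?V i))"
  by(rule clin_sum[OF TZ sub]) (auto intro!:V)
  thus ?thesis by(simp add:sum.distrib sum_distrib_left)
 qed
 finally have L: "(\<Sum>j\<le>k.(- 1) ^ j*(\<Sum>i\<le>k.(- 1) ^ i * T ?Z m(ins_word C E(face_obj j Y)(face_mor C j Y A)i k))) = T ?Z m(\<Sum>i\<le>k. ?V i)+(- 1) ^ k*(\<Sum>i\<le>k.(- 1) ^ i * T ?Z m(comp C ?Z ?q ?Z(?w i)(A(Suc k))))" .
 \<comment> \<open>The words with \<open>E\<close> in front and with \<open>E\<close> at the end
   have the same trace by \<open>T_invariant\<close>, with sign 1 because \<open>E\<close> has
   degree zero.\<close>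
 have "T ?Z m(\<Sum>i\<le>k. ?V i) = - T ?Z m(der_word C E Y A(Suc k))"
 proof -
  let ?h = "run C ?Z Y A(A 0)(Suc 0)(Suc k)"
  let ?U = "run C ?Z Y A(comp C(Y(Suc 0)) ?Z ?Z(E ?Z)(A 0))(Suc 0)(Suc k)"
  have h: "?h:ghom C ?Z ?Z n" using head_in[of Y A "Suc k",OF YA] cyc n by simp
  have EA: "comp C(Y(Suc 0)) ?Z ?Z(E ?Z)(A 0):ghom C(Y(Suc 0)) ?Z 0"
  using comp_in[OF Y Y Y E[OF Y] A,of 0] by simp
  have U: "?U:ghom C ?Z ?Z n" using run_in[of Y A ?Z _ "Suc 0" 0 "Suc k",OF YA Y EA] cyc n by simp
  have hE: "comp C ?Z ?Z ?Z ?h(E ?Z):ghom C ?Z ?Z n" using comp_in[OF Y Y Y h E[OF Y]] by simp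
  have d: "der_word C E Y A(Suc k):ghom C ?Z ?Z n" using der_word_in[of Y A E "Suc k",OF YAE] cyc n by simp
  have Uh: "?U = comp C ?Z ?Z ?Z(E ?Z) ?h"
  using run_left[of Y A ?Z ?Z "A 0" "Suc 0" 0 "E ?Z" 0 "Suc k",OF YA Y Y A E[OF Y]] cyc
  by(simp del:run.simps)
  have "T ?Z m(comp C ?Z ?Z ?Z ?h(E ?Z)) = T ?Z m ?U"
  using T_invariant[OF Y _ E[OF Y] h E_inv[OF Y],where m = m] unfolding Uh by simp
  moreover have "(\<Sum>i\<le>k. ?V i) = ?U-comp C ?Z ?Z ?Z ?h(E ?Z)-der_word C E Y A(Suc k)"
  using sum_commutators[of Y A E k,OF YAE] cyc by(simp del:run.simps der_word.simps)
  moreover have "?U-comp C ?Z ?Z ?Z ?h(E ?Z):ghom C ?Z ?Z n" by(rule sub_in[OF Y Y U hE])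
  ultimately show ?thesis
  by(simp add:clin_diff[OF TZ sub _ d] clin_diff[OF TZ sub U hE] del:run.simps der_word.simps)
 qed
 thus ?thesis unfolding L R by simp
qed

end

text \<open>A cyclic chain is read as a periodic sequence, so that the closing condition is
  \<open>Y(Suc k) = Y 0\<close> and the lemmas on sequences apply without a case for the
  wrap-around.\<close>

definition objseq :: "('o => 'p) => 'o list => nat => 'p" where
 "objseq Fo Xs i = Fo(cnth Xs i)"

definition morseq :: "('o => 'o => 'm => 'c) => 'o list => 'm list => nat => 'c" where
 "morseq a Xs fs i = a(cnth Xs(Suc i))(cnth Xs i)(fs!(i mod length fs))"

lemma cchain_obj: "cchain D k Xs fs ==> cnth Xs i:obj D"
 unfolding cchain_def by(metis length_greater_0_conv list.size(3) mod_less_divisor nat.distinct(1) nth_mem subsetD)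

lemma cchain_hom:
 assumes "cchain D k Xs fs"
 shows "fs!(i mod length fs):hom D(cnth Xs(Suc i))(cnth Xs i)"
proof -
 have "i mod Suc k<=k" by(simp add:less_Suc_eq_le[symmetric])
 hence "fs!(i mod Suc k):hom D(cnth Xs(Suc(i mod Suc k)))(cnth Xs(i mod Suc k))"
  using assms by(auto simp:cchain_def)
 moreover have "length Xs = Suc k" "length fs = Suc k" using assms by(auto simp:cchain_def)
 ultimately show ?thesis by(simp add:mod_Suc_eq)
qed

lemma cchain_nth:
 "cchain D k Xs fs ==> j<=k ==> fs!j:hom D(cnth Xs(Suc j))(cnth Xs j)"
 and cchain_length: "cchain D k Xs fs ==> length Xs = Suc k" "cchain D k Xs fs ==> length fs = Suc k"
 and cchain_set: "cchain D k Xs fs ==> set Xs \<subseteq> obj D"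
 unfolding cchain_def by blast+

lemma cchainI:
 "length Xs = Suc k ==> length fs = Suc k ==> set Xs \<subseteq> obj D ==>(!!j. j<=k ==> fs!j:hom D(cnth Xs(Suc j))(cnth Xs j)) ==> cchain D k Xs fs"
 unfolding cchain_def by blast

lemma cchain_update:
 assumes cc: "cchain D k Xs fs" and i: "i<=k" and f: "f:hom D(cnth Xs(Suc i))(cnth Xs i)"
 shows "cchain D k Xs(fs[i := f])"
proof(rule cchainI)
 show "fs[i := f]!j:hom D(cnth Xs(Suc j))(cnth Xs j)" if "j<=k" for j
  using cchain_nth[OF cc that] cchain_length[OF cc] f i by(cases "j = i") simp_all
qed(simp_all add: cchain_length[OF cc] cchain_set[OF cc])

section \<open>The cochain complex\<close>

lemma cnth_face:
 assumes "length Xs = Suc(Suc k)" "j<=k" "i<=Suc k"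
 shows "cnth(take(Suc j)Xs@drop(j+2)Xs)i = face_obj j(cnth Xs)i"
proof(cases "i = Suc k")
 case True
 thus ?thesis using assms by(simp add:face_obj_def nth_append)
next
 case False
 hence "i<Suc k" using assms by simp
 thus ?thesis using assms by(auto simp:face_obj_def nth_append)
qed

lemma cnth_rotate:
 assumes "length Xs = Suc k" "i<=k"
 shows "cnth(Xs!k#take k Xs)(Suc i) = cnth Xs i"
 using assms by(cases "i = k") (auto simp:nth_append)

lemma cnth_last:
 assumes "length Xs = Suc(Suc k)" "i<=k"
 shows "cnth(Xs!Suc k#take k(tl Xs))(Suc i) = cnth Xs(Suc i)"
 using assms by(cases "i = k") (auto simp:nth_tl)

locale cochain_data = hopf H for H :: "'h::complex_algebra_1 hopf" +
 fixes M :: "('h,'v::complex_vector)sayd" and D :: "('o,'m::complex_vector,'h)hsemicat"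
 assumes sayd_M: "sayd_module H M" and D: "left_H_category H D"
begin

lemma semicat: "lHsemi H D" using D by(simp add:left_H_category_def)

lemma D_subspace: "X:obj D ==> Y:obj D ==> csub(hom D X Y)"
 using semicat by(simp add:lHsemi_def)

lemma D_comp: "X:obj D ==> Y:obj D ==> Z:obj D ==> g:hom D Y Z ==> f:hom D X Y ==> comp D X Y Z g f:hom D X Z"
 using semicat by(simp add:lHsemi_def)

lemma D_comp_bilin: "X:obj D ==> Y:obj D ==> Z:obj D ==> cbil(hom D Y Z)(hom D X Y)(comp D X Y Z)"
 using semicat by(simp add:lHsemi_def)

lemma D_act: "X:obj D ==> Y:obj D ==> f:hom D X Y ==> act D X Y h f:hom D X Y"
 using semicat by(simp add:lHsemi_def)

lemma D_act_bilin: "X:obj D ==> Y:obj D ==> cbil UNIV(hom D X Y)(act D X Y)"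
 using semicat by(simp add:lHsemi_def)

lemma D_act_lin: "X:obj D ==> Y:obj D ==> f:hom D X Y ==> lin(%h. act D X Y h f)"
 using cbilD2[OF D_act_bilin] by blast

lemma cochain_zero: "\<phi>:cochains H M D k ==> ~ cchain D k Xs fs ==> \<phi> m Xs fs = 0"
 and cochain_lin_m: "\<phi>:cochains H M D k ==> cchain D k Xs fs ==> lin(%m. \<phi> m Xs fs)"
 and cochain_lin_f: "\<phi>:cochains H M D k ==> cchain D k Xs fs ==> i<=k ==> clin(hom D(cnth Xs(Suc i))(cnth Xs i))(%f. \<phi> m Xs(fs[i := f]))"
 and cochain_inv: "\<phi>:cochains H M D k ==> cchain D k Xs fs ==> tlift(%h1 h2. sw k(%ks. \<phi>(ract M m h1)Xs(act_list D Xs ks fs))(S h2))(\<Delta> h) = \<epsilon> h*\<phi> m Xs fs"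
 unfolding cochains_def by blast+

lemma act_list_chain:
 assumes cc: "cchain D k Xs fs"
 shows "cchain D k Xs(act_list D Xs ks fs)"
proof(rule cchainI)
 note len = cchain_length[OF cc]
 show "act_list D Xs ks fs!j:hom D(cnth Xs(Suc j))(cnth Xs j)" if "j<=k" for j
  using D_act[OF cchain_obj[OF cc] cchain_obj[OF cc] cchain_nth[OF cc that]] that len
  by(simp add:act_list_def del:upt_Suc)
qed(use cchain_length[OF cc] cchain_set[OF cc] in \<open>simp_all add: act_list_def\<close>)

lemma act_list_update:
 assumes "length ks = length fs" "i<length fs"
 shows "act_list D Xs(ks[i := h])fs = (act_list D Xs ks fs)[i := act D(cnth Xs(Suc i))(cnth Xs i)h(fs!i)]"
 using assms by(intro nth_equalityI) (auto simp:act_list_def nth_list_update)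

lemma cochain_mlin:
 assumes \<phi>: "\<phi>:cochains H M D k" and cc: "cchain D k Xs fs"
 shows "mlin k(%ks. \<phi> m Xs(act_list D Xs ks fs))"
proof(rule mlinI)
 fix ks :: "'h list" and i assume ks: "length ks = Suc k" and i: "i<=k"
 note X = cchain_obj[OF cc]
 note f = cchain_nth[OF cc i]
 have "lin(%h. \<phi> m Xs((act_list D Xs ks fs)[i := act D(cnth Xs(Suc i))(cnth Xs i)h(fs!i)]))"
  by(rule clin_compose[OF cochain_lin_f[OF \<phi> act_list_chain[OF cc] i] D_act_lin[OF X X f]])
  (rule D_act[OF X X f])
 thus "lin(%h. \<phi> m Xs(act_list D Xs(ks[i := h])fs))"
  using ks i cchain_length[OF cc] by(simp add:act_list_update)
qed

lemma ract_bilin: "bilin(ract M)"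
 using sayd_M by(simp add:sayd_module_def)

lemma cochain_inv_bilin:
 assumes \<phi>: "\<phi>:cochains H M D k" and cc: "cchain D k Xs fs"
 shows "bilin(%h1 h2. sw k(%ks. \<phi>(ract M m h1)Xs(act_list D Xs ks fs))(S h2))"
proof(rule bilinI)
 show "lin(%h2. sw k(%ks. \<phi>(ract M m h1)Xs(act_list D Xs ks fs))(S h2))" for h1
  by(rule lin_comp[OF lin_sw[OF cochain_mlin[OF \<phi> cc]] lin_antipode0])
 show "lin(%h1. sw k(%ks. \<phi>(ract M m h1)Xs(act_list D Xs ks fs))(S h2))" for h2
  by(rule lin_sw_fun[OF cochain_mlin[OF \<phi> cc]])
  (rule lin_comp[OF cochain_lin_m[OF \<phi> act_list_chain[OF cc]] bilinD1[OF ract_bilin]])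
qed

lemma cochains_sum:
 assumes \<phi>: "!!i. i:I ==> \<phi> i:cochains H M D k"
 shows "(%m Xs fs. \<Sum>i\<in>I. c i*\<phi> i m Xs fs):cochains H M D k"
proof -
 have "(\<Sum>i\<in>I. c i*\<phi> i m Xs fs) = 0" if "~ cchain D k Xs fs" for m Xs fs
  using cochain_zero[OF \<phi> that] by simp
 moreover have "lin(%m. \<Sum>i\<in>I. c i*\<phi> i m Xs fs)" if "cchain D k Xs fs" for Xs fs
  by(intro li cochain_lin_m[OF \<phi> that])
 moreover have "clin(hom D(cnth Xs(Suc j))(cnth Xs j))(%f. \<Sum>i\<in>I. c i*\<phi> i m Xs(fs[j := f]))"
  if "cchain D k Xs fs" "j<=k" for m Xs fs j
  by(intro li cochain_lin_f[OF \<phi> that])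
 moreover have "tlift(%h1 h2. sw k(%ks. \<Sum>i\<in>I. c i*\<phi> i(ract M m h1)Xs(act_list D Xs ks fs))(S h2))(\<Delta> h) = \<epsilon> h*(\<Sum>i\<in>I. c i*\<phi> i m Xs fs)" if cc: "cchain D k Xs fs" for m h Xs fs
 proof -
  let ?b = "%i h1 h2. sw k(%ks. \<phi> i(ract M m h1)Xs(act_list D Xs ks fs))(S h2)"
  have l: "lin(%x. c i * x)" for i by(intro li)
  have m: "mlin k(%ks. c i*\<phi> i m' Xs(act_list D Xs ks fs))" if "i:I" for i m'
  by(rule mlin_compose[OF cochain_mlin[OF \<phi>[OF that] cc] l])
  have "sw k(%ks. \<Sum>i\<in>I. c i*\<phi> i m' Xs(act_list D Xs ks fs))h' = (\<Sum>i\<in>I. c i * sw k(%ks. \<phi> i m' Xs(act_list D Xs ks fs))h')" for m' h'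
  by(subst sw_sum[OF m]) (auto intro!:sum.cong sw_lin[OF cochain_mlin[OF \<phi> cc] l,symmetric])
  moreover have "bilin(%h1 h2. c i * ?b i h1 h2)" if "i:I" for i
  using cochain_inv_bilin[OF \<phi>[OF that] cc] by(auto simp:cbil_def intro!:clin_mult_right)
  ultimately have "tlift(%h1 h2. sw k(%ks. \<Sum>i\<in>I. c i*\<phi> i(ract M m h1)Xs(act_list D Xs ks fs))(S h2))(\<Delta> h) = (\<Sum>i\<in>I. tlift(%h1 h2. c i * ?b i h1 h2)(\<Delta> h))"
  by(simp add:tlift_sum_fun)
  also have "... = (\<Sum>i\<in>I. c i*(\<epsilon> h*\<phi> i m Xs fs))"
  by(rule sum.cong) (simp_all add: tlift_mult_fun[OF cochain_inv_bilin[OF \<phi> cc]] cochain_inv[OF \<phi> cc])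
  finally show ?thesis by(simp add:sum_distrib_left mult.left_commute)
 qed
 ultimately show ?thesis unfolding cochains_def by blast
qed

lemma face_chain:
 assumes cc: "cchain D(Suc k)Xs fs" and j: "j<=k"
 shows "cchain D k(take(Suc j)Xs@drop(j+2)Xs)(take j fs@[comp D(cnth Xs(j+2))(cnth Xs(j+1))(cnth Xs j)(fs!j)(fs!Suc j)]@drop(j+2)fs)"
proof(rule cchainI)
 note len = cchain_length[OF cc]
 note X = cchain_obj[OF cc]
 show "set(take(Suc j)Xs@drop(j+2)Xs) \<subseteq> obj D"
  using cchain_set[OF cc] by(auto dest!: in_set_takeD in_set_dropD)
 fix i assume i: "i<=k"
 have c: "comp D(cnth Xs(j+2))(cnth Xs(j+1))(cnth Xs j)(fs!j)(fs!Suc j):hom D(cnth Xs(j+2))(cnth Xs j)"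
  using D_comp[OF X X X cchain_nth[OF cc,of j] cchain_nth[OF cc,of "Suc j"]] j by simp
 have e: "cnth(take(Suc j)Xs@drop(j+2)Xs)(Suc i) = face_obj j(cnth Xs)(Suc i)"
  "cnth(take(Suc j)Xs@drop(j+2)Xs)i = face_obj j(cnth Xs)i"
  using cnth_face[of Xs k j "Suc i"] cnth_face[of Xs k j i] len(1) i j by(simp_all only: Suc_le_mono le_SucI)
 consider "i<j" | "i = j" | "j<i" by linarith
 thus "(take j fs@[comp D(cnth Xs(j+2))(cnth Xs(j+1))(cnth Xs j)(fs!j)(fs!Suc j)]@drop(j+2)fs)!i:hom D(cnth(take(Suc j)Xs@drop(j+2)Xs)(Suc i))(cnth(take(Suc j)Xs@drop(j+2)Xs)i)"
  unfolding e
 proof cases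
  case 1
  thus "(take j fs@[comp D(cnth Xs(j+2))(cnth Xs(j+1))(cnth Xs j)(fs!j)(fs!Suc j)]@drop(j+2)fs)!i:hom D(face_obj j(cnth Xs)(Suc i))(face_obj j(cnth Xs)i)"
  using cchain_nth[OF cc,of i] i j len by(simp add:face_obj_def nth_append)
 next
  case 2
  thus "(take j fs@[comp D(cnth Xs(j+2))(cnth Xs(j+1))(cnth Xs j)(fs!j)(fs!Suc j)]@drop(j+2)fs)!i:hom D(face_obj j(cnth Xs)(Suc i))(face_obj j(cnth Xs)i)"
  using c i j len by(simp add:face_obj_def nth_append)
 next
  case 3
  thus "(take j fs@[comp D(cnth Xs(j+2))(cnth Xs(j+1))(cnth Xs j)(fs!j)(fs!Suc j)]@drop(j+2)fs)!i:hom D(face_obj j(cnth Xs)(Suc i))(face_obj j(cnth Xs)i)"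
  using cchain_nth[OF cc,of "Suc i"] i j len by(simp add:face_obj_def nth_append)
 qed
qed(use cchain_length[OF cc] j in simp_all)

lemma last_chain:
 assumes cc: "cchain D(Suc k)Xs fs" and g: "g:hom D(Xs!1)(Xs!Suc k)"
 shows "cchain D k(Xs!Suc k#take k(tl Xs))(g#take k(tl fs))"
proof(rule cchainI)
 note len = cchain_length[OF cc]
 have "Xs!Suc k:set Xs" using len by simp
 thus "set(Xs!Suc k#take k(tl Xs)) \<subseteq> obj D"
  using cchain_set[OF cc] by(auto dest!: in_set_takeD list.set_sel(2)[rotated])
 fix i assume i: "i<=k"
 show "(g#take k(tl fs))!i:hom D(cnth(Xs!Suc k#take k(tl Xs))(Suc i))(cnth(Xs!Suc k#take k(tl Xs))i)"
 proof(cases i)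
  case 0
  thus ?thesis using g cnth_last[of Xs k 0] len by(simp del:take_Suc)
 next
  case(Suc j)
  thus ?thesis
  using cchain_nth[OF cc,of "Suc j"] cnth_last[of Xs k j] cnth_last[of Xs k "Suc j"] len i
  by(simp add:nth_tl)
 qed
qed(use cchain_length[OF cc] in simp_all)

lemma rotate_chain:
 assumes cc: "cchain D k Xs fs" and g: "g:hom D(Xs!0)(Xs!k)"
 shows "cchain D k(Xs!k#take k Xs)(g#take k fs)"
proof(rule cchainI)
 note len = cchain_length[OF cc]
 have "Xs!k:set Xs" using len by simp
 thus "set(Xs!k#take k Xs) \<subseteq> obj D"
  using cchain_set[OF cc] by(auto dest!: in_set_takeD)
 fix i assume i: "i<=k"
 show "(g#take k fs)!i:hom D(cnth(Xs!k#take k Xs)(Suc i))(cnth(Xs!k#take k Xs)i)"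
 proof(cases i)
  case 0
  thus ?thesis using g cnth_rotate[of Xs k 0] len by simp
 next
  case(Suc j)
  thus ?thesis
  using cchain_nth[OF cc,of j] cnth_rotate[of Xs k j] cnth_rotate[of Xs k "Suc j"] len i by simp
 qed
qed(use cchain_length[OF cc] in simp_all)

lemma lin_S': "lin S'" by(rule lin_antipode_inv0)

lemma last_bilin:
 assumes \<phi>: "\<phi>:cochains H M D k" and cc: "cchain D(Suc k)Xs fs"
 shows "bilin(%a m0. \<phi> m0(Xs!Suc k#take k(tl Xs))(comp D(Xs!1)(Xs!0)(Xs!Suc k)(act D(Xs!0)(Xs!Suc k)(S' a)(fs!Suc k))(fs!0)#take k(tl fs)))"
proof -
 note len = cchain_length[OF cc]
 have X: "Xs!i:obj D" if "i<=Suc k" for i using cchain_obj[OF cc,of i] len that by simp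
 have f: "fs!Suc k:hom D(Xs!0)(Xs!Suc k)" "fs!0:hom D(Xs!1)(Xs!0)"
  using cchain_nth[OF cc,of "Suc k"] cchain_nth[OF cc,of 0] len by simp_all
 let ?c = "%a. comp D(Xs!1)(Xs!0)(Xs!Suc k)(act D(Xs!0)(Xs!Suc k)(S' a)(fs!Suc k))(fs!0)"
 have af: "act D(Xs!0)(Xs!Suc k)h(fs!Suc k):hom D(Xs!0)(Xs!Suc k)" for h
  by(rule D_act[OF X X f(1)]) simp_all
 have c: "?c a:hom D(Xs!1)(Xs!Suc k)" for a
  by(rule D_comp[OF X X X af f(2)]) simp_all
 have "lin(%h. comp D(Xs!1)(Xs!0)(Xs!Suc k)(act D(Xs!0)(Xs!Suc k)h(fs!Suc k))(fs!0))"
  by(rule clin_compose[OF cbilD2[OF D_comp_bilin f(2)] D_act_lin[OF _ _ f(1)] af]) (simp_all add: X)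
 from lin_comp[OF this lin_S'] have cl: "lin ?c" .
 have slot: "clin(hom D(Xs!1)(Xs!Suc k))(%g. \<phi> m0(Xs!Suc k#take k(tl Xs))(g#take k(tl fs)))" for m0
  using cochain_lin_f[OF \<phi> last_chain[OF cc c],where i = 0 and m = m0] cnth_last[of Xs k 0] len by simp
 show ?thesis
 proof(rule bilinI)
  show "lin(%m0. \<phi> m0(Xs!Suc k#take k(tl Xs))(?c a#take k(tl fs)))" for a
  by(rule cochain_lin_m[OF \<phi> last_chain[OF cc c]])
  show "lin(%a. \<phi> m0(Xs!Suc k#take k(tl Xs))(?c a#take k(tl fs)))" for m0
  by(rule clin_compose[OF slot cl c])
 qed
qed

lemma rotate_bilin:
 assumes \<phi>: "\<phi>:cochains H M D k" and cc: "cchain D k Xs fs"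
 shows "bilin(%a m0. \<phi> m0(Xs!k#take k Xs)(act D(Xs!0)(Xs!k)(S' a)(fs!k)#take k fs))"
proof -
 note len = cchain_length[OF cc]
 have X: "Xs!i:obj D" if "i<=k" for i using cchain_obj[OF cc,of i] len that by simp
 have f: "fs!k:hom D(Xs!0)(Xs!k)" using cchain_nth[OF cc,of k] len by simp
 have af: "act D(Xs!0)(Xs!k)h(fs!k):hom D(Xs!0)(Xs!k)" for h
  by(rule D_act[OF X X f]) simp_all
 have cl: "lin(%a. act D(Xs!0)(Xs!k)(S' a)(fs!k))"
  by(rule lin_comp[OF D_act_lin[OF X X f] lin_S']) simp_all
 have slot: "clin(hom D(Xs!0)(Xs!k))(%g. \<phi> m0(Xs!k#take k Xs)(g#take k fs))" for m0
  using cochain_lin_f[OF \<phi> rotate_chain[OF cc af],where i = 0 and m = m0] cnth_rotate[of Xs k 0] len by simp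
 show ?thesis
 proof(rule bilinI)
  show "lin(%m0. \<phi> m0(Xs!k#take k Xs)(act D(Xs!0)(Xs!k)(S' a)(fs!k)#take k fs))" for a
  by(rule cochain_lin_m[OF \<phi> rotate_chain[OF cc af]])
  show "lin(%a. \<phi> m0(Xs!k#take k Xs)(act D(Xs!0)(Xs!k)(S' a)(fs!k)#take k fs))" for m0
  by(rule clin_compose[OF slot cl af])
 qed
qed

lemma face_sum:
 assumes \<phi>: "!!i. i:I ==> \<phi> i:cochains H M D k"
 shows "face H M D(Suc k)j(%m Xs fs. \<Sum>i\<in>I. c i*\<phi> i m Xs fs)m Xs fs = (\<Sum>i\<in>I. c i * face H M D(Suc k)j(\<phi> i)m Xs fs)"
proof -
 have b: "bilin(%a m0. c i*\<phi> i m0(Xs!Suc k#take k(tl Xs))(comp D(Xs!1)(Xs!0)(Xs!Suc k)(act D(Xs!0)(Xs!Suc k)(S' a)(fs!Suc k))(fs!0)#take k(tl fs)))"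
  if "i:I" "cchain D(Suc k)Xs fs" for i
  using last_bilin[OF \<phi>[OF that(1)] that(2)] by(auto simp:cbil_def intro!:clin_mult_right)
 have "tlift(%a m0. \<Sum>i\<in>I. c i*\<phi> i m0(Xs!Suc k#take k(tl Xs))(comp D(Xs!1)(Xs!0)(Xs!Suc k)(act D(Xs!0)(Xs!Suc k)(S' a)(fs!Suc k))(fs!0)#take k(tl fs)))(coact M m) = (\<Sum>i\<in>I. c i * tlift(%a m0. \<phi> i m0(Xs!Suc k#take k(tl Xs))(comp D(Xs!1)(Xs!0)(Xs!Suc k)(act D(Xs!0)(Xs!Suc k)(S' a)(fs!Suc k))(fs!0)#take k(tl fs)))(coact M m))"
  if "cchain D(Suc k)Xs fs"
  by(subst tlift_sum_fun[OF b[OF _ that]],assumption,rule sum.cong[OF refl],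
  rule tlift_mult_fun,rule last_bilin[OF \<phi> that])
 thus ?thesis by(auto simp:face_def)
qed

lemma cyclic_op_sum:
 assumes \<phi>: "!!i. i:I ==> \<phi> i:cochains H M D k"
 shows "cyclic_op H M D k(%m Xs fs. \<Sum>i\<in>I. c i*\<phi> i m Xs fs)m Xs fs = (\<Sum>i\<in>I. c i * cyclic_op H M D k(\<phi> i)m Xs fs)"
proof -
 have b: "bilin(%a m0. c i*\<phi> i m0(Xs!k#take k Xs)(act D(Xs!0)(Xs!k)(S' a)(fs!k)#take k fs))"
  if "i:I" "cchain D k Xs fs" for i
  using rotate_bilin[OF \<phi>[OF that(1)] that(2)] by(auto simp:cbil_def intro!:clin_mult_right)
 have "tlift(%a m0. \<Sum>i\<in>I. c i*\<phi> i m0(Xs!k#take k Xs)(act D(Xs!0)(Xs!k)(S' a)(fs!k)#take k fs))(coact M m) = (\<Sum>i\<in>I. c i * tlift(%a m0. \<phi> i m0(Xs!k#take k Xs)(act D(Xs!0)(Xs!k)(S' a)(fs!k)#take k fs))(coact M m))"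
  if "cchain D k Xs fs"
  by(subst tlift_sum_fun[OF b[OF _ that]],assumption,rule sum.cong[OF refl],
  rule tlift_mult_fun,rule rotate_bilin[OF \<phi> that])
 thus ?thesis by(auto simp:cyclic_op_def)
qed

lemma cyclic_cochains_sum:
 assumes "finite I" and \<phi>: "!!i. i:I ==> \<phi> i:cyclic_cochains H M D k"
 shows "(%m Xs fs. \<Sum>i\<in>I. c i*\<phi> i m Xs fs):cyclic_cochains H M D k"
proof -
 have c: "\<phi> i:cochains H M D k" and e: "\<phi> i m Xs fs = (- 1) ^ k * cyclic_op H M D k(\<phi> i)m Xs fs" if "i:I" for i m Xs fs
  using \<phi>[OF that] unfolding cyclic_cochains_def by(auto dest:fun_cong)
 have e2: "(%m Xs fs. \<Sum>i\<in>I. c i*\<phi> i m Xs fs) = (%m Xs fs.(- 1) ^ k * cyclic_op H M D k(%m Xs fs. \<Sum>i\<in>I. c i*\<phi> i m Xs fs)m Xs fs)"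
 proof(intro ext)
  fix m Xs fs
  have "(\<Sum>i\<in>I. c i*\<phi> i m Xs fs) = (\<Sum>i\<in>I. c i*((- 1) ^ k * cyclic_op H M D k(\<phi> i)m Xs fs))"
  by(rule sum.cong) (simp_all add: e[symmetric])
  thus "(\<Sum>i\<in>I. c i*\<phi> i m Xs fs) = (- 1) ^ k * cyclic_op H M D k(%m Xs fs. \<Sum>i\<in>I. c i*\<phi> i m Xs fs)m Xs fs"
  by(subst cyclic_op_sum) (simp_all add: c sum_distrib_left mult.left_commute)
 qed
 have "(%m Xs fs. \<Sum>i\<in>I. c i*\<phi> i m Xs fs):cochains H M D k"
  by(rule cochains_sum) (rule c)
 with e2 show ?thesis unfolding cyclic_cochains_def by(intro CollectI conjI)
qed

lemma codiff_sum:
 assumes \<phi>: "!!i. i:I ==> \<phi> i:cochains H M D k"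
 shows "codiff H M D k(%m Xs fs. \<Sum>i\<in>I. c i*\<phi> i m Xs fs) = (%m Xs fs. \<Sum>i\<in>I. c i * codiff H M D k(\<phi> i)m Xs fs)"
proof(intro ext)
 fix m Xs fs
 show "codiff H M D k(%m Xs fs. \<Sum>i\<in>I. c i*\<phi> i m Xs fs)m Xs fs = (\<Sum>i\<in>I. c i * codiff H M D k(\<phi> i)m Xs fs)"
 proof -
  have f: "face H M D(Suc k)j(%m Xs fs. \<Sum>i\<in>I. c i*\<phi> i m Xs fs)m Xs fs = (\<Sum>i\<in>I. c i * face H M D(Suc k)j(\<phi> i)m Xs fs)" for j
  by(rule face_sum) (rule \<phi>)
  show ?thesis
  unfolding codiff_def Suc_eq_plus1[symmetric] f sum_distrib_left
  by(subst sum.swap) (simp add:mult.left_commute del:sum.atMost_Suc)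
 qed
qed

lemma coboundaries_sum:
 assumes "finite I" and \<phi>: "!!i. i:I ==> \<phi> i:coboundaries H M D n"
 shows "(%m Xs fs. \<Sum>i\<in>I. c i*\<phi> i m Xs fs):coboundaries H M D n"
proof(cases n)
 case 0
 thus ?thesis using \<phi> by auto
next
 case(Suc k)
 have "\<exists>\<psi>. \<psi>:cyclic_cochains H M D k&\<phi> i = codiff H M D k \<psi>" if "i:I" for i
  using \<phi>[OF that] Suc by auto
 then obtain \<psi> where \<psi>: "!!i. i:I ==> \<psi> i:cyclic_cochains H M D k" "!!i. i:I ==> \<phi> i = codiff H M D k(\<psi> i)"
  by metis
 have c: "\<psi> i:cochains H M D k" if "i:I" for i using \<psi>(1)[OF that] by(simp add:cyclic_cochains_def)
 have "(%m Xs fs. \<Sum>i\<in>I. c i*\<phi> i m Xs fs) = codiff H M D k(%m Xs fs. \<Sum>i\<in>I. c i*\<psi> i m Xs fs)"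
 proof -
  have "codiff H M D k(%m Xs fs. \<Sum>i\<in>I. c i*\<psi> i m Xs fs) = (%m Xs fs. \<Sum>i\<in>I. c i * codiff H M D k(\<psi> i)m Xs fs)"
  by(rule codiff_sum) (rule c)
  thus ?thesis by(simp add:\<psi>(2))
 qed
 thus ?thesis using cyclic_cochains_sum[OF assms(1) \<psi>(1)] Suc by simp
qed

text \<open>Needed for the rotation: a curve of characters is controlled through functionals that
  vanish on this subspace.\<close>

lemma sub_coboundaries: "csub(coboundaries H M D n)"
proof(rule csubI)
 show "0:coboundaries H M D n"
  using coboundaries_sum[of "{}" undefined n undefined] by(simp add:zero_fun_def)
next
 fix x y assume "x:coboundaries H M D n" "y:coboundaries H M D n"
 hence "(%m Xs fs. \<Sum>i\<in>UNIV. 1*(if i then x else y)m Xs fs):coboundaries H M D n"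
  by(intro coboundaries_sum) auto
 thus "x+y:coboundaries H M D n" by(simp add:UNIV_bool plus_fun_def add.commute)
next
 fix c x assume "x:coboundaries H M D n"
 hence "(%m Xs fs. \<Sum>i\<in>{0::nat}. c * x m Xs fs):coboundaries H M D n"
  by(intro coboundaries_sum) auto
 thus "c*.x:coboundaries H M D n" by(simp add:scaleC_fun_def scaleC_complex_def)
qed

end

section \<open>Cochains built from forms\<close>

locale cycle_functor = graded_trace H C M n T + cochain_data H M D
 for H :: "'h::complex_algebra_1 hopf" and C :: "('p,'c::complex_vector,'h)dghsemicat"
  and M :: "('h,'v::complex_vector)sayd" and n :: nat and T :: "'p => 'v => 'c => complex"
  and D :: "('o,'m::complex_vector,'h)hsemicat" +
 fixes Fo :: "'o => 'p" and a :: "'o => 'o => 'm => 'c"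
 assumes semifun: "Hfun D(deg0 C)Fo a"
begin

lemma rho_obj: "X:obj D ==> Fo X:obj C"
 and a_in: "X:obj D ==> Y:obj D ==> f:hom D X Y ==> a X Y f:ghom C(Fo X)(Fo Y) 0"
 and a_lin: "X:obj D ==> Y:obj D ==> clin(hom D X Y)(a X Y)"
 and a_act: "X:obj D ==> Y:obj D ==> f:hom D X Y ==> a X Y(act D X Y h f) = act C(Fo X)(Fo Y)h(a X Y f)"
 and a_comp: "X:obj D ==> Y:obj D ==> Z:obj D ==> g:hom D Y Z ==> f:hom D X Y ==> a X Z(comp D X Y Z g f) = comp C(Fo X)(Fo Y)(Fo Z)(a Y Z g)(a X Y f)"
 using semifun by(simp_all add: Hfun_def deg0_def)

lemma objseq_in: "cchain D k Xs fs ==> objseq Fo Xs i:obj C"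
 by(simp add:objseq_def rho_obj cchain_obj)

lemma morseq_in: "cchain D k Xs fs ==> morseq a Xs fs i:ghom C(objseq Fo Xs(Suc i))(objseq Fo Xs i) 0"
 unfolding objseq_def morseq_def by(intro a_in cchain_obj cchain_hom)

text \<open>The action on the arrows of a chain passes through the equivariant factors to the
  diagonal action on their product by \<open>wprod_act\<close>, so the invariance of the cochain is
  that of the trace.\<close>

lemma form_cochain:
 assumes W: "!!j X Y f. X:obj D ==> Y:obj D ==> f:hom D X Y ==> W j X Y f:ghom C(Fo X)(Fo Y)(e j)"
  and W_lin: "!!j X Y. X:obj D ==> Y:obj D ==> clin(hom D X Y)(W j X Y)"
  and W_act: "!!j X Y h f. X:obj D ==> Y:obj D ==> f:hom D X Y ==> W j X Y(act D X Y h f) = act C(Fo X)(Fo Y)h(W j X Y f)"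
  and e: "(\<Sum>j\<le>k. e j) = n"
 shows "(%m Xs fs. if cchain D k Xs fs then T(Fo(Xs!0))m(wprod C(objseq Fo Xs)(%i. W i(cnth Xs(Suc i))(cnth Xs i)(fs!i))k)else 0):cochains H M D k"
proof -
 let ?\<phi> = "%m Xs fs. if cchain D k Xs fs then T(Fo(Xs!0))m(wprod C(objseq Fo Xs)(%i. W i(cnth Xs(Suc i))(cnth Xs i)(fs!i))k)else 0"
 have "?\<phi> m Xs fs = 0" if "~ cchain D k Xs fs" for m Xs fs using that by simp
 moreover
 have "clin UNIV(%m. ?\<phi> m Xs fs)&(\<forall>m. \<forall>i\<le>k. clin(hom D(cnth Xs(Suc i))(cnth Xs i))(%f. ?\<phi> m Xs(fs[i := f])))&(\<forall>m h. tlift(%h1 h2. sw k(%ks. ?\<phi>(ract M m h1)Xs(act_list D Xs ks fs))(S h2))(\<Delta> h) = \<epsilon> h * ?\<phi> m Xs fs)"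
  if cc: "cchain D k Xs fs" for Xs fs
 proof -
  let ?Y = "objseq Fo Xs"
  let ?B = "%i. W i(cnth Xs(Suc i))(cnth Xs i)(fs!i)"
  have X: "cnth Xs i:obj D" for i by(rule cchain_obj[OF cc])
  have f: "fs!i:hom D(cnth Xs(Suc i))(cnth Xs i)" if "i<=k" for i
  using cc that unfolding cchain_def by blast
  have len: "length Xs = Suc k" "length fs = Suc k" using cc by(auto simp:cchain_def)
  have Y: "?Y i:obj C" for i by(rule objseq_in[OF cc])
  have B: "?B i:ghom C(?Y(Suc i))(?Y i)(e i)" if "i<=k" for i
  unfolding objseq_def by(rule W[OF X X f[OF that]])
  have Y0: "?Y(Suc k) = ?Y 0" "Fo(Xs!0) = ?Y 0" using len by(simp_all add: objseq_def)
  have w: "wprod C ?Y B' k:ghom C(?Y 0)(?Y 0)n"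
  if "!!i. i<=k ==> B' i:ghom C(?Y(Suc i))(?Y i)(e i)" for B'
  using wprod_in[of ?Y k B' e,OF Y that] e Y0 by simp
  have 1: "clin UNIV(%m. ?\<phi> m Xs fs)"
  using T_lin_m[OF Y w[OF B]] cc Y0 by simp
  have 2: "clin(hom D(cnth Xs(Suc i))(cnth Xs i))(%f. ?\<phi> m Xs(fs[i := f]))" if i: "i<=k" for m i
  proof(rule clin_cong)
  let ?H = "hom D(cnth Xs(Suc i))(cnth Xs i)"
  let ?G = "%f. T(?Y 0)m(wprod C ?Y(?B(i := W i(cnth Xs(Suc i))(cnth Xs i)f))k)"
  show "csub ?H" by(rule D_subspace[OF X X])
  have wl: "clin(ghom C(?Y(Suc i))(?Y i)(e i))(%x. wprod C ?Y(?B(i := x))k)"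
  by(rule wprod_lin[where e = e,OF Y _ i]) (rule B)
  have W': "W i(cnth Xs(Suc i))(cnth Xs i)f:ghom C(?Y(Suc i))(?Y i)(e i)" if "f : ?H" for f
  unfolding objseq_def by(rule W[OF X X that])
  have "clin ?H(%f. wprod C ?Y(?B(i := W i(cnth Xs(Suc i))(cnth Xs i)f))k)"
  by(rule clin_compose[OF wl W_lin[OF X X] W'])
  thus "clin ?H ?G"
  by(rule clin_compose[OF T_lin[OF Y]]) (rule w,use B W' in auto)
  show "?\<phi> m Xs(fs[i := f]) = ?G f" if "f : ?H" for f
  proof -
  have "cchain D k Xs(fs[i := f])"
  by(rule cchain_update[OF cc i that])
  moreover have "wprod C ?Y(%j. W j(cnth Xs(Suc j))(cnth Xs j)(fs[i := f]!j))k = wprod C ?Y(?B(i := W i(cnth Xs(Suc i))(cnth Xs i)f))k"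
  by(rule wprod_cong) (use len i in \<open>auto simp: nth_list_update\<close>)
  ultimately show ?thesis using Y0 by simp
  qed
  qed
  have 3: "tlift(%h1 h2. sw k(%ks. ?\<phi>(ract M m h1)Xs(act_list D Xs ks fs))(S h2))(\<Delta> h) = \<epsilon> h * ?\<phi> m Xs fs" for m h
  proof -
  let ?aB = "%ks i. act C(?Y(Suc i))(?Y i)(ks!i)(?B i)"
  have eq: "?\<phi> m' Xs(act_list D Xs ks fs) = T(?Y 0)m'(wprod C ?Y(?aB ks)k)" for m' ks
  proof -
  have "cchain D k Xs(act_list D Xs ks fs)" by(rule act_list_chain[OF cc])
  moreover have "wprod C ?Y(%j. W j(cnth Xs(Suc j))(cnth Xs j)(act_list D Xs ks fs!j))k = wprod C ?Y(?aB ks)k"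
  proof(rule wprod_cong)
  fix j assume j: "j<=k"
  have al: "act_list D Xs ks fs!j = act D(cnth Xs(Suc j))(cnth Xs j)(ks!j)(fs!j)"
  using j len by(simp add:act_list_def del:upt_Suc)
  show "W j(cnth Xs(Suc j))(cnth Xs j)(act_list D Xs ks fs!j) = ?aB ks j"
  unfolding al objseq_def by(rule W_act[OF X X f[OF j]])
  qed simp
  ultimately show ?thesis using Y0 by simp
  qed
  have aB: "wprod C ?Y(?aB ks)k:ghom C(?Y 0)(?Y 0)n" for ks
  by(rule w,rule act_in[OF Y Y B])
  have "sw k(%ks. T(?Y 0)m'(wprod C ?Y(?aB ks)k))h' = T(?Y 0)m'(act C(?Y 0)(?Y 0)h'(wprod C ?Y ?B k))" for m' h'
  using sw_clinear_on(2)[OF mlin_wprod_act[of ?Y k ?B e,OF Y B] T_lin[OF Y] sub_ghom[OF Y Y] aB,of m' h']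
  wprod_act[of ?Y k ?B e h',OF Y B] Y0 by simp
  thus ?thesis
  unfolding eq using T_inv[OF Y w[OF B],of m h] cc Y0 by simp
  qed
  show ?thesis using 1 2 3 by blast
 qed
 ultimately show ?thesis unfolding cochains_def by blast
qed

end

text \<open>The alternating signs are those that make the sum over the places of \<open>dE\<close>
  cyclic, by \<open>rotate_ins\<close>.\<close>

definition ins_cochain where
 "ins_cochain C T D Fo a E k m Xs fs = (if cchain D k Xs fs then \<Sum>i\<le>k.(- 1) ^ i * T(Fo(Xs!0))m(ins_word C E(objseq Fo Xs)(morseq a Xs fs)i k)else(0::complex))"

context graded_semicat
begin

text \<open>The Sweedler leg that meets an invariant factor turns into a counit. Hence multiplying
  by \<open>E\<close> or \<open>dE\<close> preserves equivariance.\<close>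

lemma act_comp_invariant:
 assumes X: "X:obj C" "Y:obj C" and g: "g:ghom C X Y i" and e: "e:ghom C X X j"
  and inv: "!!h. act C X X h e = \<epsilon> h*.e"
 shows "act C X Y h(comp C X X Y g e) = comp C X X Y(act C X Y h g)e"
proof -
 have l: "lin(%h. comp C X X Y(act C X Y h g)e)"
  by(rule clin_compose[OF comp_lin_left[OF X(1,1,2) e] act_lin_left[OF X g] act_in[OF X g]])
 have "act C X Y h(comp C X X Y g e) = tlift(%h1 h2. \<epsilon> h2*.comp C X X Y(act C X Y h1 g)e)(\<Delta> h)"
  by(simp add:act_comp[OF X(1,1,2) g e] inv clin_scale[OF comp_lin_right[OF X(1,1,2) act_in[OF X g]] e])
 thus ?thesis using counit2[OF l] by simp
qed

lemma diff_invariant: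
 assumes "X:obj C" "e:ghom C X X i" "act C X X h e = \<epsilon> h*.e"
 shows "act C X X h(diff C X X e) = \<epsilon> h*.diff C X X e"
 using assms by(simp add:diff_act[symmetric] clin_scale[OF diff_lin])

end

context cycle_functor
begin

lemma char_form_run:
 assumes "cchain D k Xs fs" "i<=k"
 shows "char_form C Fo a Xs fs i = run C(Fo(Xs!0))(objseq Fo Xs)(morseq a Xs fs)(morseq a Xs fs 0)(Suc 0)i"
 using assms(2)
proof(induction i)
 case 0
 thus ?case using cchain_length[OF assms(1)] by(simp add:morseq_def)
next
 case(Suc i)
 thus ?case using cchain_length[OF assms(1)] by(simp add:morseq_def objseq_def Let_def)
qed

lemma objseq_0: "cchain D k Xs fs ==> Fo(Xs!0) = objseq Fo Xs 0"
 using cchain_length[of D k Xs fs] by(simp add:objseq_def)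

context
 fixes E :: "'p => 'c" and k :: nat
 assumes E: "!!X. X:obj C ==> E X:ghom C X X 0"
  and E_inv: "!!X h. X:obj C ==> act C X X h(E X) = \<epsilon> h*.E X"
  and n: "n = Suc k"
begin

lemma ins_cochain_in: "ins_cochain C T D Fo a E k:cochains H M D k"
proof -
 let ?W = "%i j X Y f. ins_factor C E i j(Fo X)(Fo Y)(a X Y f)"
 let ?\<phi> = "%i m Xs fs. if cchain D k Xs fs then T(Fo(Xs!0))m(wprod C(objseq Fo Xs)(%j. ?W i j(cnth Xs(Suc j))(cnth Xs j)(fs!j))k)else 0"
 let ?e = "%i j.(if j = 0 then 0 else 1)+(if j = i then 1 else(0::nat))"
 have "?\<phi> i:cochains H M D k" if i: "i<=k" for i
 proof(rule form_cochain)
  fix j :: nat and X Y f assume X: "X:obj D" "Y:obj D"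
  note oX = rho_obj[OF X(1)] rho_obj[OF X(2)]
  let ?b = "%f. if j = 0 then a X Y f else diff C(Fo X)(Fo Y)(a X Y f)"
  let ?dE = "diff C(Fo X)(Fo X)(E(Fo X))"
  have dE: "?dE:ghom C(Fo X)(Fo X) 1" using diff_in[OF oX(1,1) E[OF oX(1)]] by simp
  have b: "?b f:ghom C(Fo X)(Fo Y)(if j = 0 then 0 else 1)" if "f:hom D X Y" for f
  using a_in[OF X that] diff_in[OF oX a_in[OF X that]] by simp
  have b_lin: "clin(hom D X Y) ?b"
  using a_lin[OF X] clin_compose[OF diff_lin[OF oX] a_lin[OF X] a_in[OF X]] by(cases "j = 0") simp_all
  show "clin(hom D X Y)(?W i j X Y)"
  using b_lin clin_compose[OF comp_lin_left[OF oX(1,1,2) dE] b_lin b]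
  by(cases "j = i") (simp_all add: ins_factor_def Let_def)
  assume f: "f:hom D X Y"
  show "?W i j X Y f:ghom C(Fo X)(Fo Y)(?e i j)"
  using b[OF f] comp_in[OF oX(1,1,2) b[OF f] dE] by(auto simp:ins_factor_def Let_def split: if_splits)
  fix h
  have ba: "?b(act D X Y h f) = act C(Fo X)(Fo Y)h(?b f)"
  by(simp add:a_act[OF X f] diff_act[OF oX a_in[OF X f]])
  have "act C(Fo X)(Fo Y)h(comp C(Fo X)(Fo X)(Fo Y)(?b f) ?dE) = comp C(Fo X)(Fo X)(Fo Y)(act C(Fo X)(Fo Y)h(?b f)) ?dE"
  by(rule act_comp_invariant[OF oX b[OF f] dE diff_invariant[OF oX(1) E[OF oX(1)] E_inv[OF oX(1)]]])
  thus "?W i j X Y(act D X Y h f) = act C(Fo X)(Fo Y)h(?W i j X Y f)"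
  using ba by(cases "j = i") (simp_all add: ins_factor_def Let_def)
 next
  have "(\<Sum>j\<le>k. ?e i j) = (\<Sum>j\<le>k. if j = 0 then 0 else 1)+1"
  using i by(simp add:sum.distrib)
  also have "(\<Sum>j\<le>k. if j = 0 then 0 else(1::nat)) = k"
  by(subst sum.atMost_shift) simp
  finally show "(\<Sum>j\<le>k. ?e i j) = n" by(simp add:n)
 qed
 hence "(%m Xs fs. \<Sum>i\<in>{..k}.(- 1) ^ i * ?\<phi> i m Xs fs):cochains H M D k"
  by(intro cochains_sum) simp
 moreover have "(%m Xs fs. \<Sum>i\<in>{..k}.(- 1) ^ i * ?\<phi> i m Xs fs) = ins_cochain C T D Fo a E k"
 proof(intro ext)
  fix m Xs fs
  show "(\<Sum>i\<in>{..k}.(- 1) ^ i * ?\<phi> i m Xs fs) = ins_cochain C T D Fo a E k m Xs fs"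
  proof(cases "cchain D k Xs fs")
  case True
  have "ins_word C E(objseq Fo Xs)(morseq a Xs fs)i k = wprod C(objseq Fo Xs)(%j. ?W i j(cnth Xs(Suc j))(cnth Xs j)(fs!j))k" if "i<=k" for i
  proof -
  have "ins_word C E(objseq Fo Xs)(morseq a Xs fs)i k = wprod C(objseq Fo Xs)(%j. ins_factor C E i j(objseq Fo Xs(Suc j))(objseq Fo Xs j)(morseq a Xs fs j))k"
  by(rule ins_word_wprod[where Y = "objseq Fo Xs" and A = "morseq a Xs fs" and E = E,OF objseq_in[OF True] morseq_in[OF True] E that])
  also have "... = wprod C(objseq Fo Xs)(%j. ?W i j(cnth Xs(Suc j))(cnth Xs j)(fs!j))k"
  by(rule wprod_cong) (simp_all add: morseq_def objseq_def cchain_length[OF True])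
  finally show ?thesis .
  qed
  thus ?thesis using True by(simp add:ins_cochain_def)
  qed(simp add:ins_cochain_def)
 qed
 ultimately show ?thesis by simp
qed

text \<open>The chain formed by the cyclic operator has exactly the rotated sequences
  \<open>Y'\<close> and \<open>A'\<close> that \<open>rotate_ins\<close> asks for.\<close>

lemma ins_cochain_cyclic: "ins_cochain C T D Fo a E k:cyclic_cochains H M D k"
proof -
 let ?\<psi> = "ins_cochain C T D Fo a E k"
 have "?\<psi> m Xs fs = (- 1) ^ k * cyclic_op H M D k ?\<psi> m Xs fs" for m Xs fs
 proof(cases "cchain D k Xs fs")
  case cc: True
  note len = cchain_length[OF cc]
  let ?Xs = "Xs!k#take k Xs"
  let ?fs = "%b. act D(Xs!0)(Xs!k)(S' b)(fs!k)#take k fs"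
  have X: "Xs!0:obj D" "Xs!k:obj D" using cchain_obj[OF cc,of 0] cchain_obj[OF cc,of k] len by simp_all
  have f: "fs!k:hom D(Xs!0)(Xs!k)" using cchain_nth[OF cc,of k] len by simp
  have cc': "cchain D k ?Xs(?fs b)" for b by(rule rotate_chain[OF cc D_act[OF X f]])
  have Y0: "objseq Fo Xs 0 = Fo(Xs!0)" "objseq Fo Xs k = Fo(Xs!k)" using len by(simp_all add: objseq_def)
  have "(\<Sum>i\<le>k.(- 1) ^ i * T(objseq Fo Xs 0)m(ins_word C E(objseq Fo Xs)(morseq a Xs fs)i k)) = (- 1) ^ k * tlift(%b m0. \<Sum>i\<le>k.(- 1) ^ i * T(objseq Fo Xs k)m0(ins_word C E(objseq Fo ?Xs)(morseq a ?Xs(?fs b))i k))(coact M m)"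
  proof(rule rotate_ins[where Y = "objseq Fo Xs" and A = "morseq a Xs fs" and E = E and k = k,OF objseq_in[OF cc] morseq_in[OF cc] E E_inv n])
  show "objseq Fo Xs(Suc k) = objseq Fo Xs 0" using len by(simp add:objseq_def)
  show "objseq Fo ?Xs 0 = objseq Fo Xs k" using len by(simp add:objseq_def)
  show "objseq Fo ?Xs(Suc j) = objseq Fo Xs j" if "j<=k" for j
  unfolding objseq_def cnth_rotate[OF len(1) that] ..
  show "morseq a ?Xs(?fs b) 0 = act C(objseq Fo Xs 0)(objseq Fo Xs k)(S' b)(morseq a Xs fs k)" for b
  proof -
  have "morseq a ?Xs(?fs b) 0 = a(Xs!0)(Xs!k)(act D(Xs!0)(Xs!k)(S' b)(fs!k))"
  using cnth_rotate[OF len(1),of 0] len by(simp add:morseq_def)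
  also have "... = act C(Fo(Xs!0))(Fo(Xs!k))(S' b)(a(Xs!0)(Xs!k)(fs!k))"
  by(rule a_act[OF X f])
  finally show ?thesis using len by(simp add:morseq_def objseq_def)
  qed
  show "morseq a ?Xs(?fs b)(Suc j) = morseq a Xs fs j" if "j<k" for b j
  unfolding morseq_def using cnth_rotate[OF len(1),of j] cnth_rotate[OF len(1),of "Suc j"] that len by simp
  qed
  thus ?thesis using cc cc' Y0 by(simp add:ins_cochain_def cyclic_op_def)
 qed(simp add:ins_cochain_def cyclic_op_def)
 hence "?\<psi> = (%m Xs fs.(- 1) ^ k * cyclic_op H M D k ?\<psi> m Xs fs)" by(intro ext)
 with ins_cochain_in show ?thesis unfolding cyclic_cochains_def by(intro CollectI conjI)
qed

text \<open>Every inner face of the chain is matched with \<open>face_obj\<close> and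
  \<open>face_mor\<close> of its sequences, the last face with the sequence whose first arrow is the
  twisted product; then \<open>codiff_seq\<close> applies.\<close>

lemma codiff_ins_cochain:
 "codiff H M D k(ins_cochain C T D Fo a E k)m Xs fs = (if cchain D n Xs fs then-T(Fo(Xs!0))m(der_word C E(objseq Fo Xs)(morseq a Xs fs)n)else 0)"
proof(cases "cchain D n Xs fs")
 case True
 hence cc: "cchain D(Suc k)Xs fs" by(simp add:n)
 let ?\<psi> = "ins_cochain C T D Fo a E k"
 note len = cchain_length[OF cc]
 let ?q = "Suc k"
 let ?Y = "objseq Fo Xs" and ?A = "morseq a Xs fs"
 let ?Xs = "Xs ! ?q#take k(tl Xs)"
 let ?g = "%b. comp D(Xs!1)(Xs!0)(Xs ! ?q)(act D(Xs!0)(Xs ! ?q)(S' b)(fs ! ?q))(fs!0)"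
 let ?fs = "%b. ?g b#take k(tl fs)"
 have X: "Xs!0:obj D" "Xs ! ?q:obj D" "Xs!1:obj D"
  using cchain_obj[OF cc,of 0] cchain_obj[OF cc,of ?q] cchain_obj[OF cc,of 1] len by simp_all
 have f: "fs ! ?q:hom D(Xs!0)(Xs ! ?q)" "fs!0:hom D(Xs!1)(Xs!0)"
  using cchain_nth[OF cc,of ?q] cchain_nth[OF cc,of 0] len by simp_all
 have g: "?g b:hom D(Xs!1)(Xs ! ?q)" for b by(rule D_comp[OF X(3,1,2) D_act[OF X(1,2) f(1)] f(2)])
 have cc': "cchain D k ?Xs(?fs b)" for b by(rule last_chain[OF cc g])
 have Y0: "?Y 0 = Fo(Xs!0)" "?Y ?q = Fo(Xs ! ?q)" using len by(simp_all add: objseq_def)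
 have faces: "face H M D ?q j ?\<psi> m Xs fs = (\<Sum>i\<le>k.(- 1) ^ i * T(?Y 0)m(ins_word C E(face_obj j ?Y)(face_mor C j ?Y ?A)i k))"
  if j: "j<=k" for j
 proof -
  let ?Xj = "take(Suc j)Xs@drop(j+2)Xs"
  let ?c = "comp D(cnth Xs(j+2))(cnth Xs(j+1))(cnth Xs j)(fs!j)(fs!Suc j)"
  let ?fj = "take j fs@[?c]@drop(j+2)fs"
  have ccj: "cchain D k ?Xj ?fj" by(rule face_chain[OF cc j])
  note lenj = cchain_length[OF ccj]
  have Yj: "objseq Fo ?Xj i = face_obj j ?Y i" if "i<=Suc k" for i
  unfolding objseq_def cnth_face[OF len(1) j that] by(simp add:face_obj_def)
  have Aj: "morseq a ?Xj ?fj i = face_mor C j ?Y ?A i" if i: "i<=k" for i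
  proof -
  have "morseq a ?Xj ?fj i = a(face_obj j(cnth Xs)(Suc i))(face_obj j(cnth Xs)i)(?fj!i)"
  unfolding morseq_def using cnth_face[OF len(1) j,of i] cnth_face[OF len(1) j,of "Suc i"] i lenj(2)
  by(simp only: Suc_le_mono le_SucI mod_less less_Suc_eq_le)
  also have "... = face_mor C j ?Y ?A i"
  proof -
  consider "i<j" | "i = j" | "j<i" by linarith
  thus ?thesis
  proof cases
  case 1
  thus ?thesis using i j len by(simp add:face_obj_def face_mor_def morseq_def nth_append)
  next
  case 2
  have "a(cnth Xs(j+2))(cnth Xs j) ?c = comp C(Fo(cnth Xs(j+2)))(Fo(cnth Xs(j+1)))(Fo(cnth Xs j))(a(cnth Xs(j+1))(cnth Xs j)(fs!j))(a(cnth Xs(j+2))(cnth Xs(j+1))(fs!Suc j))"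
  using cchain_nth[OF cc,of j] cchain_nth[OF cc,of "Suc j"] j
  by(intro a_comp cchain_obj[OF cc]) simp_all
  thus ?thesis using 2 i j len by(simp add:face_obj_def face_mor_def morseq_def objseq_def nth_append)
  next
  case 3
  thus ?thesis using i j len by(simp add:face_obj_def face_mor_def morseq_def nth_append)
  qed
  qed
  finally show ?thesis .
  qed
  have "ins_word C E(objseq Fo ?Xj)(morseq a ?Xj ?fj)i k = ins_word C E(face_obj j ?Y)(face_mor C j ?Y ?A)i k"
  if "i<=k" for i by(rule ins_word_cong[OF that Yj Aj])
  hence "?\<psi> m ?Xj ?fj = (\<Sum>i\<le>k.(- 1) ^ i * T(Fo(?Xj!0))m(ins_word C E(face_obj j ?Y)(face_mor C j ?Y ?A)i k))"
  using ccj by(simp only: ins_cochain_def if_True) (rule sum.cong,auto)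
  moreover have "?Xj!0 = Xs!0" using len by(simp add:nth_append)
  ultimately show ?thesis using cc j Y0 by(simp add:face_def)
 qed
 have lastf: "face H M D ?q ?q ?\<psi> m Xs fs = tlift(%b m0. \<Sum>i\<le>k.(- 1) ^ i * T(?Y ?q)m0(ins_word C E(objseq Fo ?Xs)(morseq a ?Xs(?fs b))i k))(coact M m)"
  using cc cc' Y0 by(simp add:face_def ins_cochain_def)
 have "codiff H M D k ?\<psi> m Xs fs = (\<Sum>j\<le>k.(- 1) ^ j*(\<Sum>i\<le>k.(- 1) ^ i * T(?Y 0)m(ins_word C E(face_obj j ?Y)(face_mor C j ?Y ?A)i k)))+(- 1) ^ ?q * tlift(%b m0. \<Sum>i\<le>k.(- 1) ^ i * T(?Y ?q)m0(ins_word C E(objseq Fo ?Xs)(morseq a ?Xs(?fs b))i k))(coact M m)"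
 proof -
  have "codiff H M D k ?\<psi> m Xs fs = (\<Sum>j\<le>k.(- 1) ^ j * face H M D ?q j ?\<psi> m Xs fs)+(- 1) ^ ?q * face H M D ?q ?q ?\<psi> m Xs fs"
  by(simp add:codiff_def)
  also have "(\<Sum>j\<le>k.(- 1) ^ j * face H M D ?q j ?\<psi> m Xs fs) = (\<Sum>j\<le>k.(- 1) ^ j*(\<Sum>i\<le>k.(- 1) ^ i * T(?Y 0)m(ins_word C E(face_obj j ?Y)(face_mor C j ?Y ?A)i k)))"
  by(rule sum.cong) (simp_all add: faces)
  finally show ?thesis unfolding lastf .
 qed
 also have "... = - T(?Y 0)m(der_word C E ?Y ?A ?q)"
 proof(rule codiff_seq[where Y = ?Y and A = ?A and E = E and k = k,OF objseq_in[OF cc] morseq_in[OF cc] E E_inv n])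
  show "?Y(Suc(Suc k)) = ?Y 0" using len by(simp add:objseq_def)
  show "objseq Fo ?Xs 0 = ?Y ?q" using len by(simp add:objseq_def)
  show "objseq Fo ?Xs(Suc j) = ?Y(Suc j)" if "j<=k" for j
  unfolding objseq_def cnth_last[OF len(1) that] ..
  show "morseq a ?Xs(?fs b) 0 = comp C(?Y(Suc 0))(?Y 0)(?Y ?q)(act C(?Y 0)(?Y ?q)(S' b)(?A ?q))(?A 0)" for b
  proof -
  have "morseq a ?Xs(?fs b) 0 = a(Xs!1)(Xs ! ?q)(?g b)"
  using cnth_last[OF len(1),of 0] len by(simp add:morseq_def)
  also have "... = comp C(Fo(Xs!1))(Fo(Xs!0))(Fo(Xs ! ?q))(act C(Fo(Xs!0))(Fo(Xs ! ?q))(S' b)(a(Xs!0)(Xs ! ?q)(fs ! ?q)))(a(Xs!1)(Xs!0)(fs!0))"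
  unfolding a_comp[OF X(3,1,2) D_act[OF X(1,2) f(1)] f(2)] a_act[OF X(1,2) f(1)] ..
  finally show ?thesis using len by(simp add:morseq_def objseq_def)
  qed
  show "morseq a ?Xs(?fs b)(Suc j) = ?A(Suc j)" if "j<k" for b j
  unfolding morseq_def using cnth_last[OF len(1),of j] cnth_last[OF len(1),of "Suc j"] that len
  by(simp add:nth_tl)
 qed
 finally show ?thesis using True Y0 by(simp add:n)
qed(simp add:codiff_def face_def n)

lemma der_cochain_coboundary:
 "(%m Xs fs. if cchain D n Xs fs then T(Fo(Xs!0))m(der_word C E(objseq Fo Xs)(morseq a Xs fs)n)else 0):coboundaries H M D n"
proof -
 have "codiff H M D k(ins_cochain C T D Fo a E k):coboundaries H M D n"
  using ins_cochain_cyclic by(simp add:n)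
 hence "- codiff H M D k(ins_cochain C T D Fo a E k):coboundaries H M D n"
  by(rule csub_neg[OF sub_coboundaries])
 moreover have "- codiff H M D k(ins_cochain C T D Fo a E k) = (%m Xs fs. if cchain D n Xs fs then T(Fo(Xs!0))m(der_word C E(objseq Fo Xs)(morseq a Xs fs)n)else 0)"
  by(intro ext) (simp add:codiff_ins_cochain)
 ultimately show ?thesis by simp
qed

end

end

section \<open>Curves with finite-dimensional image\<close>

text \<open>A finite sum of differentiable scalar functions times fixed vectors, carried together
  with its derivative. No topology on the vector space is involved, and linear and bilinear maps
  preserve such curves for formal reasons.\<close>

inductive smooth_curve :: "'a::complex_vector set =>(real => 'a) =>(real => 'a) => bool" for A where
 base: "v:A ==>(!!s.(q has_vector_derivative q' s)(at s)) ==> smooth_curve A(%s. q s*.v)(%s. q' s*.v)"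
| add: "smooth_curve A x x' ==> smooth_curve A y y' ==> smooth_curve A(%s. x s+y s)(%s. x' s+y' s)"

lemma smooth_curve_in:
 assumes "smooth_curve A x x'" "csub A"
 shows "x s:A" "x' s:A"
 using assms(1)
 by(induction) (simp_all add: csub_scale csub_add assms(2))

lemma smooth_curve_linear:
 assumes "smooth_curve A x x'" "csub A" "clin A f" "!!v. v:A ==> f v:B"
 shows "smooth_curve B(%s. f(x s))(%s. f(x' s))"
 using assms(1)
proof induction
 case(base v q q')
 thus ?case using smooth_curve.base[of "f v" B q q'] assms by(simp add:clin_scale[OF assms(3)])
next
 case(add x x' y y')
 thus ?case
  using smooth_curve.add[OF add.IH] smooth_curve_in[OF _ assms(2)]
  by(simp add:clin_add[OF assms(3)])
qed

lemma smooth_curve_bilinear: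
 assumes x: "smooth_curve A x x'" and y: "smooth_curve B y y'"
  and A: "csub A" and B: "csub B"
  and f: "cbil A B f" "!!v w. v:A ==> w:B ==> f v w:V"
 shows "smooth_curve V(%s. f(x s)(y s))(%s. f(x' s)(y s)+f(x s)(y' s))"
 using x
proof induction
 case v: (base v q q')
 show ?case
  using y
 proof induction
  case w: (base w p p')
  have "((%s. q s * p s)has_vector_derivative(q' s * p s+q s * p' s))(at s)" for s
  using has_vector_derivative_mult[OF v(2) w(2)] by(simp add:add.commute)
  from smooth_curve.base[OF f(2)[OF v(1) w(1)] this]
  show ?case using v(1) w(1)
  by(simp add:clin_scale[OF cbilD1[OF f(1)]] clin_scale[OF cbilD2[OF f(1)]]
  scaleC_scaleC scaleC_add_left csub_scale[OF A] mult.commute)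
 next
  case(add y y' z z')
  thus ?case
  using smooth_curve.add[OF add.IH] v(1) smooth_curve_in[OF add(1) B] smooth_curve_in[OF add(2) B]
  by(simp add:clin_add[OF cbilD1[OF f(1)]] csub_scale[OF A] algebra_simps)
 qed
next
 case(add x x' z z')
 thus ?case
  using smooth_curve.add[OF add.IH] smooth_curve_in[OF add(1) A] smooth_curve_in[OF add(2) A] smooth_curve_in[OF y B]
  by(simp add:clin_add[OF cbilD2[OF f(1)]] algebra_simps)
qed

lemma smooth_curve_complex:
 fixes x :: "real => complex"
 assumes "smooth_curve A x x'"
 shows "(x has_vector_derivative x' s)(at s)"
 using assms
proof induction
 case(base v q q')
 thus ?case by(auto simp:scaleC_complex_def intro!:derivative_eq_intros)
qed(rule has_vector_derivative_add)

text \<open>A curve moving inside a subspace up to its starting point: a functional that vanishes on the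
 subspace is constant along the curve.\<close>

lemma smooth_curve_diff_in:
 fixes x :: "real => 'a::complex_vector"
 assumes x: "smooth_curve UNIV x x'" and B: "csub B" and x': "!!s. x' s:B"
 shows "x s-x t:B"
proof -
 obtain P where P: "lin P" "!!v. P v:B" "!!v. v:B ==> P v = v"
  using sub_projection[OF B] by blast
 define w where "w = (x s-x t)-P(x s-x t)"
 have "w = 0"
 proof(rule ccontr)
  \<comment> \<open>Take a functional \<open>g\<close> with \<open>g w = 1\<close>. The map
    \<open>%v. g(v - P v)\<close> kills \<open>B\<close>, so it is constant along the curve and its
    increment, which is \<open>g w\<close>, would be 0.\<close>
  assume w: "w~=0"
  interpret vs: vector_space_pair "scaleC :: complex => 'a => 'a" "scaleC :: complex => complex => complex" ..
  have "complex_vector.independent {w}" using w by(simp add:complex_vector.dependent_single)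
  from vs.linear_independent_extend[OF this,of "%_. 1"] obtain g where
  g: "Vector_Spaces.linear scaleC scaleC g" "g w = (1::complex)" by auto
  have g': "lin g" using g(1) by(simp add:clin_def vs.linear_add vs.linear_scale)
  have Q: "lin(%v. v-P v)" by(intro li P(1))
  have l: "lin(%v. g(v-P v))" by(rule lin_comp[OF g' Q])
  have "smooth_curve UNIV(%s. g(x s-P(x s)))(%s. g(x' s-P(x' s)))"
  by(rule smooth_curve_linear[OF x _ l]) simp_all
  from smooth_curve_complex[OF this]
  have "((%s. g(x s-P(x s)))has_vector_derivative 0)(at u)" for u
  using clin_zero[OF g'] by(simp add:P(3) x')
  hence "((%s. g(x s-P(x s)))has_derivative(%h. 0))(at u)" for u
  by(simp add:has_vector_derivative_def)
  then obtain c where c: "!!u. g(x u-P(x u)) = c"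
  using has_derivative_zero_constant[of UNIV "%s. g(x s-P(x s))"] by auto
  have "w = (x s-P(x s))-(x t-P(x t))"
  unfolding w_def using clin_diff[OF P(1),of "x s" "x t"] by simp
  hence "g w = c-c"
  using clin_diff[OF g',of "x s-P(x s)" "x t-P(x t)"] c by simp
  thus False using g(2) by simp
 qed
 hence "x s-x t = P(x s-x t)" by(simp add:w_def)
 thus ?thesis using P(2)[of "x s-x t"] by simp
qed

lemma semifunctor_degree_zeroI:
 assumes "!!X. X:obj D ==> Fo X:obj C"
  and "!!X Y f. X:obj D ==> Y:obj D ==> f:hom D X Y ==> Fa X Y f:ghom C(Fo X)(Fo Y) 0"
  and "!!X Y. X:obj D ==> Y:obj D ==> clin(hom D X Y)(Fa X Y)"
  and "!!X Y h f. X:obj D ==> Y:obj D ==> f:hom D X Y ==> Fa X Y(act D X Y h f) = act C(Fo X)(Fo Y)h(Fa X Y f)"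
  and "!!X Y Z g f. X:obj D ==> Y:obj D ==> Z:obj D ==> g:hom D Y Z ==> f:hom D X Y ==> Fa X Z(comp D X Y Z g f) = comp C(Fo X)(Fo Y)(Fo Z)(Fa Y Z g)(Fa X Y f)"
 shows "Hfun D(deg0 C)Fo Fa"
 using assms by(simp add:Hfun_def deg0_def)

lemma smooth_curve_cong:
 "smooth_curve A x x' ==>(!!s. x s = y s) ==>(!!s. x' s = y' s) ==> smooth_curve A y y'"
 by(metis ext)

section \<open>Rotating one semifunctor into another\<close>

lemma bilinear_expand3:
 assumes f: "cbil A B f" and A: "csub A" and B: "csub B"
  and x: "x1:A" "x2:A" "x3:A" and y: "y1:B" "y2:B" "y3:B"
 shows "f(a1*.x1+a2*.x2+a3*.x3)(b1*.y1+b2*.y2+b3*.y3) = (a1 * b1)*.f x1 y1+(a1 * b2)*.f x1 y2+(a1 * b3)*.f x1 y3+(a2 * b1)*.f x2 y1+(a2 * b2)*.f x2 y2+(a2 * b3)*.f x2 y3+(a3 * b1)*.f x3 y1+(a3 * b2)*.f x3 y2+(a3 * b3)*.f x3 y3"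
proof -
 have y': "b1*.y1+b2*.y2+b3*.y3:B"
  using y by(intro csub_add[OF B] csub_scale[OF B])
 have l: "f(a1*.x1+a2*.x2+a3*.x3)y = a1*.f x1 y+a2*.f x2 y+a3*.f x3 y" if "y:B" for y
  using clin_add[OF cbilD2[OF f that]] clin_scale[OF cbilD2[OF f that]] x
  by(simp add:csub_add[OF A] csub_scale[OF A])
 have r: "f x(b1*.y1+b2*.y2+b3*.y3) = b1*.f x y1+b2*.f x y2+b3*.f x y3" if "x:A" for x
  using clin_add[OF cbilD1[OF f that]] clin_scale[OF cbilD1[OF f that]] y
  by(simp add:csub_add[OF B] csub_scale[OF B])
 show ?thesis
  unfolding l[OF y'] r[OF x(1)] r[OF x(2)] r[OF x(3)]
  by(simp add:scaleC_add_right scaleC_scaleC add.assoc)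
qed

text \<open>To be used with \<open>cos^2\<close>, \<open>sin^2\<close> and \<open>sin cos\<close>
  for \<open>c\<close>, \<open>s\<close> and \<open>cs\<close>, and with \<open>u\<close>,
  \<open>v\<close> the products of \<open>Q\<close> and \<open>P\<close> with \<open>E\<close> on
  the right. The left side is the nine-term product of two values of the rotation.\<close>

lemma rotation_identity:
 fixes p q u v :: "'a::complex_vector" and c s cs :: complex
 assumes "c+s = 1" "cs * cs = c * s"
 shows "(c * c)*.p+(c * s)*.0+(c * cs) *.(- v)+(s * c)*.0+(s * s)*.q+(s * cs)*.u+(cs * c)*.u+(cs * s) *.(- v)+(cs * cs) *.(p+q) = c*.p+s*.q+cs *.(u-v)"
proof -
 have "c * c+cs * cs = (c+s) * c" "s * s+cs * cs = (c+s) * s"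
  "s * cs+cs * c = (c+s) * cs" "c * cs+cs * s = (c+s) * cs"
  unfolding assms(2) by(simp_all add: algebra_simps)
 hence e: "c * c+cs * cs = c" "s * s+cs * cs = s" "s * cs+cs * c = cs" "c * cs+cs * s = cs"
  using assms(1) by simp_all
 have "(c * c)*.p+(c * s)*.0+(c * cs) *.(- v)+(s * c)*.0+(s * s)*.q+(s * cs)*.u+(cs * c)*.u+(cs * s) *.(- v)+(cs * cs) *.(p+q) = (c * c+cs * cs)*.p+(s * s+cs * cs)*.q+((s * cs+cs * c)*.u-(c * cs+cs * s)*.v)"
  by(simp add:scaleC_add_left scaleC_add_right scale_simps algebra_simps)
 thus ?thesis unfolding e by(simp add:cscale_right_diff_distrib)
qed

locale rotation = graded_trace H C M n T + cochain_data H M D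
 for H :: "'h::complex_algebra_1 hopf" and C :: "('p,'c::complex_vector,'h)dghsemicat"
  and M :: "('h,'v::complex_vector)sayd" and n :: nat and T :: "'p => 'v => 'c => complex"
  and D :: "('o,'m::complex_vector,'h)hsemicat" +
 fixes Fo :: "'o => 'p" and P Q :: "'o => 'o => 'm => 'c" and E :: "'p => 'c"
 assumes P: "Hfun D(deg0 C)Fo P" and Q: "Hfun D(deg0 C)Fo Q"
  and E: "!!X. X:obj C ==> E X:ghom C X X 0"
  and E_inv: "!!X h. X:obj C ==> act C X X h(E X) = \<epsilon> h*.E X"
  and EP: "!!X Y f. X:obj D ==> Y:obj D ==> f:hom D X Y ==> comp C(Fo X)(Fo Y)(Fo Y)(E(Fo Y))(P X Y f) = comp C(Fo X)(Fo X)(Fo Y)(Q X Y f)(E(Fo X))"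
  and EQ: "!!X Y f. X:obj D ==> Y:obj D ==> f:hom D X Y ==> comp C(Fo X)(Fo Y)(Fo Y)(E(Fo Y))(Q X Y f) = comp C(Fo X)(Fo X)(Fo Y)(P X Y f)(E(Fo X))"
  and EEP: "!!X Y f. X:obj D ==> Y:obj D ==> f:hom D X Y ==> comp C(Fo X)(Fo Y)(Fo Y)(E(Fo Y))(comp C(Fo X)(Fo Y)(Fo Y)(E(Fo Y))(P X Y f)) = - P X Y f"
  and EEQ: "!!X Y f. X:obj D ==> Y:obj D ==> f:hom D X Y ==> comp C(Fo X)(Fo Y)(Fo Y)(E(Fo Y))(comp C(Fo X)(Fo Y)(Fo Y)(E(Fo Y))(Q X Y f)) = - Q X Y f"
  and PQ: "!!X Y Z g f. X:obj D ==> Y:obj D ==> Z:obj D ==> g:hom D Y Z ==> f:hom D X Y ==> comp C(Fo X)(Fo Y)(Fo Z)(P Y Z g)(Q X Y f) = 0"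
  and QP: "!!X Y Z g f. X:obj D ==> Y:obj D ==> Z:obj D ==> g:hom D Y Z ==> f:hom D X Y ==> comp C(Fo X)(Fo Y)(Fo Z)(Q Y Z g)(P X Y f) = 0"
begin

sublocale P: cycle_functor H C M n T D Fo P by unfold_locales(rule P)
sublocale Q: cycle_functor H C M n T D Fo Q by unfold_locales(rule Q)

abbreviation(input) eR :: "'o => 'o => 'c => 'c" where "eR X Y x == comp C(Fo X)(Fo X)(Fo Y)x(E(Fo X))"
abbreviation(input) eL :: "'o => 'o => 'c => 'c" where "eL X Y x == comp C(Fo X)(Fo Y)(Fo Y)(E(Fo Y))x"
abbreviation(input) cc :: "'o => 'o => 'o => 'c => 'c => 'c" where "cc X Y Z == comp C(Fo X)(Fo Y)(Fo Z)"
abbreviation(input) G0 :: "'o => 'o => 'c set" where "G0 X Y == ghom C(Fo X)(Fo Y) 0"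

definition R :: "'o => 'o => 'm => 'c" where "R X Y f = eR X Y(Q X Y f)-eR X Y(P X Y f)"

lemma G0_sub: "X:obj D ==> Y:obj D ==> csub(G0 X Y)"
 by(intro sub_ghom P.rho_obj)

lemma cc_in: "X:obj D ==> Y:obj D ==> Z:obj D ==> g:G0 Y Z ==> f:G0 X Y ==> cc X Y Z g f:G0 X Z"
 using comp_in[of "Fo X" "Fo Y" "Fo Z" g 0 f 0] P.rho_obj by simp

lemma cc_assoc: "W:obj D ==> X:obj D ==> Y:obj D ==> Z:obj D ==> g:G0 Y Z ==> f:G0 X Y ==> e:G0 W X ==> cc W X Z(cc X Y Z g f)e = cc W Y Z g(cc W X Y f e)"
 by(rule comp_assoc) (auto intro:P.rho_obj)

lemma cc_bilin: "X:obj D ==> Y:obj D ==> Z:obj D ==> cbil(G0 Y Z)(G0 X Y)(cc X Y Z)"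
 by(intro comp_bilin P.rho_obj)

lemma E_G0: "X:obj D ==> E(Fo X):G0 X X"
 by(intro E P.rho_obj)

lemma eR_in: "X:obj D ==> Y:obj D ==> x:G0 X Y ==> eR X Y x:G0 X Y"
 and eL_in: "X:obj D ==> Y:obj D ==> x:G0 X Y ==> eL X Y x:G0 X Y"
 by(rule cc_in; assumption?; rule E_G0; assumption)+

lemma eR_lin: "X:obj D ==> Y:obj D ==> clin(G0 X Y)(eR X Y)"
 and eL_lin: "X:obj D ==> Y:obj D ==> clin(G0 X Y)(eL X Y)"
 using cbilD2[OF cc_bilin E_G0] cbilD1[OF cc_bilin E_G0] by blast+

lemma R_in: "X:obj D ==> Y:obj D ==> f:hom D X Y ==> R X Y f:G0 X Y"
 unfolding R_def by(intro csub_diff[OF G0_sub] eR_in P.a_in Q.a_in)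

lemma PEE:
 assumes X: "X:obj D" "Y:obj D" and f: "f:hom D X Y"
 shows "eR X Y(eR X Y(P X Y f)) = - P X Y f" "eR X Y(eR X Y(Q X Y f)) = - Q X Y f"
 using EEP[OF X f] EEQ[OF X f]
  cc_assoc[OF X(1) X(1) X(2) X(2) E_G0[OF X(2)] P.a_in[OF X f] E_G0[OF X(1)]]
  cc_assoc[OF X(1) X(1) X(2) X(2) E_G0[OF X(2)] Q.a_in[OF X f] E_G0[OF X(1)]]
 by(simp_all add: EP[OF X f] EQ[OF X f])

text \<open>This is \<open>(cos s + sin s E) P (cos s - sin s E)\<close>, multiplied out by means of
  \<open>E P = Q E\<close> and \<open>E E = -1\<close>; in this form it does not mention a
  unit.\<close>

definition rot :: "real => 'o => 'o => 'm => 'c" where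
 "rot s X Y f = complex_of_real(cos s * cos s)*.P X Y f+complex_of_real(sin s * sin s)*.Q X Y f+complex_of_real(sin s * cos s)*.R X Y f"

text \<open>Since \<open>P\<close> and \<open>Q\<close> are orthogonal and \<open>E\<close> moves
  through them, each of the nine products reduces to \<open>P\<close>, \<open>Q\<close> or one of
  these times \<open>E\<close>, all evaluated at the composite; the identity for
  \<open>cos^2 + sin^2\<close> does the rest.\<close>

lemma rot_comp:
 assumes X: "X:obj D" "Y:obj D" "Z:obj D" and g: "g:hom D Y Z" and f: "f:hom D X Y"
 shows "rot s X Z(comp D X Y Z g f) = cc X Y Z(rot s Y Z g)(rot s X Y f)"
proof -
 let ?gf = "comp D X Y Z g f"
 let ?p = "P X Z ?gf" and ?q = "Q X Z ?gf"
 note XY = X(1,2) and YZ = X(2,3) and XZ = X(1,3)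
 have in': "P X Y f:G0 X Y" "Q X Y f:G0 X Y" "P Y Z g:G0 Y Z" "Q Y Z g:G0 Y Z" "R X Y f:G0 X Y" "R Y Z g:G0 Y Z"
  by(intro P.a_in Q.a_in R_in X g f)+
 note Ein = E_G0[OF X(1)] E_G0[OF X(2)]
 have gf: "?gf:hom D X Z" by(rule D_comp[OF X g f])
 have r: "cc X Y Z x(R X Y f) = eR X Z(cc X Y Z x(Q X Y f))-eR X Z(cc X Y Z x(P X Y f))" if x: "x:G0 Y Z" for x
  unfolding R_def cc_assoc[OF X(1,1,2,3) x in'(2) Ein(1)] cc_assoc[OF X(1,1,2,3) x in'(1) Ein(1)]
  by(rule clin_diff[OF cbilD1[OF cc_bilin[OF X] x] G0_sub[OF XY] eR_in[OF XY in'(2)] eR_in[OF XY in'(1)]])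
 have l: "cc X Y Z(R Y Z g)x = cc X Y Z(Q Y Z g)(eL X Y x)-cc X Y Z(P Y Z g)(eL X Y x)" if x: "x:G0 X Y" for x
  unfolding R_def cc_assoc[OF X(1,2,2,3) in'(4) Ein(2) x,symmetric] cc_assoc[OF X(1,2,2,3) in'(3) Ein(2) x,symmetric]
  by(rule clin_diff[OF cbilD2[OF cc_bilin[OF X] x] G0_sub[OF YZ] eR_in[OF YZ in'(4)] eR_in[OF YZ in'(3)]])
 have eR0: "eR X Z 0 = 0" by(rule clin_zero[OF eR_lin[OF XZ] G0_sub[OF XZ]])
 have PP: "cc X Y Z(P Y Z g)(P X Y f) = ?p" and QQ: "cc X Y Z(Q Y Z g)(Q X Y f) = ?q"
  using P.a_comp[OF X g f] Q.a_comp[OF X g f] by simp_all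
 have PR: "cc X Y Z(P Y Z g)(R X Y f) = - eR X Z ?p"
  using r[OF in'(3)] PP PQ[OF X g f] eR0 by simp
 have QR: "cc X Y Z(Q Y Z g)(R X Y f) = eR X Z ?q"
  using r[OF in'(4)] QQ QP[OF X g f] eR0 by simp
 have asPE: "cc X Y Z(P Y Z g)(eR X Y(P X Y f)) = eR X Z ?p" "cc X Y Z(Q Y Z g)(eR X Y(Q X Y f)) = eR X Z ?q"
  "cc X Y Z(P Y Z g)(eR X Y(Q X Y f)) = 0" "cc X Y Z(Q Y Z g)(eR X Y(P X Y f)) = 0"
  using cc_assoc[OF X(1,1,2,3) in'(3) in'(1) Ein(1)] cc_assoc[OF X(1,1,2,3) in'(4) in'(2) Ein(1)]
  cc_assoc[OF X(1,1,2,3) in'(3) in'(2) Ein(1)] cc_assoc[OF X(1,1,2,3) in'(4) in'(1) Ein(1)]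
  by(simp_all add: PP QQ PQ[OF X g f] QP[OF X g f] eR0)
 have RP: "cc X Y Z(R Y Z g)(P X Y f) = eR X Z ?q"
  using l[OF in'(1)] EP[OF XY f] asPE by simp
 have RQ: "cc X Y Z(R Y Z g)(Q X Y f) = - eR X Z ?p"
  using l[OF in'(2)] EQ[OF XY f] asPE by simp
 have RR: "cc X Y Z(R Y Z g)(R X Y f) = ?p + ?q"
 proof -
  have "eR X Z(- eR X Z ?p) = ?p"
  using clin_minus[OF eR_lin[OF XZ] eR_in[OF XZ P.a_in[OF XZ gf]]] PEE(1)[OF XZ gf] by simp
  thus ?thesis
  using r[OF in'(6)] RP RQ PEE[OF XZ gf] by simp
 qed
 let ?c = "complex_of_real(cos s * cos s)" and ?s = "complex_of_real(sin s * sin s)" and ?cs = "complex_of_real(sin s * cos s)"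
 have "cc X Y Z(rot s Y Z g)(rot s X Y f) = (?c * ?c) *. ?p+(?c * ?s)*.0+(?c * ?cs) *.(- eR X Z ?p)+(?s * ?c)*.0+(?s * ?s) *. ?q+(?s * ?cs)*.eR X Z ?q+(?cs * ?c)*.eR X Z ?q+(?cs * ?s) *.(- eR X Z ?p)+(?cs * ?cs) *.(?p + ?q)"
  unfolding rot_def bilinear_expand3[OF cc_bilin[OF X] G0_sub[OF YZ] G0_sub[OF XY] in'(3,4,6) in'(1,2,5)]
  by(simp only: PP QQ PQ[OF X g f] QP[OF X g f] PR QR RP RQ RR)
 also have "... = ?c *. ?p + ?s *. ?q + ?cs *.(eR X Z ?q-eR X Z ?p)"
 proof(rule rotation_identity)
  have "cos s * cos s+sin s * sin s = 1" using sin_cos_squared_add3[of s] by simp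
  thus "?c + ?s = 1" by(metis of_real_1 of_real_add)
  show "?cs * ?cs = ?c * ?s" by simp
 qed
 also have "... = rot s X Z ?gf" by(simp add:rot_def R_def)
 finally show ?thesis ..
qed

lemma rot_semifunctor: "Hfun D(deg0 C)Fo(rot s)"
proof(rule semifunctor_degree_zeroI)
 show "Fo X:obj C" if "X:obj D" for X by(rule P.rho_obj[OF that])
 fix X Y assume X: "X:obj D" "Y:obj D"
 note oX = P.rho_obj[OF X(1)] P.rho_obj[OF X(2)]
 show "rot s X Y f:G0 X Y" if "f:hom D X Y" for f
  unfolding rot_def using that
  by(intro csub_add[OF G0_sub] csub_scale[OF G0_sub] P.a_in Q.a_in R_in X)
 have "clin(hom D X Y)(R X Y)"
  unfolding R_def using clin_compose[OF eR_lin[OF X] P.a_lin[OF X] P.a_in[OF X]] clin_compose[OF eR_lin[OF X] Q.a_lin[OF X] Q.a_in[OF X]]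
  by(intro clin_minus_fun)
 thus "clin(hom D X Y)(rot s X Y)"
  unfolding rot_def by(intro li P.a_lin Q.a_lin X)
 show "rot s X Y(act D X Y h f) = act C(Fo X)(Fo Y)h(rot s X Y f)" if f: "f:hom D X Y" for h f
 proof -
  note l = act_lin_right[OF oX,of 0 h]
  note in' = P.a_in[OF X f] Q.a_in[OF X f] R_in[OF X f]
  note sc = csub_scale[OF G0_sub[OF X]]
  have "R X Y(act D X Y h f) = act C(Fo X)(Fo Y)h(R X Y f)"
  unfolding R_def P.a_act[OF X f] Q.a_act[OF X f] clin_diff[OF l G0_sub[OF X] eR_in[OF X in'(2)] eR_in[OF X in'(1)]]
  act_comp_invariant[OF oX in'(1) E[OF oX(1)] E_inv[OF oX(1)]] act_comp_invariant[OF oX in'(2) E[OF oX(1)] E_inv[OF oX(1)]] ..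
  thus ?thesis
  unfolding rot_def clin_add[OF l csub_add[OF G0_sub[OF X] sc[OF in'(1)] sc[OF in'(2)]] sc[OF in'(3)]]
  clin_add[OF l sc[OF in'(1)] sc[OF in'(2)]] clin_scale[OF l in'(1)] clin_scale[OF l in'(2)]
  clin_scale[OF l in'(3)] P.a_act[OF X f] Q.a_act[OF X f] by simp
 qed
qed(rule rot_comp)

lemma cycle_functor_rot: "cycle_functor H C M n T D Fo(rot s)"
 by unfold_locales(rule rot_semifunctor)

text \<open>Along the rotation the derivative is the inner derivation by \<open>E\<close>.\<close>

lemma rot_commutator:
 assumes X: "X:obj D" "Y:obj D" and f: "f:hom D X Y"
 shows "eL X Y(rot s X Y f)-eR X Y(rot s X Y f) = complex_of_real(- (2 * sin s * cos s))*.P X Y f+complex_of_real(2 * sin s * cos s)*.Q X Y f+complex_of_real(cos s * cos s-sin s * sin s)*.R X Y f"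
proof -
 note in' = P.a_in[OF X f] Q.a_in[OF X f] R_in[OF X f]
 note sc = csub_scale[OF G0_sub[OF X]]
 let ?p = "P X Y f" and ?q = "Q X Y f"
 have lin3: "g(a1 *. ?p+a2 *. ?q+a3*.R X Y f) = a1*.g ?p+a2*.g ?q+a3*.g(R X Y f)"
  if l: "clin(G0 X Y)g" for g :: "'c => 'c" and a1 a2 a3
  unfolding clin_add[OF l csub_add[OF G0_sub[OF X] sc[OF in'(1)] sc[OF in'(2)]] sc[OF in'(3)]]
  clin_add[OF l sc[OF in'(1)] sc[OF in'(2)]] clin_scale[OF l in'(1)] clin_scale[OF l in'(2)]
  clin_scale[OF l in'(3)] ..
 have eRR: "eR X Y(R X Y f) = ?p - ?q"
  unfolding R_def clin_diff[OF eR_lin[OF X] G0_sub[OF X] eR_in[OF X in'(2)] eR_in[OF X in'(1)]] PEE[OF X f] by simp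
 have eLR: "eL X Y(R X Y f) = ?q - ?p"
  unfolding R_def EP[OF X f,symmetric] EQ[OF X f,symmetric]
  clin_diff[OF eL_lin[OF X] G0_sub[OF X] eL_in[OF X in'(1)] eL_in[OF X in'(2)]] EEP[OF X f] EEQ[OF X f] by simp
 let ?c = "complex_of_real(cos s * cos s)" and ?s = "complex_of_real(sin s * sin s)" and ?cs = "complex_of_real(sin s * cos s)"
 have "eL X Y(rot s X Y f)-eR X Y(rot s X Y f) = (?c*.eR X Y ?q + ?s*.eR X Y ?p + ?cs *.(?q - ?p))-(?c*.eR X Y ?p + ?s*.eR X Y ?q + ?cs *.(?p - ?q))"
  unfolding rot_def lin3[OF eL_lin[OF X]] lin3[OF eR_lin[OF X]] eRR eLR EP[OF X f] EQ[OF X f] ..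
 also have "... = (- (?cs + ?cs)) *. ?p+(?cs + ?cs) *. ?q+(?c - ?s) *.(eR X Y ?q-eR X Y ?p)"
  by(simp only: scaleC_add_left cscale_minus_left cscale_left_diff_distrib cscale_right_diff_distrib)
  (simp add:algebra_simps)
 finally show ?thesis by(simp add:R_def mult_ac)
qed

text \<open>Being a coboundary concerns a cochain as a whole, so the curve must run in one vector
  space that holds the forms of all chains at once. The value 0 off chains matches the convention
  for cochains.\<close>

definition fam :: "('o list => 'p) =>('o list => 'p) => nat =>('o list => 'm list => 'c)set" where
 "fam src tgt d = {g. \<forall>Xs fs.(cchain D n Xs fs-->g Xs fs:ghom C(src Xs)(tgt Xs)d)&(~ cchain D n Xs fs-->g Xs fs = 0)}"

abbreviation(input) ob :: "nat => 'o list => 'p" where "ob i == %Xs. objseq Fo Xs i"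

lemma fam_subspace: "csub(fam(ob i)(ob j)d)"
proof(rule csubI)
 show "0:fam(ob i)(ob j)d"
  by(simp add:fam_def zero_in P.objseq_in)
 show "x+y:fam(ob i)(ob j)d" if "x:fam(ob i)(ob j)d" "y:fam(ob i)(ob j)d" for x y
  using that by(simp add:fam_def add_in P.objseq_in)
 show "c*.x:fam(ob i)(ob j)d" if "x:fam(ob i)(ob j)d" for c x
  using that by(simp add:fam_def scale_in P.objseq_in scaleC_fun_def cscale_zero_right)
qed

lemma fam_I:
 "(!!Xs fs. cchain D n Xs fs ==> g Xs fs:ghom C(ob i Xs)(ob j Xs)d) ==>(%Xs fs. if cchain D n Xs fs then g Xs fs else 0):fam(ob i)(ob j)d"
 by(simp add:fam_def)

lemma fam_D: "g:fam(ob i)(ob j)d ==> cchain D n Xs fs ==> g Xs fs:ghom C(ob i Xs)(ob j Xs)d"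
 by(simp add:fam_def)

lemma fam_ev: "clin(fam(ob i)(ob j)d)(%g. g Xs fs)"
 by(simp add:clin_def scaleC_fun_apply)

lemma curve_mor:
 "smooth_curve(fam(ob(Suc i))(ob i) 0)(%s Xs fs. if cchain D n Xs fs then morseq(rot s)Xs fs i else 0)(%s Xs fs. if cchain D n Xs fs then inner_der C E(objseq Fo Xs)(morseq(rot s)Xs fs)i else 0)"
proof -
 let ?V = "fam(ob(Suc i))(ob i) 0"
 let ?f = "%B Xs fs. if cchain D n Xs fs then morseq B Xs fs i else 0"
 let ?c = "%s. complex_of_real(cos s * cos s)" and ?s = "%s. complex_of_real(sin s * sin s)" and ?cs = "%s. complex_of_real(sin s * cos s)"
 have PV: "?f P : ?V" by(rule fam_I[OF P.morseq_in])
 have QV: "?f Q : ?V" by(rule fam_I[OF Q.morseq_in])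
 have RV: "?f R : ?V"
  by(rule fam_I) (simp add:morseq_def objseq_def R_in cchain_obj cchain_hom)
 have d: "(?c has_vector_derivative complex_of_real(- (2 * sin s * cos s)))(at s)"
  "(?s has_vector_derivative complex_of_real(2 * sin s * cos s))(at s)"
  "(?cs has_vector_derivative complex_of_real(cos s * cos s-sin s * sin s))(at s)" for s
  by(rule has_vector_derivative_of_real; auto intro!:derivative_eq_intros simp:algebra_simps)+
 have "smooth_curve ?V(%s. ?c s *. ?f P + ?s s *. ?f Q + ?cs s *. ?f R)(%s. complex_of_real(- (2 * sin s * cos s)) *. ?f P+complex_of_real(2 * sin s * cos s) *. ?f Q+complex_of_real(cos s * cos s-sin s * sin s) *. ?f R)"
  by(intro smooth_curve.add smooth_curve.base PV QV RV d)
 moreover have "?c s *. ?f P + ?s s *. ?f Q + ?cs s *. ?f R = ?f(rot s)" for s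
  by(intro ext) (simp add:scaleC_fun_def morseq_def rot_def cscale_zero_right)
 moreover have "complex_of_real(- (2 * sin s * cos s)) *. ?f P+complex_of_real(2 * sin s * cos s) *. ?f Q+complex_of_real(cos s * cos s-sin s * sin s) *. ?f R = (%Xs fs. if cchain D n Xs fs then inner_der C E(objseq Fo Xs)(morseq(rot s)Xs fs)i else 0)" for s
 proof(intro ext)
  fix Xs fs
  show "(complex_of_real(- (2 * sin s * cos s)) *. ?f P+complex_of_real(2 * sin s * cos s) *. ?f Q+complex_of_real(cos s * cos s-sin s * sin s) *. ?f R)Xs fs = (if cchain D n Xs fs then inner_der C E(objseq Fo Xs)(morseq(rot s)Xs fs)i else 0)"
  proof(cases "cchain D n Xs fs")
  case True
  have "eL(cnth Xs(Suc i))(cnth Xs i)(rot s(cnth Xs(Suc i))(cnth Xs i)(fs!(i mod length fs)))-eR(cnth Xs(Suc i))(cnth Xs i)(rot s(cnth Xs(Suc i))(cnth Xs i)(fs!(i mod length fs))) = complex_of_real(- (2 * sin s * cos s))*.P(cnth Xs(Suc i))(cnth Xs i)(fs!(i mod length fs))+complex_of_real(2 * sin s * cos s)*.Q(cnth Xs(Suc i))(cnth Xs i)(fs!(i mod length fs))+complex_of_real(cos s * cos s-sin s * sin s)*.R(cnth Xs(Suc i))(cnth Xs i)(fs!(i mod length fs))"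
  by(rule rot_commutator[OF cchain_obj[OF True] cchain_obj[OF True] cchain_hom[OF True]])
  thus ?thesis
  using True by(simp only: scaleC_fun_def inner_der_def morseq_def objseq_def plus_fun_def if_True)
  qed(simp add:scaleC_fun_def cscale_zero_right)
 qed
 ultimately show ?thesis by simp
qed

text \<open>The product rule reproduces the recursion of \<open>der_word\<close>: either the head is
  differentiated or the newly appended factor is.\<close>

lemma curve_run:
 "smooth_curve(fam(ob(Suc i))(ob 0)i)(%s Xs fs. if cchain D n Xs fs then run C(ob 0 Xs)(objseq Fo Xs)(morseq(rot s)Xs fs)(morseq(rot s)Xs fs 0)(Suc 0)i else 0)(%s Xs fs. if cchain D n Xs fs then der_word C E(objseq Fo Xs)(morseq(rot s)Xs fs)i else 0)"
proof(induction i)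
 case 0
 show ?case using curve_mor[of 0] unfolding run.simps der_word.simps .
next
 case(Suc i)
 let ?q = "Suc i"
 let ?df = "%g Xs fs. if cchain D n Xs fs then diff C(ob(Suc ?q)Xs)(ob ?q Xs)(g Xs fs)else 0"
 let ?m = "%g g' Xs fs. if cchain D n Xs fs then comp C(ob(Suc ?q)Xs)(ob ?q Xs)(ob 0 Xs)(g Xs fs)(g' Xs fs)else 0"
 have dl: "clin(fam(ob(Suc ?q))(ob ?q) 0) ?df"
 proof(intro clin_funI)
  fix Xs fs
  show "clin(fam(ob(Suc ?q))(ob ?q) 0)(%g. ?df g Xs fs)"
  proof(cases "cchain D n Xs fs")
  case True
  have "clin(fam(ob(Suc ?q))(ob ?q) 0)(%g. diff C(ob(Suc ?q)Xs)(ob ?q Xs)(g Xs fs))"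
  by(rule clin_compose[OF diff_lin[OF P.objseq_in[OF True] P.objseq_in[OF True]] fam_ev],erule fam_D[OF _ True])
  thus ?thesis using True by simp
  qed(simp add:clin_const_zero)
 qed
 have din: "?df g:fam(ob(Suc ?q))(ob ?q) 1" if "g:fam(ob(Suc ?q))(ob ?q) 0" for g
  by(rule fam_I) (use diff_in[OF P.objseq_in P.objseq_in fam_D[OF that]] in simp)
 have ml: "cbil(fam(ob ?q)(ob 0)i)(fam(ob(Suc ?q))(ob ?q) 1) ?m"
 proof(rule cbilI; intro clin_funI)
  fix g Xs fs assume g: "g:fam(ob ?q)(ob 0)i"
  show "clin(fam(ob(Suc ?q))(ob ?q) 1)(%g'. ?m g g' Xs fs)"
  proof(cases "cchain D n Xs fs")
  case True
  note o = P.objseq_in[OF True]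
  have "clin(fam(ob(Suc ?q))(ob ?q) 1)(%g'. comp C(ob(Suc ?q)Xs)(ob ?q Xs)(ob 0 Xs)(g Xs fs)(g' Xs fs))"
  by(rule clin_compose[OF comp_lin_right[OF o o o fam_D[OF g True]] fam_ev],erule fam_D[OF _ True])
  thus ?thesis using True by simp
  qed(simp add:clin_const_zero)
 next
  fix g' Xs fs assume g': "g':fam(ob(Suc ?q))(ob ?q) 1"
  show "clin(fam(ob ?q)(ob 0)i)(%g. ?m g g' Xs fs)"
  proof(cases "cchain D n Xs fs")
  case True
  note o = P.objseq_in[OF True]
  have "clin(fam(ob ?q)(ob 0)i)(%g. comp C(ob(Suc ?q)Xs)(ob ?q Xs)(ob 0 Xs)(g Xs fs)(g' Xs fs))"
  by(rule clin_compose[OF comp_lin_left[OF o o o fam_D[OF g' True]] fam_ev],erule fam_D[OF _ True])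
  thus ?thesis using True by simp
  qed(simp add:clin_const_zero)
 qed
 have min: "?m g g':fam(ob(Suc ?q))(ob 0) ?q" if "g:fam(ob ?q)(ob 0)i" "g':fam(ob(Suc ?q))(ob ?q) 1" for g g'
  by(rule fam_I) (use comp_in[OF P.objseq_in P.objseq_in P.objseq_in fam_D[OF that(1)] fam_D[OF that(2)]] in simp)
 note dcurve = smooth_curve_linear[OF curve_mor fam_subspace dl din]
 show ?case
  by(rule smooth_curve_cong[OF smooth_curve_bilinear[OF Suc.IH dcurve fam_subspace fam_subspace ml min]])
  (simp_all add: fun_eq_iff)
qed

lemma character_rot:
 "character D n C T Fo(rot s) = (%m Xs fs. if cchain D n Xs fs then T(ob 0 Xs)m(run C(ob 0 Xs)(objseq Fo Xs)(morseq(rot s)Xs fs)(morseq(rot s)Xs fs 0)(Suc 0)n)else 0)"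
proof -
 interpret r: cycle_functor H C M n T D Fo "rot s" by(rule cycle_functor_rot)
 show ?thesis
  by(intro ext) (simp add:character_def r.char_form_run r.objseq_0)
qed

lemma curve_character:
 "smooth_curve UNIV(%s. character D n C T Fo(rot s))(%s m Xs fs. if cchain D n Xs fs then T(ob 0 Xs)m(der_word C E(objseq Fo Xs)(morseq(rot s)Xs fs)n)else 0)"
proof -
 let ?L = "%g m Xs fs. if cchain D n Xs fs then T(ob 0 Xs)m(g Xs fs)else 0"
 have o: "ob(Suc n)Xs = ob 0 Xs" if "cchain D n Xs fs" for Xs fs
  using cchain_length[OF that] by(simp add:objseq_def)
 have "clin(fam(ob(Suc n))(ob 0)n) ?L"
 proof(intro clin_funI)
  fix m Xs fs
  show "clin(fam(ob(Suc n))(ob 0)n)(%g. ?L g m Xs fs)"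
  proof(cases "cchain D n Xs fs")
  case True
  have "clin(fam(ob(Suc n))(ob 0)n)(%g. T(ob 0 Xs)m(g Xs fs))"
  by(rule clin_compose[OF T_lin[OF P.objseq_in[OF True]] fam_ev])
  (use fam_D[OF _ True,of _ "Suc n" 0 n] o[OF True] in simp)
  thus ?thesis using True by simp
  qed(simp add:clin_const_zero)
 qed
 thus ?thesis
  by(rule smooth_curve_cong[OF smooth_curve_linear[OF curve_run fam_subspace]])
  (simp_all add: fun_eq_iff character_rot)
qed

text \<open>The derivative of the character at every parameter is a coboundary, so its increment
  from 0 to \<open>pi / 2\<close> is one; at these ends the rotation is \<open>P\<close> and
  \<open>Q\<close>.\<close>

theorem rotation_coboundary:
 assumes n: "n = Suc k"
 shows "character D n C T Fo P-character D n C T Fo Q:coboundaries H M D n"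
proof -
 have "(%m Xs fs. if cchain D n Xs fs then T(ob 0 Xs)m(der_word C E(objseq Fo Xs)(morseq(rot s)Xs fs)n)else 0):coboundaries H M D n" for s
 proof -
  interpret r: cycle_functor H C M n T D Fo "rot s" by(rule cycle_functor_rot)
  have "(%m Xs fs. if cchain D n Xs fs then T(Fo(Xs!0))m(der_word C E(objseq Fo Xs)(morseq(rot s)Xs fs)n)else 0):coboundaries H M D n"
  by(rule r.der_cochain_coboundary[OF E E_inv n])
  moreover have "(%m Xs fs. if cchain D n Xs fs then T(Fo(Xs!0))m(der_word C E(objseq Fo Xs)(morseq(rot s)Xs fs)n)else 0) = (%m Xs fs. if cchain D n Xs fs then T(ob 0 Xs)m(der_word C E(objseq Fo Xs)(morseq(rot s)Xs fs)n)else 0)"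
  by(intro ext) (simp add:r.objseq_0)
  ultimately show ?thesis by simp
 qed
 from smooth_curve_diff_in[OF curve_character sub_coboundaries this,of 0 "pi / 2"]
 have "character D n C T Fo(rot 0)-character D n C T Fo(rot(pi / 2)):coboundaries H M D n" .
 moreover have "rot 0 = P" "rot(pi / 2) = Q"
  by(intro ext,simp add:rot_def scale_simps)+
 ultimately show ?thesis by simp
qed

text \<open>In dimension zero a coboundary is 0, so equality is needed. The trace of
  \<open>E E P\<close> equals that of \<open>E P E\<close>, since \<open>E\<close> is invariant; the
  first argument is \<open>- P\<close> and the second is \<open>- Q\<close>.\<close>

lemma trace_degree_zero:
 assumes n: "n = 0" and X: "X:obj D" and f: "f:hom D X X"
 shows "T(Fo X)m(P X X f) = T(Fo X)m(Q X X f)"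
proof -
 note o = P.rho_obj[OF X]
 have EPin: "eL X X(P X X f):ghom C(Fo X)(Fo X)n"
  using eL_in[OF X X P.a_in[OF X X f]] n by simp
 have "eR X X(eL X X(P X X f)) = - Q X X f"
  unfolding EP[OF X X f] by(rule PEE(2)[OF X X f])
 moreover have "T(Fo X)m(eR X X(eL X X(P X X f))) = T(Fo X)m(eL X X(eL X X(P X X f)))"
  using T_invariant[OF o _ E[OF o] EPin E_inv[OF o],of m] by simp
 ultimately show ?thesis
  using clin_minus[OF T_lin[OF o],of "P X X f" m] clin_minus[OF T_lin[OF o],of "Q X X f" m]
  P.a_in[OF X X f] Q.a_in[OF X X f] n by(simp add:EEP[OF X X f])
qed

end

section \<open>Matrices over a graded semicategory\<close>

text \<open>Plain matrices instead of a tensor product with \<open>M_2\<close>: entries can be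
  inspected directly and the construction can be iterated. The field \<open>hom\<close> is a dummy,
  since only \<open>ghom\<close> enters \<open>graded_semicat\<close>.\<close>

definition mat2 :: "('p,'c::complex_vector,'h)dghsemicat =>('p,'c^2^2,'h)dghsemicat" where
 "mat2 C = \<lparr>obj = obj C,hom = (%X Y. {}),comp = (%X Y Z A B. \<chi> i j. \<Sum>k\<in>UNIV. comp C X Y Z(A$i$k)(B$k$j)),act = (%X Y h A. \<chi> i j. act C X Y h(A$i$j)),ghom = (%X Y n. {A. \<forall>i j. A$i$j:ghom C X Y n}),diff = (%X Y A. \<chi> i j. diff C X Y(A$i$j))\<rparr>"

lemma mat2_simps [simp]:
 "obj(mat2 C) = obj C"
 "comp(mat2 C)X Y Z A B = (\<chi> i j. \<Sum>k\<in>UNIV. comp C X Y Z(A$i$k)(B$k$j))"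
 "act(mat2 C)X Y h A = (\<chi> i j. act C X Y h(A$i$j))"
 "A:ghom(mat2 C)X Y n \<longleftrightarrow>(\<forall>i j. A$i$j:ghom C X Y n)"
 "diff(mat2 C)X Y A = (\<chi> i j. diff C X Y(A$i$j))"
 by(simp_all add: mat2_def)

definition mtrace :: "('p => 'v => 'c => complex) => 'p => 'v => 'c^2^2 => complex" where
 "mtrace T X m A = (\<Sum>i\<in>UNIV. T X m(A$i$i))"

definition diag2 :: "'c::zero => 'c => 'c^2^2" where
 "diag2 x y = (\<chi> i j. if i = 1&j = 1 then x else if i = 2&j = 2 then y else 0)"

definition offdiag2 :: "'c::zero => 'c => 'c^2^2" where
 "offdiag2 x y = (\<chi> i j. if i = 1&j = 2 then x else if i = 2&j = 1 then y else 0)"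

lemma diag2_nth [simp]: "diag2 x y$1$1 = x" "diag2 x y$1$2 = 0" "diag2 x y$2$1 = 0" "diag2 x y$2$2 = y"
 by(simp_all add: diag2_def)

lemma offdiag2_nth [simp]: "offdiag2 x y$1$1 = 0" "offdiag2 x y$1$2 = x" "offdiag2 x y$2$1 = y" "offdiag2 x y$2$2 = 0"
 by(simp_all add: offdiag2_def)

lemma mat2_eq_iff: "A = B \<longleftrightarrow> A$1$1 = B$1$1&A$1$2 = B$1$2&A$2$1 = B$2$1&A$2$2 = B$2$2"
 for A B :: "'c^2^2"
 by(auto simp:vec_eq_iff forall_2)

lemma clin_vecI: "(!!i j. clin V(%x. f x$i$j)) ==> clin V f"
 for f :: "'a::complex_vector => 'c::complex_vector^'k^'k"
 by(simp add:clin_def vec_eq_iff scaleC_vec_nth)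

lemma lin_nth: "lin(%A :: 'c::complex_vector^'k^'k. A$i$j)"
 by(simp add:clin_def scaleC_vec_nth)

context graded_semicat
begin

lemma comp_zero_left: "X:obj C ==> Y:obj C ==> Z:obj C ==> f:ghom C X Y j ==> comp C X Y Z 0 f = 0"
 by(rule clin_zero[OF comp_lin_left[where i = 0] sub_ghom])

lemma comp_zero_right: "X:obj C ==> Y:obj C ==> Z:obj C ==> g:ghom C Y Z i ==> comp C X Y Z g 0 = 0"
 by(rule clin_zero[OF comp_lin_right[where j = 0] sub_ghom])

lemma diff_zero: "X:obj C ==> Y:obj C ==> diff C X Y 0 = 0"
 by(rule clin_zero[OF diff_lin[where i = 0] sub_ghom])

lemma act_zero: "X:obj C ==> Y:obj C ==> act C X Y h 0 = 0"
 by(rule clin_zero[OF act_lin_right[where i = 0] sub_ghom])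

lemma sum_ghom: "X:obj C ==> Y:obj C ==>(!!k. k:K ==> x k:ghom C X Y i) ==>(\<Sum>k\<in>K. x k):ghom C X Y i"
 by(rule csub_sum[OF sub_ghom])

lemma act_comp_bilin:
 assumes X: "X:obj C" "Y:obj C" "Z:obj C" and g: "g:ghom C Y Z i" and f: "f:ghom C X Y j"
 shows "bilin(%h1 h2. comp C X Y Z(act C Y Z h1 g)(act C X Y h2 f))"
proof(rule bilinI)
 show "lin(%h2. comp C X Y Z(act C Y Z h1 g)(act C X Y h2 f))" for h1
  by(rule clin_compose[OF comp_lin_right[OF X act_in[OF X(2,3) g]] act_lin_left[OF X(1,2) f] act_in[OF X(1,2) f]])
 show "lin(%h1. comp C X Y Z(act C Y Z h1 g)(act C X Y h2 f))" for h2
  by(rule clin_compose[OF comp_lin_left[OF X act_in[OF X(1,2) f]] act_lin_left[OF X(2,3) g] act_in[OF X(2,3) g]])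
qed

lemma graded_mat2: "graded_semicat H(mat2 C)"
proof(unfold_locales,goal_cases)
 case(1 X Y i)
 thus ?case
  using sub_ghom[of X Y i]
  by(auto simp:csub_def mat2_def scaleC_vec_nth)
next
 case(2 X Y Z g i f j)
 thus ?case by(auto intro!:sum_ghom comp_in)
next
 case(3 X Y Z i j)
 hence X: "X:obj C" "Y:obj C" "Z:obj C" by simp_all
 show ?case
 proof(rule cbilI; rule clin_vecI)
  fix A :: "'c^2^2" and a b :: 2 assume A: "A:ghom(mat2 C)Y Z i"
  have "clin(ghom(mat2 C)X Y j)(%B. \<Sum>k\<in>UNIV. comp C X Y Z(A$a$k)(B$k$b))"
  by(intro clin_setsum clin_compose[OF comp_lin_right[OF X] clin_subset[OF lin_nth]])
  (use A in auto)
  thus "clin(ghom(mat2 C)X Y j)(%B. comp(mat2 C)X Y Z A B$a$b)" by simp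
 next
  fix B :: "'c^2^2" and a b :: 2 assume B: "B:ghom(mat2 C)X Y j"
  have "clin(ghom(mat2 C)Y Z i)(%A. \<Sum>k\<in>UNIV. comp C X Y Z(A$a$k)(B$k$b))"
  by(intro clin_setsum clin_compose[OF comp_lin_left[OF X] clin_subset[OF lin_nth]])
  (use B in auto)
  thus "clin(ghom(mat2 C)Y Z i)(%A. comp(mat2 C)X Y Z A B$a$b)" by simp
 qed
next
 case(4 W X Y Z g i f j e k)
 hence X: "W:obj C" "X:obj C" "Y:obj C" "Z:obj C" by simp_all
 have in': "!!a b. g$a$b:ghom C Y Z i" "!!a b. f$a$b:ghom C X Y j" "!!a b. e$a$b:ghom C W X k"
  using 4 by simp_all
 have l: "comp C W X Z(\<Sum>b\<in>UNIV. comp C X Y Z(g$a$b)(f$b$c))(e$c$d) = (\<Sum>b\<in>UNIV. comp C W X Z(comp C X Y Z(g$a$b)(f$b$c))(e$c$d))" for a c d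
  by(rule clin_sum[OF comp_lin_left[OF X(1,2,4) in'(3)] sub_ghom[OF X(2,4)]]) (rule comp_in[OF X(2,3,4) in'(1,2)])
 have r: "comp C W Y Z(g$a$b)(\<Sum>c\<in>UNIV. comp C W X Y(f$b$c)(e$c$d)) = (\<Sum>c\<in>UNIV. comp C W Y Z(g$a$b)(comp C W X Y(f$b$c)(e$c$d)))" for a b d
  by(rule clin_sum[OF comp_lin_right[OF X(1,3,4) in'(1)] sub_ghom[OF X(1,3)]]) (rule comp_in[OF X(1,2,3) in'(2,3)])
 show ?case
  unfolding mat2_simps vec_eq_iff vec_lambda_beta l r
  by(intro allI,subst sum.swap) (simp add:comp_assoc[OF X in'])
next
 case(5 X Y f i h)
 thus ?case by(simp add:act_in)
next
 case(6 X Y i)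
 hence X: "X:obj C" "Y:obj C" by simp_all
 show ?case
 proof(rule cbilI; rule clin_vecI)
  fix h a b
  have "clin(ghom(mat2 C)X Y i)(%A. act C X Y h(A$a$b))"
  by(rule clin_compose[OF act_lin_right[OF X] clin_subset[OF lin_nth]]) auto
  thus "clin(ghom(mat2 C)X Y i)(%A. act(mat2 C)X Y h A$a$b)" by simp
 next
  fix A a b assume "A:ghom(mat2 C)X Y i"
  hence "A$a$b:ghom C X Y i" by simp
  from act_lin_left[OF X this] show "lin(%h. act(mat2 C)X Y h A$a$b)" by simp
 qed
next
 case(7 X Y f i)
 thus ?case by(simp add:vec_eq_iff act_one[where i = i])
next
 case(8 X Y f i a b)
 thus ?case by(simp add:vec_eq_iff act_mult[where i = i])
next
 case(9 X Y Z g i f j h)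
 hence X: "X:obj C" "Y:obj C" "Z:obj C" by simp_all
 have in': "!!a b. g$a$b:ghom C Y Z i" "!!a b. f$a$b:ghom C X Y j" using 9 by simp_all
 let ?c = "%a b k h1 h2. comp C X Y Z(act C Y Z h1(g$a$k))(act C X Y h2(f$k$b))"
 have bk: "bilin(?c a b k)" for a b k by(rule act_comp_bilin[OF X in'])
 have bv: "bilin(%h1 h2. comp(mat2 C)X Y Z(act(mat2 C)Y Z h1 g)(act(mat2 C)X Y h2 f))"
  by(rule bilinI; rule clin_vecI; simp only: mat2_simps vec_lambda_beta; rule clin_setsum;
  rule bilinD1[OF bk] bilinD2[OF bk])
 have "act(mat2 C)X Z h(comp(mat2 C)X Y Z g f)$a$b = tlift(%h1 h2. comp(mat2 C)X Y Z(act(mat2 C)Y Z h1 g)(act(mat2 C)X Y h2 f))(comult H h)$a$b" for a b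
 proof -
  have "act C X Z h(\<Sum>k\<in>UNIV. comp C X Y Z(g$a$k)(f$k$b)) = (\<Sum>k\<in>UNIV. act C X Z h(comp C X Y Z(g$a$k)(f$k$b)))"
  by(rule clin_sum[OF act_lin_right[OF X(1,3)] sub_ghom[OF X(1,3)]]) (rule comp_in[OF X in'])
  also have "... = tlift(%h1 h2. \<Sum>k\<in>UNIV. ?c a b k h1 h2)(\<Delta> h)"
  by(simp add:act_comp[OF X in'] tlift_sum_fun[OF bk])
  also have "... = tlift(%h1 h2. comp(mat2 C)X Y Z(act(mat2 C)Y Z h1 g)(act(mat2 C)X Y h2 f))(\<Delta> h)$a$b"
  by(subst tlift_lin[OF bv lin_nth]) simp
  finally show ?thesis by simp
 qed
 thus ?case
  by(intro vec_eq_iff[THEN iffD2] allI)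
next
 case(10 X Y f i)
 thus ?case by(simp add:diff_in)
next
 case(11 X Y i)
 hence X: "X:obj C" "Y:obj C" by simp_all
 show ?case
 proof(rule clin_vecI)
  fix a b
  have "clin(ghom(mat2 C)X Y i)(%A. diff C X Y(A$a$b))"
  by(rule clin_compose[OF diff_lin[OF X] clin_subset[OF lin_nth]]) auto
  thus "clin(ghom(mat2 C)X Y i)(%A. diff(mat2 C)X Y A$a$b)" by simp
 qed
next
 case(12 X Y f i)
 thus ?case by(simp add:vec_eq_iff diff_diff[where i = i])
next
 case(13 X Y f i h)
 thus ?case by(simp add:vec_eq_iff diff_act[where i = i])
next
 case(14 X Y Z g i f j)
 hence X: "X:obj C" "Y:obj C" "Z:obj C" by simp_all
 have in': "!!a b. g$a$b:ghom C Y Z i" "!!a b. f$a$b:ghom C X Y j" using 14 by simp_all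
 have "diff C X Z(\<Sum>k\<in>UNIV. comp C X Y Z(g$a$k)(f$k$b)) = (\<Sum>k\<in>UNIV. diff C X Z(comp C X Y Z(g$a$k)(f$k$b)))" for a b
  by(rule clin_sum[OF diff_lin[OF X(1,3)] sub_ghom[OF X(1,3)]]) (rule comp_in[OF X in'])
 thus ?case
  by(simp add:vec_eq_iff scaleC_vec_nth leibniz[OF X in'] sum.distrib cscale_sum_right)
qed

lemma comp_diag2:
 assumes X: "X:obj C" "Y:obj C" "Z:obj C" and g: "g:ghom C Y Z i" "g':ghom C Y Z i"
  and f: "f:ghom C X Y j" "f':ghom C X Y j"
 shows "comp(mat2 C)X Y Z(diag2 g g')(diag2 f f') = diag2(comp C X Y Z g f)(comp C X Y Z g' f')"
  and "comp(mat2 C)X Y Z(diag2 g g')(offdiag2 f f') = offdiag2(comp C X Y Z g f)(comp C X Y Z g' f')"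
  and "comp(mat2 C)X Y Z(offdiag2 g g')(diag2 f f') = offdiag2(comp C X Y Z g f')(comp C X Y Z g' f)"
  and "comp(mat2 C)X Y Z(offdiag2 g g')(offdiag2 f f') = diag2(comp C X Y Z g f')(comp C X Y Z g' f)"
 using comp_zero_left[OF X zero_in[OF X(1,2)]] comp_zero_left[OF X f(1)] comp_zero_left[OF X f(2)]
  comp_zero_right[OF X g(1)] comp_zero_right[OF X g(2)]
 by(simp_all add: mat2_eq_iff sum_2)

lemma diag2_in: "X:obj C ==> Y:obj C ==> diag2 f g:ghom(mat2 C)X Y i \<longleftrightarrow> f:ghom C X Y i&g:ghom C X Y i"
 and offdiag2_in: "X:obj C ==> Y:obj C ==> offdiag2 f g:ghom(mat2 C)X Y i \<longleftrightarrow> f:ghom C X Y i&g:ghom C X Y i"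
 by(auto simp:forall_2 zero_in)

lemma diag2_semifunctor:
 assumes P: "Hfun D(deg0 C)Fo P" and Q: "Hfun D(deg0 C)Fo Q"
 shows "Hfun D(deg0(mat2 C))Fo(%X Y f. diag2(P X Y f)(Q X Y f))"
proof -
 have o: "Fo X:obj C" if "X:obj D" for X using P that by(simp add:Hfun_def deg0_def)
 have in': "P X Y f:ghom C(Fo X)(Fo Y) 0" "Q X Y f:ghom C(Fo X)(Fo Y) 0"
  if "X:obj D" "Y:obj D" "f:hom D X Y" for X Y f
  using P Q that by(simp_all add: Hfun_def deg0_def)
 show ?thesis
 proof(rule semifunctor_degree_zeroI)
  show "Fo X:obj(mat2 C)" if "X:obj D" for X using o[OF that] by simp
  fix X Y assume X: "X:obj D" "Y:obj D"
  have l: "clin(hom D X Y)(P X Y)" "clin(hom D X Y)(Q X Y)"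
  using P Q X by(simp_all add: Hfun_def deg0_def)
  show "clin(hom D X Y)(%f. diag2(P X Y f)(Q X Y f))"
  using l by(simp add:clin_def mat2_eq_iff scaleC_vec_nth scale_simps)
  fix f assume f: "f:hom D X Y"
  show "diag2(P X Y f)(Q X Y f):ghom(mat2 C)(Fo X)(Fo Y) 0"
  unfolding diag2_in[OF o[OF X(1)] o[OF X(2)]] using in'[OF X f] by simp
  show "diag2(P X Y(act D X Y h f))(Q X Y(act D X Y h f)) = act(mat2 C)(Fo X)(Fo Y)h(diag2(P X Y f)(Q X Y f))" for h
  using P Q X f o by(simp add:Hfun_def deg0_def mat2_eq_iff act_zero)
 next
  fix X Y Z g f assume X: "X:obj D" "Y:obj D" "Z:obj D" and g: "g:hom D Y Z" and f: "f:hom D X Y"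
  show "diag2(P X Z(comp D X Y Z g f))(Q X Z(comp D X Y Z g f)) = comp(mat2 C)(Fo X)(Fo Y)(Fo Z)(diag2(P Y Z g)(Q Y Z g))(diag2(P X Y f)(Q X Y f))"
  unfolding comp_diag2(1)[OF o[OF X(1)] o[OF X(2)] o[OF X(3)] in'[OF X(2,3) g] in'[OF X(1,2) f]]
  using P Q X g f by(simp add:Hfun_def deg0_def)
 qed
qed

lemma zero_semifunctor:
 assumes "!!X. X:obj D ==> Fo X:obj C"
 shows "Hfun D(deg0 C)Fo(%X Y f. 0)"
 by(rule semifunctor_degree_zeroI) (simp_all add: assms zero_in act_zero clin_const_zero comp_zero_left[OF _ _ _ zero_in[of _ _ 0]])

end

context graded_trace
begin

lemma T_inv_bilin:
 assumes X: "X:obj C" and f: "f:ghom C X X n"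
 shows "bilin(%h1 h2. T X(ract M m h1)(act C X X(S h2)f))"
proof(rule bilinI)
 have r: "bilin(ract M)" using sayd by(simp add:sayd_module_def)
 show "lin(%h2. T X(ract M m h1)(act C X X(S h2)f))" for h1
  by(rule lin_comp[OF clin_compose[OF T_lin[OF X] act_lin_left[OF X X f] act_in[OF X X f]] lin_antipode0])
 show "lin(%h1. T X(ract M m h1)(act C X X(S h2)f))" for h2
  by(rule lin_comp[OF T_lin_m[OF X act_in[OF X X f]] bilinD1[OF r]])
qed

text \<open>All axioms are inherited entrywise; the trace property exchanges the two summation
  indices of the matrix product.\<close>

lemma cgtrace_mat2: "cgtrace H M(mat2 C)n(mtrace T)"
 unfolding cgtrace_def
proof(intro conjI ballI allI impI,goal_cases)
 case(1 X)
 hence X: "X:obj C" by simp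
 show ?case
 proof(rule cbilI)
  show "clin(ghom(mat2 C)X X n)(mtrace T X m)" for m
  unfolding mtrace_def
  by(intro clin_setsum clin_compose[OF T_lin[OF X] clin_subset[OF lin_nth]]) auto
  show "lin(%m. mtrace T X m A)" if "A:ghom(mat2 C)X X n" for A
  unfolding mtrace_def by(intro clin_setsum T_lin_m[OF X]) (use that in simp)
 qed
next
 case(2 X m h f)
 hence X: "X:obj C" and f: "!!i j. f$i$j:ghom C X X n" by simp_all
 show ?case
  by(simp add:mtrace_def tlift_sum_fun[OF T_inv_bilin[OF X f]] T_inv[OF X f] sum_distrib_left)
next
 case(3 X m k f)
 thus ?case by(simp add:mtrace_def T_closed)
next
 case(4 X Y m i j g g')
 hence X: "X:obj C" "Y:obj C" and g: "!!a b. g$a$b:ghom C X Y i" and g': "!!a b. g'$a$b:ghom C Y X j"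
  and ij: "i+j = n" by simp_all
 let ?t = "%a k b m0. T Y m0(comp C Y X Y(act C X Y(S' b)(g$k$a))(g'$a$k))"
 have b: "bilin(?t a k)" for a k by(rule rot_bilin[OF X ij g g'])
 have in1: "comp C X Y X(g'$a$k)(g$k$b):ghom C X X n" for a k b
  using comp_in[OF X(1,2,1) g' g] ij by(simp add:add.commute)
 have in2: "comp C Y X Y(act C X Y h(g$k$a))(g'$a$b):ghom C Y Y n" for a k b h
  using comp_in[OF X(2,1,2) act_in[OF X g] g'] ij by simp
 have "mtrace T X m(comp(mat2 C)X Y X g' g) = (\<Sum>a\<in>UNIV. \<Sum>k\<in>UNIV. T X m(comp C X Y X(g'$a$k)(g$k$a)))"
  unfolding mtrace_def
  by(simp add:clin_sum[OF T_lin[OF X(1)] sub_ghom[OF X(1,1)]] in1)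
 also have "... = (\<Sum>a\<in>UNIV. \<Sum>k\<in>UNIV.(- 1) ^ (i * j) * tlift(?t a k)(coact M m))"
  by(simp add:T_trace[OF X ij g g'])
 also have "... = (- 1) ^ (i * j) * tlift(%b m0. \<Sum>k\<in>UNIV. \<Sum>a\<in>UNIV. ?t a k b m0)(coact M m)"
  by(subst sum.swap) (simp add:tlift_sum_fun[OF bilin_sum[OF b]] tlift_sum_fun[OF b] sum_distrib_left)
 also have "(%b m0. \<Sum>k\<in>UNIV. \<Sum>a\<in>UNIV. ?t a k b m0) = (%b m0. mtrace T Y m0(comp(mat2 C)Y X Y(act(mat2 C)X Y(S' b)g)g'))"
  unfolding mtrace_def
  by(intro ext) (simp add:clin_sum[OF T_lin[OF X(2)] sub_ghom[OF X(2,2)]] in2)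
 finally show ?case .
qed

lemma graded_trace_mat2: "graded_trace H(mat2 C)M n(mtrace T)"
proof -
 interpret m: graded_semicat H "mat2 C" by(rule graded_mat2)
 show ?thesis by unfold_locales(rule sayd,rule cgtrace_mat2)
qed

text \<open>Block diagonal arrows have block diagonal differentials and products, so by induction
  the whole form is block diagonal and the matrix trace adds the two characters.\<close>

lemma character_diag2:
 assumes P: "cycle_functor H C M n T D Fo P" and Q: "cycle_functor H C M n T D Fo Q"
 shows "character D n(mat2 C)(mtrace T)Fo(%X Y f. diag2(P X Y f)(Q X Y f)) = character D n C T Fo P+character D n C T Fo Q"
proof(intro ext)
 interpret P: cycle_functor H C M n T D Fo P by(rule P)
 interpret Q: cycle_functor H C M n T D Fo Q by(rule Q)
 fix m Xs fs
 let ?F = "%X Y f. diag2(P X Y f)(Q X Y f)"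
 show "character D n(mat2 C)(mtrace T)Fo ?F m Xs fs = (character D n C T Fo P+character D n C T Fo Q)m Xs fs"
 proof(cases "cchain D n Xs fs")
  case True
  note len = cchain_length[OF True]
  have o: "Fo(cnth Xs i):obj C" for i by(rule P.rho_obj[OF cchain_obj[OF True]])
  have o0: "Fo(Xs!0):obj C" using o[of 0] len by simp
  have f: "fs!i:hom D(cnth Xs(Suc i))(cnth Xs i)" if "i<=n" for i by(rule cchain_nth[OF True that])
  have X: "cnth Xs i:obj D" for i by(rule cchain_obj[OF True])
  have cf: "char_form C Fo P Xs fs i:ghom C(Fo(cnth Xs(Suc i)))(Fo(Xs!0))i&char_form C Fo Q Xs fs i:ghom C(Fo(cnth Xs(Suc i)))(Fo(Xs!0))i&char_form(mat2 C)Fo ?F Xs fs i = diag2(char_form C Fo P Xs fs i)(char_form C Fo Q Xs fs i)" if "i<=n" for i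
  using that
  proof(induction i)
  case 0
  show ?case using P.a_in[OF X X f[of 0]] Q.a_in[OF X X f[of 0]] len by simp
  next
  case(Suc i)
  let ?X = "cnth Xs(i+2)" and ?Y = "cnth Xs(i+1)"
  let ?p = "P ?X ?Y(fs!Suc i)" and ?q = "Q ?X ?Y(fs!Suc i)"
  have pq: "?p:ghom C(Fo ?X)(Fo ?Y) 0" "?q:ghom C(Fo ?X)(Fo ?Y) 0"
  using P.a_in[OF X X f[of "Suc i"]] Q.a_in[OF X X f[of "Suc i"]] Suc.prems by simp_all
  have dd: "diff(mat2 C)(Fo ?X)(Fo ?Y)(diag2 ?p ?q) = diag2(diff C(Fo ?X)(Fo ?Y) ?p)(diff C(Fo ?X)(Fo ?Y) ?q)"
  by(simp add:mat2_eq_iff diff_zero[OF o o])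
  have IH: "char_form C Fo P Xs fs i:ghom C(Fo ?Y)(Fo(Xs!0))i"
  "char_form C Fo Q Xs fs i:ghom C(Fo ?Y)(Fo(Xs!0))i"
  "char_form(mat2 C)Fo ?F Xs fs i = diag2(char_form C Fo P Xs fs i)(char_form C Fo Q Xs fs i)"
  using Suc by simp_all
  note d = diff_in[OF o o pq(1)] diff_in[OF o o pq(2)]
  show ?case
  using comp_in[OF o o o0 IH(1) d(1)] comp_in[OF o o o0 IH(2) d(2)]
  unfolding char_form.simps Let_def IH(3) dd comp_diag2(1)[OF o o o0 IH(1,2) d] by simp
  qed
  show ?thesis using True cf[of n] by(simp add:character_def mtrace_def sum_2)
 qed(simp add:character_def)
qed

lemma character_zero:
 assumes Z: "cycle_functor H C M n T D Fo(%X Y f. 0)"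
 shows "character D n C T Fo(%X Y f. 0) = 0"
proof(intro ext)
 interpret Z: cycle_functor H C M n T D Fo "%X Y f. 0" by(rule Z)
 fix m Xs fs
 show "character D n C T Fo(%X Y f. 0)m Xs fs = 0 m Xs fs"
 proof(cases "cchain D n Xs fs")
  case True
  have o: "Fo(cnth Xs i):obj C" for i by(rule Z.rho_obj[OF cchain_obj[OF True]])
  have o0: "Fo(Xs!0):obj C" using o[of 0] cchain_length[OF True] by simp
  have "char_form C Fo(%X Y f. 0)Xs fs i = 0" for i
  using comp_zero_left[OF o o o0 diff_in[OF o o zero_in[OF o o]]]
  by(induction i) (simp_all add: Let_def)
  thus ?thesis
  using True clin_zero[OF T_lin[OF o0] sub_ghom[OF o0 o0]] by(simp add:character_def)
 qed(simp add:character_def)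
qed

end

section \<open>Vanishing cycles have trivial character\<close>

lemma(in hopf) graded_semicat_of_DGH:
 assumes "lDGH H C"
 shows "graded_semicat H C"
proof -
 have semi: "lHsemi H C" using assms by(simp add:lDGH_def)
 have ids: "internal_direct_sum(hom C X Y)(ghom C X Y)" if "X:obj C" "Y:obj C" for X Y
  using assms that by(simp add:lDGH_def)
 have sub: "ghom C X Y i \<subseteq> hom C X Y" if "X:obj C" "Y:obj C" for X Y i
  using ids[OF that] cspan_superset[of "\<Union>n. ghom C X Y n"] by(auto simp:internal_direct_sum_def)
 show ?thesis
 proof(unfold_locales,goal_cases)
  case(1 X Y i)
  thus ?case using ids by(simp add:internal_direct_sum_def)
 next
  case(2 X Y Z g i f j)
  thus ?case using assms by(simp add:lDGH_def)
 next
  case(3 X Y Z i j)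
  hence b: "cbil(hom C Y Z)(hom C X Y)(comp C X Y Z)" using semi 3 by(simp add:lHsemi_def)
  show ?case
  by(rule cbilI)
  (use 3 sub[of Y Z] sub[of X Y] in \<open>blast intro: clin_subset cbilD1[OF b] cbilD2[OF b]\<close>)+
 next
  case(4 W X Y Z g i f j e k)
  hence "g:hom C Y Z" "f:hom C X Y" "e:hom C W X" using sub by blast+
  thus ?case using semi 4 by(simp add:lHsemi_def)
 next
  case(5 X Y f i h)
  thus ?case using assms by(simp add:lDGH_def)
 next
  case(6 X Y i)
  hence b: "cbil UNIV(hom C X Y)(act C X Y)" using semi 6 by(simp add:lHsemi_def)
  show ?case
  by(rule cbilI)
  (use 6 sub[of X Y] in \<open>blast intro: clin_subset cbilD1[OF b] cbilD2[OF b]\<close>)+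
 next
  case(7 X Y f i)
  hence "f:hom C X Y" using sub by blast
  thus ?case using semi 7 by(simp add:lHsemi_def)
 next
  case(8 X Y f i a b)
  hence "f:hom C X Y" using sub by blast
  thus ?case using semi 8 by(simp add:lHsemi_def)
 next
  case(9 X Y Z g i f j h)
  hence "f:hom C X Y" "g:hom C Y Z" using sub by blast+
  thus ?case using semi 9 by(simp add:lHsemi_def)
 next
  case(10 X Y f i)
  thus ?case using assms by(simp add:lDGH_def)
 next
  case(11 X Y i)
  hence "clin(hom C X Y)(diff C X Y)" using assms by(simp add:lDGH_def)
  thus ?case using clin_subset sub 11 by blast
 next
  case(12 X Y f i)
  hence "f:hom C X Y" using sub by blast
  thus ?case using assms 12 by(simp add:lDGH_def)
 next
  case(13 X Y f i h)
  hence "f:hom C X Y" using sub by blast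
  thus ?case using assms 13 by(simp add:lDGH_def)
 next
  case(14 X Y Z g i f j)
  thus ?case using assms by(simp add:lDGH_def)
 qed
qed

text \<open>The identification of the tensor product of a space with $M_2$ and matrices over that space.\<close>

definition entries :: "'c::complex_vector set =>('c,complex^2^2)tensor => 'c^2^2" where
 "entries A t = (\<chi> i j. tlift_on A UNIV(%f B. B$i$j*.f)t)"

context
 fixes A :: "'c::complex_vector set"
 assumes A: "csub A"
begin

lemma entries_bilin: "cbil A UNIV(%f B :: complex^2^2. B$i$j*.f)"
 by(rule cbilI) (intro clin_scaleC clin_ident clin_scaleC_left lin_nth)+

lemma entries_lin: "clin(tsp A UNIV)(entries A)"
 by(rule clin_vecI)
  (simp add:entries_def clin_tensor_lift_on[OF A csub_UNIV entries_bilin])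

lemma entries_pure: "f:A ==> entries A(f \<otimes>\<^sub>C B) = (\<chi> i j. B$i$j*.f)"
 by(simp add:entries_def tlift_on_pure[OF A csub_UNIV entries_bilin])

lemma entries_zero: "entries A 0 = 0"
 by(rule clin_zero[OF entries_lin sub_tensor_space])

lemma entries_in:
 assumes "t:tsp A UNIV"
 shows "entries A t$i$j:A"
 using assms A
proof(induction t rule: tsp_induct)
 case zero
 show ?case by(simp add:entries_zero csub_0[OF A])
next
 case(add a b t)
 thus ?case
  by(simp add:clin_add[OF entries_lin] pure_in_tensor_space entries_pure
  csub_add[OF A] csub_scale[OF A])
qed

lemma entries_surj:
 assumes "!!i j. N$i$j:A"
 obtains t where "t:tsp A UNIV" "entries A t = N"
proof
 define u :: "2 => 2 => complex^2^2" where "u a b = (\<chi> i j. if i = a&j = b then 1 else 0)" for a b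
 let ?t = "\<Sum>a\<in>UNIV. \<Sum>b\<in>UNIV.(N$a$b) \<otimes>\<^sub>C u a b"
 have in': "(N$a$b) \<otimes>\<^sub>C u a b:tsp A UNIV" for a b
  by(rule pure_in_tensor_space) (simp_all add: assms)
 show "?t:tsp A UNIV"
  by(intro csub_sum[OF sub_tensor_space] in')
 have "entries A ?t = (\<Sum>a\<in>UNIV. \<Sum>b\<in>UNIV. entries A((N$a$b) \<otimes>\<^sub>C u a b))"
  by(simp add:clin_sum[OF entries_lin sub_tensor_space] in' csub_sum[OF sub_tensor_space])
 also have "... = N"
  by(simp add:entries_pure assms mat2_eq_iff sum_2 u_def scale_simps scaleC_one)
 finally show "entries A ?t = N" .
qed

end

context graded_semicat
begin

abbreviation(input) M2 :: "('p,('c,complex^2^2)tensor,'h)hsemicat" where "M2 == tensor_M2(deg0 C)"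
abbreviation(input) ent :: "'p => 'p =>('c,complex^2^2)tensor => 'c^2^2" where "ent X Y == entries(ghom C X Y 0)"

lemma M2_hom: "hom M2 X Y = tsp(ghom C X Y 0)UNIV"
 by(simp add:tensor_M2_def deg0_def)

lemma lin_matrix_mult_right: "lin(%B :: complex^2^2. A ** B)" for A :: "complex^2^2"
 by(rule clin_vecI)
  (simp add:matrix_matrix_mult_def,intro clin_setsum clin_mult_right lin_nth)

lemma lin_matrix_mult_left: "lin(%A :: complex^2^2. A ** B)" for B :: "complex^2^2"
 by(rule clin_vecI)
  (simp add:matrix_matrix_mult_def,intro clin_setsum clin_mult_left lin_nth)

text \<open>\<open>entries\<close> turns the doubly lifted composition of \<open>tensor_M2\<close>
  into the matrix product. The inner lift over \<open>u\<close> is treated first, then the outer one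
  over \<open>t\<close>, both by induction on tensors.\<close>

lemma M2_comp:
 assumes X: "X:obj C" "Y:obj C" "Z:obj C" and t: "t:hom M2 Y Z" and u: "u:hom M2 X Y"
 shows "comp M2 X Y Z t u:hom M2 X Z"
  and "ent X Z(comp M2 X Y Z t u) = comp(mat2 C)X Y Z(ent Y Z t)(ent X Y u)"
proof -
 let ?A = "ghom C Y Z 0" and ?B = "ghom C X Y 0" and ?W = "tsp(ghom C X Z 0)UNIV"
 note sA = sub_ghom[OF X(2,3),of 0] and sB = sub_ghom[OF X(1,2),of 0] and sC = sub_ghom[OF X(1,3),of 0]
 note sU = csub_UNIV
 have u: "u:tsp ?B UNIV" and t: "t:tsp ?A UNIV" using t u by(simp_all add: M2_hom)
 define F where "F u g A = tlift_on ?B UNIV(%f B. comp C X Y Z g f \<otimes>\<^sub>C((A :: complex^2^2) ** (B :: complex^2^2)))u" for u g and A :: "complex^2^2"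
 have c: "comp M2 X Y Z t u = tlift_on ?A UNIV(F u)t"
  by(simp add:tensor_M2_def deg0_def F_def[abs_def])
 have Fb: "cbil ?B UNIV(%f B. comp C X Y Z g f \<otimes>\<^sub>C((A :: complex^2^2) ** (B :: complex^2^2)))" if "g : ?A" for g A
  by(rule cbilI) (intro clin_pure_left clin_pure_right lin_matrix_mult_right comp_lin_right[OF X that])+
 have Fl: "clin(tsp ?B UNIV)(%u. F u g A)" if "g : ?A" for g A
  unfolding F_def by(rule clin_tensor_lift_on[OF sB sU Fb[OF that]])
 have Fp: "F(f \<otimes>\<^sub>C B)g A = comp C X Y Z g f \<otimes>\<^sub>C((A :: complex^2^2) ** (B :: complex^2^2))" if "g : ?A" "f : ?B" for f B g A
  unfolding F_def by(rule tlift_on_pure[OF sB sU Fb]) (use that in auto)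
 have F0: "F 0 g A = 0" if "g : ?A" for g A
  by(rule clin_zero[OF Fl[OF that] sub_tensor_space])
 have Fa: "F(f \<otimes>\<^sub>C B+u)g A = comp C X Y Z g f \<otimes>\<^sub>C((A :: complex^2^2) ** (B :: complex^2^2))+F u g A"
  if "g : ?A" "f : ?B" "u:tsp ?B UNIV" for f B u g A
  using clin_add[OF Fl[OF that(1)] pure_in_tensor_space[OF that(2) UNIV_I] that(3)] Fp[OF that(1,2)] by simp
 have cin: "comp C X Y Z g f:ghom C X Z 0" if "g : ?A" "f : ?B" for g f
  using comp_in[OF X that] by simp
 \<comment> \<open>Bilinearity of \<open>F u\<close> belongs to the induction: it is what allows the
   outer lift to be evaluated, and for a general \<open>u\<close> it follows only from its
   summands.\<close>
 have main: "cbil ?A UNIV(F u)&(\<forall>g\<in>?A. \<forall>A. F u g A : ?W&ent X Z(F u g A) = comp(mat2 C)X Y Z(\<chi> i j. A$i$j*.g)(ent X Y u))"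
  using u sB
 proof(induction u rule: tsp_induct)
  case zero
  show ?case
  by(auto intro!:cbilI clin_cong[OF clin_const_zero] sA sU
  simp:F0 csub_0[OF sub_tensor_space] entries_zero[OF sC] entries_zero[OF sB]
  vec_eq_iff comp_zero_right[OF X,where i = 0] scale_in[OF X(2,3)])
 next
  case(add f B u)
  have "cbil ?A UNIV(F(f \<otimes>\<^sub>C B+u))"
  proof(rule cbilI)
  fix g assume g: "g : ?A"
  show "lin(F(f \<otimes>\<^sub>C B+u)g)"
  by(rule clin_cong[OF _ sU Fa[OF g add(1,3)]])
  (intro clin_plus clin_pure_right lin_matrix_mult_left,use add.IH g in \<open>blast intro: cbilD1\<close>)
  next
  fix A
  show "clin ?A(%g. F(f \<otimes>\<^sub>C B+u)g A)"
  by(rule clin_cong[OF _ sA Fa[OF _ add(1,3)]])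
  (intro clin_plus clin_pure_left comp_lin_left[OF X add(1)],use add.IH in \<open>auto intro: cbilD2\<close>)
  qed
  moreover have "F(f \<otimes>\<^sub>C B+u)g A : ?W&ent X Z(F(f \<otimes>\<^sub>C B+u)g A) = comp(mat2 C)X Y Z(\<chi> i j. A$i$j*.g)(ent X Y(f \<otimes>\<^sub>C B+u))"
  if g: "g : ?A" for g A
  proof -
  have W: "F u g A : ?W" "comp C X Y Z g f \<otimes>\<^sub>C((A :: complex^2^2) ** (B :: complex^2^2)) : ?W"
  using add.IH g pure_in_tensor_space[OF cin[OF g add(1)] UNIV_I] by simp_all
  have IH: "ent X Z(F u g A) = comp(mat2 C)X Y Z(\<chi> i j. A$i$j*.g)(ent X Y u)" using add.IH g by simp
  have s: "a*.g : ?A" for a using scale_in[OF X(2,3) g] .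
  have e: "entries ?B u$i$j : ?B" for i j by(rule entries_in[OF sB add(3)])
  have f: "a*.f : ?B" for a using scale_in[OF X(1,2) add(1)] .
  show ?thesis
  unfolding Fa[OF g add(1,3)] clin_add[OF entries_lin[OF sC] W(2,1)]
  clin_add[OF entries_lin[OF sB] pure_in_tensor_space[OF add(1) UNIV_I] add(3)] IH
  entries_pure[OF sC cin[OF g add(1)]] entries_pure[OF sB add(1)]
  using csub_add[OF sub_tensor_space W(2,1)]
  by(simp add:vec_eq_iff clin_add[OF comp_lin_right[OF X s] f e] sum.distrib
  clin_scale[OF comp_lin_left[OF X f] g] clin_scale[OF comp_lin_right[OF X g] add(1)]
  matrix_matrix_mult_def cscale_sum_left scaleC_scaleC)
  qed
  ultimately show ?case by blast
 qed
 hence Fu: "cbil ?A UNIV(F u)" by simp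
 note L = clin_tensor_lift_on[OF sA sU Fu] and Lp = tlift_on_pure[OF sA sU Fu]
 have e: "entries ?B u$i$j : ?B" for i j by(rule entries_in[OF sB u])
 have "tlift_on ?A UNIV(F u)t : ?W&ent X Z(tlift_on ?A UNIV(F u)t) = comp(mat2 C)X Y Z(ent Y Z t)(ent X Y u)"
  using t sA
 proof(induction t rule: tsp_induct)
  case zero
  show ?case
  by(simp add:clin_zero[OF L sub_tensor_space] csub_0[OF sub_tensor_space]
  entries_zero[OF sC] entries_zero[OF sA] vec_eq_iff comp_zero_left[OF X e])
 next
  case(add g A t)
  have W: "tlift_on ?A UNIV(F u)t : ?W" "F u g A : ?W" using add main by simp_all
  have IH: "ent X Z(tlift_on ?A UNIV(F u)t) = comp(mat2 C)X Y Z(ent Y Z t)(ent X Y u)" using add by simp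
  have m: "ent X Z(F u g A) = comp(mat2 C)X Y Z(\<chi> i j. A$i$j*.g)(ent X Y u)" using main add(1) by simp
  have eg: "entries ?A t$i$j : ?A" for i j by(rule entries_in[OF sA add(3)])
  have s: "a*.g : ?A" for a using scale_in[OF X(2,3) add(1)] .
  show ?case
  unfolding clin_add[OF L pure_in_tensor_space[OF add(1) UNIV_I] add(3)] Lp[OF add(1) UNIV_I]
  clin_add[OF entries_lin[OF sC] W(2,1)] IH m
  clin_add[OF entries_lin[OF sA] pure_in_tensor_space[OF add(1) UNIV_I] add(3)] entries_pure[OF sA add(1)]
  using csub_add[OF sub_tensor_space W(2,1)]
  by(simp add:vec_eq_iff clin_add[OF comp_lin_left[OF X e] s eg] sum.distrib)
 qed
 thus "comp M2 X Y Z t u:hom M2 X Z"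
  "ent X Z(comp M2 X Y Z t u) = comp(mat2 C)X Y Z(ent Y Z t)(ent X Y u)"
  by(simp_all add: c M2_hom)
qed

lemma M2_act:
 assumes X: "X:obj C" and t: "t:hom M2 X X"
 shows "act M2 X X h t:hom M2 X X" and "ent X X(act M2 X X h t) = act(mat2 C)X X h(ent X X t)"
proof -
 let ?A = "ghom C X X 0"
 note sA = sub_ghom[OF X X,of 0] and sU = csub_UNIV
 have b: "cbil ?A UNIV(%f B. act C X X h f \<otimes>\<^sub>C(B :: complex^2^2))"
  by(rule cbilI) (intro clin_pure_left clin_pure_right clin_ident act_lin_right[OF X X])+
 note L = clin_tensor_lift_on[OF sA sU b] and Lp = tlift_on_pure[OF sA sU b]
 have a: "act M2 X X h t = tlift_on ?A UNIV(%f B. act C X X h f \<otimes>\<^sub>C(B :: complex^2^2))t"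
  by(simp add:tensor_M2_def deg0_def)
 have "t:tsp ?A UNIV" using t by(simp add:M2_hom)
 hence "tlift_on ?A UNIV(%f B. act C X X h f \<otimes>\<^sub>C(B :: complex^2^2))t:tsp ?A UNIV&entries ?A(tlift_on ?A UNIV(%f B. act C X X h f \<otimes>\<^sub>C(B :: complex^2^2))t) = act(mat2 C)X X h(entries ?A t)"
  using sA
 proof(induction t rule: tsp_induct)
  case zero
  show ?case
  by(simp add:clin_zero[OF L sub_tensor_space] csub_0[OF sub_tensor_space]
  entries_zero[OF sA] vec_eq_iff act_zero[OF X X])
 next
  case(add f B t)
  let ?L = "tlift_on ?A UNIV(%f B. act C X X h f \<otimes>\<^sub>C(B :: complex^2^2))t"
  have W: "?L:tsp ?A UNIV" "act C X X h f \<otimes>\<^sub>C B:tsp ?A UNIV"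
  using add.IH pure_in_tensor_space[OF act_in[OF X X add(1)] UNIV_I] by simp_all
  have e: "entries ?A t$i$j : ?A" for i j by(rule entries_in[OF sA add(3)])
  have s: "a*.f : ?A" for a using scale_in[OF X X add(1)] .
  show ?case
  unfolding clin_add[OF L pure_in_tensor_space[OF add(1) UNIV_I] add(3)] Lp[OF add(1) UNIV_I]
  clin_add[OF entries_lin[OF sA] W(2,1)] conjunct2[OF add.IH]
  clin_add[OF entries_lin[OF sA] pure_in_tensor_space[OF add(1) UNIV_I] add(3)] entries_pure[OF sA add(1)]
  entries_pure[OF sA act_in[OF X X add(1)]]
  using csub_add[OF sub_tensor_space W(2,1)]
  by(simp add:vec_eq_iff clin_add[OF act_lin_right[OF X X] s e] clin_scale[OF act_lin_right[OF X X] add(1)])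
 qed
 thus "act M2 X X h t:hom M2 X X" "ent X X(act M2 X X h t) = act(mat2 C)X X h(ent X X t)"
  by(simp_all add: a M2_hom)
qed

text \<open>Every matrix is the image of a tensor by \<open>entries_surj\<close>, so the unit laws
  carry over.\<close>

lemma M2_identity:
 assumes e: "is_identity M2 X e" and X: "X:obj C" "Y:obj C"
 shows "N:ghom(mat2 C)X Y 0 ==> comp(mat2 C)X X Y N(ent X X e) = N"
  and "N:ghom(mat2 C)Y X 0 ==> comp(mat2 C)Y X X(ent X X e)N = N"
proof -
 have e': "e:hom M2 X X" and Y: "Y:obj M2" using e X by(simp_all add: is_identity_def tensor_M2_def deg0_def)
 { assume N: "N:ghom(mat2 C)X Y 0"
  obtain t where t: "t:tsp(ghom C X Y 0)UNIV" "ent X Y t = N"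
  using entries_surj[OF sub_ghom[OF X,of 0],of N] N by auto
  hence t': "t:hom M2 X Y" by(simp add:M2_hom)
  have "comp M2 X X Y t e = t" using e t' Y unfolding is_identity_def by blast
  thus "comp(mat2 C)X X Y N(ent X X e) = N"
  using M2_comp(2)[OF X(1,1,2) t' e'] t(2) by metis }
 { assume N: "N:ghom(mat2 C)Y X 0"
  obtain t where t: "t:tsp(ghom C Y X 0)UNIV" "ent Y X t = N"
  using entries_surj[OF sub_ghom[OF X(2,1),of 0],of N] N by auto
  hence t': "t:hom M2 Y X" by(simp add:M2_hom)
  have "comp M2 Y X X e t = t" using e t' Y unfolding is_identity_def by blast
  thus "comp(mat2 C)Y X X(ent X X e)N = N"
  using M2_comp(2)[OF X(2,1,1) e' t'] t(2) by metis }
qed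

end

context graded_semicat
begin

text \<open>Restates the data in matrices, with the conjugation split into two intertwining
  relations, one for \<open>N\<close> and one for its inverse; the rotation uses both.\<close>

lemma vanishing_mat2:
 assumes van: "vanishing H C"
 obtains \<upsilon> N N' where "Hfun(deg0 C)(deg0 C)(%X. X) \<upsilon>"
  and "!!X. X:obj C ==> N X:ghom(mat2 C)X X 0" "!!X. X:obj C ==> N' X:ghom(mat2 C)X X 0"
  and "!!X h. X:obj C ==> act(mat2 C)X X h(N X) = \<epsilon> h*.N X"
  and "!!X h. X:obj C ==> act(mat2 C)X X h(N' X) = \<epsilon> h*.N' X"
  and "!!X Y A. X:obj C ==> Y:obj C ==> A:ghom(mat2 C)X Y 0 ==> comp(mat2 C)X Y Y(N Y)(comp(mat2 C)X Y Y(N' Y)A) = A"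
  and "!!X Y A. X:obj C ==> Y:obj C ==> A:ghom(mat2 C)X Y 0 ==> comp(mat2 C)X Y Y(N' Y)(comp(mat2 C)X Y Y(N Y)A) = A"
  and "!!X Y f. X:obj C ==> Y:obj C ==> f:ghom C X Y 0 ==> comp(mat2 C)X Y Y(N Y)(diag2 f(\<upsilon> X Y f)) = comp(mat2 C)X X Y(diag2 0(\<upsilon> X Y f))(N X)"
  and "!!X Y f. X:obj C ==> Y:obj C ==> f:ghom C X Y 0 ==> comp(mat2 C)X Y Y(N' Y)(diag2 0(\<upsilon> X Y f)) = comp(mat2 C)X X Y(diag2 f(\<upsilon> X Y f))(N' X)"
proof -
 have h0: "hom(deg0 C)X Y = ghom C X Y 0" for X Y by(simp add:deg0_def)
 obtain \<upsilon> \<eta> \<eta>' where u: "Hfun(deg0 C)(deg0 C)(%X. X) \<upsilon>"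
  and mi: "!!X. X:obj C ==> mutually_inverse M2 X(\<eta> X)(\<eta>' X)"
  and inv: "!!X h. X:obj C ==> act M2 X X h(\<eta> X) = \<epsilon> h*.\<eta> X"
  and conj: "!!X Y f. X:obj C ==> Y:obj C ==> f:ghom C X Y 0 ==> comp M2 X X Y(comp M2 X Y Y(\<eta> Y)(f \<otimes>\<^sub>C E11+\<upsilon> X Y f \<otimes>\<^sub>C E22))(\<eta>' X) = \<upsilon> X Y f \<otimes>\<^sub>C E22"
  using van unfolding vanishing_def Let_def h0 by blast
 have cat: "left_H_category H(deg0 C)" using van by(simp add:vanishing_def Let_def)
 interpret m: graded_semicat H "mat2 C" by(rule graded_mat2)
 define N where "N X = ent X X(\<eta> X)" for X
 define N' where "N' X = ent X X(\<eta>' X)" for X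
 let ?c = "comp(mat2 C)" and ?G = "%X Y. ghom(mat2 C)X Y 0"
 have eta: "\<eta> X:hom M2 X X" "\<eta>' X:hom M2 X X" if "X:obj C" for X
  using mi[OF that] by(simp_all add: mutually_inverse_def)
 have Nin: "N X : ?G X X" "N' X : ?G X X" if "X:obj C" for X
  using eta[OF that] entries_in[OF sub_ghom[OF that that,of 0]] by(simp_all add: M2_hom N_def N'_def)
 have oo: "obj(mat2 C) = obj C" by simp
 have cin: "?c X Y Z A B : ?G X Z" if "X:obj C" "Y:obj C" "Z:obj C" "A : ?G Y Z" "B : ?G X Y" for X Y Z A B
  using m.comp_in[of X Y Z A 0 B 0] that unfolding oo by simp
 have ass: "?c W X Z(?c X Y Z A B)B' = ?c W Y Z A(?c W X Y B B')"
  if "W:obj C" "X:obj C" "Y:obj C" "Z:obj C" "A : ?G Y Z" "B : ?G X Y" "B' : ?G W X" for W X Y Z A B B'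
  using m.comp_assoc[of W X Y Z A 0 B 0 B' 0] that unfolding oo by blast
 have id1: "?c X X Y A(?c X X X(N X)(N' X)) = A" "?c X X Y A(?c X X X(N' X)(N X)) = A"
  if X: "X:obj C" "Y:obj C" and A: "A : ?G X Y" for X Y A
  using mi[OF X(1)] M2_identity(1)[OF _ X A] M2_comp(2)[OF X(1,1,1) eta(1)[OF X(1)] eta(2)[OF X(1)]]
  M2_comp(2)[OF X(1,1,1) eta(2)[OF X(1)] eta(1)[OF X(1)]]
  unfolding N_def N'_def mutually_inverse_def by metis+
 have id2: "?c X Y Y(?c Y Y Y(N Y)(N' Y))A = A" "?c X Y Y(?c Y Y Y(N' Y)(N Y))A = A"
  if X: "X:obj C" "Y:obj C" and A: "A : ?G X Y" for X Y A
  using mi[OF X(2)] M2_identity(2)[OF _ X(2,1) A] M2_comp(2)[OF X(2,2,2) eta(1)[OF X(2)] eta(2)[OF X(2)]]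
  M2_comp(2)[OF X(2,2,2) eta(2)[OF X(2)] eta(1)[OF X(2)]]
  unfolding N_def N'_def mutually_inverse_def by metis+
 have id3: "?c X Y Y(N Y)(?c X Y Y(N' Y)A) = A" "?c X Y Y(N' Y)(?c X Y Y(N Y)A) = A"
  if X: "X:obj C" "Y:obj C" and A: "A : ?G X Y" for X Y A
  using id2[OF X A] ass[OF X X(2,2) Nin(1)[OF X(2)] Nin(2)[OF X(2)] A] ass[OF X X(2,2) Nin(2)[OF X(2)] Nin(1)[OF X(2)] A]
  by simp_all
 have Ninv: "act(mat2 C)X X h(N X) = \<epsilon> h*.N X" if X: "X:obj C" for X h
  using M2_act(2)[OF X eta(1)[OF X],of h] inv[OF X] clin_scale[OF entries_lin[OF sub_ghom[OF X X]]] eta(1)[OF X]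
  unfolding N_def M2_hom by metis
 \<comment> \<open>Invariance is given for \<open>N\<close>; for the inverse it is derived.
   \<open>N N'\<close> is the diagonal matrix of an invariant identity, hence \<open>N\<close> times
   \<open>h N'\<close> is \<open>\<epsilon> h\<close> times \<open>N N'\<close>, and
   \<open>N\<close> can be cancelled.\<close>
 have N'inv: "act(mat2 C)X X h(N' X) = \<epsilon> h*.N' X" if X: "X:obj C" for X h
 proof -
  obtain e where e: "is_identity(deg0 C)X e" "!!h. act C X X h e = \<epsilon> h*.e"
  using cat X by(auto simp:left_H_category_def deg0_def)
  have ein: "e:ghom C X X 0" and eid: "!!f. f:ghom C X X 0 ==> comp C X X X e f = f"
  using e(1) X by(auto simp:is_identity_def deg0_def)
  let ?I = "diag2 e e"
  have I: "?I : ?G X X" unfolding diag2_in[OF X X] using ein by simp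
  have NN: "?c X X X(N X)(N' X) : ?G X X" by(rule cin[OF X X X Nin[OF X]])
  have Il: "?c X X X ?I A = A" if "A : ?G X X" for A
  using that by(simp add:mat2_eq_iff sum_2 eid comp_zero_left[OF X X X,where j = 0])
  have "?c X X X(N X)(N' X) = ?I"
  using id1(1)[OF X X I] Il[OF NN] by metis
  hence J: "act(mat2 C)X X h(?c X X X(N X)(N' X)) = \<epsilon> h *. ?c X X X(N X)(N' X)"
  by(simp add:mat2_eq_iff e(2) act_zero[OF X X] scaleC_vec_nth scale_simps del:mat2_simps(2))
  note X' = X[folded oo]
  have l: "lin(%h. ?c X X X(N X)(act(mat2 C)X X h(N' X)))"
  by(rule clin_compose[OF m.comp_lin_right[OF X' X' X' Nin(1)[OF X]] m.act_lin_left[OF X' X' Nin(2)[OF X]] m.act_in[OF X' X' Nin(2)[OF X]]])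
  have aN: "act(mat2 C)X X h(N' X) : ?G X X" by(rule m.act_in[OF X' X' Nin(2)[OF X]])
  have "act(mat2 C)X X h(?c X X X(N X)(N' X)) = tlift(%h1 h2. \<epsilon> h1 *. ?c X X X(N X)(act(mat2 C)X X h2(N' X)))(\<Delta> h)"
  unfolding m.act_comp[OF X' X' X' Nin(1)[OF X] Nin(2)[OF X]] Ninv[OF X]
  clin_scale[OF m.comp_lin_left[OF X' X' X' m.act_in[OF X' X' Nin(2)[OF X]]] Nin(1)[OF X]] ..
  also have "... = ?c X X X(N X)(act(mat2 C)X X h(N' X))" by(rule counit1[OF l])
  finally have "?c X X X(N' X)(?c X X X(N X)(act(mat2 C)X X h(N' X))) = ?c X X X(N' X)(\<epsilon> h *. ?c X X X(N X)(N' X))"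
  using J by simp
  thus ?thesis
  unfolding id3(2)[OF X X aN] clin_scale[OF m.comp_lin_right[OF X' X' X' Nin(2)[OF X]] NN] id1(1)[OF X X Nin(2)[OF X]] .
 qed
 have uin: "\<upsilon> X Y f:ghom C X Y 0" if "X:obj C" "Y:obj C" "f:ghom C X Y 0" for X Y f
  using u that by(simp add:Hfun_def deg0_def)
 have E: "ent X Y(f \<otimes>\<^sub>C E11) = diag2 f 0" "ent X Y(f \<otimes>\<^sub>C E22) = diag2 0 f"
  "f \<otimes>\<^sub>C E11:hom M2 X Y" "f \<otimes>\<^sub>C E22:hom M2 X Y"
  if "X:obj C" "Y:obj C" "f:ghom C X Y 0" for X Y f
  using entries_pure[OF sub_ghom[OF that(1,2)] that(3)]
  by(simp_all add: mat2_eq_iff E11_def E22_def scaleC_one scale_simps M2_hom pure_in_tensor_space[OF that(3)])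
 have conj': "?c X X Y(?c X Y Y(N Y)(diag2 f(\<upsilon> X Y f)))(N' X) = diag2 0(\<upsilon> X Y f)"
  if X: "X:obj C" "Y:obj C" and f: "f:ghom C X Y 0" for X Y f
 proof -
  let ?t = "f \<otimes>\<^sub>C E11+\<upsilon> X Y f \<otimes>\<^sub>C E22"
  have t: "?t:hom M2 X Y"
  using E(3)[OF X f] E(4)[OF X uin[OF X f]] csub_add[OF sub_tensor_space] unfolding M2_hom by blast
  have "ent X Y ?t = diag2 f 0+diag2 0(\<upsilon> X Y f)"
  using clin_add[OF entries_lin[OF sub_ghom[OF X,of 0]],of "f \<otimes>\<^sub>C E11" "\<upsilon> X Y f \<otimes>\<^sub>C E22"]
  E[OF X f] E[OF X uin[OF X f]] by(simp add:M2_hom)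
  also have "... = diag2 f(\<upsilon> X Y f)" by(simp add:mat2_eq_iff)
  finally have t': "ent X Y ?t = diag2 f(\<upsilon> X Y f)" .
  show ?thesis
  using arg_cong[OF conj[OF X f],of "ent X Y"] E(2)[OF X uin[OF X f]]
  M2_comp(2)[OF X(1,1,2) M2_comp(1)[OF X X(2) eta(1)[OF X(2)] t] eta(2)[OF X(1)]]
  M2_comp(2)[OF X X(2) eta(1)[OF X(2)] t]
  unfolding N_def N'_def t' by metis
 qed
 have F: "diag2 f(\<upsilon> X Y f) : ?G X Y" "diag2 0(\<upsilon> X Y f) : ?G X Y"
  if "X:obj C" "Y:obj C" "f:ghom C X Y 0" for X Y f
  unfolding diag2_in[OF that(1,2)] using uin[OF that] that(3) zero_in[OF that(1,2)] by simp_all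
 show thesis
 proof
  show "Hfun(deg0 C)(deg0 C)(%X. X) \<upsilon>" by(rule u)
  fix X assume X: "X:obj C"
  show "N X : ?G X X" "N' X : ?G X X" by(rule Nin[OF X])+
  show "act(mat2 C)X X h(N X) = \<epsilon> h*.N X" "act(mat2 C)X X h(N' X) = \<epsilon> h*.N' X" for h
  by(rule Ninv[OF X] N'inv[OF X])+
  fix Y assume Y: "Y:obj C"
  show "?c X Y Y(N Y)(?c X Y Y(N' Y)A) = A" "?c X Y Y(N' Y)(?c X Y Y(N Y)A) = A" if "A : ?G X Y" for A
  by(rule id3[OF X Y that])+
  fix f assume f: "f:ghom C X Y 0"
  note F' = F[OF X Y f] and N = Nin[OF Y] and NX = Nin[OF X]
  have NF: "?c X Y Y(N Y)(diag2 f(\<upsilon> X Y f)) : ?G X Y" by(rule cin[OF X Y Y N(1) F'(1)])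
  show "?c X Y Y(N Y)(diag2 f(\<upsilon> X Y f)) = ?c X X Y(diag2 0(\<upsilon> X Y f))(N X)"
  using ass[OF X X X Y NF NX(2,1)] id1(2)[OF X Y NF] unfolding conj'[OF X Y f] by simp
  have "?c X X Y(diag2 f(\<upsilon> X Y f))(N' X) = ?c X Y Y(N' Y)(?c X Y Y(N Y)(?c X X Y(diag2 f(\<upsilon> X Y f))(N' X)))"
  by(rule id3(2)[OF X Y cin[OF X X Y F'(1) NX(2)],symmetric])
  also have "?c X Y Y(N Y)(?c X X Y(diag2 f(\<upsilon> X Y f))(N' X)) = diag2 0(\<upsilon> X Y f)"
  using ass[OF X X Y Y N(1) F'(1) NX(2)] conj'[OF X Y f] by simp
  finally show "?c X Y Y(N' Y)(diag2 0(\<upsilon> X Y f)) = ?c X X Y(diag2 f(\<upsilon> X Y f))(N' X)" by simp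
 qed
qed

end

\<comment> \<open>The conjugate semifunctors \<open>diag(a, \<upsilon> a)\<close> and
  \<open>diag(0, \<upsilon> a)\<close> have characters that differ by the character of
  \<open>a\<close>; the rotation shows that the difference is a coboundary.\<close>
theorem(in cycle_functor) vanishing_character_coboundary:
 assumes van: "vanishing H C"
 shows "character D n C T Fo a:coboundaries H M D n"
proof -
 obtain \<upsilon> N N' where u: "Hfun(deg0 C)(deg0 C)(%X. X) \<upsilon>"
  and N: "!!X. X:obj C ==> N X:ghom(mat2 C)X X 0" "!!X. X:obj C ==> N' X:ghom(mat2 C)X X 0"
  and N_inv: "!!X h. X:obj C ==> act(mat2 C)X X h(N X) = \<epsilon> h*.N X"
  "!!X h. X:obj C ==> act(mat2 C)X X h(N' X) = \<epsilon> h*.N' X"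
  and NN: "!!X Y A. X:obj C ==> Y:obj C ==> A:ghom(mat2 C)X Y 0 ==> comp(mat2 C)X Y Y(N Y)(comp(mat2 C)X Y Y(N' Y)A) = A"
  "!!X Y A. X:obj C ==> Y:obj C ==> A:ghom(mat2 C)X Y 0 ==> comp(mat2 C)X Y Y(N' Y)(comp(mat2 C)X Y Y(N Y)A) = A"
  and NF: "!!X Y f. X:obj C ==> Y:obj C ==> f:ghom C X Y 0 ==> comp(mat2 C)X Y Y(N Y)(diag2 f(\<upsilon> X Y f)) = comp(mat2 C)X X Y(diag2 0(\<upsilon> X Y f))(N X)"
  "!!X Y f. X:obj C ==> Y:obj C ==> f:ghom C X Y 0 ==> comp(mat2 C)X Y Y(N' Y)(diag2 0(\<upsilon> X Y f)) = comp(mat2 C)X X Y(diag2 f(\<upsilon> X Y f))(N' X)"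
  by(rule vanishing_mat2[OF van]) (rule that; assumption)
 let ?ua = "%X Y f. \<upsilon>(Fo X)(Fo Y)(a X Y f)"
 have semi_ua: "Hfun D(deg0 C)Fo ?ua"
 proof(rule semifunctor_degree_zeroI)
  show "Fo X:obj C" if "X:obj D" for X by(rule rho_obj[OF that])
  fix X Y assume X: "X:obj D" "Y:obj D"
  note o = rho_obj[OF X(1)] rho_obj[OF X(2)]
  have ul: "clin(ghom C(Fo X)(Fo Y) 0)(\<upsilon>(Fo X)(Fo Y))"
  using u o by(simp add:Hfun_def deg0_def)
  show "clin(hom D X Y)(?ua X Y)" by(rule clin_compose[OF ul a_lin[OF X] a_in[OF X]])
  fix f assume f: "f:hom D X Y"
  show "?ua X Y f:ghom C(Fo X)(Fo Y) 0"
  using u o a_in[OF X f] by(simp add:Hfun_def deg0_def)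
  show "?ua X Y(act D X Y h f) = act C(Fo X)(Fo Y)h(?ua X Y f)" for h
  using u o a_in[OF X f] a_act[OF X f] by(simp add:Hfun_def deg0_def)
 next
  fix X Y Z g f assume X: "X:obj D" "Y:obj D" "Z:obj D" and g: "g:hom D Y Z" and f: "f:hom D X Y"
  show "?ua X Z(comp D X Y Z g f) = comp C(Fo X)(Fo Y)(Fo Z)(?ua Y Z g)(?ua X Y f)"
  using u rho_obj[OF X(1)] rho_obj[OF X(2)] rho_obj[OF X(3)] a_in[OF X(2,3) g] a_in[OF X(1,2) f] a_comp[OF X g f]
  by(simp add:Hfun_def deg0_def)
 qed
 \<comment> \<open>The inner layer of matrices holds the sum with \<open>\<upsilon> a\<close>; a
   second layer provides the two blocks that make the conjugate semifunctors orthogonal.\<close>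
 let ?m = "mat2 C" and ?t = "mtrace T"
 let ?F0 = "%X Y f. diag2(a X Y f)(?ua X Y f)" and ?F1 = "%X Y f. diag2 0(?ua X Y f)"
 interpret m: graded_trace H ?m M n ?t by(rule graded_trace_mat2)
 interpret mm: graded_trace H "mat2 ?m" M n "mtrace ?t" by(rule m.graded_trace_mat2)
 have z: "Hfun D(deg0 C)Fo(%X Y f. 0)" by(rule zero_semifunctor[OF rho_obj])
 have zm: "Hfun D(deg0 ?m)Fo(%X Y f. 0)" by(rule m.zero_semifunctor) (simp add:rho_obj)
 have semi_F0: "Hfun D(deg0 ?m)Fo ?F0" by(rule diag2_semifunctor[OF semifun semi_ua])
 have semi_F1: "Hfun D(deg0 ?m)Fo ?F1" by(rule diag2_semifunctor[OF z semi_ua])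
 interpret z: cycle_functor H C M n T D Fo "%X Y f. 0" by unfold_locales(rule z)
 interpret ua: cycle_functor H C M n T D Fo ?ua by unfold_locales(rule semi_ua)
 interpret zm: cycle_functor H ?m M n ?t D Fo "%X Y f. 0" by unfold_locales(rule zm)
 interpret F0: cycle_functor H ?m M n ?t D Fo ?F0 by unfold_locales(rule semi_F0)
 interpret F1: cycle_functor H ?m M n ?t D Fo ?F1 by unfold_locales(rule semi_F1)
 let ?P = "%X Y f. diag2(?F0 X Y f) 0" and ?Q = "%X Y f. diag2 0(?F1 X Y f)"
 \<comment> \<open>The sign makes the square equal to \<open>- diag(N' N, N N')\<close>, which acts
   as \<open>-1\<close> on the degree zero arrows in question.\<close>
 let ?E = "%X. offdiag2(- N' X)(N X)"
 have oo: "obj ?m = obj C" by simp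
 have ro: "Fo X:obj ?m" if "X:obj D" for X using rho_obj[OF that] by simp
 have Nm: "- N' X:ghom ?m X X 0" if "X:obj C" for X
  using m.scale_in[of X X "N' X" 0 "-1"] N(2)[OF that] that unfolding oo by(simp add:scale_simps)
 have comp_in0: "comp ?m X Y Z A B:ghom ?m X Z 0"
  if "X:obj ?m" "Y:obj ?m" "Z:obj ?m" "A:ghom ?m Y Z 0" "B:ghom ?m X Y 0" for X Y Z A B
  using m.comp_in[OF that] by simp
 have comp_minus: "comp ?m X Y Z(- A)B = - comp ?m X Y Z A B" "comp ?m X Y Z A(- B) = - comp ?m X Y Z A B"
  if "X:obj ?m" "Y:obj ?m" "Z:obj ?m" "A:ghom ?m Y Z 0" "B:ghom ?m X Y 0" for X Y Z A B
  using clin_minus[OF m.comp_lin_left[OF that(1-3,5)] that(4)] clin_minus[OF m.comp_lin_right[OF that(1-4)] that(5)]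
  by blast+
 have z0: "0:ghom ?m X Y 0" if "X:obj ?m" "Y:obj ?m" for X Y by(rule m.zero_in[OF that])
 have EP: "comp(mat2 ?m)(Fo X)(Fo Y)(Fo Y)(?E(Fo Y))(?P X Y f) = offdiag2 0(comp ?m(Fo X)(Fo Y)(Fo Y)(N(Fo Y))(?F0 X Y f))"
  and QE: "comp(mat2 ?m)(Fo X)(Fo X)(Fo Y)(?Q X Y f)(?E(Fo X)) = offdiag2 0(comp ?m(Fo X)(Fo X)(Fo Y)(?F1 X Y f)(N(Fo X)))"
  and EQ: "comp(mat2 ?m)(Fo X)(Fo Y)(Fo Y)(?E(Fo Y))(?Q X Y f) = offdiag2(- comp ?m(Fo X)(Fo Y)(Fo Y)(N'(Fo Y))(?F1 X Y f)) 0"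
  and PE: "comp(mat2 ?m)(Fo X)(Fo X)(Fo Y)(?P X Y f)(?E(Fo X)) = offdiag2(- comp ?m(Fo X)(Fo X)(Fo Y)(?F0 X Y f)(N'(Fo X))) 0"
  and EEP: "comp(mat2 ?m)(Fo X)(Fo Y)(Fo Y)(?E(Fo Y))(offdiag2 0(comp ?m(Fo X)(Fo Y)(Fo Y)(N(Fo Y))(?F0 X Y f))) = - ?P X Y f"
  and EEQ: "comp(mat2 ?m)(Fo X)(Fo Y)(Fo Y)(?E(Fo Y))(offdiag2(- comp ?m(Fo X)(Fo Y)(Fo Y)(N'(Fo Y))(?F1 X Y f)) 0) = - ?Q X Y f"
  if X: "X:obj D" "Y:obj D" and f: "f:hom D X Y" for X Y f
 proof -
  note r = ro[OF X(1)] ro[OF X(2)]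
  note oX = rho_obj[OF X(1)] and oY = rho_obj[OF X(2)]
  note zz = m.comp_zero_left[where j = 0] m.comp_zero_right[where i = 0]
  note f0 = F0.a_in[OF X f] and f1 = F1.a_in[OF X f]
  show "comp(mat2 ?m)(Fo X)(Fo Y)(Fo Y)(?E(Fo Y))(?P X Y f) = offdiag2 0(comp ?m(Fo X)(Fo Y)(Fo Y)(N(Fo Y))(?F0 X Y f))"
  unfolding m.comp_diag2(3)[OF r r(2) Nm[OF oY] N(1)[OF oY] f0 z0[OF r]] m.comp_zero_right[OF r r(2) Nm[OF oY]] ..
  show "comp(mat2 ?m)(Fo X)(Fo X)(Fo Y)(?Q X Y f)(?E(Fo X)) = offdiag2 0(comp ?m(Fo X)(Fo X)(Fo Y)(?F1 X Y f)(N(Fo X)))"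
  unfolding m.comp_diag2(2)[OF r(1,1,2) z0[OF r] f1 Nm[OF oX] N(1)[OF oX]] m.comp_zero_left[OF r(1,1,2) Nm[OF oX]] ..
  show "comp(mat2 ?m)(Fo X)(Fo Y)(Fo Y)(?E(Fo Y))(?Q X Y f) = offdiag2(- comp ?m(Fo X)(Fo Y)(Fo Y)(N'(Fo Y))(?F1 X Y f)) 0"
  unfolding m.comp_diag2(3)[OF r r(2) Nm[OF oY] N(1)[OF oY] z0[OF r] f1] m.comp_zero_right[OF r r(2) N(1)[OF oY]]
  comp_minus(1)[OF r r(2) N(2)[OF oY] f1] ..
  show "comp(mat2 ?m)(Fo X)(Fo X)(Fo Y)(?P X Y f)(?E(Fo X)) = offdiag2(- comp ?m(Fo X)(Fo X)(Fo Y)(?F0 X Y f)(N'(Fo X))) 0"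
  unfolding m.comp_diag2(2)[OF r(1,1,2) f0 z0[OF r] Nm[OF oX] N(1)[OF oX]] m.comp_zero_left[OF r(1,1,2) N(1)[OF oX]]
  comp_minus(2)[OF r(1,1,2) f0 N(2)[OF oX]] ..
  have nf: "comp ?m(Fo X)(Fo Y)(Fo Y)(N(Fo Y))(?F0 X Y f):ghom ?m(Fo X)(Fo Y) 0"
  "comp ?m(Fo X)(Fo Y)(Fo Y)(N'(Fo Y))(?F1 X Y f):ghom ?m(Fo X)(Fo Y) 0"
  by(rule comp_in0[OF r r(2) N(1)[OF oY] f0],rule comp_in0[OF r r(2) N(2)[OF oY] f1])
  have nf': "- comp ?m(Fo X)(Fo Y)(Fo Y)(N'(Fo Y))(?F1 X Y f):ghom ?m(Fo X)(Fo Y) 0"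
  by(rule csub_neg[OF m.sub_ghom[OF r] nf(2)])
  show "comp(mat2 ?m)(Fo X)(Fo Y)(Fo Y)(?E(Fo Y))(offdiag2 0(comp ?m(Fo X)(Fo Y)(Fo Y)(N(Fo Y))(?F0 X Y f))) = - ?P X Y f"
  unfolding m.comp_diag2(4)[OF r r(2) Nm[OF oY] N(1)[OF oY] z0[OF r] nf(1)] m.comp_zero_right[OF r r(2) N(1)[OF oY]]
  comp_minus(1)[OF r r(2) N(2)[OF oY] nf(1)] NN(2)[OF oX oY f0]
  by(simp add:mat2_eq_iff)
  show "comp(mat2 ?m)(Fo X)(Fo Y)(Fo Y)(?E(Fo Y))(offdiag2(- comp ?m(Fo X)(Fo Y)(Fo Y)(N'(Fo Y))(?F1 X Y f)) 0) = - ?Q X Y f"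
  unfolding m.comp_diag2(4)[OF r r(2) Nm[OF oY] N(1)[OF oY] nf' z0[OF r]] m.comp_zero_right[OF r r(2) Nm[OF oY]]
  comp_minus(2)[OF r r(2) N(1)[OF oY] nf(2)] NN(1)[OF oX oY f1]
  by(simp add:mat2_eq_iff)
 qed
 interpret rotation H "mat2 ?m" M n "mtrace ?t" D Fo ?P ?Q ?E
 proof(unfold_locales,goal_cases)
  case 1
  show ?case by(rule m.diag2_semifunctor[OF semi_F0 zm])
 next
  case 2
  show ?case by(rule m.diag2_semifunctor[OF zm semi_F1])
 next
  case(3 X)
  hence X: "X:obj C" by(simp del:mat2_simps(4))
  show ?case using m.offdiag2_in[of X X "- N' X" "N X" 0] Nm[OF X] N(1)[OF X] X by(simp del:mat2_simps(4))
 next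
  case(4 X h)
  hence X: "X:obj C" by(simp del:mat2_simps(4))
  hence X': "X:obj ?m" by simp
  have "act ?m X X h(- N' X) = \<epsilon> h *. - N' X"
  using clin_minus[OF m.act_lin_right[OF X' X'] N(2)[OF X]] N_inv(2)[OF X] by(simp add:scale_simps del:mat2_simps)
  moreover have "act(mat2 ?m)X X h(offdiag2 A B) = offdiag2(act ?m X X h A)(act ?m X X h B)" for A B
  by(subst mat2_eq_iff) (simp add:mat2_simps(3)[of ?m] m.act_zero[OF X' X'] del:mat2_simps)
  moreover have "offdiag2(c*.A)(c*.B) = c*.offdiag2 A B" for c and A B :: "'c^2^2"
  by(subst mat2_eq_iff) (simp add:scaleC_vec_nth scale_simps)
  ultimately show ?case using N_inv(1)[OF X] by metis
 next
  case(5 X Y f)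
  show ?case unfolding EP[OF 5] QE[OF 5] NF(1)[OF rho_obj[OF 5(1)] rho_obj[OF 5(2)] a_in[OF 5]] ..
 next
  case(6 X Y f)
  show ?case unfolding EQ[OF 6] PE[OF 6] NF(2)[OF rho_obj[OF 6(1)] rho_obj[OF 6(2)] a_in[OF 6]] ..
 next
  case(7 X Y f)
  show ?case unfolding EP[OF 7] EEP[OF 7] ..
 next
  case(8 X Y f)
  show ?case unfolding EQ[OF 8] EEQ[OF 8] ..
 next
  case(9 X Y Z g f)
  note r = ro[OF 9(1)] ro[OF 9(2)] ro[OF 9(3)]
  note f0 = F0.a_in[OF 9(2,3,4)] and f1 = F1.a_in[OF 9(1,2,5)]
  show ?case
  unfolding m.comp_diag2(1)[OF r f0 z0[OF r(2,3)] z0[OF r(1,2)] f1] m.comp_zero_right[OF r f0] m.comp_zero_left[OF r f1]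
  by(simp add:mat2_eq_iff)
 next
  case(10 X Y Z g f)
  note r = ro[OF 10(1)] ro[OF 10(2)] ro[OF 10(3)]
  note f1 = F1.a_in[OF 10(2,3,4)] and f0 = F0.a_in[OF 10(1,2,5)]
  show ?case
  unfolding m.comp_diag2(1)[OF r z0[OF r(2,3)] f1 f0 z0[OF r(1,2)]] m.comp_zero_right[OF r f1] m.comp_zero_left[OF r f0]
  by(simp add:mat2_eq_iff)
 qed
 \<comment> \<open>The two characters share the summand of \<open>\<upsilon> a\<close>, which
   cancels in their difference.\<close>
 have chP: "character D n(mat2 ?m)(mtrace ?t)Fo ?P = character D n C T Fo a+character D n C T Fo ?ua"
  unfolding m.character_diag2[OF F0.cycle_functor_axioms zm.cycle_functor_axioms]
  character_diag2[OF cycle_functor_axioms ua.cycle_functor_axioms] m.character_zero[OF zm.cycle_functor_axioms] by simp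
 have chQ: "character D n(mat2 ?m)(mtrace ?t)Fo ?Q = character D n C T Fo ?ua"
  unfolding m.character_diag2[OF zm.cycle_functor_axioms F1.cycle_functor_axioms]
  character_diag2[OF z.cycle_functor_axioms ua.cycle_functor_axioms] m.character_zero[OF zm.cycle_functor_axioms]
  character_zero[OF z.cycle_functor_axioms] by simp
 show ?thesis
 proof(cases n)
  case(Suc k)
  show ?thesis using rotation_coboundary[OF Suc] unfolding chP chQ by simp
 next
  \<comment> \<open>Equality of the two characters leaves the character of \<open>a\<close> equal to
    0, the only coboundary in degree zero.\<close>
  case 0
  have "character D n(mat2 ?m)(mtrace ?t)Fo ?P m Xs fs = character D n(mat2 ?m)(mtrace ?t)Fo ?Q m Xs fs" for m Xs fs
  proof(cases "cchain D n Xs fs")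
  case True
  have l: "length Xs = 1" using cchain_length[OF True] 0 by simp
  have X: "Xs!0:obj D" using cchain_obj[OF True,of 0] by simp
  have "fs!0:hom D(Xs!0)(Xs!0)" using cchain_nth[OF True,of 0] l by simp
  from trace_degree_zero[OF 0 X this,of m] show ?thesis using True l 0 by(simp add:character_def)
  qed(simp add:character_def)
  hence "character D n(mat2 ?m)(mtrace ?t)Fo ?P = character D n(mat2 ?m)(mtrace ?t)Fo ?Q"
  by(intro ext)
  hence "character D n C T Fo a = 0" unfolding chP chQ by simp
  thus ?thesis using 0 by(simp add:zero_fun_def)
 qed
qed

corollary(in cochain_data) vanishing_cycle_character_coboundary:
 fixes C :: "('p,'c::complex_vector,'h)dghsemicat"
 assumes "is_cycle H M D n C T Fo \<rho>" "vanishing H C"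
 shows "character D n C T Fo \<rho>:coboundaries H M D n"
proof -
 interpret graded_semicat H C
  by(rule graded_semicat_of_DGH) (use assms(1) in \<open>simp add: is_cycle_def\<close>)
 interpret cycle_functor H C M n T D Fo \<rho>
  by unfold_locales(use assms(1) sayd_M in \<open>simp_all add: is_cycle_def\<close>)
 show ?thesis by(rule vanishing_character_coboundary[OF assms(2)])
qed

section \<open>Infinite matrices\<close>

type_synonym imat = "nat => nat => complex"

definition rowfin :: "imat => bool" where
 "rowfin a \<longleftrightarrow>(\<forall>i. finite {j. a i j~=0})"

text \<open>One bound for all non-zero columns, not merely finite support of each column. This is
  what makes the diagonal finite and hence the trace meaningful.\<close>

definition colfin :: "imat => bool" where
 "colfin a \<longleftrightarrow>(\<exists>N. \<forall>i j. N<=j-->a i j = 0)"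

text \<open>The coefficients of words with \<open>l\<close> letters, that is of forms of degree \<open>l - 1\<close>. In positive
 degree they form a two-sided ideal of row-finite matrices which have a trace.\<close>

definition wcoeffs :: "nat => imat set" where
 "wcoeffs l = {a. rowfin a&(Suc 0<l-->colfin a)}"

text \<open>Summing over the support of a row keeps the sum finite for row-finite \<open>a\<close>;
  a sum over an infinite set would be 0.\<close>

definition mm :: "imat => imat => imat" where
 "mm a b = (%i k. \<Sum>j | a i j~=0. a i j * b j k)"

definition mone :: imat where
 "mone = (%i j. if i = j then 1 else 0)"

definition mtr :: "imat => complex" where
 "mtr a = (\<Sum>i | a i i~=0. a i i)"

lemma imat_simps [simp]: "((a :: imat)+b)i j = a i j+b i j" "(c *.(a :: imat))i j = c * a i j" "(0 :: imat)i j = 0"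
 by(simp_all add: scaleC_fun_apply scaleC_complex_def)

lemma mm_eq:
 assumes "finite F" "!!j. a i j~=0 ==> j:F"
 shows "mm a b i k = (\<Sum>j\<in>F. a i j * b j k)"
 unfolding mm_def by(rule sum.mono_neutral_left) (use assms in auto)

lemma rowfinD: "rowfin a ==> finite {j. a i j~=0}"
 by(simp add:rowfin_def)

lemma rowfin_add: "rowfin a ==> rowfin b ==> rowfin(a+b)"
 unfolding rowfin_def
proof
 fix i assume "\<forall>i. finite {j. a i j~=0}" "\<forall>i. finite {j. b i j~=0}"
 hence "finite({j. a i j~=0} \<union> {j. b i j~=0})" by blast
 thus "finite {j.(a+b)i j~=0}" by(rule rev_finite_subset) auto
qed

lemma rowfin_scale: "rowfin a ==> rowfin(c*.a)"
 unfolding rowfin_def by(auto intro:rev_finite_subset)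

lemma rowfin_zero: "rowfin 0"
 by(simp add:rowfin_def)

lemma colfin_add: "colfin a ==> colfin b ==> colfin(a+b)"
 unfolding colfin_def
proof -
 assume "\<exists>N. \<forall>i j. N<=j-->a i j = 0" "\<exists>N. \<forall>i j. N<=j-->b i j = 0"
 then obtain N N' where "\<forall>i j. N<=j-->a i j = 0" "\<forall>i j. N'<=j-->b i j = 0" by blast
 thus "\<exists>N. \<forall>i j. N<=j -->(a+b)i j = 0" by(intro exI[of _ "max N N'"]) simp
qed

lemma colfin_scale: "colfin a ==> colfin(c*.a)"
 unfolding colfin_def by force

lemma sub_wcoeffs: "csub(wcoeffs l)"
 by(rule csubI)
  (auto simp:wcoeffs_def rowfin_add rowfin_scale colfin_add colfin_scale rowfin_zero colfin_def[of 0])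

lemma rowfin_mm:
 assumes "rowfin a" "rowfin b"
 shows "rowfin(mm a b)"
 unfolding rowfin_def
proof
 fix i
 have "finite(\<Union>j\<in>{j. a i j~=0}. {k. b j k~=0})" using assms by(simp add:rowfin_def)
 thus "finite {k. mm a b i k~=0}"
  by(rule rev_finite_subset) (auto simp:mm_def elim!: sum.not_neutral_contains_not_neutral)
qed

lemma colfin_mm_right: "colfin b ==> colfin(mm a b)"
 unfolding colfin_def mm_def by(metis(no_types,lifting) mult_zero_right sum.neutral)

lemma rows_bound:
 assumes "rowfin b"
 obtains M where "!!i j. j<(N :: nat) ==> M<=i ==> b j i = 0"
proof -
 have "finite(\<Union>j\<in>{..<N}. {i. b j i~=0})" using assms by(simp add:rowfin_def)
 then obtain M where "\<forall>i\<in>(\<Union>j\<in>{..<N}. {i. b j i~=0}). i<M"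
  using finite_nat_set_iff_bounded by auto
 thus thesis by(intro that[of M]) (metis(mono_tags,lifting) UN_I lessThan_iff mem_Collect_eq not_le)
qed

lemma colfin_mm_left:
 assumes "colfin a" "rowfin b"
 shows "colfin(mm a b)"
proof -
 obtain N where N: "!!i j. N<=j ==> a i j = 0" using assms(1) by(auto simp:colfin_def)
 obtain M where M: "!!i j. j<N ==> M<=i ==> b j i = 0" using rows_bound[OF assms(2)] by blast
 have "mm a b i k = 0" if "M<=k" for i k
  unfolding mm_def
 proof(rule sum.neutral,rule ballI)
  fix j assume "j:{j. a i j~=0}"
  hence "j<N" using N[of j i] by(auto simp:not_le[symmetric])
  thus "a i j * b j k = 0" using M that by simp
 qed
 thus ?thesis by(auto simp:colfin_def)
qed

text \<open>The product of words composes the two neighbouring arrows, whence one letter fewer. If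
  either word has positive degree its columns are bounded, and this survives multiplication by a
  row-finite matrix from either side.\<close>

lemma mm_wcoeffs: "a:wcoeffs(Suc l) ==> b:wcoeffs(Suc l') ==> mm a b:wcoeffs(Suc(l+l'))"
 by(cases "l = 0") (auto simp:wcoeffs_def rowfin_mm colfin_mm_left colfin_mm_right)

lemma mm_lin_right: "lin(mm a)"
 by(rule clinI) (simp_all add: mm_def fun_eq_iff distrib_left sum.distrib sum_distrib_left mult.left_commute)

lemma mm_add_left: "rowfin a ==> rowfin a' ==> mm(a+a')b = mm a b+mm a' b"
proof(intro ext)
 fix i k assume r: "rowfin a" "rowfin a'"
 let ?F = "{j. a i j~=0} \<union> {j. a' i j~=0}"
 have F: "finite ?F" using r by(simp add:rowfin_def)
 have "mm a b i k = (\<Sum>j\<in>?F. a i j * b j k)" "mm a' b i k = (\<Sum>j\<in>?F. a' i j * b j k)"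
  "mm(a+a')b i k = (\<Sum>j\<in>?F.(a+a')i j * b j k)"
  by(rule mm_eq[OF F]; auto)+
 thus "mm(a+a')b i k = (mm a b+mm a' b)i k" by(simp add:distrib_right sum.distrib)
qed

lemma mm_scale_left: "mm(c*.a)b = c*.mm a b"
 by(cases "c = 0") (simp_all add: mm_def fun_eq_iff sum_distrib_left mult.assoc)

lemma mm_lin_left: "clin(wcoeffs l)(%a. mm a b)"
 by(rule clinI) (auto simp:wcoeffs_def mm_add_left mm_scale_left)

lemma mm_assoc:
 assumes "rowfin a" "rowfin b"
 shows "mm(mm a b)c = mm a(mm b c)"
proof(intro ext)
 fix i l
 let ?J = "{j. a i j~=0}"
 let ?K = "\<Union>j\<in>?J. {k. b j k~=0}"
 have J: "finite ?J" and K: "finite ?K" using assms by(simp_all add: rowfin_def)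
 have ab: "mm a b i k = (\<Sum>j\<in>?J. a i j * b j k)" for k by(simp add:mm_def)
 have "mm(mm a b)c i l = (\<Sum>k\<in>?K. mm a b i k * c k l)"
  by(rule mm_eq[OF K]) (auto simp:ab elim!: sum.not_neutral_contains_not_neutral)
 also have "... = (\<Sum>j\<in>?J. a i j*(\<Sum>k\<in>?K. b j k * c k l))"
  unfolding ab sum_distrib_left sum_distrib_right by(subst sum.swap) (simp add:mult.assoc)
 also have "... = (\<Sum>j\<in>?J. a i j * mm b c j l)"
  by(rule sum.cong[OF refl],subst mm_eq[OF K]) auto
 finally show "mm(mm a b)c i l = mm a(mm b c)i l" by(simp add:mm_def)
qed

lemma rowfin_mone: "rowfin mone"
 by(simp add:rowfin_def mone_def)

lemma mm_mone_left: "mm mone a = a"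
proof(intro ext)
 fix i k
 have "mm mone a i k = (\<Sum>j\<in>{i}. mone i j * a j k)" by(rule mm_eq) (auto simp:mone_def split: if_splits)
 thus "mm mone a i k = a i k" by(simp add:mone_def)
qed

lemma mm_mone_right: "rowfin a ==> mm a mone = a"
 by(intro ext) (auto simp:mm_def mone_def rowfin_def if_distrib[of "%x. _ * x"] cong: if_cong)

lemma mtr_eq: "finite F ==>(!!i. a i i~=0 ==> i:F) ==> mtr a = (\<Sum>i\<in>F. a i i)"
 unfolding mtr_def by(rule sum.mono_neutral_left) auto

lemma mtr_lin: "clin(wcoeffs(Suc(Suc l)))mtr"
proof(rule clinI)
 fix a b assume "a:wcoeffs(Suc(Suc l))" "b:wcoeffs(Suc(Suc l))"
 then obtain N N' where N: "!!i j. N<=j ==> a i j = 0" "!!i j. N'<=j ==> b i j = 0" by(auto simp:wcoeffs_def colfin_def)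
 let ?F = "{..<max N N'}"
 have "mtr a = (\<Sum>i\<in>?F. a i i)" "mtr b = (\<Sum>i\<in>?F. b i i)" "mtr(a+b) = (\<Sum>i\<in>?F.(a+b)i i)"
  by(rule mtr_eq; auto simp:not_le[symmetric] N)+
 thus "mtr(a+b) = mtr a+mtr b" by(simp add:sum.distrib)
next
 fix c a
 show "mtr(c*.a) = c*.mtr a"
  by(cases "c = 0") (simp_all add: mtr_def sum_distrib_left scaleC_complex_def)
qed

text \<open>If the columns of \<open>a\<close> vanish from \<open>N\<close> on, only the first
  \<open>N\<close> rows of \<open>b\<close> matter, and these have a common finite support. Both
  traces are then the same finite double sum.\<close>

lemma mtr_commute:
 assumes "colfin a" "rowfin b"
 shows "mtr(mm a b) = mtr(mm b a)"
proof -
 obtain N where N: "!!i j. N<=j ==> a i j = 0" using assms(1) by(auto simp:colfin_def)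
 obtain M where M: "!!i j. j<N ==> M<=i ==> b j i = 0" using rows_bound[OF assms(2)] by blast
 have ab: "mm a b i k = (\<Sum>j<N. a i j * b j k)" for i k
  by(rule mm_eq) (auto simp:not_le[symmetric] N)
 have ba: "mm b a j j = (\<Sum>i<M. b j i * a i j)" if "j<N" for j
  by(rule mm_eq) (auto simp:not_le[symmetric] M[OF that])
 have "mtr(mm a b) = (\<Sum>i<M. mm a b i i)"
 proof(rule mtr_eq)
  have "mm a b i i = 0" if "M<=i" for i unfolding ab using M[OF _ that] by(intro sum.neutral) simp
  thus "i:{..<M}" if "mm a b i i~=0" for i using that by(auto simp:not_le[symmetric])
 qed simp
 also have "... = (\<Sum>j<N. \<Sum>i<M. b j i * a i j)"
  unfolding ab by(subst sum.swap) (simp add:mult.commute)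
 also have "... = (\<Sum>j<N. mm b a j j)" by(simp add:ba)
 also have "... = mtr(mm b a)"
  by(rule mtr_eq[symmetric]) (auto simp:mm_def N not_le[symmetric])
 finally show ?thesis .
qed

lemma mtr_wcoeffs_commute:
 assumes "a:wcoeffs(Suc i)" "b:wcoeffs(Suc j)" "0<i+j"
 shows "mtr(mm a b) = mtr(mm b a)"
 using assms mtr_commute[of a b] mtr_commute[of b a] by(cases "i = 0") (auto simp:wcoeffs_def)

text \<open>The matrix \<open>mr\<close> has square zero and satisfies \<open>mp mr mp = mp\<close>.\<close>

definition mp :: imat where "mp = (%i j. if i = 0&j = 0 then 1 else 0)"

definition mr :: imat where "mr = (%i j. if i<2&j<2 then(if j = 0 then 1 else-1)else 0)"

text \<open>A local right unit in the ideal: when a word of positive degree is split off, its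
  coefficient must have bounded columns, so \<open>mone\<close> would not be admissible.\<close>

definition mcut :: "nat => imat" where "mcut N = (%i j. if i = j&i<N then 1 else 0)"

lemma rowfin_bounded: "(!!i j. N<=j ==> a i j = 0) ==> rowfin a"
 unfolding rowfin_def by(metis(mono_tags,lifting) finite_nat_set_iff_bounded mem_Collect_eq not_le)

lemma wcoeffs_bounded: "(!!i j. N<=j ==> a i j = 0) ==> a:wcoeffs l"
 unfolding wcoeffs_def colfin_def using rowfin_bounded by blast

lemma mp_wcoeffs: "mp:wcoeffs l"
 by(rule wcoeffs_bounded[of 2]) (simp add:mp_def)

lemma mr_wcoeffs: "mr:wcoeffs l"
 by(rule wcoeffs_bounded[of 2]) (simp add:mr_def)

lemma mcut_wcoeffs: "mcut N:wcoeffs l"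
 by(rule wcoeffs_bounded[of N]) (simp add:mcut_def)

lemma mm_cut: "(!!i j. N<=j ==> a i j = 0) ==> mm a(mcut N) = a"
proof(intro ext)
 fix i k assume N: "!!i j. N<=j ==> a i j = 0"
 have "mm a(mcut N)i k = (\<Sum>j<N. a i j * mcut N j k)"
  by(rule mm_eq) (auto simp:not_le[symmetric] N)
 also have "... = (\<Sum>j<N. if j = k then a i j else 0)" by(rule sum.cong) (auto simp:mcut_def)
 also have "... = a i k" using N[of k i] by(auto simp:not_less)
 finally show "mm a(mcut N)i k = a i k" .
qed

lemma mp_mr: "mm mr mr = 0" "mm mp mp = mp" "mm mp(mm mr mp) = mp" "mm(mm mp mr)mr = 0" "mm(mm mp mr)(mm mp mr) = mm mp mr"
 "mm mp(mm mp mr) = mm mp mr" "mm(mm mp mr)(mm mr mp) = 0"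
 and mtr_mp: "mtr mp = 1" "mtr(mm mp mr) = 1"
proof -
 have p: "mm mp b i k = (if i = 0 then b 0 k else 0)" for b i k
  by(subst mm_eq[of "{0}"]) (auto simp:mp_def split: if_splits)
 have r: "mm mr b i k = (if i<2 then b 0 k-b 1 k else 0)" for b i k
  by(subst mm_eq[of "{0,1}"]) (auto simp:mr_def split: if_splits)
 show "mm mr mr = 0" "mm mp mp = mp" "mm mp(mm mr mp) = mp" 
  by(auto simp:fun_eq_iff p r) (auto simp:mr_def mp_def)
 have pr: "mm(mm mp mr)b i k = (if i = 0 then b 0 k-b 1 k else 0)" for b i k
  by(subst mm_eq[of "{0,1}"]) (auto simp:p mr_def split: if_splits)
 show "mm(mm mp mr)mr = 0" "mm(mm mp mr)(mm mp mr) = mm mp mr" "mm mp(mm mp mr) = mm mp mr" "mm(mm mp mr)(mm mr mp) = 0"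
  by(auto simp:fun_eq_iff p pr r) (auto simp:mr_def mp_def)
 show "mtr mp = 1" by(subst mtr_eq[of "{0}"]) (auto simp:mp_def split: if_splits)
 show "mtr(mm mp mr) = 1" by(subst mtr_eq[of "{0}"]) (auto simp:p mr_def split: if_splits)
qed

section \<open>The infinite swindle\<close>

text \<open>The matrix \<open>ups a\<close> is an infinite direct sum of copies of \<open>a\<close> and of zeros. The bijection \<open>swr\<close>
 of \<open>{1, 2} \<times> nat\<close> adds one more copy of \<open>a\<close>, and with it infinitely many zeros, to \<open>ups a\<close>.\<close>

definition enc :: "nat\<times>nat+nat => nat" where
 "enc x = sum_encode(case x of Inl a => Inl(prod_encode a) | Inr y => Inr y)"

definition dec :: "nat => nat\<times>nat+nat" where
 "dec i = (case sum_decode i of Inl a => Inl(prod_decode a) | Inr y => Inr y)"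

lemma dec_enc [simp]: "dec(enc x) = x"
 by(cases x) (simp_all add: enc_def dec_def)

lemma enc_dec [simp]: "enc(dec i) = i"
proof -
 have *: "sum_encode(sum_decode i) = i" by simp
 show ?thesis
  using * by(cases "sum_decode i") (simp_all add: enc_def dec_def del:sum_decode_inverse)
qed

definition ups :: "imat => imat" where
 "ups a i j = (case(dec i,dec j)of(Inl(k,x),Inl(l,y)) => if k = l then a x y else 0 | _ => 0)"

text \<open>Sends row indices of \<open>diag(0, ups a)\<close> to row indices of
  \<open>diag(a, ups a)\<close>. Copy 0 goes to the additional copy and copy \<open>k\<close> to
  copy \<open>k - 1\<close>; the empty block 1 goes to the even zero coordinates and the old zero
  coordinates go to the odd ones.\<close>

definition swr :: "2\<times>nat => 2\<times>nat" where
 "swr p = (if fst p = 1 then(2,enc(Inr(2 * snd p)))else(case dec(snd p)of Inl(k,x) => if k = 0 then(1,x)else(2,enc(Inl(k-1,x))) | Inr y =>(2,enc(Inr(2 * y+1)))))"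

definition swl :: "2\<times>nat => 2\<times>nat" where
 "swl p = (if fst p = 1 then(2,enc(Inl(0,snd p)))else(case dec(snd p)of Inl(k,x) =>(2,enc(Inl(Suc k,x))) | Inr y => if even y then(1,y div 2)else(2,enc(Inr(y div 2)))))"

lemma swr_swl: "swr(swl p) = p" and swl_swr: "swl(swr p) = p"
proof -
 obtain a x where p: "p = (a,x)" by(cases p)
 show "swr(swl p) = p"
 proof(cases "a = 1")
  case False
  hence a: "a = 2" using exhaust_2[of a] by simp
  have "x = enc(dec x)" by simp
  thus ?thesis
  by(cases "dec x") (auto simp:p a swr_def swl_def elim!: oddE evenE simp del:enc_dec split: prod.split)
 qed(simp add:p swr_def swl_def)
 show "swl(swr p) = p"
 proof(cases "a = 1")
  case False
  hence a: "a = 2" using exhaust_2[of a] by simp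
  have "x = enc(dec x)" by simp
  thus ?thesis
  by(cases "dec x") (auto simp:p a swr_def swl_def simp del:enc_dec split: prod.split)
 qed(simp add:p swr_def swl_def)
qed

text \<open>The blocks of the permutation matrix of \<open>s\<close>, as a 2 by 2 matrix of infinite
  matrices.\<close>

definition blk :: "(2\<times>nat => 2\<times>nat) => 2 => 2 => imat" where
 "blk s a b i j = (if s(a,i) = (b,j)then 1 else 0)"

lemma rowfin_blk: "rowfin(blk s a b)"
proof -
 have "{j. blk s a b i j~=0} \<subseteq> {snd(s(a,i))}" for i by(auto simp:blk_def split: if_splits)
 thus ?thesis unfolding rowfin_def using finite_subset by blast
qed

lemma mm_blk_left: "mm(blk s a c)x i k = (if fst(s(a,i)) = c then x(snd(s(a,i)))k else 0)"
 by(subst mm_eq[of "{snd(s(a,i))}"]) (auto simp:blk_def prod_eq_iff split: if_splits)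

text \<open>Multiplication from the right selects columns and therefore uses the inverse bijection
  \<open>swl\<close>.\<close>

lemma mm_blk_right:
 assumes "rowfin x"
 shows "mm x(blk swr c b)i k = (if fst(swl(b,k)) = c then x i(snd(swl(b,k)))else 0)"
proof -
 have "blk swr c b j k = (if fst(swl(b,k)) = c&j = snd(swl(b,k))then 1 else 0)" for j
  using swr_swl[of "(b,k)"] swl_swr[of "(c,j)"] by(auto simp:blk_def prod_eq_iff)
 hence "mm x(blk swr c b)i k = (\<Sum>j | x i j~=0. if j = snd(swl(b,k))then(if fst(swl(b,k)) = c then x i j else 0)else 0)"
  unfolding mm_def by(intro sum.cong) auto
 thus ?thesis using rowfinD[OF assms,of i] by(auto simp:if_distrib cong: if_cong)
qed

lemma blk_inverse:
 assumes "!!p. s'(s p) = p"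
 shows "(\<Sum>c\<in>UNIV. mm(blk s a c)(blk s' c b)) = (if a = b then mone else 0)"
proof(intro ext)
 fix i k
 have "(\<Sum>c\<in>UNIV. mm(blk s a c)(blk s' c b))i k = (\<Sum>c\<in>UNIV. if fst(s(a,i)) = c then blk s' c b(snd(s(a,i)))k else 0)"
  unfolding sum_fun_apply mm_blk_left by simp
 also have "... = (if s'(s(a,i)) = (b,k)then 1 else 0)" by(simp add:blk_def)
 finally show "(\<Sum>c\<in>UNIV. mm(blk s a c)(blk s' c b))i k = (if a = b then mone else 0)i k"
  by(simp add:assms mone_def)
qed

lemma rowfin_ups:
 assumes "rowfin a"
 shows "rowfin(ups a)"
 unfolding rowfin_def
proof
 fix i
 show "finite {j. ups a i j~=0}"
 proof(cases "dec i")
  case(Inl p)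
  then obtain k x where p: "dec i = Inl(k,x)" by(cases p) auto
  have "{j. ups a i j~=0} \<subseteq>(%y. enc(Inl(k,y))) ` {y. a x y~=0}"
  proof
  fix j assume "j:{j. ups a i j~=0}"
  then obtain y where "dec j = Inl(k,y)" "a x y~=0" by(auto simp:ups_def p split: sum.splits prod.splits if_splits)
  thus "j:(%y. enc(Inl(k,y))) ` {y. a x y~=0}" by(metis(mono_tags,lifting) enc_dec image_eqI mem_Collect_eq)
  qed
  thus ?thesis using rowfinD[OF assms,of x] by(meson finite_imageI finite_subset)
 qed(simp add:ups_def)
qed

lemma lin_ups: "lin ups"
 by(rule clinI) (auto simp:fun_eq_iff ups_def split: sum.split)

lemma ups_mm:
 assumes "rowfin a"
 shows "ups(mm a b) = mm(ups a)(ups b)"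
proof(intro ext)
 fix i k
 show "ups(mm a b)i k = mm(ups a)(ups b)i k"
 proof(cases "dec i")
  case(Inl p)
  then obtain l x where p: "dec i = Inl(l,x)" by(cases p) auto
  let ?J = "{y. a x y~=0}" and ?e = "%y. enc(Inl(l,y))"
  have inj: "inj_on ?e ?J" by(rule inj_onI) (metis dec_enc prod.inject sum.inject(1))
  have "mm(ups a)(ups b)i k = (\<Sum>j\<in>?e ` ?J. ups a i j * ups b j k)"
  proof(rule mm_eq)
  show "finite(?e ` ?J)" using rowfinD[OF assms] by simp
  fix j assume "ups a i j~=0"
  then obtain y where "dec j = Inl(l,y)" "a x y~=0" by(auto simp:ups_def p split: sum.splits prod.splits if_splits)
  thus "j : ?e ` ?J" by(metis(mono_tags,lifting) enc_dec image_eqI mem_Collect_eq)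
  qed
  also have "... = (\<Sum>y\<in>?J. a x y * ups b(?e y)k)"
  by(simp add:sum.reindex[OF inj] ups_def[of a] p)
  also have "... = ups(mm a b)i k" by(auto simp:ups_def p mm_def split: sum.split)
  finally show ?thesis by simp
 qed(simp add:ups_def mm_def)
qed

text \<open>The swindle itself: permuting the rows of \<open>diag(x, ups x)\<close> by
  \<open>swr\<close> gives the same matrix as permuting the columns of
  \<open>diag(0, ups x)\<close>. It is checked coordinate by coordinate.\<close>

lemma blk_conj:
 assumes "rowfin x"
 shows "(\<Sum>c\<in>UNIV. mm(blk swr a c)(if c = b then(if c = 1 then x else ups x)else 0)) = (\<Sum>c\<in>UNIV. mm(if a = c&c = 2 then ups x else 0)(blk swr c b))"
proof(intro ext)
 fix i k
 obtain u v where i: "i = enc u" and k: "k = enc v" by(metis enc_dec)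
 let ?F = "%c. if c = b then(if c = 1 then x else ups x)else 0" and ?G = "%c. if a = c&c = 2 then ups x else 0"
 have G: "rowfin(?G c)" for c by(simp add:rowfin_ups[OF assms] rowfin_zero)
 have ab: "a = 1 \<or> a = 2" "b = 1 \<or> b = 2" using exhaust_2 by blast+
 have "(\<Sum>c\<in>UNIV. mm(blk swr a c)(?F c))i k = ?F(fst(swr(a,i)))(snd(swr(a,i)))k"
  unfolding sum_fun_apply mm_blk_left by simp
 also have "... = ?G(fst(swl(b,k)))i(snd(swl(b,k)))"
  using ab by(elim disjE; cases u; cases v)
  (auto simp:i k swr_def swl_def ups_def split: prod.split)
 also have "... = (\<Sum>c\<in>UNIV. mm(?G c)(blk swr c b))i k"
  unfolding sum_fun_apply mm_blk_right[OF G] by simp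
 finally show "(\<Sum>c\<in>UNIV. mm(blk swr a c)(?F c))i k = (\<Sum>c\<in>UNIV. mm(?G c)(blk swr c b))i k" .
qed

section \<open>Words of composable arrows\<close>

type_synonym('o,'m) arrow = "'o \<times> 'm \<times> 'o"

abbreviation tgt :: "('o,'m)arrow => 'o" where "tgt e == fst e"
abbreviation mor :: "('o,'m)arrow => 'm" where "mor e == fst(snd e)"
abbreviation src :: "('o,'m)arrow => 'o" where "src e == snd(snd e)"

text \<open>Exactly three letters of the prescribed alphabet for each arrow, both endpoints included
  because Hom spaces may overlap; the fixed length makes the code injective.\<close>

primrec arrow_code :: "('o,'m)arrow list =>('o + 'm+imat)list" where
 "arrow_code [] = []"
| "arrow_code(e#es) = Inl(tgt e)#Inr(Inl(mor e))#Inl(src e)#arrow_code es"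

definition word_code :: "imat =>('o,'m)arrow list =>('o + 'm+imat)list" where
 "word_code c es = Inr(Inr c)#arrow_code es"

lemma arrow_code_inj: "arrow_code es = arrow_code es' ==> es = es'"
proof(induction es arbitrary: es')
 case Nil
 thus ?case by(cases es') auto
next
 case(Cons e es)
 thus ?case by(cases es') (auto simp:prod_eq_iff)
qed

text \<open>Arbitrary on letter sequences that are not codes; the later constructions vanish on, or
  never meet, such sequences after passing to \<open>word\<close>.\<close>

definition word_decode :: "('o + 'm+imat)list => imat \<times>('o,'m)arrow list" where
 "word_decode w = (SOME p. word_code(fst p)(snd p) = w)"

lemma word_decode_code [simp]: "word_decode(word_code c es) = (c,es)"
proof -
 have "word_code(fst(word_decode(word_code c es)))(snd(word_decode(word_code c es))) = word_code c es"
  unfolding word_decode_def by(rule someI[of _ "(c,es)"]) simp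
 thus ?thesis by(auto simp:word_code_def prod_eq_iff dest:arrow_code_inj)
qed

definition free_ext :: "(imat =>('o,'m)arrow list => 'a::complex_vector) =>('o,'m)word_space => 'a" where
 "free_ext \<phi> p = (\<Sum>w\<in>Poly_Mapping.keys p. Poly_Mapping.lookup p w*.case_prod \<phi>(word_decode w))"

lemma lin_free_ext:
 fixes \<phi> :: "imat =>('o,'m)arrow list => 'a::complex_vector"
 shows "lin(free_ext \<phi>)"
proof(rule clinI)
 have ext: "free_ext \<phi> r = (\<Sum>w\<in>K. Poly_Mapping.lookup r w*.case_prod \<phi>(word_decode w))"
  if "finite K" "Poly_Mapping.keys r \<subseteq> K" for r K
  unfolding free_ext_def using that by(intro sum.mono_neutral_left) (auto simp:in_keys_iff)
 fix p q :: "('o,'m)word_space" and c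
 let ?K = "Poly_Mapping.keys p \<union> Poly_Mapping.keys q"
 show "free_ext \<phi>(p+q) = free_ext \<phi> p+free_ext \<phi> q"
  using ext[of ?K p] ext[of ?K q] ext[of ?K "p+q"] Poly_Mapping.keys_add[of p q]
  by(simp add:lookup_add scaleC_add_left sum.distrib)
 show "free_ext \<phi>(c*.p) = c*.free_ext \<phi> p"
  using ext[of "Poly_Mapping.keys p" "c*.p"] keys_scaleC[of c p]
  by(simp add:free_ext_def lookup_scaleC scaleC_complex_def cscale_sum_right)
qed

lemma free_ext_single: "free_ext \<phi>(sgl(word_code c es) 1) = \<phi> c es"
 by(simp add:free_ext_def scaleC_one)

lemma clin_free_ext_fun:
 "(!!c es. clin A(%x. \<phi> x c es)) ==> clin A(%x. free_ext(\<phi> x)p)"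
 unfolding free_ext_def by(intro clin_setsum clin_scaleC) (simp add:case_prod_beta)

lemma span_lin_eq:
 assumes "x:cspan B" "lin f" "lin g" "!!b. b:B ==> f b = g b"
 shows "f x = g x"
 using assms(1)
proof(induction rule: cspan_induct_alt)
 case base
 show ?case using clin_zero[OF assms(2)] clin_zero[OF assms(3)] by simp
next
 case(step c x y)
 thus ?case
  by(simp add:clin_add[OF assms(2)] clin_add[OF assms(3)] clin_scale[OF assms(2)]
  clin_scale[OF assms(3)] assms(4))
qed

lemma span_lin_in:
 assumes "x:cspan B" "lin f" "csub A" "!!b. b:B ==> f b:A"
 shows "f x:A"
 using assms(1)
proof(induction rule: cspan_induct_alt)
 case base
 show ?case using clin_zero[OF assms(2)] csub_0[OF assms(3)] by simp
next
 case(step c x y)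
 thus ?case
  by(simp add:clin_add[OF assms(2)] clin_scale[OF assms(2)] assms(4)
  csub_add[OF assms(3)] csub_scale[OF assms(3)])
qed

context hopf
begin

lemma sw_add: "mlin n F ==> mlin n G ==> sw n(%ks. F ks+G ks)h = sw n F h+sw n G h"
 using sw_sum[of UNIV n "%b. if b then F else G" h] by(simp add:UNIV_bool add.commute)

lemma sw_scale: "mlin n F ==> sw n(%ks. c*.F ks)h = c*.sw n F h"
 by(rule sw_lin[symmetric],assumption,intro li)

lemma clin_sw_fun:
 assumes "!!x. x:A ==> mlin n(F x)" "!!ks. length ks = Suc n ==> clin A(%x. F x ks)"
 shows "clin A(%x. sw n(F x)h)"
proof(rule clinI)
 fix x y assume xy: "x:A" "y:A"
 have "sw n(F(x+y))h = sw n(%ks. F x ks+F y ks)h"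
  by(rule sw_cong) (rule clin_add[OF assms(2) xy])
 thus "sw n(F(x+y))h = sw n(F x)h+sw n(F y)h" by(simp add:sw_add assms(1) xy)
next
 fix c x assume x: "x:A"
 have "sw n(F(c*.x))h = sw n(%ks. c*.F x ks)h"
  by(rule sw_cong) (rule clin_scale[OF assms(2) x])
 thus "sw n(F(c*.x))h = c*.sw n(F x)h" by(simp add:sw_scale assms(1) x)
qed

lemma sw_swap:
 assumes "!!ls. length ls = Suc m ==> mlin n(%ks. G ks ls)" "!!ks. length ks = Suc n ==> mlin m(G ks)"
 shows "sw n(%ks. sw m(G ks)b)a = sw m(%ls. sw n(%ks. G ks ls)a)b"
 using assms
proof(induction n arbitrary: G a)
 case(Suc n)
 have IH: "sw n(%ks. sw m(G(h1#ks))b)h2 = sw m(%ls. sw n(%ks. G(h1#ks)ls)h2)b" for h1 h2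
  by(rule Suc.IH) (use Suc.prems in auto)
 show ?case
  unfolding sweedler_list.simps IH
 proof(rule sw_tensor_lift[symmetric])
  show "mlin m(%ls. sw n(%ks. G(h1#ks)ls)h2)" for h1 h2
  proof(rule mlinI,rule lin_sw_fun)
  fix ls :: "'h list" and i x assume "length ls = Suc m" "i<=m"
  thus "mlin n(%ks. G(h1#ks)(ls[i := x]))" using Suc.prems(1)[of "ls[i := x]"] by simp
  show "lin(%x. G(h1#ks)(ls[i := x]))" if "length ks = Suc n" for ks
  using mlinD[OF Suc.prems(2)] that \<open>length ls = Suc m\<close> \<open>i \<le> m\<close> by simp
  qed
  show "bilin(%h1 h2. sw n(%ks. G(h1#ks)ls)h2)" if "length ls = Suc m" for ls
  by(rule bilin_sw[OF Suc.prems(1)[OF that]])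
 qed
qed simp

lemma mlin_prod:
 fixes F :: "'h list => 'a::complex_vector" and G :: "'h list => 'b::complex_vector"
 assumes F: "mlin i F" and G: "mlin j G" and B: "bilin B"
 shows "mlin(Suc(i+j))(%ks. B(F(take(Suc i)ks))(G(drop(Suc i)ks)))"
proof(rule mlinI)
 fix ks :: "'h list" and l assume ks: "length ks = Suc(Suc(i+j))" and l: "l<=Suc(i+j)"
 show "lin(%h. B(F(take(Suc i)(ks[l := h])))(G(drop(Suc i)(ks[l := h]))))"
 proof(cases "l<=i")
  case True
  thus ?thesis
  using lin_comp[OF bilinD2[OF B,of "G(drop(Suc i)ks)"] mlinD[OF F,of "take(Suc i)ks" l]] ks
  by(simp add:take_update_swap)
 next
  case False
  hence "drop(Suc i)(ks[l := h]) = (drop(Suc i)ks)[l-Suc i := h]" for h by(simp add:drop_update_swap)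
  thus ?thesis
  using lin_comp[OF bilinD1[OF B,of "F(take(Suc i)ks)"] mlinD[OF G,of "drop(Suc i)ks" "l-Suc i"]] ks l False
  by simp
 qed
qed

end

context cochain_data
begin

section \<open>Multilinear words as elements of the prescribed ambient space\<close>

definition arr :: "('o,'m)arrow => bool" where
 "arr e \<longleftrightarrow> tgt e:obj D&src e:obj D&mor e:hom D(src e)(tgt e)"

definition wpath :: "('o,'m)arrow list => bool" where
 "wpath es \<longleftrightarrow> es~=[]&(\<forall>e\<in>set es. arr e)&successively(%a b. src a = tgt b)es"

definition wvalid :: "imat =>('o,'m)arrow list => bool" where
 "wvalid c es \<longleftrightarrow> wpath es&c:wcoeffs(length es)"

lemma wpath_split:
 "wpath(as@e#bs) \<longleftrightarrow>(as = [] \<or> wpath as&src(last as) = tgt e)&arr e&(bs = [] \<or> wpath bs&src e = tgt(hd bs))"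
 by(cases bs) (auto simp:wpath_def successively_append_iff successively_Cons)

lemma wpath_Cons: "wpath(e#bs) \<longleftrightarrow> arr e&(bs = [] \<or> wpath bs&src e = tgt(hd bs))"
 using wpath_split[of "[]"] by simp

lemma wpath_snoc: "wpath(as@[e]) \<longleftrightarrow>(as = [] \<or> wpath as&src(last as) = tgt e)&arr e"
 using wpath_split[of as e "[]"] by simp

lemma wpath_nth: "wpath es ==> i<length es ==> arr(es!i)"
 by(auto simp:wpath_def)

lemma wpath_src_tgt: "wpath es ==> Suc i<length es ==> src(es!i) = tgt(es!Suc i)"
 by(simp add:wpath_def successively_conv_nth)

lemma wpathI: "es~=[] ==>(!!i. i<length es ==> arr(es!i)) ==>(!!i. Suc i<length es ==> src(es!i) = tgt(es!Suc i)) ==> wpath es"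
 unfolding wpath_def successively_conv_nth by(metis in_set_conv_nth)

text \<open>The functions that should factor through the tensor product of the coefficient space and
  the Hom spaces along a path. Nothing is asked about lists that are not paths.\<close>

definition multi :: "(imat =>('o,'m)arrow list => 'a::complex_vector) => bool" where
 "multi \<phi> \<longleftrightarrow>(\<forall>es. wpath es-->clin(wcoeffs(length es))(%c. \<phi> c es))&(\<forall>c as X f Y bs. wvalid c(as@(X,f,Y)#bs)-->clin(hom D Y X)(%f. \<phi> c(as@(X,f,Y)#bs)))"

lemma multiI:
 assumes "!!es. wpath es ==> clin(wcoeffs(length es))(%c. \<phi> c es)"
  and "!!c as X f Y bs. wvalid c(as@(X,f,Y)#bs) ==> clin(hom D Y X)(%f. \<phi> c(as@(X,f,Y)#bs))"
 shows "multi \<phi>"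
 using assms by(auto simp:multi_def)

lemma multi_coeff: "multi \<phi> ==> wpath es ==> clin(wcoeffs(length es))(%c. \<phi> c es)"
 and multi_slot: "multi \<phi> ==> wvalid c(as@(X,f,Y)#bs) ==> clin(hom D Y X)(%f. \<phi> c(as@(X,f,Y)#bs))"
 unfolding multi_def by blast+

lemma wvalid_slot: "wvalid c(as@(X,f,Y)#bs) ==> f':hom D Y X ==> wvalid c(as@(X,f',Y)#bs)"
 by(auto simp:wvalid_def wpath_split arr_def)

definition relators :: "('o,'m)word_space set" where
 "relators = (let w = %c es. sgl(word_code c es) 1 in {w(c+c')es-w c es-w c' es | c c' es. wpath es&c:wcoeffs(length es)&c':wcoeffs(length es)} \<union> {w(z*.c)es-z*.w c es | z c es. wpath es&c:wcoeffs(length es)} \<union> {w c(as@(X,f+f',Y)#bs)-w c(as@(X,f,Y)#bs)-w c(as@(X,f',Y)#bs) | c as X f f' Y bs. wvalid c(as@(X,f,Y)#bs)&f:hom D Y X&f':hom D Y X} \<union> {w c(as@(X,z*.f,Y)#bs)-z*.w c(as@(X,f,Y)#bs) | z c as X f Y bs. wvalid c(as@(X,f,Y)#bs)&f:hom D Y X})"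

lemma free_ext_relators:
 assumes \<phi>: "multi \<phi>" and x: "x:cspan relators"
 shows "free_ext \<phi> x = 0"
proof(rule span_lin_eq[OF x lin_free_ext])
 note d = clin_diff[OF lin_free_ext csub_UNIV UNIV_I UNIV_I]
  clin_scale[OF lin_free_ext UNIV_I] free_ext_single
 fix b assume "b:relators"
 thus "free_ext \<phi> b = 0"
  unfolding relators_def Let_def
 proof(elim UnE)
  assume "b:{sgl(word_code(c+c')es) 1-sgl(word_code c es) 1-sgl(word_code c' es) 1 | c c' es. wpath es&c:wcoeffs(length es)&c':wcoeffs(length es)}"
  thus ?thesis using clin_add[OF multi_coeff[OF \<phi>]] by(force simp:d)
 next
  assume "b:{sgl(word_code(z*.c)es) 1-z*.sgl(word_code c es) 1 | z c es. wpath es&c:wcoeffs(length es)}"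
  thus ?thesis using clin_scale[OF multi_coeff[OF \<phi>]] by(force simp:d)
 next
  assume "b:{sgl(word_code c(as@(X,f+f',Y)#bs)) 1-sgl(word_code c(as@(X,f,Y)#bs)) 1-sgl(word_code c(as@(X,f',Y)#bs)) 1 | c as X f f' Y bs. wvalid c(as@(X,f,Y)#bs)&f:hom D Y X&f':hom D Y X}"
  thus ?thesis using clin_add[OF multi_slot[OF \<phi>]] by(force simp:d)
 next
  assume "b:{sgl(word_code c(as@(X,z*.f,Y)#bs)) 1-z*.sgl(word_code c(as@(X,f,Y)#bs)) 1 | z c as X f Y bs. wvalid c(as@(X,f,Y)#bs)&f:hom D Y X}"
  thus ?thesis using clin_scale[OF multi_slot[OF \<phi>]] by(force simp:d)
 qed
qed(rule li)

text \<open>Hom spaces have to be subspaces of the given ambient type, so the quotient by the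
  relations is realised as the kernel of a chosen projection onto their span.\<close>

definition relator_proj :: "('o,'m)word_space =>('o,'m)word_space" where
 "relator_proj = (SOME P. lin P&(\<forall>x. P x:cspan relators)&(\<forall>x\<in>cspan relators. P x = x))"

lemma relator_proj: "lin relator_proj" "relator_proj x:cspan relators"
 "x:cspan relators ==> relator_proj x = x"
proof -
 obtain P :: "('o,'m)word_space =>('o,'m)word_space" where
  "lin P" "!!x. P x:cspan relators" "!!x. x:cspan relators ==> P x = x"
  using sub_projection[OF csub_span[of relators]] by blast
 hence "\<exists>P. lin P&(\<forall>x. P x:cspan relators)&(\<forall>x\<in>cspan relators. P x = x)" by blast
 from someI_ex[OF this,folded relator_proj_def]
 show "lin relator_proj" "relator_proj x:cspan relators"
  "x:cspan relators ==> relator_proj x = x" by blast+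
qed

text \<open>The words span a complement of the relations, so that they are multilinear and universal.\<close>

definition word :: "imat =>('o,'m)arrow list =>('o,'m)word_space" where
 "word c es = sgl(word_code c es) 1-relator_proj(sgl(word_code c es) 1)"

text \<open>The universal property: a multilinear function vanishes on the relations, so the
  correction by \<open>relator_proj\<close> does not change its value.\<close>

lemma free_ext_word: "multi \<phi> ==> free_ext \<phi>(word c es) = \<phi> c es"
 by(simp add:word_def clin_diff[OF lin_free_ext] free_ext_single free_ext_relators relator_proj(2))

lemma multi_word: "multi word"
proof -
 define q where "q x = x-relator_proj x" for x
 have q: "lin q" unfolding q_def by(intro li relator_proj(1))
 have q0: "q x = 0" if "x:relators" for x
  by(simp add:q_def relator_proj(3) cspan_base that)
 note qd = clin_diff[OF q csub_UNIV UNIV_I UNIV_I] clin_scale[OF q UNIV_I]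
 have w: "word c es = q(sgl(word_code c es) 1)" for c es by(simp add:word_def q_def)
 show ?thesis
 proof(rule multiI; rule clinI)
  fix es c c' assume "wpath es" "c:wcoeffs(length es)" "c':wcoeffs(length es)"
  hence "sgl(word_code(c+c')es) 1-sgl(word_code c es) 1-sgl(word_code c' es) 1:relators"
  unfolding relators_def Let_def by blast
  from q0[OF this] show "word(c+c')es = word c es+word c' es" unfolding w qd by(simp add:algebra_simps)
 next
  fix es z c assume "wpath es" "c:wcoeffs(length es)"
  hence "sgl(word_code(z*.c)es) 1-z*.sgl(word_code c es) 1:relators"
  unfolding relators_def Let_def by blast
  from q0[OF this] show "word(z*.c)es = z*.word c es" unfolding w qd by simp
 next
  fix c as X g Y bs f f'
  assume v: "wvalid c(as@(X,g,Y)#bs)" and f: "f:hom D Y X" "f':hom D Y X"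
  from wvalid_slot[OF v f(1)] f have "sgl(word_code c(as@(X,f+f',Y)#bs)) 1-sgl(word_code c(as@(X,f,Y)#bs)) 1-sgl(word_code c(as@(X,f',Y)#bs)) 1:relators"
  unfolding relators_def Let_def by blast
  from q0[OF this] show "word c(as@(X,f+f',Y)#bs) = word c(as@(X,f,Y)#bs)+word c(as@(X,f',Y)#bs)"
  unfolding w qd by(simp add:algebra_simps)
 next
  fix c as X g Y bs z f
  assume v: "wvalid c(as@(X,g,Y)#bs)" and f: "f:hom D Y X"
  from wvalid_slot[OF v f] f have "sgl(word_code c(as@(X,z*.f,Y)#bs)) 1-z*.sgl(word_code c(as@(X,f,Y)#bs)) 1:relators"
  unfolding relators_def Let_def by blast
  from q0[OF this] show "word c(as@(X,z*.f,Y)#bs) = z*.word c(as@(X,f,Y)#bs)"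
  unfolding w qd by simp
 qed
qed

lemma multi_zero: "multi(%c es. 0)"
 by(rule multiI) (rule clin_const_zero)+

text \<open>Length and endpoints of a word do not change when the morphism in a slot varies, so a
  condition on them cannot destroy linearity.\<close>

lemma multi_if:
 assumes "multi \<phi>"
 shows "multi(%c es. if G(length es)(tgt(hd es))(src(last es))then \<phi> c es else 0)"
proof(rule multiI)
 fix c as X f Y bs assume v: "wvalid c(as@(X,f,Y)#bs)"
 have "\<exists>t. \<forall>f. tgt(hd(as@(X,f,Y)#bs)) = t" "\<exists>s. \<forall>f. src(last(as@(X,f,Y)#bs)) = s"
  by(cases as; simp) (cases bs; simp)
 then obtain t s where t: "!!f. tgt(hd(as@(X,f,Y)#bs)) = t" and s: "!!f. src(last(as@(X,f,Y)#bs)) = s" by blast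
 have l: "length(as@(X,f,Y)#bs) = length as+Suc(length bs)" for f by simp
 show "clin(hom D Y X)(%f. if G(length(as@(X,f,Y)#bs))(tgt(hd(as@(X,f,Y)#bs)))(src(last(as@(X,f,Y)#bs)))then \<phi> c(as@(X,f,Y)#bs)else 0)"
  unfolding t s l by(intro clin_if multi_slot[OF assms v] clin_const_zero)
qed(auto intro:clin_if clin_const_zero multi_coeff[OF assms])

section \<open>Composition and action of arrows, and the product and action they induce on
  words\<close>

definition acomp :: "('o,'m)arrow =>('o,'m)arrow =>('o,'m)arrow" where
 "acomp a b = (tgt a,comp D(src b)(src a)(tgt a)(mor a)(mor b),src b)"

definition hact :: "'h =>('o,'m)arrow =>('o,'m)arrow" where
 "hact k e = (tgt e,act D(src e)(tgt e)k(mor e),src e)"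

lemma tgt_acomp [simp]: "tgt(acomp a b) = tgt a" and src_acomp [simp]: "src(acomp a b) = src b"
 and tgt_hact [simp]: "tgt(hact k e) = tgt e" and src_hact [simp]: "src(hact k e) = src e"
 by(simp_all add: acomp_def hact_def)

lemma arr_acomp: "arr a ==> arr b ==> src a = tgt b ==> arr(acomp a b)"
 by(auto simp:arr_def acomp_def intro:D_comp)

lemma arr_hact: "arr e ==> arr(hact k e)"
 by(auto simp:arr_def hact_def intro:D_act)

lemma acomp_assoc: "arr a ==> arr b ==> arr c ==> src a = tgt b ==> src b = tgt c ==> acomp(acomp a b)c = acomp a(acomp b c)"
 using semicat by(auto simp:arr_def acomp_def lHsemi_def)

lemma hact_one: "arr e ==> hact 1 e = e"
 using semicat by(cases e) (auto simp:arr_def hact_def lHsemi_def)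

lemma hact_mult: "arr e ==> hact(a * b)e = hact a(hact b e)"
 using semicat by(cases e) (auto simp:arr_def hact_def lHsemi_def)

text \<open>An identity is chosen together with its invariance, which is guaranteed for an
  \<open>H\<close>-category and later makes \<open>iota\<close> and \<open>theta\<close>
  invariant.\<close>

definition aident :: "'o =>('o,'m)arrow" where
 "aident X = (X,SOME e. is_identity D X e&(\<forall>h. act D X X h e = \<epsilon> h*.e),X)"

lemma tgt_aident [simp]: "tgt(aident X) = X" and src_aident [simp]: "src(aident X) = X"
 by(simp_all add: aident_def)

lemma aident:
 assumes X: "X:obj D"
 shows "arr(aident X)" "hact h(aident X) = (X,\<epsilon> h*.mor(aident X),X)"
  "arr e ==> src e = X ==> acomp e(aident X) = e" "arr e ==> tgt e = X ==> acomp(aident X)e = e"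
proof -
 have "\<exists>e. is_identity D X e&(\<forall>h. act D X X h e = \<epsilon> h*.e)" using D X by(auto simp:left_H_category_def)
 from someI_ex[OF this] have "is_identity D X(mor(aident X))" "!!h. act D X X h(mor(aident X)) = \<epsilon> h*.mor(aident X)"
  by(simp_all add: aident_def)
 thus "arr(aident X)" "hact h(aident X) = (X,\<epsilon> h*.mor(aident X),X)"
  "arr e ==> src e = X ==> acomp e(aident X) = e" "arr e ==> tgt e = X ==> acomp(aident X)e = e"
  using X by(simp_all add: arr_def hact_def acomp_def is_identity_def prod_eq_iff)
qed

definition hacts :: "'h list =>('o,'m)arrow list =>('o,'m)arrow list" where
 "hacts ks es = map2 hact ks es"

lemma hacts_simps [simp]: "hacts [] es = []" "hacts ks [] = []" "hacts(k#ks)(e#es) = hact k e#hacts ks es"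
 by(simp_all add: hacts_def)

lemma length_hacts [simp]: "length(hacts ks es) = min(length ks)(length es)"
 by(simp add:hacts_def)

lemma hacts_split:
 "length ks = Suc(length as+length bs) ==> hacts ks(as@e#bs) = hacts(take(length as)ks)as@hact(ks!length as)e#hacts(drop(Suc(length as))ks)bs"
proof -
 assume l: "length ks = Suc(length as+length bs)"
 have "ks = take(length as)ks@ks!length as#drop(Suc(length as))ks"
  using id_take_nth_drop[of "length as" ks] l by simp
 moreover have "hacts(us@u#vs)(as@e#bs) = hacts us as@hact u e#hacts vs bs" if "length us = length as" for us u vs
  using that by(simp add:hacts_def)
 moreover have "length(take(length as)ks) = length as" using l by simp
 ultimately show ?thesis by metis
qed

lemma wpath_hacts:
 assumes "wpath es" "length ks = length es"
 shows "wpath(hacts ks es)" "tgt(hd(hacts ks es)) = tgt(hd es)" "src(last(hacts ks es)) = src(last es)"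
proof -
 have ne: "es~=[]" using assms by(auto simp:wpath_def)
 have nth: "hacts ks es!i = hact(ks!i)(es!i)" if "i<length es" for i using assms that by(simp add:hacts_def)
 have len: "length(hacts ks es) = length es" using assms by simp
 have n2: "hacts ks es~=[]" using len ne by(metis length_0_conv)
 show "wpath(hacts ks es)"
 proof(rule wpathI[OF n2])
  show "arr(hacts ks es!i)" if "i<length(hacts ks es)" for i
  using that unfolding len by(simp add:nth arr_hact wpath_nth[OF assms(1)])
  show "src(hacts ks es!i) = tgt(hacts ks es!Suc i)" if "Suc i<length(hacts ks es)" for i
  using that unfolding len by(simp add:nth wpath_src_tgt[OF assms(1)])
 qed
 show "tgt(hd(hacts ks es)) = tgt(hd es)" "src(last(hacts ks es)) = src(last es)"
  using ne n2 len nth[of 0] nth[of "length es-1"] by(simp_all add: hd_conv_nth last_conv_nth del:length_hacts)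
qed

lemma wvalid_hacts: "wvalid c es ==> length ks = length es ==> wvalid c(hacts ks es)"
 by(simp add:wvalid_def wpath_hacts)

lemma mlin_multi_hacts:
 assumes \<phi>: "multi \<phi>" and v: "wvalid c es" and l: "length es = Suc n"
 shows "mlin n(%ks. \<phi> c(hacts ks es))"
proof(rule mlinI)
 fix ks :: "'h list" and i assume ks: "length ks = Suc n" and i: "i<=n"
 let ?ys = "hacts ks es" and ?e = "es!i"
 have e: "arr ?e" using v i l by(simp add:wvalid_def wpath_nth)
 have up: "hacts(ks[i := h])es = take i ?ys@(tgt ?e,act D(src ?e)(tgt ?e)h(mor ?e),src ?e)#drop(Suc i) ?ys" for h
  using map2_update_left[of ks es hact i h] ks l i upd_conv_take_nth_drop[of i ?ys "hact h ?e"]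
  by(simp add:hacts_def hact_def[of h ?e])
 have "wvalid c(hacts(ks[i := 1])es)" by(rule wvalid_hacts[OF v]) (simp add:ks l)
 hence cl: "clin(hom D(src ?e)(tgt ?e))(%f. \<phi> c(take i ?ys@(tgt ?e,f,src ?e)#drop(Suc i) ?ys))"
  unfolding up by(rule multi_slot[OF \<phi>])
 have o: "src ?e:obj D" "tgt ?e:obj D" "mor ?e:hom D(src ?e)(tgt ?e)" using e by(auto simp:arr_def)
 show "lin(%h. \<phi> c(hacts(ks[i := h])es))"
  unfolding up by(rule clin_compose[OF cl D_act_lin[OF o]]) (rule D_act[OF o])
qed

text \<open>The arrows that meet are composed, so degrees add. The value 0 on words that do not
  match makes the product a total bilinear map on the ambient space.\<close>

definition mulw :: "imat =>('o,'m)arrow list => imat =>('o,'m)arrow list =>('o,'m)word_space" where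
 "mulw c es c' es' = (if wvalid c es&wvalid c' es'&src(last es) = tgt(hd es')then word(mm c c')(butlast es@acomp(last es)(hd es')#tl es')else 0)"

lemma mulw_split: "wvalid c(as@[a]) ==> wvalid c'(b#bs) ==> src a = tgt b ==> mulw c(as@[a])c'(b#bs) = word(mm c c')(as@acomp a b#bs)"
 by(simp add:mulw_def)

lemma wvalid_mul:
 assumes "wvalid c(as@[a])" "wvalid c'(b#bs)" "src a = tgt b"
 shows "wvalid(mm c c')(as@acomp a b#bs)"
 using assms mm_wcoeffs[of c "length as" c' "length bs"]
 by(auto simp:wvalid_def wpath_snoc wpath_Cons wpath_split intro:arr_acomp)

lemma wpath_snocE: assumes "wpath es" obtains as a where "es = as@[a]"
 using assms by(metis wpath_def rev_exhaust)

lemma wpath_ConsE: assumes "wpath es" obtains b bs where "es = b#bs"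
 using assms by(metis wpath_def list.exhaust)

lemma multi_mulw_right: "multi(mulw c es)"
proof(cases "wvalid c es")
 case False
 hence "mulw c es = (%c' es'. 0)" by(intro ext) (simp add:mulw_def)
 thus ?thesis by(simp add:multi_zero)
next
 case v: True
 then obtain as a where es: "es = as@[a]" by(auto simp:wvalid_def elim: wpath_snocE)
 show ?thesis
 proof(rule multiI)
  fix es' assume p: "wpath es'"
  then obtain b bs where es': "es' = b#bs" by(rule wpath_ConsE)
  show "clin(wcoeffs(length es'))(%c'. mulw c es c' es')"
  proof(cases "src a = tgt b")
  case True
  have m: "mulw c es c' es' = word(mm c c')(as@acomp a b#bs)" if "c':wcoeffs(length es')" for c'
  unfolding es es' using v p that es es' True by(intro mulw_split) (simp_all add: wvalid_def)
  have "wpath(as@acomp a b#bs)" using v p True by(auto simp:es es' wvalid_def wpath_snoc wpath_Cons wpath_split intro:arr_acomp)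
  from clin_compose[OF multi_coeff[OF multi_word this] clin_subset[OF mm_lin_right subset_UNIV,of "wcoeffs(length es')" c]]
  have "clin(wcoeffs(length es'))(%c'. word(mm c c')(as@acomp a b#bs))"
  using mm_wcoeffs[of c "length as" _ "length bs"] v by(simp add:es es' wvalid_def)
  thus ?thesis by(rule clin_cong[OF _ sub_wcoeffs m])
  next
  case False
  thus ?thesis using clin_const_zero by(simp add:es es' mulw_def)
  qed
 next
  fix c' us X f Y vs assume v': "wvalid c'(us@(X,f,Y)#vs)"
  have X: "X:obj D" "Y:obj D" using v' by(auto simp:wvalid_def wpath_split arr_def)
  show "clin(hom D Y X)(%f. mulw c es c'(us@(X,f,Y)#vs))"
  proof(cases us)
  \<comment> \<open>The varied arrow is the one composed at the junction, so linearity comes from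
    composition in \<open>D\<close>; in the other case it is an untouched slot of the
    product.\<close>
  case Nil
  show ?thesis
  proof(cases "src a = X")
  case True
  have a: "arr a" using v by(simp add:es wvalid_def wpath_snoc)
  have m: "mulw c es c'(us@(X,f,Y)#vs) = word(mm c c')(as@(tgt a,comp D Y X(tgt a)(mor a)f,Y)#vs)"
  if "f:hom D Y X" for f
  using mulw_split[of c as a c' "(X,f,Y)" vs] v wvalid_slot[OF v' that] True by(simp add:es Nil acomp_def)
  have "clin(hom D Y X)(%f. word(mm c c')(as@(tgt a,comp D Y X(tgt a)(mor a)f,Y)#vs))"
  proof(rule clin_compose[OF multi_slot[OF multi_word]])
  show "wvalid(mm c c')(as@(tgt a,comp D Y X(tgt a)(mor a)f,Y)#vs)"
  using wvalid_mul[of c as a c' "(X,f,Y)" vs] v v' True by(simp add:es Nil acomp_def)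
  show "clin(hom D Y X)(comp D Y X(tgt a)(mor a))"
  using cbilD1[OF D_comp_bilin[OF X(2,1)]] a True by(simp add:arr_def)
  show "comp D Y X(tgt a)(mor a)f:hom D Y(tgt a)" if "f:hom D Y X" for f
  using D_comp[OF X(2,1) _ _ that] a True by(simp add:arr_def)
  qed
  thus ?thesis by(rule clin_cong[OF _ D_subspace[OF X(2,1)] m])
  qed(use clin_const_zero in \<open>simp add: es Nil mulw_def\<close>)
  next
  case(Cons b us')
  show ?thesis
  proof(cases "src a = tgt b")
  case True
  have m: "mulw c es c'(us@(X,f,Y)#vs) = word(mm c c')((as@acomp a b#us')@(X,f,Y)#vs)"
  if "f:hom D Y X" for f
  using mulw_split[of c as a c' b "us'@(X,f,Y)#vs"] v wvalid_slot[OF v' that] True by(simp add:es Cons)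
  have "clin(hom D Y X)(%f. word(mm c c')((as@acomp a b#us')@(X,f,Y)#vs))"
  using wvalid_mul[of c as a c' b "us'@(X,f,Y)#vs"] v v' True
  by(intro multi_slot[OF multi_word,of _ _ _ f]) (simp add:es Cons)
  thus ?thesis by(rule clin_cong[OF _ D_subspace[OF X(2,1)] m])
  qed(use clin_const_zero in \<open>simp add: es Cons mulw_def\<close>)
  qed
 qed
qed

lemma multi_mulw_left: "multi(%c es. mulw c es c' es')"
proof(cases "wvalid c' es'")
 case False
 hence "(%c es. mulw c es c' es') = (%c es. 0)" by(intro ext) (simp add:mulw_def)
 thus ?thesis by(simp add:multi_zero)
next
 case v': True
 then obtain b bs where es': "es' = b#bs" by(auto simp:wvalid_def elim: wpath_ConsE)
 show ?thesis
 proof(rule multiI)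
  fix es assume p: "wpath es"
  then obtain as a where es: "es = as@[a]" by(rule wpath_snocE)
  show "clin(wcoeffs(length es))(%c. mulw c es c' es')"
  proof(cases "src a = tgt b")
  case True
  have m: "mulw c es c' es' = word(mm c c')(as@acomp a b#bs)" if "c:wcoeffs(length es)" for c
  unfolding es es' using v' p that es es' True by(intro mulw_split) (simp_all add: wvalid_def)
  have "wpath(as@acomp a b#bs)" using v' p True by(auto simp:es es' wvalid_def wpath_snoc wpath_Cons wpath_split intro:arr_acomp)
  from clin_compose[OF multi_coeff[OF multi_word this] mm_lin_left[of "length es" c']]
  have "clin(wcoeffs(length es))(%c. word(mm c c')(as@acomp a b#bs))"
  using mm_wcoeffs[of _ "length as" c' "length bs"] v' by(simp add:es es' wvalid_def)
  thus ?thesis by(rule clin_cong[OF _ sub_wcoeffs m])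
  next
  case False
  thus ?thesis using clin_const_zero by(simp add:es es' mulw_def)
  qed
 next
  fix c us X f Y vs assume v: "wvalid c(us@(X,f,Y)#vs)"
  have X: "X:obj D" "Y:obj D" using v by(auto simp:wvalid_def wpath_split arr_def)
  show "clin(hom D Y X)(%f. mulw c(us@(X,f,Y)#vs)c' es')"
  proof(cases vs rule: rev_cases)
  case Nil
  show ?thesis
  proof(cases "Y = tgt b")
  case True
  have b: "arr b" using v' by(simp add:es' wvalid_def wpath_Cons)
  have m: "mulw c(us@(X,f,Y)#vs)c' es' = word(mm c c')(us@(X,comp D(src b)Y X f(mor b),src b)#bs)"
  if "f:hom D Y X" for f
  using mulw_split[of c us "(X,f,Y)" c' b bs] v' wvalid_slot[OF v that] True by(simp add:es' Nil acomp_def)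
  have "clin(hom D Y X)(%f. word(mm c c')(us@(X,comp D(src b)Y X f(mor b),src b)#bs))"
  proof(rule clin_compose[OF multi_slot[OF multi_word]])
  show "wvalid(mm c c')(us@(X,comp D(src b)Y X f(mor b),src b)#bs)"
  using wvalid_mul[of c us "(X,f,Y)" c' b bs] v v' True by(simp add:es' Nil acomp_def)
  show "clin(hom D Y X)(%f. comp D(src b)Y X f(mor b))"
  using cbilD2[OF D_comp_bilin[OF _ X(2,1)]] b True by(simp add:arr_def)
  show "comp D(src b)Y X f(mor b):hom D(src b)X" if "f:hom D Y X" for f
  using D_comp[OF _ X(2,1) that] b True by(simp add:arr_def)
  qed
  thus ?thesis by(rule clin_cong[OF _ D_subspace[OF X(2,1)] m])
  qed(use clin_const_zero in \<open>simp add: es' Nil mulw_def\<close>)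
  next
  case(snoc vs' a)
  show ?thesis
  proof(cases "src a = tgt b")
  case True
  have m: "mulw c(us@(X,f,Y)#vs)c' es' = word(mm c c')(us@(X,f,Y)#(vs'@acomp a b#bs))"
  if "f:hom D Y X" for f
  using mulw_split[of c "us@(X,f,Y)#vs'" a c' b bs] v' wvalid_slot[OF v that] True by(simp add:es' snoc)
  have "clin(hom D Y X)(%f. word(mm c c')(us@(X,f,Y)#(vs'@acomp a b#bs)))"
  using wvalid_mul[of c "us@(X,f,Y)#vs'" a c' b bs] v v' True
  by(intro multi_slot[OF multi_word,of _ _ _ f]) (simp add:es' snoc)
  thus ?thesis by(rule clin_cong[OF _ D_subspace[OF X(2,1)] m])
  qed(use clin_const_zero in \<open>simp add: es' snoc mulw_def\<close>)
  qed
 qed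
qed

definition wmul :: "('o,'m)word_space =>('o,'m)word_space =>('o,'m)word_space" where
 "wmul x y = free_ext(%c es. free_ext(mulw c es)y)x"

lemma bilin_wmul: "bilin wmul"
 unfolding wmul_def
 by(rule bilinI) (rule clin_free_ext_fun lin_free_ext)+

lemma wmul_word: "wmul(word c es)(word c' es') = mulw c es c' es'"
 unfolding wmul_def by(simp add:free_ext_word multi_mulw_right multi_mulw_left)

lemma wmul_word_split: "wvalid c(as@[a]) ==> wvalid c'(b#bs) ==> src a = tgt b ==> wmul(word c(as@[a]))(word c'(b#bs)) = word(mm c c')(as@acomp a b#bs)"
 by(simp add:wmul_word mulw_split)

definition actw :: "'h => imat =>('o,'m)arrow list =>('o,'m)word_space" where
 "actw h c es = (if wvalid c es then sw(length es-1)(%ks. word c(hacts ks es))h else 0)"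

lemma wvalid_length: "wvalid c es ==> \<exists>n. length es = Suc n"
 by(cases es) (auto simp:wvalid_def wpath_def)

lemma lin_actw: "lin(%h. actw h c es)"
proof(cases "wvalid c es")
 case True
 then obtain n where n: "length es = Suc n" using wvalid_length by blast
 show ?thesis using lin_sw[OF mlin_multi_hacts[OF multi_word True n]] True by(simp add:actw_def n)
qed(simp add:actw_def clin_const_zero)

lemma multi_sw_hacts:
 assumes \<phi>: "multi \<phi>"
 shows "multi(%c es. if wvalid c es then sw(length es-1)(%ks. \<phi> c(hacts ks es))h else 0)"
proof(rule multiI)
 fix es assume p: "wpath es"
 then obtain n where n: "length es = Suc n" by(cases es) (auto simp:wpath_def)
 have "clin(wcoeffs(length es))(%c. sw n(%ks. \<phi> c(hacts ks es))h)"
 proof(rule clin_sw_fun)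
  show "mlin n(%ks. \<phi> c(hacts ks es))" if "c:wcoeffs(length es)" for c
  by(rule mlin_multi_hacts[OF \<phi> _ n]) (simp add:wvalid_def p that)
  show "clin(wcoeffs(length es))(%c. \<phi> c(hacts ks es))" if "length ks = Suc n" for ks
  using multi_coeff[OF \<phi> wpath_hacts(1)[OF p]] that n by simp
 qed
 thus "clin(wcoeffs(length es))(%c. if wvalid c es then sw(length es-1)(%ks. \<phi> c(hacts ks es))h else 0)"
  by(rule clin_cong[OF _ sub_wcoeffs]) (simp add:wvalid_def p n)
next
 fix c as X f Y bs assume v: "wvalid c(as@(X,f,Y)#bs)"
 have X: "X:obj D" "Y:obj D" using v by(auto simp:wvalid_def wpath_split arr_def)
 define n where "n = length as+length bs"
 have n: "length(as@(X,f,Y)#bs) = Suc n" for f by(simp add:n_def)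
 note v' = wvalid_slot[OF v]
 have "clin(hom D Y X)(%f. sw n(%ks. \<phi> c(hacts ks(as@(X,f,Y)#bs)))h)"
 proof(rule clin_sw_fun)
  show "mlin n(%ks. \<phi> c(hacts ks(as@(X,f,Y)#bs)))" if "f:hom D Y X" for f
  by(rule mlin_multi_hacts[OF \<phi> v'[OF that] n])
  fix ks :: "'h list" assume ks: "length ks = Suc n"
  have s: "hacts ks(as@(X,f,Y)#bs) = hacts(take(length as)ks)as@(X,act D Y X(ks!length as)f,Y)#hacts(drop(Suc(length as))ks)bs" for f
  using hacts_split[of ks as bs] ks by(simp add:n_def hact_def)
  show "clin(hom D Y X)(%f. \<phi> c(hacts ks(as@(X,f,Y)#bs)))"
  unfolding s
  proof(rule clin_compose[OF multi_slot[OF \<phi>]])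
  show "wvalid c(hacts(take(length as)ks)as@(X,act D Y X(ks!length as)f,Y)#hacts(drop(Suc(length as))ks)bs)"
  using wvalid_hacts[OF v,of ks] ks n[of f] unfolding s by simp
  show "clin(hom D Y X)(act D Y X(ks!length as))"
  by(rule cbilD1[OF D_act_bilin[OF X(2,1)]]) simp
  qed(rule D_act[OF X(2,1)])
 qed
 thus "clin(hom D Y X)(%f. if wvalid c(as@(X,f,Y)#bs)then sw(length(as@(X,f,Y)#bs)-1)(%ks. \<phi> c(hacts ks(as@(X,f,Y)#bs)))h else 0)"
  by(rule clin_cong[OF _ D_subspace[OF X(2,1)]]) (simp add:v' n_def)
qed

definition wact :: "'h =>('o,'m)word_space =>('o,'m)word_space" where
 "wact h = free_ext(actw h)"

lemma bilin_wact: "bilin wact"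
 unfolding wact_def
 by(rule bilinI) (rule clin_free_ext_fun lin_free_ext lin_actw)+

lemma lin_wact: "lin(wact h)"
 by(rule bilinD1[OF bilin_wact])

lemma wact_word:
 assumes "wvalid c es" "length es = Suc n"
 shows "wact h(word c es) = sw n(%ks. word c(hacts ks es))h"
proof -
 have "multi(actw h)" unfolding actw_def using multi_sw_hacts[OF multi_word] by simp
 thus ?thesis using assms by(simp add:wact_def free_ext_word actw_def)
qed

end

section \<open>The differential graded semicategory of words\<close>

context cochain_data
begin

definition words :: "'o => 'o => nat =>('o,'m)word_space set" where
 "words X Y j = {word c es | c es. wvalid c es&length es = Suc j&tgt(hd es) = Y&src(last es) = X}"

abbreviation wghom :: "'o => 'o => nat =>('o,'m)word_space set" where
 "wghom X Y j == cspan(words X Y j)"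

abbreviation whom :: "'o => 'o =>('o,'m)word_space set" where
 "whom X Y == cspan(\<Union>j. words X Y j)"

lemma words_whom: "w:words X Y j ==> w:wghom X Y j" "w:words X Y j ==> w:whom X Y"
 by(auto intro:cspan_base)

lemma wghom_whom: "wghom X Y j \<subseteq> whom X Y"
 by(rule cspan_mono) auto

lemma wghom_subspace: "csub(wghom X Y j)" and whom_subspace: "csub(whom X Y)"
 by(rule csub_span)+

lemma words_ConsE:
 assumes "w:words X Y j"
 obtains c b bs where "w = word c(b#bs)" "wvalid c(b#bs)" "length bs = j" "tgt b = Y" "src(last(b#bs)) = X"
proof -
 obtain c es where es: "w = word c es" "wvalid c es" "length es = Suc j" "tgt(hd es) = Y" "src(last es) = X"
  using assms by(auto simp:words_def)
 thus thesis using that by(cases es) auto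
qed

lemma words_snocE:
 assumes "w:words X Y j"
 obtains c as a where "w = word c(as@[a])" "wvalid c(as@[a])" "length as = j" "tgt(hd(as@[a])) = Y" "src a = X"
proof -
 obtain c es where es: "w = word c es" "wvalid c es" "length es = Suc j" "tgt(hd es) = Y" "src(last es) = X"
  using assms by(auto simp:words_def)
 thus thesis using that by(cases es rule: rev_cases) auto
qed

lemma wordsI: "wvalid c es ==> length es = Suc j ==> tgt(hd es) = Y ==> src(last es) = X ==> word c es:words X Y j"
 by(auto simp:words_def)

lemma wmul_words:
 assumes "g:words Y Z i" "f:words X Y j"
 shows "wmul g f:words X Z(i+j)"
proof -
 obtain c as a where g: "g = word c(as@[a])" "wvalid c(as@[a])" "length as = i" "tgt(hd(as@[a])) = Z" "src a = Y"
  by(rule words_snocE[OF assms(1)])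
 obtain c' b bs where f: "f = word c'(b#bs)" "wvalid c'(b#bs)" "length bs = j" "tgt b = Y" "src(last(b#bs)) = X"
  by(rule words_ConsE[OF assms(2)])
 have "wmul g f = word(mm c c')(as@acomp a b#bs)"
  unfolding g(1) f(1) by(rule wmul_word_split) (use g f in auto)
 moreover have "tgt(hd(as@acomp a b#bs)) = Z" using g(4) by(cases as) auto
 moreover have "src(last(as@acomp a b#bs)) = X" using f(5) by(cases bs) auto
 ultimately show ?thesis
  using wvalid_mul[OF g(2) f(2)] g(3,5) f(3,4) by(auto intro!:wordsI)
qed

lemma lin_wmul_left: "lin(%x. wmul x y)" and lin_wmul_right: "lin(wmul x)"
 using bilinD1[OF bilin_wmul] bilinD2[OF bilin_wmul] by blast+

lemma wmul_wghom:
 assumes "g:wghom Y Z i" "f:wghom X Y j"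
 shows "wmul g f:wghom X Z(i+j)"
 by(rule span_lin_in[OF assms(1) lin_wmul_left wghom_subspace],rule span_lin_in[OF assms(2) lin_wmul_right wghom_subspace])
  (rule words_whom(1),rule wmul_words)

lemma wmul_whom:
 assumes "g:whom Y Z" "f:whom X Y"
 shows "wmul g f:whom X Z"
proof(rule span_lin_in[OF assms(1) lin_wmul_left whom_subspace],rule span_lin_in[OF assms(2) lin_wmul_right whom_subspace])
 fix u v assume "u:(\<Union>j. words Y Z j)" "v:(\<Union>j. words X Y j)"
 then obtain i j where "u:words Y Z i" "v:words X Y j" by blast
 from words_whom(2)[OF wmul_words[OF this]] show "wmul u v:whom X Z" .
qed

text \<open>If the middle word is a single arrow, three arrows are composed at one place and
  associativity in \<open>D\<close> is needed; otherwise the two junctions do not interfere.\<close>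

lemma wmul_assoc_words:
 assumes "g:words Y Z i" "f:words X Y j" "e:words W X k"
 shows "wmul(wmul g f)e = wmul g(wmul f e)"
proof -
 obtain c as a where g': "g = word c(as@[a])" "wvalid c(as@[a])" "length as = i" "tgt(hd(as@[a])) = Z" "src a = Y"
  by(rule words_snocE[OF assms(1)])
 note g = g'(1,2,5)
 obtain c' b bs where f': "f = word c'(b#bs)" "wvalid c'(b#bs)" "length bs = j" "tgt b = Y" "src(last(b#bs)) = X"
  by(rule words_ConsE[OF assms(2)])
 note f = f'(1,2,4,5)
 obtain c'' d ds where e': "e = word c''(d#ds)" "wvalid c''(d#ds)" "length ds = k" "tgt d = X" "src(last(d#ds)) = W"
  by(rule words_ConsE[OF assms(3)])
 note e = e'(1,2,4)
 have as: "mm(mm c c')c'' = mm c(mm c' c'')"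
  by(rule mm_assoc) (use g(2) f(2) in \<open>auto simp: wvalid_def wcoeffs_def\<close>)
 show ?thesis
 proof(cases bs rule: rev_cases)
  case Nil
  have "arr a" "arr b" "arr d" using g(2) f(2) e(2) by(auto simp:wvalid_def wpath_snoc wpath_Cons)
  hence a3: "acomp(acomp a b)d = acomp a(acomp b d)" using g(3) f(3,4) e(3) Nil by(intro acomp_assoc) auto
  have v1: "wvalid(mm c c')(as@[acomp a b])" using wvalid_mul[OF g(2) f(2)] g(3) f(3) Nil by simp
  have v2: "wvalid(mm c' c'')(acomp b d#ds)" using wvalid_mul[of c' "[]" b c'' d ds] f e Nil by simp
  have 1: "wmul g f = word(mm c c')(as@[acomp a b])"
  using wmul_word_split[OF g(2) f(2)] g(1,3) f(1,3) Nil by simp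
  have 2: "wmul f e = word(mm c' c'')(acomp b d#ds)"
  using wmul_word_split[of c' "[]" b c'' d ds] f e Nil by simp
  have s: "src(acomp a b) = tgt d" "src a = tgt(acomp b d)" using g(3) f(3,4) e(3) Nil by simp_all
  show ?thesis
  unfolding 1 2 unfolding g(1) e(1) wmul_word_split[OF v1 e(2) s(1)] wmul_word_split[OF g(2) v2 s(2)] as a3 ..
 next
  case(snoc bs' b')
  have s: "src a = tgt b" "src b' = tgt d" using g(3) f(3,4) e(3) snoc by simp_all
  have f2: "wvalid c'((b#bs')@[b'])" using f(2) snoc by simp
  have v1: "wvalid(mm c c')((as@acomp a b#bs')@[b'])" using wvalid_mul[OF g(2) f(2) s(1)] snoc by simp
  have v2: "wvalid(mm c' c'')(b#bs'@acomp b' d#ds)" using wvalid_mul[OF f2 e(2) s(2)] by simp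
  have 1: "wmul g f = word(mm c c')((as@acomp a b#bs')@[b'])"
  using wmul_word_split[OF g(2) f(2) s(1)] g(1) f(1) snoc by simp
  have 2: "wmul f e = word(mm c' c'')(b#bs'@acomp b' d#ds)"
  using wmul_word_split[OF f2 e(2) s(2)] f(1) e(1) snoc by simp
  show ?thesis
  unfolding 1 2 unfolding g(1) e(1) wmul_word_split[OF v1 e(2) s(2)] wmul_word_split[OF g(2) v2 s(1)] as by simp
 qed
qed

lemma wmul_assoc:
 assumes "g:whom Y Z" "f:whom X Y" "e:whom W X"
 shows "wmul(wmul g f)e = wmul g(wmul f e)"
proof(rule span_lin_eq[OF assms(1)])
 fix g' assume g': "g':(\<Union>j. words Y Z j)"
 show "wmul(wmul g' f)e = wmul g'(wmul f e)"
 proof(rule span_lin_eq[OF assms(2)])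
  fix f' assume f': "f':(\<Union>j. words X Y j)"
  show "wmul(wmul g' f')e = wmul g'(wmul f' e)"
  by(rule span_lin_eq[OF assms(3) lin_wmul_right lin_comp[OF lin_wmul_right lin_wmul_right]])
  (use g' f' in \<open>auto intro: wmul_assoc_words\<close>)
 qed(rule lin_comp[OF lin_wmul_left lin_wmul_right] lin_comp[OF lin_wmul_right lin_wmul_left])+
qed(rule lin_comp[OF lin_wmul_left lin_wmul_left] lin_wmul_left)+

lemma wact_words:
 assumes "w:words X Y j"
 shows "wact h w:wghom X Y j"
proof -
 obtain c es where w: "w = word c es" and v: "wvalid c es" and l: "length es = Suc j" "tgt(hd es) = Y" "src(last es) = X"
  using assms by(auto simp:words_def)
 show ?thesis
  unfolding w wact_word[OF v l(1)]
 proof(rule sw_clinear_on(1)[OF mlin_multi_hacts[OF multi_word v l(1)] clin_ident wghom_subspace])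
  fix ks :: "'h list" assume ks: "length ks = Suc j"
  have "wpath es" using v by(simp add:wvalid_def)
  note p = wpath_hacts[OF this,of ks]
  show "word c(hacts ks es):wghom X Y j"
  using p wvalid_hacts[OF v,of ks] ks l by(intro words_whom(1) wordsI) simp_all
 qed
qed

lemma wact_wghom: "x:wghom X Y j ==> wact h x:wghom X Y j"
 by(erule span_lin_in[OF _ lin_wact wghom_subspace]) (rule wact_words)

lemma wact_whom: "x:whom X Y ==> wact h x:whom X Y"
 by(erule span_lin_in[OF _ lin_wact whom_subspace]) (auto intro:subsetD[OF wghom_whom wact_words])

lemma wact_one: "x:whom X Y ==> wact 1 x = x"
proof(erule span_lin_eq[OF _ lin_wact clin_ident])
 fix w assume "w:(\<Union>j. words X Y j)"
 then obtain c es j where w: "w = word c es" and v: "wvalid c es" and l: "length es = Suc j" by(auto simp:words_def)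
 have "hacts(replicate(Suc j) 1)es = es"
  using v l by(intro nth_equalityI) (auto simp:hacts_def wvalid_def hact_one wpath_nth simp del:replicate_Suc)
 thus "wact 1 w = w"
  unfolding w wact_word[OF v l] by(simp add:sw_one[OF mlin_multi_hacts[OF multi_word v l]] del:replicate_Suc)
qed

lemma hacts_mult: "wpath es ==> length ks = length es ==> length ls = length es ==> hacts(map2 (*)ks ls)es = hacts ks(hacts ls es)"
 by(rule nth_equalityI) (auto simp:hacts_def hact_mult wpath_nth)

lemma wact_mult: "x:whom X Y ==> wact(a * b)x = wact a(wact b x)"
proof(erule span_lin_eq[OF _ lin_wact lin_comp[OF lin_wact lin_wact]])
 fix w assume "w:(\<Union>j. words X Y j)"
 then obtain c es j where w: "w = word c es" and v: "wvalid c es" and l: "length es = Suc j" by(auto simp:words_def)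
 have p: "wpath es" using v by(simp add:wvalid_def)
 note m = mlin_multi_hacts[OF multi_word v l]
 have m1: "mlin j(%ks. word c(hacts ks(hacts ls es)))" if "length ls = Suc j" for ls
  using mlin_multi_hacts[OF multi_word wvalid_hacts[OF v],of ls j] that l by simp
 have e: "word c(hacts ks(hacts ls es)) = word c(hacts(map2 (*)ks ls)es)" if "length ks = Suc j" "length ls = Suc j" for ks ls
  using hacts_mult[OF p] that l by simp
 have m2: "mlin j(%ls. word c(hacts ks(hacts ls es)))" if "length ks = Suc j" for ks
  using mlin_map2_right[OF m that] by(subst mlin_cong[OF e[OF that]])
 have "wact a(wact b w) = sw j(%ls. wact a(word c(hacts ls es)))b"
  unfolding w wact_word[OF v l] by(rule sw_lin[OF m lin_wact])
 also have "... = sw j(%ls. sw j(%ks. word c(hacts ks(hacts ls es)))a)b"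
  by(rule sw_cong,rule wact_word) (use wvalid_hacts[OF v] l in simp_all)
 also have "... = sw j(%ks. sw j(%ls. word c(hacts ks(hacts ls es)))b)a"
  by(rule sw_swap[symmetric]) (auto intro:m1 m2)
 also have "... = sw j(%ks. sw j(%ls. word c(hacts(map2 (*)ks ls)es))b)a"
  by(intro sw_cong e)
 also have "... = wact(a * b)w"
  unfolding w wact_word[OF v l] by(rule sw_mult[OF m,symmetric])
 finally show "wact(a * b)w = wact a(wact b w)" by simp
qed

text \<open>Compatibility of action and composition, seen through a function of one slot. The
  function is linear only on the Hom space of that slot.\<close>

lemma hact_acomp:
 assumes \<phi>: "clin(hom D(src b)(tgt a))(%f. \<phi>(tgt a,f,src b))" and ab: "arr a" "arr b" "src a = tgt b"
 shows "bilin(%p q. \<phi>(acomp(hact p a)(hact q b)))"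
  and "\<phi>(hact k(acomp a b)) = tlift(%p q. \<phi>(acomp(hact p a)(hact q b)))(\<Delta> k)"
proof -
 let ?c = "%p q. comp D(src b)(src a)(tgt a)(act D(src a)(tgt a)p(mor a))(act D(src b)(tgt b)q(mor b))"
 have o: "tgt a:obj D" "src a:obj D" "src b:obj D" and ma: "mor a:hom D(src a)(tgt a)" and mb: "mor b:hom D(src b)(src a)"
  using ab by(auto simp:arr_def)
 have in': "?c p q:hom D(src b)(tgt a)" for p q
  using ab(3) by(intro D_comp o D_act ma) (simp_all add: mb[unfolded ab(3)] D_act o[unfolded ab(3)])
 have b: "bilin ?c"
 proof(rule bilinI)
  show "lin(%q. ?c p q)" for p
  by(rule clin_compose[OF cbilD1[OF D_comp_bilin[OF o(3,2,1)] D_act[OF o(2,1) ma]]])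
  (use ab(3) D_act_lin[OF o(3,2) mb] D_act[OF o(3,2) mb] in simp_all)
  show "lin(%p. ?c p q)" for q
  by(rule clin_compose[OF cbilD2[OF D_comp_bilin[OF o(3,2,1)]]])
  (use ab(3) D_act_lin[OF o(2,1) ma] D_act[OF o(2,1) ma] D_act[OF o(3,2) mb] in simp_all)
 qed
 have ac: "act D(src b)(tgt a)k(comp D(src b)(src a)(tgt a)(mor a)(mor b)) = tlift ?c(\<Delta> k)"
  using semicat o ma mb ab(3) by(simp add:lHsemi_def)
 note t = tlift_clinear_on[OF b \<phi> D_subspace[OF o(3,1)] in']
 show "bilin(%p q. \<phi>(acomp(hact p a)(hact q b)))" using t(1) by(simp add:acomp_def hact_def)
 show "\<phi>(hact k(acomp a b)) = tlift(%p q. \<phi>(acomp(hact p a)(hact q b)))(\<Delta> k)"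
  using t(2) by(simp add:acomp_def hact_def ac)
qed

text \<open>Acting on the two factors uses one more Sweedler slot than acting on the product. The
  slot of the composed arrow accounts for it: its coproduct distributes over the two arrows.\<close>

lemma wact_wmul_words:
 assumes "g:words Y Z i" "f:words X Y j"
 shows "wact h(wmul g f) = tlift(%h1 h2. wmul(wact h1 g)(wact h2 f))(\<Delta> h)"
proof -
 obtain c as a where g': "g = word c(as@[a])" "wvalid c(as@[a])" "length as = i" "tgt(hd(as@[a])) = Z" "src a = Y"
  by(rule words_snocE[OF assms(1)])
 note g = g'(1,2,3,5)
 obtain c' b bs where f': "f = word c'(b#bs)" "wvalid c'(b#bs)" "length bs = j" "tgt b = Y" "src(last(b#bs)) = X"
  by(rule words_ConsE[OF assms(2)])
 note f = f'(1-4)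
 have s: "src a = tgt b" using g(4) f(4) by simp
 let ?es = "as@acomp a b#bs"
 have v: "wvalid(mm c c') ?es" by(rule wvalid_mul[OF g(2) f(2) s])
 have l: "length ?es = Suc(i+j)" using g(3) f(3) by simp
 have ab: "arr a" "arr b" using g(2) f(2) by(auto simp:wvalid_def wpath_snoc wpath_Cons)
 have la: "length(as@[a]) = Suc i" and lb: "length(b#bs) = Suc j" using g(3) f(3) by simp_all
 let ?F = "%ks. wmul(word c(hacts(take(Suc i)ks)(as@[a])))(word c'(hacts(drop(Suc i)ks)(b#bs)))"
 have mF: "mlin(Suc(i+j)) ?F"
  by(rule mlin_prod[OF mlin_multi_hacts[OF multi_word g(2) la] mlin_multi_hacts[OF multi_word f(2) lb] bilin_wmul])
 note mg = mlin_multi_hacts[OF multi_word g(2) la] and mf = mlin_multi_hacts[OF multi_word f(2) lb]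
 have "tlift(%h1 h2. wmul(wact h1 g)(wact h2 f))(\<Delta> h) = tlift(%h1 h2. sw i(%ks. sw j(%ls. ?F(ks@ls))h2)h1)(\<Delta> h)"
 proof(rule arg_cong[where f = "%F. tlift F(\<Delta> h)"],intro ext)
  fix h1 h2
  have "wmul(wact h1 g)(wact h2 f) = sw i(%ks. wmul(word c(hacts ks(as@[a])))(wact h2 f))h1"
  unfolding g(1) wact_word[OF g(2) la] by(rule sw_lin[OF mg lin_wmul_left])
  also have "... = sw i(%ks. sw j(%ls. wmul(word c(hacts ks(as@[a])))(word c'(hacts ls(b#bs))))h2)h1"
  unfolding f(1) wact_word[OF f(2) lb] by(rule sw_cong,rule sw_lin[OF mf lin_wmul_right])
  also have "... = sw i(%ks. sw j(%ls. ?F(ks@ls))h2)h1"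
  by(rule sw_cong) simp
  finally show "wmul(wact h1 g)(wact h2 f) = sw i(%ks. sw j(%ls. ?F(ks@ls))h2)h1" .
 qed
 also have "... = sw(Suc(i+j)) ?F h" by(rule sw_split[OF mF,symmetric])
 \<comment> \<open>The slot \<open>i\<close> is that of the arrow composed at the junction.\<close>
 also have "... = sw(i+j)(%ks. tlift(%p q. ?F(take i ks@p#q#drop(Suc i)ks))(\<Delta>(ks!i)))h"
  by(rule sw_insert[OF mF]) simp
 also have "... = sw(i+j)(%ks. word(mm c c')(hacts ks ?es))h"
 proof(rule sw_cong)
  fix ks :: "'h list" assume ks: "length ks = Suc(i+j)"
  let ?us = "hacts(take i ks)as" and ?vs = "hacts(drop(Suc i)ks)bs"
  have hs: "hacts ks(as@e#bs) = ?us@hact(ks!i)e # ?vs" for e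
  using hacts_split[of ks as bs e] ks g(3) f(3) by simp
  have F: "?F(take i ks@p#q#drop(Suc i)ks) = word(mm c c')(?us@acomp(hact p a)(hact q b) # ?vs)" for p q
  proof -
  have 1: "hacts(take i ks@[p])(as@[a]) = ?us@[hact p a]"
  using hacts_split[of "take i ks@[p]" as "[]" a] ks g(3) by(simp add:nth_append)
  have "wvalid c(?us@[hact p a])"
  using wvalid_hacts[OF g(2),of "take i ks@[p]"] ks g(3) unfolding 1 by simp
  moreover have "wvalid c'(hact q b # ?vs)"
  using wvalid_hacts[OF f(2),of "q#drop(Suc i)ks"] ks f(3) by simp
  moreover have "take(Suc i)(take i ks@p#q#drop(Suc i)ks) = take i ks@[p]"
  "drop(Suc i)(take i ks@p#q#drop(Suc i)ks) = q#drop(Suc i)ks" using ks by simp_all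
  ultimately show ?thesis using wmul_word_split[of c ?us "hact p a" c' "hact q b" ?vs] s by(simp add:1)
  qed
  have "wvalid(mm c c')(?us@hact(ks!i)(acomp a b) # ?vs)"
  using wvalid_hacts[OF v,of ks] ks l unfolding hs by simp
  hence "clin(hom D(src b)(tgt a))(%f. word(mm c c')(?us@(tgt a,f,src b) # ?vs))"
  by(intro multi_slot[OF multi_word,of _ _ _ "mor(hact(ks!i)(acomp a b))"]) (simp add:hact_def)
  from hact_acomp(2)[OF this ab s,of "ks!i"]
  show "tlift(%p q. ?F(take i ks@p#q#drop(Suc i)ks))(\<Delta>(ks!i)) = word(mm c c')(hacts ks ?es)"
  unfolding F hs by simp
 qed
 also have "... = wact h(wmul g f)"
  unfolding g(1) f(1) wmul_word_split[OF g(2) f(2) s] wact_word[OF v l] ..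
 finally show ?thesis by simp
qed

lemma bilin_wmul_act: "bilin(%h1 h2. wmul(wact h1 g)(wact h2 f))"
 by(rule bilinI) (rule lin_comp[OF lin_wmul_right bilinD2[OF bilin_wact]] lin_comp[OF lin_wmul_left bilinD2[OF bilin_wact]])+

lemma wact_wmul:
 assumes "g:whom Y Z" "f:whom X Y"
 shows "wact h(wmul g f) = tlift(%h1 h2. wmul(wact h1 g)(wact h2 f))(\<Delta> h)"
proof(rule span_lin_eq[OF assms(1) lin_comp[OF lin_wact lin_wmul_left]])
 fix g' assume g': "g':(\<Union>j. words Y Z j)"
 show "wact h(wmul g' f) = tlift(%h1 h2. wmul(wact h1 g')(wact h2 f))(\<Delta> h)"
 proof(rule span_lin_eq[OF assms(2) lin_comp[OF lin_wact lin_wmul_right]])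
  show "lin(%f. tlift(%h1 h2. wmul(wact h1 g')(wact h2 f))(\<Delta> h))"
  by(rule lin_tensor_lift_fun[OF bilin_wmul_act lin_comp[OF lin_wmul_right lin_wact]])
 qed(use g' in \<open>auto intro: wact_wmul_words\<close>)
next
 show "lin(%g. tlift(%h1 h2. wmul(wact h1 g)(wact h2 f))(\<Delta> h))"
  by(rule lin_tensor_lift_fun[OF bilin_wmul_act lin_comp[OF lin_wmul_left lin_wact]])
qed

text \<open>With coefficient \<open>mr\<close> it generates the differential; with general
  coefficients these degree one elements are also needed as multiplicative generators.\<close>

definition theta :: "imat => 'o =>('o,'m)word_space" where
 "theta c X = word c [aident X,aident X]"

lemma wvalid_theta: "X:obj D ==> c:wcoeffs 2 ==> wvalid c [aident X,aident X]"
 by(simp add:wvalid_def wpath_Cons aident numeral_2_eq_2)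

lemma theta_words: "X:obj D ==> c:wcoeffs 2 ==> theta c X:words X X 1"
 unfolding theta_def by(rule wordsI) (simp_all add: wvalid_theta)

lemma wact_theta:
 assumes X: "X:obj D" and c: "c:wcoeffs 2"
 shows "wact h(theta c X) = \<epsilon> h*.theta c X"
proof -
 let ?e = "aident X"
 note v = wvalid_theta[OF X c]
 have e: "mor ?e:hom D X X" "?e = (X,mor ?e,X)" using aident(1)[OF X] by(simp_all add: arr_def prod_eq_iff)
 have ek: "hact k ?e = (X,\<epsilon> k*.mor ?e,X)" for k by(rule aident(2)[OF X])
 have v1: "wvalid c [?e,(X,f,X)]" if "f:hom D X X" for f
  using wvalid_slot[of c "[?e]" X "mor ?e" X "[]"] v e(2) that by simp
 have w: "word c [hact k ?e,hact l ?e] = \<epsilon> k *.(\<epsilon> l*.theta c X)" for k l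
 proof -
  have "wvalid c [(X,mor ?e,X),hact l ?e]"
  using v1[of "\<epsilon> l*.mor ?e"] e csub_scale[OF D_subspace[OF X X] e(1)] by(simp add:ek)
  hence "word c [hact k ?e,hact l ?e] = \<epsilon> k*.word c [(X,mor ?e,X),hact l ?e]"
  using clin_scale[OF multi_slot[OF multi_word,of c "[]" X "mor ?e" X "[hact l ?e]"] e(1),of "\<epsilon> k"] by(simp add:ek)
  also have "word c [(X,mor ?e,X),hact l ?e] = \<epsilon> l*.theta c X"
  using clin_scale[OF multi_slot[OF multi_word,of c "[?e]" X "mor ?e" X "[]"] e(1),of "\<epsilon> l"] v1[OF e(1)] e(2)
  by(simp add:ek theta_def)
  finally show ?thesis .
 qed
 have "wact h(theta c X) = tlift(%k l. \<epsilon> k *.(\<epsilon> l*.theta c X))(\<Delta> h)"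
  unfolding theta_def wact_word[OF v,of 1,simplified] using w by(simp add:theta_def)
 also have "... = \<epsilon> h*.theta c X" by(rule counit1) (intro li lin_counit0)
 finally show ?thesis .
qed

lemma wact_theta_mul:
 assumes "X:obj D" "Y:obj D" "x:whom X Y" "c:wcoeffs 2"
 shows "wact h(wmul(theta c Y)x) = wmul(theta c Y)(wact h x)"
  and "wact h(wmul x(theta c X)) = wmul(wact h x)(theta c X)"
proof -
 note t = words_whom(2)[OF theta_words[OF assms(1,4)]] words_whom(2)[OF theta_words[OF assms(2,4)]]
 have "wact h(wmul(theta c Y)x) = tlift(%h1 h2. \<epsilon> h1*.wmul(theta c Y)(wact h2 x))(\<Delta> h)"
  by(simp add:wact_wmul[OF t(2) assms(3)] wact_theta[OF assms(2,4)] clin_scale[OF lin_wmul_left])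
 also have "... = wmul(theta c Y)(wact h x)"
  by(rule counit1) (rule lin_comp[OF lin_wmul_right bilinD2[OF bilin_wact]])
 finally show "wact h(wmul(theta c Y)x) = wmul(theta c Y)(wact h x)" .
 have "wact h(wmul x(theta c X)) = tlift(%h1 h2. \<epsilon> h2*.wmul(wact h1 x)(theta c X))(\<Delta> h)"
  by(simp add:wact_wmul[OF assms(3) t(1)] wact_theta[OF assms(1,4)] clin_scale[OF lin_wmul_right])
 also have "... = wmul(wact h x)(theta c X)"
  by(rule counit2) (rule lin_comp[OF lin_wmul_left bilinD2[OF bilin_wact]])
 finally show "wact h(wmul x(theta c X)) = wmul(wact h x)(theta c X)" .
qed

lemma theta_square: "X:obj D ==> wmul(theta mr X)(theta mr X) = 0"
proof -
 assume X: "X:obj D"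
 let ?e = "aident X" and ?es = "[aident X,acomp(aident X)(aident X),aident X]"
 note v = wvalid_theta[OF X mr_wcoeffs]
 have "wmul(theta mr X)(theta mr X) = word(mm mr mr) ?es"
  using wmul_word_split[of mr "[?e]" ?e mr ?e "[?e]"] v by(simp add:theta_def)
 also have "... = 0"
 proof -
  have "wvalid(mm mr mr) ?es" using wvalid_mul[of mr "[?e]" ?e mr ?e "[?e]"] v by simp
  thus ?thesis using clin_zero[OF multi_coeff[OF multi_word] sub_wcoeffs] by(simp add:mp_mr wvalid_def)
 qed
 finally show ?thesis .
qed

text \<open>The sign of the degree as one linear operator, so that the graded commutator is defined
  on all elements and not only on homogeneous ones.\<close>

definition wsgn :: "('o,'m)word_space =>('o,'m)word_space" where
 "wsgn = free_ext(%c es.(- 1) ^ (length es-1)*.word c es)"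

lemma multi_scale_length: "multi \<phi> ==> multi(%c es. z(length es)*.\<phi> c es)"
 by(rule multiI) (auto intro!:clin_scaleC dest:multi_coeff multi_slot)

lemma wsgn: "x:wghom X Y j ==> wsgn x = (- 1) ^ j*.x"
proof(erule span_lin_eq[OF _ _ clin_scaleC[OF clin_ident]])
 show "lin wsgn" by(simp add:wsgn_def lin_free_ext)
 fix b assume "b:words X Y j"
 then obtain c es where b: "b = word c es" "length es = Suc j" by(auto simp:words_def)
 have "wsgn b = (- 1) ^ (length es-1)*.word c es"
  unfolding wsgn_def b(1) by(rule free_ext_word[OF multi_scale_length[OF multi_word]])
 thus "wsgn b = (- 1) ^ j*.b" by(simp add:b)
qed

text \<open>A graded commutator satisfies Leibniz by associativity, has square zero because
  \<open>mr\<close> does, and commutes with \<open>H\<close> because \<open>theta\<close> is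
  invariant.\<close>

definition wdiff :: "'o => 'o =>('o,'m)word_space =>('o,'m)word_space" where
 "wdiff X Y x = wmul(theta mr Y)x-wmul(wsgn x)(theta mr X)"

lemma lin_wsgn: "lin wsgn"
 by(simp add:wsgn_def lin_free_ext)

lemma lin_wdiff: "lin(wdiff X Y)"
 unfolding wdiff_def by(intro clin_minus_fun lin_wmul_right lin_comp[OF lin_wmul_left lin_wsgn])

lemma wdiff_eq: "x:wghom X Y j ==> wdiff X Y x = wmul(theta mr Y)x-(- 1) ^ j*.wmul x(theta mr X)"
 by(simp add:wdiff_def wsgn clin_scale[OF lin_wmul_left])

lemma wdiff_in:
 assumes "X:obj D" "Y:obj D" "x:wghom X Y j"
 shows "wdiff X Y x:wghom X Y(Suc j)"
proof -
 have t: "theta mr Z:wghom Z Z 1" if "Z:obj D" for Z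
  by(rule words_whom(1)[OF theta_words[OF that mr_wcoeffs]])
 have "wmul(theta mr Y)x:wghom X Y(Suc j)" "wmul x(theta mr X):wghom X Y(Suc j)"
  using wmul_wghom[OF t[OF assms(2)] assms(3)] wmul_wghom[OF assms(3) t[OF assms(1)]] by simp_all
 thus ?thesis
  unfolding wdiff_eq[OF assms(3)]
  by(intro csub_diff[OF wghom_subspace] csub_scale[OF wghom_subspace])
qed

lemma wdiff_wdiff:
 assumes "X:obj D" "Y:obj D" "x:wghom X Y j"
 shows "wdiff X Y(wdiff X Y x) = 0"
proof -
 let ?X = "theta mr X" and ?Y = "theta mr Y"
 have x: "x:whom X Y" using assms(3) wghom_whom by blast
 have t: "theta mr Z:whom Z Z" if "Z:obj D" for Z by(rule words_whom(2)[OF theta_words[OF that mr_wcoeffs]])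
 have 1: "wmul ?Y(wmul ?Y x) = 0"
  using wmul_assoc[OF t[OF assms(2)] t[OF assms(2)] x] theta_square[OF assms(2)] clin_zero[OF lin_wmul_left] by simp
 have 2: "wmul(wmul x ?X) ?X = 0"
  using wmul_assoc[OF x t[OF assms(1)] t[OF assms(1)]] theta_square[OF assms(1)] clin_zero[OF lin_wmul_right] by simp
 have 3: "wmul(wmul ?Y x) ?X = wmul ?Y(wmul x ?X)" by(rule wmul_assoc[OF t[OF assms(2)] x t[OF assms(1)]])
 have d: "wmul u(v-w) = wmul u v-wmul u w" "wmul(v-w)u = wmul v u-wmul w u" for u v w
  using clin_diff[OF lin_wmul_right] clin_diff[OF lin_wmul_left] by simp_all
 show ?thesis
  unfolding wdiff_eq[OF wdiff_in[OF assms]] unfolding wdiff_eq[OF assms(3)]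
  by(simp add:d clin_scale[OF lin_wmul_right] clin_scale[OF lin_wmul_left] 1 2 3 scale_simps scaleC_scaleC)
qed

lemma wdiff_act:
 assumes "X:obj D" "Y:obj D" "x:wghom X Y j"
 shows "wdiff X Y(wact h x) = wact h(wdiff X Y x)"
proof -
 have x: "x:whom X Y" using assms(3) wghom_whom by blast
 show ?thesis
  unfolding wdiff_eq[OF wact_wghom[OF assms(3)]] wdiff_eq[OF assms(3)]
  by(simp add:clin_diff[OF lin_wact] clin_scale[OF lin_wact] wact_theta_mul[OF assms(1,2) x mr_wcoeffs])
qed

lemma wdiff_leibniz:
 assumes "X:obj D" "Y:obj D" "Z:obj D" "g:wghom Y Z i" "f:wghom X Y j"
 shows "wdiff X Z(wmul g f) = wmul(wdiff Y Z g)f+(- 1) ^ i*.wmul g(wdiff X Y f)"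
proof -
 have x: "g:whom Y Z" "f:whom X Y" using assms(4,5) wghom_whom by blast+
 have t: "theta mr Z:whom Z Z" if "Z:obj D" for Z by(rule words_whom(2)[OF theta_words[OF that mr_wcoeffs]])
 have 1: "wmul(theta mr Z)(wmul g f) = wmul(wmul(theta mr Z)g)f"
  by(rule wmul_assoc[OF t[OF assms(3)] x,symmetric])
 have 2: "wmul(wmul g f)(theta mr X) = wmul g(wmul f(theta mr X))" by(rule wmul_assoc[OF x t[OF assms(1)]])
 have 3: "wmul(wmul g(theta mr Y))f = wmul g(wmul(theta mr Y)f)" by(rule wmul_assoc[OF x(1) t[OF assms(2)] x(2)])
 have d: "wmul u(v-w) = wmul u v-wmul u w" "wmul(v-w)u = wmul v u-wmul w u" for u v w
  using clin_diff[OF lin_wmul_right] clin_diff[OF lin_wmul_left] by simp_all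
 show ?thesis
  unfolding wdiff_eq[OF wmul_wghom[OF assms(4,5)]] wdiff_eq[OF assms(4)] wdiff_eq[OF assms(5)]
  by(simp add:d clin_scale[OF lin_wmul_right] clin_scale[OF lin_wmul_left] 1 2 3
  cscale_right_diff_distrib scaleC_scaleC power_add)
qed

definition wsemicat :: "('o,('o,'m)word_space,'h)dghsemicat" where
 "wsemicat = \<lparr>obj = obj D,hom = whom,comp = (%X Y Z. wmul),act = (%X Y. wact),ghom = wghom,diff = wdiff\<rparr>"

lemma wsemicat_simps [simp]: "obj wsemicat = obj D" "hom wsemicat X Y = whom X Y" "comp wsemicat X Y Z = wmul"
 "act wsemicat X Y = wact" "ghom wsemicat X Y j = wghom X Y j" "diff wsemicat X Y = wdiff X Y"
 by(simp_all add: wsemicat_def)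

lemma bilin_subset: "bilin f ==> cbil A B f"
proof(rule cbilI)
 assume f: "bilin f"
 show "clin B(f a)" for a by(rule clin_subset[OF bilinD1[OF f] subset_UNIV])
 show "clin A(%a. f a b)" for b by(rule clin_subset[OF bilinD2[OF f] subset_UNIV])
qed

lemma wsemicat_H: "lHsemi H wsemicat"
 unfolding lHsemi_def wsemicat_simps
proof(intro conjI ballI allI,goal_cases)
 case(1 X Y)
 show ?case by(rule whom_subspace)
next
 case(2 X Y Z g f)
 thus ?case by(intro wmul_whom)
next
 case(3 X Y Z)
 show ?case by(rule bilin_subset[OF bilin_wmul])
next
 case(4 W X Y Z g f e)
 thus ?case by(intro wmul_assoc)
next
 case(5 X Y h f)
 thus ?case by(intro wact_whom)
next
 case(6 X Y)
 show ?case by(rule bilin_subset[OF bilin_wact])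
next
 case(7 X Y f)
 thus ?case by(intro wact_one)
next
 case(8 X Y a b f)
 thus ?case by(intro wact_mult)
next
 case(9 X Y Z h g f)
 thus ?case by(intro wact_wmul)
qed

lemma words_direct_sum: "internal_direct_sum(whom X Y)(wghom X Y)"
 unfolding internal_direct_sum_def
proof(intro conjI allI impI)
 show "csub(wghom X Y n)" for n by(rule wghom_subspace)
 show "whom X Y = cspan(\<Union>n. wghom X Y n)"
 proof
  show "whom X Y \<subseteq> cspan(\<Union>n. wghom X Y n)"
  by(rule cspan_mono,rule UN_mono[OF subset_refl]) (rule cspan_superset)
  show "cspan(\<Union>n. wghom X Y n) \<subseteq> whom X Y"
  by(rule cspan_minimal[OF UN_least[OF wghom_whom] whom_subspace])
 qed
 fix N x n assume x: "\<forall>n\<le>N. x n:wghom X Y n" and s: "(\<Sum>n\<le>N. x n) = 0" and n: "n<=N"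
 \<comment> \<open>The projection onto words of one length is multilinear and therefore well
   defined; it isolates the component \<open>x n\<close> of a vanishing sum.\<close>
 define \<pi> where "\<pi> = free_ext(%c es. if length es = Suc n then word c es else 0)"
 have m: "multi(%c es. if length es = Suc n then word c es else 0)"
  by(rule multi_if[OF multi_word,of "%l _ _. l = Suc n"])
 have l: "lin \<pi>" by(simp add:\<pi>_def lin_free_ext)
 have p: "\<pi> y = (if j = n then y else 0)" if "y:wghom X Y j" for y j
 proof(rule span_lin_eq[OF that l])
  show "lin(%y. if j = n then y else 0)" by(intro clin_if clin_ident clin_const_zero)
  fix b assume "b:words X Y j"
  then obtain c es where b: "b = word c es" "length es = Suc j" by(auto simp:words_def)
  show "\<pi> b = (if j = n then b else 0)" unfolding \<pi>_def b(1) free_ext_word[OF m] by(simp add:b)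
 qed
 have "0 = \<pi>(\<Sum>j\<le>N. x j)" using s clin_zero[OF l] by simp
 also have "... = (\<Sum>j\<le>N. \<pi>(x j))" by(rule clin_sum[OF l]) simp_all
 also have "... = (\<Sum>j\<le>N. if j = n then x j else 0)" by(rule sum.cong) (use x p in auto)
 also have "... = x n" using n by simp
 finally show "x n = 0" by simp
qed

lemma wdiff_whom:
 assumes "X:obj D" "Y:obj D" "x:whom X Y"
 shows "wdiff X Y(wdiff X Y x) = 0" "wdiff X Y(wact h x) = wact h(wdiff X Y x)"
proof -
 show "wdiff X Y(wdiff X Y x) = 0"
  by(rule span_lin_eq[OF assms(3) lin_comp[OF lin_wdiff lin_wdiff] clin_const_zero])
  (auto intro:wdiff_wdiff[OF assms(1,2) words_whom(1)])
 show "wdiff X Y(wact h x) = wact h(wdiff X Y x)"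
  by(rule span_lin_eq[OF assms(3) lin_comp[OF lin_wdiff lin_wact] lin_comp[OF lin_wact lin_wdiff]])
  (auto intro:wdiff_act[OF assms(1,2) words_whom(1)])
qed

lemma wsemicat_DGH: "lDGH H wsemicat"
 unfolding lDGH_def wsemicat_simps
proof(intro conjI ballI allI,goal_cases)
 case 1
 show ?case by(rule wsemicat_H)
next
 case(2 X Y)
 show ?case by(rule words_direct_sum)
next
 case(3 X Y n h f)
 thus ?case by(simp add:wact_wghom)
next
 case(4 X Y)
 show ?case by(rule clin_subset[OF lin_wdiff subset_UNIV])
next
 case(5 X Y n f)
 thus ?case by(simp add:wdiff_in)
next
 case(6 X Y f)
 thus ?case by(simp add:wdiff_whom)
next
 case(7 X Y h f)
 thus ?case by(simp add:wdiff_whom)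
next
 case(8 X Y Z i j g f)
 thus ?case by(simp add:wmul_wghom)
next
 case(9 X Y Z i j g f)
 thus ?case by(intro wdiff_leibniz)
qed

end

section \<open>The cycle of words is vanishing\<close>

definition munit :: "2 => 2 => complex^2^2" where
 "munit a b = (\<chi> i j. if i = a&j = b then 1 else 0)"

text \<open>Expansion in matrix units; it yields the injectivity that allows equations in
  \<open>tensor_M2\<close> to be verified on matrices.\<close>

lemma entries_inverse:
 assumes A: "csub A" and t: "t:tsp A UNIV"
 shows "(\<Sum>a\<in>UNIV. \<Sum>b\<in>UNIV.(entries A t$a$b) \<otimes>\<^sub>C munit a b) = t"
 using t A
proof(induction t rule: tsp_induct)
 case zero
 have "(0 :: 'a) \<otimes>\<^sub>C munit a b = 0" for a b
  by(rule clin_zero[OF clin_pure_left[OF clin_ident] csub_UNIV])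
 thus ?case by(simp add:entries_zero[OF A])
next
 case(add f B t)
 have l: "lin(%B. f \<otimes>\<^sub>C(B :: complex^2^2))" by(intro li)
 have B: "(\<Sum>a\<in>UNIV. \<Sum>b\<in>UNIV. B$a$b*.munit a b) = B"
  by(simp add:mat2_eq_iff sum_2 munit_def scaleC_vec_nth scaleC_complex_def)
 have "f \<otimes>\<^sub>C(\<Sum>a\<in>UNIV. \<Sum>b\<in>UNIV. B$a$b*.munit a b) = (\<Sum>a\<in>UNIV. \<Sum>b\<in>UNIV. f \<otimes>\<^sub>C(B$a$b*.munit a b))"
  by(simp only: clin_sum[OF l csub_UNIV UNIV_I])
 hence 1: "(\<Sum>a\<in>UNIV. \<Sum>b\<in>UNIV.(B$a$b*.f) \<otimes>\<^sub>C munit a b) = f \<otimes>\<^sub>C B"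
  unfolding B by(simp add:pure_tensor_scale_left pure_tensor_scale_right)
 have "entries A(f \<otimes>\<^sub>C B+t)$a$b = B$a$b*.f+entries A t$a$b" for a b
  using clin_add[OF entries_lin[OF A] pure_in_tensor_space[OF add(1) UNIV_I] add(3)] entries_pure[OF A add(1),of B] by simp
 hence "(\<Sum>a\<in>UNIV. \<Sum>b\<in>UNIV.(entries A(f \<otimes>\<^sub>C B+t)$a$b) \<otimes>\<^sub>C munit a b) = (\<Sum>a\<in>UNIV. \<Sum>b\<in>UNIV.(B$a$b*.f) \<otimes>\<^sub>C munit a b)+(\<Sum>a\<in>UNIV. \<Sum>b\<in>UNIV.(entries A t$a$b) \<otimes>\<^sub>C munit a b)"
  by(simp only: pure_tensor_add_left sum.distrib)
 thus ?case unfolding 1 add.IH .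
qed

lemma entries_inj:
 assumes "csub A" "t:tsp A UNIV" "u:tsp A UNIV" "entries A t = entries A u"
 shows "t = u"
 by(subst entries_inverse[OF assms(1,2),symmetric],subst assms(4)) (rule entries_inverse[OF assms(1,3)])

context graded_semicat
begin

lemma deg0_semicategory: "lHsemi H(deg0 C)"
proof -
 have c: "comp C X Y Z g f:ghom C X Z 0" if "X:obj C" "Y:obj C" "Z:obj C" "g:ghom C Y Z 0" "f:ghom C X Y 0" for X Y Z g f
  using comp_in[OF that] by simp
 show ?thesis
  unfolding lHsemi_def deg0_def hsemicat.simps
  by(intro conjI ballI allI sub_ghom c comp_bilin comp_assoc[of _ _ _ _ _ 0 _ 0 _ 0] act_in act_bilin
  act_one[of _ _ _ 0] act_mult[of _ _ _ 0] act_comp[of _ _ _ _ 0 _ 0])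
qed

text \<open>The converse of the translation to matrices: lift \<open>N\<close> and \<open>N'\<close>
  to tensors and verify each condition after \<open>entries\<close>, which is injective and respects
  composition and action.\<close>

lemma vanishingI_mat2:
 assumes cat: "left_H_category H(deg0 C)"
  and u: "Hfun(deg0 C)(deg0 C)(%X. X) \<upsilon>"
  and N: "!!X. X:obj C ==> N X:ghom(mat2 C)X X 0" "!!X. X:obj C ==> N' X:ghom(mat2 C)X X 0"
  and inv: "!!X h. X:obj C ==> act(mat2 C)X X h(N X) = \<epsilon> h*.N X"
  and e: "!!X. X:obj C ==> is_identity(deg0 C)X(e X)"
  and NN: "!!X. X:obj C ==> comp(mat2 C)X X X(N X)(N' X) = diag2(e X)(e X)"
  "!!X. X:obj C ==> comp(mat2 C)X X X(N' X)(N X) = diag2(e X)(e X)"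
  and NF: "!!X Y f. X:obj C ==> Y:obj C ==> f:ghom C X Y 0 ==> comp(mat2 C)X Y Y(N Y)(diag2 f(\<upsilon> X Y f)) = comp(mat2 C)X X Y(diag2 0(\<upsilon> X Y f))(N X)"
 shows "vanishing H C"
proof -
 interpret m: graded_semicat H "mat2 C" by(rule graded_mat2)
 have oo: "obj(mat2 C) = obj C" by simp
 have h0: "hom(deg0 C)X Y = ghom C X Y 0" for X Y by(simp add:deg0_def)
 have lift: "\<exists>t. t:hom M2 X X&ent X X t = A" if X: "X:obj C" and A: "A:ghom(mat2 C)X X 0" for X A
 proof -
  have "A$i$j:ghom C X X 0" for i j using A by simp
  from entries_surj[OF sub_ghom[OF X X,of 0] this] show ?thesis unfolding M2_hom by metis
 qed
 define \<eta> where "\<eta> X = (SOME t. t:hom M2 X X&ent X X t = N X)" for X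
 define \<eta>' where "\<eta>' X = (SOME t. t:hom M2 X X&ent X X t = N' X)" for X
 have \<eta>: "\<eta> X:hom M2 X X" "ent X X(\<eta> X) = N X" if "X:obj C" for X
  using someI_ex[OF lift[OF that N(1)[OF that]]] by(simp_all add: \<eta>_def)
 have \<eta>': "\<eta>' X:hom M2 X X" "ent X X(\<eta>' X) = N' X" if "X:obj C" for X
  using someI_ex[OF lift[OF that N(2)[OF that]]] by(simp_all add: \<eta>'_def)
 have inj: "t = t'" if "X:obj C" "Y:obj C" "t:hom M2 X Y" "t':hom M2 X Y" "ent X Y t = ent X Y t'" for X Y t t'
  using entries_inj[OF sub_ghom[OF that(1,2)]] that(3,4,5) by(simp add:M2_hom)
 have ein: "e X:ghom C X X 0" if "X:obj C" for X using e[OF that] by(simp add:is_identity_def h0)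
 have er: "comp C X X Y f(e X) = f" "comp C Y X X(e X)g = g"
  if "X:obj C" "Y:obj C" "f:ghom C X Y 0" "g:ghom C Y X 0" for X Y f g
  using e[OF that(1)] that(2-4) by(auto simp:is_identity_def deg0_def)
 have dr: "comp(mat2 C)X X Y A(diag2(e X)(e X)) = A" if "X:obj C" "Y:obj C" "A:ghom(mat2 C)X Y 0" for X Y A
  using that er(1)[OF that(1,2) _ zero_in[OF that(2,1)]] comp_zero_right[OF that(1,1,2),where i = 0]
  by(simp add:mat2_eq_iff sum_2)
 have dl: "comp(mat2 C)Y X X(diag2(e X)(e X))A = A" if "X:obj C" "Y:obj C" "A:ghom(mat2 C)Y X 0" for X Y A
  using that er(2)[OF that(1,2) zero_in[OF that(1,2)]] comp_zero_left[OF that(2,1,1),where j = 0]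
  by(simp add:mat2_eq_iff sum_2)
 have ent_in: "ent X Y t:ghom(mat2 C)X Y 0" if "X:obj C" "Y:obj C" "t:hom M2 X Y" for X Y t
  using entries_in[OF sub_ghom[OF that(1,2)],of t 0] that(3) by(simp add:M2_hom)
 have idI: "is_identity M2 X t" if X: "X:obj C" and t: "t:hom M2 X X" "ent X X t = diag2(e X)(e X)" for X t
  unfolding is_identity_def
 proof(intro conjI ballI)
  show "t:hom M2 X X" by(rule t(1))
  fix Y assume "Y:obj M2"
  hence Y: "Y:obj C" by(simp add:tensor_M2_def deg0_def)
  show "comp M2 X X Y f t = f" if f: "f:hom M2 X Y" for f
  by(rule inj[OF X Y M2_comp(1)[OF X X Y f t(1)] f]) (simp only: M2_comp(2)[OF X X Y f t(1)] t(2) dr[OF X Y ent_in[OF X Y f]])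
  show "comp M2 Y X X t f = f" if f: "f:hom M2 Y X" for f
  by(rule inj[OF Y X M2_comp(1)[OF Y X X t(1) f] f]) (simp only: M2_comp(2)[OF Y X X t(1) f] t(2) dl[OF X Y ent_in[OF Y X f]])
 qed
 have mi: "mutually_inverse M2 X(\<eta> X)(\<eta>' X)" if X: "X:obj C" for X
  unfolding mutually_inverse_def
  using M2_comp(1)[OF X X X \<eta>(1)[OF X] \<eta>'(1)[OF X]] M2_comp(1)[OF X X X \<eta>'(1)[OF X] \<eta>(1)[OF X]] \<eta>(1)[OF X] \<eta>'(1)[OF X]
  M2_comp(2)[OF X X X \<eta>(1)[OF X] \<eta>'(1)[OF X]] M2_comp(2)[OF X X X \<eta>'(1)[OF X] \<eta>(1)[OF X]]
  by(intro conjI idI[OF X]) (simp_all only: \<eta>(2)[OF X] \<eta>'(2)[OF X] NN[OF X])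
 have ai: "act M2 X X h(\<eta> X) = \<epsilon> h*.\<eta> X" if X: "X:obj C" for X h
 proof(rule inj[OF X X M2_act(1)[OF X \<eta>(1)[OF X]]])
  have t: "\<eta> X:tsp(ghom C X X 0)UNIV" using \<eta>(1)[OF X] by(simp add:M2_hom)
  thus "\<epsilon> h*.\<eta> X:hom M2 X X" by(simp add:M2_hom csub_scale[OF sub_tensor_space])
  show "ent X X(act M2 X X h(\<eta> X)) = ent X X(\<epsilon> h*.\<eta> X)"
  unfolding M2_act(2)[OF X \<eta>(1)[OF X]] clin_scale[OF entries_lin[OF sub_ghom[OF X X]] t] \<eta>(2)[OF X] by(rule inv[OF X])
 qed
 have uin: "\<upsilon> X Y f:ghom C X Y 0" if "X:obj C" "Y:obj C" "f:ghom C X Y 0" for X Y f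
  using u that by(simp add:Hfun_def deg0_def)
 have E: "ent X Y(f \<otimes>\<^sub>C E11) = diag2 f 0" "ent X Y(f \<otimes>\<^sub>C E22) = diag2 0 f"
  "f \<otimes>\<^sub>C E11:hom M2 X Y" "f \<otimes>\<^sub>C E22:hom M2 X Y"
  if "X:obj C" "Y:obj C" "f:ghom C X Y 0" for X Y f
  using entries_pure[OF sub_ghom[OF that(1,2)] that(3)]
  by(simp_all add: mat2_eq_iff E11_def E22_def scaleC_one scale_simps M2_hom pure_in_tensor_space[OF that(3)])
 have conj: "comp M2 X X Y(comp M2 X Y Y(\<eta> Y)(f \<otimes>\<^sub>C E11+\<upsilon> X Y f \<otimes>\<^sub>C E22))(\<eta>' X) = \<upsilon> X Y f \<otimes>\<^sub>C E22"
  if X: "X:obj C" "Y:obj C" and f: "f:ghom C X Y 0" for X Y f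
 proof -
  let ?t = "f \<otimes>\<^sub>C E11+\<upsilon> X Y f \<otimes>\<^sub>C E22"
  note uf = uin[OF X f]
  have t: "?t:hom M2 X Y"
  using E(3)[OF X f] E(4)[OF X uf] csub_add[OF sub_tensor_space] unfolding M2_hom by blast
  have "ent X Y ?t = diag2 f 0+diag2 0(\<upsilon> X Y f)"
  using clin_add[OF entries_lin[OF sub_ghom[OF X,of 0]],of "f \<otimes>\<^sub>C E11" "\<upsilon> X Y f \<otimes>\<^sub>C E22"]
  E[OF X f] E[OF X uf] by(simp add:M2_hom)
  also have "... = diag2 f(\<upsilon> X Y f)" by(simp add:mat2_eq_iff)
  finally have t': "ent X Y ?t = diag2 f(\<upsilon> X Y f)" .
  have c1: "comp M2 X Y Y(\<eta> Y) ?t:hom M2 X Y" by(rule M2_comp(1)[OF X X(2) \<eta>(1)[OF X(2)] t])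
  have F: "diag2 0(\<upsilon> X Y f):ghom(mat2 C)X Y 0" unfolding diag2_in[OF X] using uf zero_in[OF X] by simp
  note Xo = X(1)[folded oo] X(2)[folded oo]
  show ?thesis
  proof(rule inj[OF X M2_comp(1)[OF X(1,1,2) c1 \<eta>'(1)[OF X(1)]] E(4)[OF X uf]])
  have "ent X Y(comp M2 X X Y(comp M2 X Y Y(\<eta> Y) ?t)(\<eta>' X)) = comp(mat2 C)X X Y(comp(mat2 C)X X Y(diag2 0(\<upsilon> X Y f))(N X))(N' X)"
  unfolding M2_comp(2)[OF X(1,1,2) c1 \<eta>'(1)[OF X(1)]] M2_comp(2)[OF X X(2) \<eta>(1)[OF X(2)] t] t'
  \<eta>(2)[OF X(2)] \<eta>'(2)[OF X(1)] NF[OF X f] ..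
  also have "... = diag2 0(\<upsilon> X Y f)"
  unfolding m.comp_assoc[OF Xo(1,1,1,2) F N(1)[OF X(1)] N(2)[OF X(1)]] NN(1)[OF X(1)] by(rule dr[OF X F])
  finally show "ent X Y(comp M2 X X Y(comp M2 X Y Y(\<eta> Y) ?t)(\<eta>' X)) = ent X Y(\<upsilon> X Y f \<otimes>\<^sub>C E22)"
  unfolding E(2)[OF X uf] .
  qed
 qed
 show ?thesis
  unfolding vanishing_def Let_def h0 using cat u mi ai conj by blast
qed

end

lemma diag2_if: "diag2 x y$a$b = (if a = b then(if a = 1 then x else y)else 0)"
 using exhaust_2[of a] exhaust_2[of b] by auto

context cochain_data
begin

text \<open>Infinite matrices as degree zero endomorphisms: they act on the coefficients only and
  \<open>H\<close> acts on them by the counit.\<close>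

definition iota :: "'o => imat =>('o,'m)word_space" where
 "iota X c = word c [aident X]"

lemma wvalid_single: "wvalid c [e] \<longleftrightarrow> arr e&rowfin c"
 by(auto simp:wvalid_def wpath_Cons wcoeffs_def)

lemma lin_word_single: "arr e ==> clin(Collect rowfin)(%c. word c [e])"
 using multi_coeff[OF multi_word,of "[e]"] by(simp add:wpath_Cons wcoeffs_def)

lemma sub_rowfin: "csub(Collect rowfin)"
 using sub_wcoeffs[of 1] by(simp add:wcoeffs_def)

lemma iota_words: "X:obj D ==> rowfin c ==> iota X c:words X X 0"
 unfolding iota_def by(rule wordsI) (simp_all add: wvalid_single aident)

lemma wmul_single: "arr e ==> arr e' ==> rowfin c ==> rowfin c' ==> src e = tgt e' ==> wmul(word c [e])(word c' [e']) = word(mm c c')[acomp e e']"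
 using wmul_word_split[of c "[]" e c' e' "[]"] by(simp add:wvalid_single)

lemma wmul_iota:
 assumes e: "arr e" and c: "rowfin c" "rowfin m"
 shows "wmul(iota(tgt e)m)(word c [e]) = word(mm m c)[e]" "wmul(word c [e])(iota(src e)m) = word(mm c m)[e]"
proof -
 have o: "tgt e:obj D" "src e:obj D" using e by(simp_all add: arr_def)
 show "wmul(iota(tgt e)m)(word c [e]) = word(mm m c)[e]" "wmul(word c [e])(iota(src e)m) = word(mm c m)[e]"
  unfolding iota_def using wmul_single[OF aident(1)[OF o(1)] e c(2,1)] wmul_single[OF e aident(1)[OF o(2)] c] aident(3,4) o e
  by simp_all
qed

lemma words_zeroE:
 assumes "w:words X Y 0"
 obtains c e where "w = word c [e]" "arr e" "rowfin c" "tgt e = Y" "src e = X"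
proof -
 obtain c b bs where "w = word c(b#bs)" "wvalid c(b#bs)" "length bs = 0" "tgt b = Y" "src(last(b#bs)) = X"
  by(rule words_ConsE[OF assms])
 thus thesis using that by(auto simp:wvalid_single)
qed

lemma wact_single: "arr e ==> rowfin c ==> wact h(word c [e]) = word c [hact h e]"
 using wact_word[of c "[e]" 0] by(simp add:wvalid_single)

lemma wact_iota:
 assumes X: "X:obj D" and c: "rowfin c"
 shows "wact h(iota X c) = \<epsilon> h*.iota X c"
proof -
 let ?e = "aident X"
 have e: "?e = (X,mor ?e,X)" "mor ?e:hom D X X" using aident(1)[OF X] by(simp_all add: arr_def prod_eq_iff)
 have "clin(hom D X X)(%f. word c([]@(X,f,X)#[]))"
  by(rule multi_slot[OF multi_word,of _ _ _ "mor ?e"]) (use e aident(1)[OF X] c in \<open>simp add: wvalid_single\<close>)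
 from clin_scale[OF this e(2),of "\<epsilon> h"] show ?thesis
  using e(1) by(simp add:iota_def wact_single[OF aident(1)[OF X] c] aident(2)[OF X])
qed

lemma iota_identity:
 assumes X: "X:obj D"
 shows "is_identity(deg0 wsemicat)X(iota X mone)"
proof -
 have "wmul f(iota X mone) = f" if "f:wghom X Y 0" for f Y
 proof(rule span_lin_eq[OF that lin_wmul_left clin_ident])
  fix w assume "w:words X Y 0"
  then obtain c e where "w = word c [e]" "arr e" "rowfin c" "tgt e = Y" "src e = X" by(rule words_zeroE)
  thus "wmul w(iota X mone) = w" using wmul_iota(2)[of e c mone] by(simp add:rowfin_mone mm_mone_right)
 qed
 moreover have "wmul(iota X mone)f = f" if "f:wghom Y X 0" for f Y
 proof(rule span_lin_eq[OF that lin_wmul_right clin_ident])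
  fix w assume "w:words Y X 0"
  then obtain c e where "w = word c [e]" "arr e" "rowfin c" "tgt e = X" "src e = Y" by(rule words_zeroE)
  thus "wmul(iota X mone)w = w" using wmul_iota(1)[of e c mone] by(simp add:rowfin_mone mm_mone_left)
 qed
 ultimately show ?thesis
  using words_whom(1)[OF iota_words[OF X rowfin_mone]] by(simp add:is_identity_def deg0_def)
qed

text \<open>Confined to degree zero: infinitely many copies of a matrix stay row-finite, but bounded
  columns are not preserved.\<close>

definition wups :: "('o,'m)word_space =>('o,'m)word_space" where
 "wups = free_ext(%c es. if length es = Suc 0 then word(ups c)es else 0)"

lemma lin_wups: "lin wups"
 by(simp add:wups_def lin_free_ext)

lemma wups_word:
 assumes "arr e"
 shows "wups(word c [e]) = word(ups c)[e]"
proof -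
 have "multi(%c es. if length es = Suc 0 then word(ups c)es else 0)"
 proof(rule multiI)
  fix es assume p: "wpath es"
  show "clin(wcoeffs(length es))(%c. if length es = Suc 0 then word(ups c)es else 0)"
  proof(cases "length es = Suc 0")
  case True
  have "clin(wcoeffs(Suc 0))(%c. word(ups c)es)"
  using multi_coeff[OF multi_word p] unfolding True
  by(rule clin_compose[OF _ clin_subset[OF lin_ups subset_UNIV]]) (simp add:wcoeffs_def rowfin_ups)
  thus ?thesis using True by simp
  qed(simp add:clin_const_zero)
 next
  fix c as X f Y bs assume v: "wvalid c(as@(X,f,Y)#bs)"
  show "clin(hom D Y X)(%f. if length(as@(X,f,Y)#bs) = Suc 0 then word(ups c)(as@(X,f,Y)#bs)else 0)"
  proof(cases "as = []&bs = []")
  case True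
  hence "wvalid(ups c)(as@(X,f,Y)#bs)" using v by(simp add:wvalid_single rowfin_ups)
  from multi_slot[OF multi_word this] show ?thesis using True by simp
  next
  case False
  hence "~ length(as@(X,f,Y)#bs) = Suc 0" for f by auto
  thus ?thesis by(simp only: if_False clin_const_zero)
  qed
 qed
 thus ?thesis unfolding wups_def by(simp add:free_ext_word)
qed

lemma wsemicat_graded: "graded_semicat H wsemicat"
 by(rule graded_semicat_of_DGH[OF wsemicat_DGH])

lemma wups_semifunctor: "Hfun(deg0 wsemicat)(deg0 wsemicat)(%X. X)(%X Y. wups)"
proof(rule semifunctor_degree_zeroI)
 have d: "hom(deg0 wsemicat)X Y = wghom X Y 0" "obj(deg0 wsemicat) = obj D"
  "comp(deg0 wsemicat)X Y Z = wmul" "act(deg0 wsemicat)X Y = wact" for X Y Z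
  by(simp_all add: deg0_def)
 show "X:obj wsemicat" if "X:obj(deg0 wsemicat)" for X using that by(simp add:d)
 show "clin(hom(deg0 wsemicat)X Y)wups" for X Y by(rule clin_subset[OF lin_wups subset_UNIV])
 show "wups f:ghom wsemicat X Y 0" if f: "f:hom(deg0 wsemicat)X Y" for X Y f
  unfolding wsemicat_simps
 proof(rule span_lin_in[OF f[unfolded d] lin_wups wghom_subspace])
  fix w assume "w:words X Y 0"
  then obtain c e where w: "w = word c [e]" "arr e" "rowfin c" "tgt e = Y" "src e = X" by(rule words_zeroE)
  hence "word(ups c)[e]:words X Y 0" by(intro wordsI) (simp_all add: wvalid_single rowfin_ups)
  thus "wups w:wghom X Y 0" using w by(simp add:wups_word words_whom(1))
 qed
 show "wups(act(deg0 wsemicat)X Y h f) = act wsemicat X Y h(wups f)"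
  if f: "f:hom(deg0 wsemicat)X Y" for X Y h f
  unfolding wsemicat_simps d
 proof(rule span_lin_eq[OF f[unfolded d] lin_comp[OF lin_wups lin_wact] lin_comp[OF lin_wact lin_wups]])
  fix w assume "w:words X Y 0"
  then obtain c e where w: "w = word c [e]" "arr e" "rowfin c" "tgt e = Y" "src e = X" by(rule words_zeroE)
  thus "wups(wact h w) = wact h(wups w)" by(simp add:wups_word wact_single arr_hact rowfin_ups)
 qed
 show "wups(comp(deg0 wsemicat)X Y Z g f) = comp wsemicat X Y Z(wups g)(wups f)"
  if g: "g:hom(deg0 wsemicat)Y Z" and f: "f:hom(deg0 wsemicat)X Y" for X Y Z g f
  unfolding wsemicat_simps d
 proof(rule span_lin_eq[OF g[unfolded d] lin_comp[OF lin_wups lin_wmul_left] lin_comp[OF lin_wmul_left lin_wups]])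
  fix v assume "v:words Y Z 0"
  then obtain c e where v: "v = word c [e]" "arr e" "rowfin c" "tgt e = Z" "src e = Y" by(rule words_zeroE)
  show "wups(wmul v f) = wmul(wups v)(wups f)"
  proof(rule span_lin_eq[OF f[unfolded d] lin_comp[OF lin_wups lin_wmul_right] lin_comp[OF lin_wmul_right lin_wups]])
  fix w assume "w:words X Y 0"
  then obtain c' e' where w: "w = word c' [e']" "arr e'" "rowfin c'" "tgt e' = Y" "src e' = X" by(rule words_zeroE)
  have s: "src e = tgt e'" using v(5) w(4) by simp
  show "wups(wmul v w) = wmul(wups v)(wups w)"
  unfolding v(1) w(1) wups_word[OF v(2)] wups_word[OF w(2)] wmul_single[OF v(2) w(2) v(3) w(3) s]
  wups_word[OF arr_acomp[OF v(2) w(2) s]] wmul_single[OF v(2) w(2) rowfin_ups[OF v(3)] rowfin_ups[OF w(3)] s]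
  ups_mm[OF v(3)] ..
  qed
 qed
qed

definition sw_matrix :: "(2\<times>nat => 2\<times>nat) => 'o =>('o,'m)word_space^2^2" where
 "sw_matrix s X = (\<chi> a b. iota X(blk s a b))"

lemma sw_matrix_inverse:
 assumes X: "X:obj D" and s: "!!p. s'(s p) = p"
 shows "comp(mat2 wsemicat)X X X(sw_matrix s X)(sw_matrix s' X) = diag2(iota X mone)(iota X mone)"
proof -
 note l = lin_word_single[OF aident(1)[OF X]] and sub = sub_rowfin
 have m: "wmul(iota X(blk s a c))(iota X(blk s' c b)) = word(mm(blk s a c)(blk s' c b))[aident X]" for a b c
  using wmul_iota(1)[OF aident(1)[OF X],of "blk s' c b" "blk s a c"] by(simp add:rowfin_blk iota_def)
 have "(\<Sum>c\<in>UNIV. wmul(iota X(blk s a c))(iota X(blk s' c b))) = word(\<Sum>c\<in>UNIV. mm(blk s a c)(blk s' c b))[aident X]" for a b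
  unfolding m by(rule clin_sum[OF l sub,symmetric]) (simp add:rowfin_mm rowfin_blk)
 also have "word(\<Sum>c\<in>UNIV. mm(blk s a c)(blk s' c b))[aident X] = diag2(iota X mone)(iota X mone)$a$b" for a b
  unfolding blk_inverse[of s' s,OF s] using clin_zero[OF l sub] by(simp add:diag2_if iota_def)
 finally show ?thesis by(simp add:vec_eq_iff sw_matrix_def)
qed

text \<open>Both sides are linear in \<open>f\<close>. On a word of length one the arrow stays fixed
  and the claim becomes \<open>blk_conj\<close> for its coefficient.\<close>

lemma sw_matrix_conj:
 assumes X: "X:obj D" "Y:obj D" and f: "f:wghom X Y 0"
 shows "comp(mat2 wsemicat)X Y Y(sw_matrix swr Y)(diag2 f(wups f)) = comp(mat2 wsemicat)X X Y(diag2 0(wups f))(sw_matrix swr X)"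
proof -
 have "(\<Sum>c\<in>UNIV. wmul(iota Y(blk swr a c))(if c = b then(if c = 1 then f else wups f)else 0)) = (\<Sum>c\<in>UNIV. wmul(if a = c&c = 2 then wups f else 0)(iota X(blk swr c b)))" for a b
 proof(rule span_lin_eq[OF f])
  show "lin(%f. \<Sum>c\<in>UNIV. wmul(iota Y(blk swr a c))(if c = b then(if c = 1 then f else wups f)else 0))"
  by(intro clin_setsum lin_comp[OF lin_wmul_right] clin_if clin_ident lin_wups clin_const_zero)
  show "lin(%f. \<Sum>c\<in>UNIV. wmul(if a = c&c = 2 then wups f else 0)(iota X(blk swr c b)))"
  by(intro clin_setsum lin_comp[OF lin_wmul_left] clin_if lin_wups clin_const_zero)
  fix w assume "w:words X Y 0"
  then obtain x e where w: "w = word x [e]" "arr e" "rowfin x" "tgt e = Y" "src e = X" by(rule words_zeroE)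
  note l = lin_word_single[OF w(2)]
  have z: "word 0 [e] = 0" by(rule clin_zero[OF l sub_rowfin])
  let ?F = "%c. if c = b then(if c = 1 then x else ups x)else 0" and ?G = "%c. if a = c&c = 2 then ups x else 0"
  have F: "rowfin(?F c)" and G: "rowfin(?G c)" for c by(simp_all add: w(3) rowfin_ups rowfin_zero)
  have "(\<Sum>c\<in>UNIV. wmul(iota Y(blk swr a c))(if c = b then(if c = 1 then w else wups w)else 0)) = (\<Sum>c\<in>UNIV. wmul(iota Y(blk swr a c))(word(?F c)[e]))"
  by(rule sum.cong[OF refl]) (simp add:w(1) wups_word[OF w(2)] z)
  also have "... = (\<Sum>c\<in>UNIV. word(mm(blk swr a c)(?F c))[e])"
  using wmul_iota(1)[OF w(2) F rowfin_blk] w(4) by simp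
  also have "... = word(\<Sum>c\<in>UNIV. mm(blk swr a c)(?F c))[e]"
  by(rule clin_sum[OF l sub_rowfin,symmetric]) (simp add:rowfin_mm rowfin_blk F del:if_split)
  also have "... = word(\<Sum>c\<in>UNIV. mm(?G c)(blk swr c b))[e]" unfolding blk_conj[OF w(3)] ..
  also have "... = (\<Sum>c\<in>UNIV. word(mm(?G c)(blk swr c b))[e])"
  by(rule clin_sum[OF l sub_rowfin]) (simp add:rowfin_mm rowfin_blk G del:if_split)
  also have "... = (\<Sum>c\<in>UNIV. wmul(word(?G c)[e])(iota X(blk swr c b)))"
  using wmul_iota(2)[OF w(2) G rowfin_blk] w(5) by simp
  also have "... = (\<Sum>c\<in>UNIV. wmul(if a = c&c = 2 then wups w else 0)(iota X(blk swr c b)))"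
  by(rule sum.cong[OF refl]) (simp add:w(1) wups_word[OF w(2)] z)
  finally show "(\<Sum>c\<in>UNIV. wmul(iota Y(blk swr a c))(if c = b then(if c = 1 then w else wups w)else 0)) = (\<Sum>c\<in>UNIV. wmul(if a = c&c = 2 then wups w else 0)(iota X(blk swr c b)))" .
 qed
 moreover have "diag2 0(wups f)$a$c = (if a = c&c = 2 then wups f else 0)" for a c
  using exhaust_2[of a] exhaust_2[of c] by auto
 ultimately show ?thesis by(simp add:vec_eq_iff sw_matrix_def diag2_if[of f])
qed

theorem wsemicat_vanishing: "vanishing H wsemicat"
proof -
 interpret W: graded_semicat H wsemicat by(rule wsemicat_graded)
 show ?thesis
 proof(rule W.vanishingI_mat2[where N = "sw_matrix swr" and N' = "sw_matrix swl" and e = "%X. iota X mone" and \<upsilon> = "%X Y. wups"])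
  show "left_H_category H(deg0 wsemicat)"
  unfolding left_H_category_def
  proof(intro conjI ballI W.deg0_semicategory)
  fix X assume "X:obj(deg0 wsemicat)"
  hence X: "X:obj D" by(simp add:deg0_def)
  show "\<exists>e. is_identity(deg0 wsemicat)X e&(\<forall>h. act(deg0 wsemicat)X X h e = \<epsilon> h*.e)"
  using iota_identity[OF X] wact_iota[OF X rowfin_mone] by(auto simp:deg0_def)
  qed
  show "Hfun(deg0 wsemicat)(deg0 wsemicat)(%X. X)(%X Y. wups)" by(rule wups_semifunctor)
  fix X assume "X:obj wsemicat"
  hence X: "X:obj D" by simp
  show "sw_matrix swr X:ghom(mat2 wsemicat)X X 0" "sw_matrix swl X:ghom(mat2 wsemicat)X X 0"
  using words_whom(1)[OF iota_words[OF X rowfin_blk]] by(simp_all add: sw_matrix_def)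
  show "act(mat2 wsemicat)X X h(sw_matrix swr X) = \<epsilon> h*.sw_matrix swr X" for h
  using wact_iota[OF X rowfin_blk] by(simp add:vec_eq_iff sw_matrix_def scaleC_vec_nth)
  show "is_identity(deg0 wsemicat)X(iota X mone)" by(rule iota_identity[OF X])
  show "comp(mat2 wsemicat)X X X(sw_matrix swr X)(sw_matrix swl X) = diag2(iota X mone)(iota X mone)"
  "comp(mat2 wsemicat)X X X(sw_matrix swl X)(sw_matrix swr X) = diag2(iota X mone)(iota X mone)"
  by(rule sw_matrix_inverse,simp_all only: X swl_swr swr_swl)+
  fix Y f assume "Y:obj wsemicat" "f:ghom wsemicat X Y 0"
  thus "comp(mat2 wsemicat)X Y Y(sw_matrix swr Y)(diag2 f(wups f)) = comp(mat2 wsemicat)X X Y(diag2 0(wups f))(sw_matrix swr X)"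
  using sw_matrix_conj[OF X] by(simp del:mat2_simps)
 qed
qed

end

section \<open>The trace defined by a cyclic cochain\<close>

context cochain_data
begin

lemma lin_coact_M: "lin(coact M)" and lin_ract: "lin(ract M m)" "lin(%m. ract M m h)"
 using sayd_M by(simp_all add: sayd_module_def bilinD1 bilinD2)

lemma coact_counit_M:
 assumes G: "lin G"
 shows "tlift(%a m0. \<epsilon> a*.G m0)(coact M m) = G m"
proof -
 have "tlift(%a m0. G(\<epsilon> a*.m0))(coact M m) = G(tlift(%a m0. \<epsilon> a*.m0)(coact M m))"
  by(rule tlift_lin[OF _ G,symmetric]) (intro bilinI li lin_counit0)
 thus ?thesis using sayd_M by(simp add:clin_scale[OF G] sayd_module_def)
qed

text \<open>Coassociativity of the coaction, and \<open>S'\<close> reversing coproducts. In use it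
  says that rotating two factors one after the other is the rotation of their product.\<close>

lemma coact_rot:
 assumes F: "!!a b. lin(F a b)" "!!a c. lin(%b. F a b c)" "!!b c. lin(%a. F a b c)"
 shows "tlift(%x c. tlift(%y d. F(S' y)(S' x)d)(coact M c))(coact M m) = tlift(%x c. tlift(%p q. F p q c)(\<Delta>(S' x)))(coact M m)"
proof -
 have "tlift(%p q. F p q c)(\<Delta>(S' x)) = tlift(%a b. F(S' b)(S' a)c)(\<Delta> x)" for x c
  by(rule antipode_inv_comult) (intro bilinI F)
 moreover have "tlift(%x c. tlift(%a b. F(S' b)(S' a)c)(\<Delta> x))(coact M m) = tlift(%x c. tlift(%y d. F(S' y)(S' x)d)(coact M c))(coact M m)"
 proof(rule coassoc_general[OF _ lin_coact_M])
  show "tlift(%a c. tlift(%a1 a2. a1 \<otimes>\<^sub>C(a2 \<otimes>\<^sub>C c))(\<Delta> a))(coact M m) = tlift(%a c. a \<otimes>\<^sub>C coact M c)(coact M m)"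
  using sayd_M by(simp add:sayd_module_def)
 qed(rule F lin_comp[OF F(2) lin_S'] lin_comp[OF F(3) lin_S'])+
 ultimately show ?thesis by simp
qed

lemma coact_ract:
 assumes F: "bilin F"
 shows "tlift F(coact M(ract M m h)) = tlift(%h12 h3. tlift(%h1 h2. tlift(%a m0. F(S h3 * a * h1)(ract M m0 h2))(coact M m))(\<Delta> h12))(\<Delta> h)"
proof -
 let ?G = "%h1 h2 h3 a m0.(S h3 * a * h1) \<otimes>\<^sub>C ract M m0 h2"
 have b1: "bilin(?G h1 h2 h3)" for h1 h2 h3
  by(rule bilinI) (intro clin_pure_right lin_ract clin_pure_left clin_mult_left clin_mult_right clin_ident)+
 have b2: "bilin(%h1 h2. tlift(?G h1 h2 h3)(coact M m))" for h3
  by(rule bilinI; rule lin_tensor_lift_fun[OF b1];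
  intro clin_pure_right lin_ract clin_pure_left clin_mult_right clin_ident)
 have b3: "bilin(%h12 h3. tlift(%h1 h2. tlift(?G h1 h2 h3)(coact M m))(\<Delta> h12))"
 proof(rule bilinI)
  show "lin(%h12. tlift(%h1 h2. tlift(?G h1 h2 h3)(coact M m))(\<Delta> h12))" for h3
  by(rule lin_comp[OF lin_tensor_lift[OF b2] lin_comult])
  show "lin(%h3. tlift(%h1 h2. tlift(?G h1 h2 h3)(coact M m))(\<Delta> h12))" for h12
  by(rule lin_tensor_lift_fun[OF b2],rule lin_tensor_lift_fun[OF b1],
  intro clin_pure_left clin_mult_left lin_antipode0)
 qed
 note L = lin_tensor_lift[OF F]
 have "coact M(ract M m h) = tlift(%h12 h3. tlift(%h1 h2. tlift(?G h1 h2 h3)(coact M m))(\<Delta> h12))(\<Delta> h)"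
  using sayd_M by(simp add:sayd_module_def)
 thus ?thesis
  by(simp only: tlift_lin[OF b3 L] tlift_lin[OF b2 L] tlift_lin[OF b1 L] tlift_pure[OF F])
qed

text \<open>Acting first by \<open>b\<close> and then by \<open>a\<close> is acting by
  \<open>a * b\<close>, for scalar functions of a path, where no \<open>wact\<close> is at
  hand.\<close>

lemma sw_hacts_mult:
 assumes m: "mlin n(%ks. \<phi>(hacts ks es))" and p: "wpath es" and l: "length es = Suc n"
 shows "sw n(%ls. sw n(%ks. \<phi>(hacts ks(hacts ls es)))a)b = sw n(%ks. \<phi>(hacts ks es))(a * b)"
  and "length ls = Suc n ==> mlin n(%ks. \<phi>(hacts ks(hacts ls es)))"
  and "mlin n(%ls. sw n(%ks. \<phi>(hacts ks(hacts ls es)))a)"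
proof -
 have e: "\<phi>(hacts ks(hacts ls es)) = \<phi>(hacts(map2 (*)ks ls)es)" if "length ks = Suc n" "length ls = Suc n" for ks ls
  using hacts_mult[OF p] that l by simp
 have m1: "mlin n(%ks. \<phi>(hacts ks(hacts ls es)))" if "length ls = Suc n" for ls
  using mlin_map2_left[OF m that] by(subst mlin_cong[OF e[OF _ that]])
 have m2: "mlin n(%ls. \<phi>(hacts ks(hacts ls es)))" if "length ks = Suc n" for ks
  using mlin_map2_right[OF m that] by(subst mlin_cong[OF e[OF that]])
 show "mlin n(%ks. \<phi>(hacts ks(hacts ls es)))" if "length ls = Suc n" by(rule m1[OF that])
 show "mlin n(%ls. sw n(%ks. \<phi>(hacts ks(hacts ls es)))a)"
 proof(rule mlinI,rule lin_sw_fun)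
  fix ls :: "'h list" and i x assume *: "length ls = Suc n" "i<=n"
  thus "mlin n(%ks. \<phi>(hacts ks(hacts(ls[i := x])es)))" by(intro m1) simp
  show "lin(%x. \<phi>(hacts ks(hacts(ls[i := x])es)))" if "length ks = Suc n" for ks
  by(rule mlinD[OF m2[OF that] *])
 qed
 have "sw n(%ls. sw n(%ks. \<phi>(hacts ks(hacts ls es)))a)b = sw n(%ks. sw n(%ls. \<phi>(hacts ks(hacts ls es)))b)a"
  by(rule sw_swap[symmetric]) (auto intro:m1 m2)
 also have "... = sw n(%ks. sw n(%ls. \<phi>(hacts(map2 (*)ks ls)es))b)a" by(intro sw_cong e)
 also have "... = sw n(%ks. \<phi>(hacts ks es))(a * b)" by(rule sw_mult[OF m,symmetric])
 finally show "sw n(%ls. sw n(%ks. \<phi>(hacts ks(hacts ls es)))a)b = sw n(%ks. \<phi>(hacts ks es))(a * b)" .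
qed

lemma hacts_one: "wpath es ==> hacts(replicate(length es) 1)es = es"
 by(intro nth_equalityI) (auto simp:hacts_def hact_one wpath_nth)

definition wclosed :: "('o,'m)arrow list => bool" where
 "wclosed es \<longleftrightarrow> wpath es&src(last es) = tgt(hd es)"

lemma wclosed_Cons: "wclosed(e#cs) \<longleftrightarrow> arr e&(if cs = [] then src e = tgt e else wpath cs&src e = tgt(hd cs)&src(last cs) = tgt e)"
 by(auto simp:wclosed_def wpath_Cons)

lemma wclosed_Cons_snoc: "wclosed(b#cs@[a]) \<longleftrightarrow> arr a&arr b&src a = tgt b&(if cs = [] then src b = tgt a else wpath cs&src b = tgt(hd cs)&src(last cs) = tgt a)"
 by(auto simp:wclosed_def wpath_Cons wpath_snoc)

lemma wclosed_wrap: "wclosed(b#cs@[a]) ==> wclosed(acomp(hact z a)b#cs)"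
 unfolding wclosed_Cons_snoc wclosed_Cons[of "acomp _ _"] by(auto intro:arr_acomp arr_hact split: if_splits)

lemma wclosed_hacts: "wclosed es ==> length ks = length es ==> wclosed(hacts ks es)"
 by(simp add:wclosed_def wpath_hacts)

lemma wclosed_slot: "wclosed(as@(X,f,Y)#bs) ==> f':hom D Y X ==> wclosed(as@(X,f',Y)#bs)"
proof -
 assume c: "wclosed(as@(X,f,Y)#bs)" and f': "f':hom D Y X"
 have "tgt(hd(as@(X,f',Y)#bs)) = tgt(hd(as@(X,f,Y)#bs))" by(cases as) auto
 moreover have "src(last(as@(X,f',Y)#bs)) = src(last(as@(X,f,Y)#bs))" by(cases bs) auto
 moreover have "wpath(as@(X,f',Y)#bs)" using c f' by(auto simp:wclosed_def wpath_split arr_def)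
 ultimately show ?thesis using c by(simp only: wclosed_def)
qed

lemma wclosed_cyc:
 assumes c: "wclosed es" and i: "i<length es"
 shows "cnth(map tgt es)i = tgt(es!i)" "cnth(map tgt es)(Suc i) = src(es!i)"
proof -
 have ne: "es~=[]" using i by auto
 show "cnth(map tgt es)i = tgt(es!i)" using i by simp
 show "cnth(map tgt es)(Suc i) = src(es!i)"
 proof(cases "Suc i<length es")
  case True
  thus ?thesis using wpath_src_tgt[of es i] c by(simp add:wclosed_def)
 next
  case False
  hence "Suc i = length es" using i by simp
  thus ?thesis using c ne by(simp add:wclosed_def hd_conv_nth last_conv_nth flip: \<open>Suc i = length es\<close>)
 qed
qed

lemma wclosed_chain:
 assumes c: "wclosed es" and l: "length es = Suc j"
 shows "cchain D j(map tgt es)(map mor es)"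
proof(rule cchainI)
 have a: "arr(es!i)" if "i<length es" for i using c that by(simp add:wclosed_def wpath_nth)
 have "tgt e:obj D" if "e:set es" for e using c that by(simp add:wclosed_def wpath_def arr_def)
 thus "set(map tgt es) \<subseteq> obj D" by auto
 show "map mor es!i:hom D(cnth(map tgt es)(Suc i))(cnth(map tgt es)i)" if "i<=j" for i
  using a[of i] that l unfolding wclosed_cyc[OF c,of i,unfolded l less_Suc_eq_le,OF that] by(simp add:arr_def)
qed(simp_all add: l)

lemma act_list_hacts: "wclosed es ==> length ks = length es ==> act_list D(map tgt es)ks(map mor es) = map mor(hacts ks es)"
proof(rule nth_equalityI)
 assume c: "wclosed es" and l: "length ks = length es"
 show "length(act_list D(map tgt es)ks(map mor es)) = length(map mor(hacts ks es))" using l by(simp add:act_list_def)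
 fix i assume "i<length(act_list D(map tgt es)ks(map mor es))"
 hence i: "i<length es" by(simp add:act_list_def)
 have "hacts ks es!i = hact(ks!i)(es!i)" using i l by(simp add:hacts_def)
 moreover have "act_list D(map tgt es)ks(map mor es)!i = act D(cnth(map tgt es)(Suc i))(cnth(map tgt es)i)(ks!i)(map mor es!i)"
  using i by(simp add:act_list_def del:upt_Suc)
 ultimately show "act_list D(map tgt es)ks(map mor es)!i = map mor(hacts ks es)!i"
  unfolding wclosed_cyc[OF c i] using i l by(simp add:hact_def)
qed

lemma map_tgt_hacts: "length ks = length es ==> map tgt(hacts ks es) = map tgt es"
 by(rule nth_equalityI) (auto simp:hacts_def hact_def)

text \<open>Multiplying by the trace of the coefficient turns functions of closed paths into functions of words.\<close>

lemma multi_closed: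
 assumes g: "!!as X f Y bs. wclosed(as@(X,f,Y)#bs) ==> length(as@(X,f,Y)#bs) = Suc(Suc j) ==> clin(hom D Y X)(%f. g(as@(X,f,Y)#bs))"
 shows "multi(%c es. if wclosed es&length es = Suc(Suc j)then mtr c * g es else(0 :: complex))"
proof(rule multiI)
 fix es
 show "clin(wcoeffs(length es))(%c. if wclosed es&length es = Suc(Suc j)then mtr c * g es else 0)"
  using mtr_lin by(intro clin_if clin_const_zero clin_mult_left) simp
next
 fix c as X f Y bs assume v: "wvalid c(as@(X,f,Y)#bs)"
 let ?es = "%f. as@(X,f,Y)#bs"
 have X: "X:obj D" "Y:obj D" "f:hom D Y X" using v by(auto simp:wvalid_def wpath_split arr_def)
 show "clin(hom D Y X)(%f. if wclosed(?es f)&length(?es f) = Suc(Suc j)then mtr c * g(?es f)else 0)"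
 proof(cases "wclosed(?es f)&length(?es f) = Suc(Suc j)")
  case True
  hence "clin(hom D Y X)(%f. mtr c * g(?es f))" by(intro clin_mult_right g[of as X f Y bs]) auto
  thus ?thesis
  by(rule clin_cong[OF _ D_subspace[OF X(2,1)]]) (use True wclosed_slot in auto)
 next
  case False
  hence "~ (wclosed(?es f')&length(?es f') = Suc(Suc j))" if "f':hom D Y X" for f'
  using wclosed_slot[OF _ X(3)] by auto
  thus ?thesis by(intro clin_cong[OF clin_const_zero D_subspace[OF X(2,1)]]) (simp only: if_False)
 qed
qed

text \<open>The coefficient \<open>mp\<close> has trace 1, so multilinearity on closed paths can be
  borrowed from that on words.\<close>

lemma mlin_closed:
 assumes g: "!!as X f Y bs. wclosed(as@(X,f,Y)#bs) ==> length(as@(X,f,Y)#bs) = Suc(Suc j) ==> clin(hom D Y X)(%f. g(as@(X,f,Y)#bs) :: complex)"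
  and es: "wclosed es" "length es = Suc(Suc j)"
 shows "mlin(Suc j)(%ks. g(hacts ks es))"
proof -
 have "wvalid mp es" using es mp_wcoeffs by(simp add:wvalid_def wclosed_def)
 from mlin_multi_hacts[OF multi_closed[of j g,OF g] this es(2)] show ?thesis
  by(subst(asm) mlin_cong[where G = "%ks. g(hacts ks es)"]) (simp_all add: wclosed_hacts es mp_mr mtr_mp)
qed

end

locale cyclic_cochain_data = cochain_data H M D
 for H :: "'h::complex_algebra_1 hopf" and M :: "('h,'v::complex_vector)sayd"
  and D :: "('o,'m::complex_vector,'h)hsemicat" +
 fixes k :: nat and \<psi> :: "('o,'m,'v)cochain"
 assumes psi: "\<psi>:cyclic_cochains H M D k"
begin

lemma psi_c: "\<psi>:cochains H M D k" and psi_cyc: "\<psi> m Xs fs = (- 1) ^ k * cyclic_op H M D k \<psi> m Xs fs"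
 using psi unfolding cyclic_cochains_def by(auto dest:fun_cong)

definition Psi :: "'v =>('o,'m)arrow list => complex" where
 "Psi m es = \<psi> m(map tgt es)(map mor es)"

lemma Psi_lin_m: "wclosed es ==> length es = Suc k ==> lin(%m. Psi m es)"
 unfolding Psi_def by(rule cochain_lin_m[OF psi_c wclosed_chain])

lemma Psi_slot:
 assumes c: "wclosed(as@(X,f,Y)#bs)" and l: "length(as@(X,f,Y)#bs) = Suc k"
 shows "clin(hom D Y X)(%f. Psi m(as@(X,f,Y)#bs))"
proof -
 let ?es = "as@(X,f,Y)#bs"
 have i: "length as<length ?es" "length as<=k" using l by simp_all
 have "(map mor ?es)[length as := g] = map mor(as@(X,g,Y)#bs)" for g
  using list_update_length[of "map mor as" f "map mor bs" g] by simp
 moreover have "map tgt ?es = map tgt(as@(X,g,Y)#bs)" for g by simp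
 ultimately show ?thesis
  using cochain_lin_f[OF psi_c wclosed_chain[OF c l] i(2),of m] unfolding wclosed_cyc[OF c i(1)] Psi_def by simp
qed

lemma Psi_hacts: "wclosed es ==> length ks = length es ==> Psi m(hacts ks es) = \<psi> m(map tgt es)(act_list D(map tgt es)ks(map mor es))"
 by(simp add:Psi_def act_list_hacts map_tgt_hacts)

lemma Psi_mlin: "wclosed es ==> length es = Suc k ==> mlin k(%ks. Psi m(hacts ks es))"
 using cochain_mlin[OF psi_c wclosed_chain,of es m] by(subst mlin_cong[OF Psi_hacts]) simp_all

text \<open>The invariance of a cochain, freed of the antipode. Write \<open>\<epsilon> x\<close>
  times the value at \<open>y\<close> as the sum of the values with \<open>a\<close> on the module
  and \<open>S b * y\<close> on the word, reassociate, and contract \<open>S b\<close> with its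
  neighbour.\<close>

lemma Psi_act:
 assumes c: "wclosed es" and l: "length es = Suc k"
 shows "Psi(ract M m h)es = sw k(%ks. Psi m(hacts ks es))h"
proof -
 let ?B = "%m g. sw k(%ks. Psi m(hacts ks es))g"
 have p: "wpath es" using c by(simp add:wclosed_def)
 note ml = Psi_mlin[OF c l]
 have Bl: "lin(?B m)" for m by(rule lin_sw[OF ml])
 have Bm: "lin(%m. ?B m g)" for g
  by(rule lin_sw_fun[OF ml]) (rule Psi_lin_m[OF wclosed_hacts[OF c]],simp_all add: l)
 have inv: "tlift(%a b. sw k(%ks. Psi(ract M m a)(hacts ks es'))(S b))(\<Delta> h) = \<epsilon> h * Psi m es'"
  and invb: "bilin(%a b. sw k(%ks. Psi(ract M m a)(hacts ks es'))(S b))"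
  if c': "wclosed es'" and l': "length es' = Suc k" for es' h
 proof -
  have e: "sw k(%ks. Psi(ract M m a)(hacts ks es'))(S b) = sw k(%ks. \<psi>(ract M m a)(map tgt es')(act_list D(map tgt es')ks(map mor es')))(S b)" for a b
  by(rule sw_cong,rule Psi_hacts[OF c']) (simp add:l')
  show "tlift(%a b. sw k(%ks. Psi(ract M m a)(hacts ks es'))(S b))(\<Delta> h) = \<epsilon> h * Psi m es'"
  unfolding e cochain_inv[OF psi_c wclosed_chain[OF c' l']] by(simp add:Psi_def)
  show "bilin(%a b. sw k(%ks. Psi(ract M m a)(hacts ks es'))(S b))"
  unfolding e by(rule cochain_inv_bilin[OF psi_c wclosed_chain[OF c' l']])
 qed
 have h1: "?B m 1 = Psi m es" for m using sw_one[OF ml,of m] hacts_one[OF p] by(simp add:l)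
 have "?B m h = tlift(%x y. \<epsilon> x *. ?B m y)(\<Delta> h)" by(rule counit1[OF Bl,symmetric])
 also have "... = tlift(%x y. tlift(%a b. ?B(ract M m a)(S b * y))(\<Delta> x))(\<Delta> h)"
 proof(rule arg_cong[where f = "%F. tlift F(\<Delta> h)"],intro ext)
  fix x y
  have "\<epsilon> x *. ?B m y = sw k(%ls. \<epsilon> x*.Psi m(hacts ls es))y" by(rule sw_scale[OF ml,symmetric])
  also have "... = sw k(%ls. tlift(%a b. sw k(%ks. Psi(ract M m a)(hacts ks(hacts ls es)))(S b))(\<Delta> x))y"
  by(rule sw_cong,subst inv) (simp_all add: l c wclosed_hacts scaleC_complex_def)
  also have "... = tlift(%a b. sw k(%ls. sw k(%ks. Psi(ract M m a)(hacts ks(hacts ls es)))(S b))y)(\<Delta> x)"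
  by(rule sw_tensor_lift[OF sw_hacts_mult(3)[OF ml p l] invb]) (simp_all add: l c wclosed_hacts)
  also have "... = tlift(%a b. ?B(ract M m a)(S b * y))(\<Delta> x)"
  unfolding sw_hacts_mult(1)[OF ml p l] ..
  finally show "\<epsilon> x *. ?B m y = tlift(%a b. ?B(ract M m a)(S b * y))(\<Delta> x)" .
 qed
 also have "... = tlift(%a y. tlift(%b c. ?B(ract M m a)(S b * c))(\<Delta> y))(\<Delta> h)"
 proof(rule coassoc)
  show "lin(%c. ?B(ract M m a)(S b * c))" for a b by(rule lin_comp[OF Bl]) (intro li)
  show "lin(%b. ?B(ract M m a)(S b * c))" for a c by(rule lin_comp[OF Bl]) (intro li lin_antipode0)
  show "lin(%a. ?B(ract M m a)(S b * c))" for b c by(rule lin_comp[OF Bm lin_ract(1)])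
 qed
 also have "... = tlift(%a y. \<epsilon> y *. ?B(ract M m a) 1)(\<Delta> h)"
  unfolding antipode1[OF Bl] ..
 also have "... = ?B(ract M m h) 1" by(rule counit2) (rule lin_comp[OF Bm lin_ract(1)])
 finally show ?thesis unfolding h1 ..
qed

lemma Psi_cyc:
 assumes c: "wclosed(as@[a])" and l: "length as = k"
 shows "Psi m(as@[a]) = (- 1) ^ k * tlift(%x m0. Psi m0(hact(S' x)a#as))(coact M m)"
proof -
 have cc: "cchain D k(map tgt(as@[a]))(map mor(as@[a]))" by(rule wclosed_chain[OF c]) (simp add:l)
 have t: "map tgt(as@[a])!0 = src a" using c by(cases as) (auto simp:wclosed_def)
 have n: "map tgt(as@[a])!k = tgt a" "map mor(as@[a])!k = mor a" "take k(map tgt(as@[a])) = map tgt as"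
  "take k(map mor(as@[a])) = map mor as"
  using l by(simp_all add: nth_append)
 have "cyclic_op H M D k \<psi> m(map tgt(as@[a]))(map mor(as@[a])) = tlift(%x m0. \<psi> m0(tgt a#map tgt as)(act D(src a)(tgt a)(S' x)(mor a)#map mor as))(coact M m)"
  unfolding cyclic_op_def t n using cc by simp
 thus ?thesis
  using psi_cyc[of m "map tgt(as@[a])" "map mor(as@[a])"] by(simp add:Psi_def hact_def)
qed

text \<open>The closing up in the last face: the final arrow, acted on by \<open>z\<close>, is
  composed with the first one.\<close>

definition wrap :: "'h =>('o,'m)arrow list =>('o,'m)arrow list" where
 "wrap z es = acomp(hact z(last es))(hd es)#butlast(tl es)"

lemma wrap_split: "wrap z(b#cs@[a]) = acomp(hact z a)b#cs"
 by(simp add:wrap_def)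

lemma split_ends:
 assumes "length es = Suc(Suc j)"
 obtains b cs a where "es = b#cs@[a]" "length cs = j"
proof -
 obtain b ds where b: "es = b#ds" using assms by(cases es) auto
 thus thesis using that assms by(cases ds rule: rev_cases) auto
qed

lemma Psi_wrap_slot:
 assumes c: "wclosed(as@(X,f,Y)#bs)" and l: "length(as@(X,f,Y)#bs) = Suc(Suc k)"
 shows "clin(hom D Y X)(%f. Psi m(wrap z(as@(X,f,Y)#bs)))"
proof -
 have X: "X:obj D" "Y:obj D" "f:hom D Y X" using c by(auto simp:wclosed_def wpath_split arr_def)
 show ?thesis
 proof(cases as)
  case Nil
  then obtain cs a where bs: "bs = cs@[a]" using l by(cases bs rule: rev_cases) auto
  have c': "wclosed((X,f,Y)#cs@[a])" using c by(simp add:Nil bs)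
  hence a: "arr(hact z a)" "src a = X" by(auto simp:wclosed_Cons_snoc arr_hact)
  have w: "wrap z(as@(X,f,Y)#bs) = []@(tgt a,comp D Y X(tgt a)(mor(hact z a))f,Y)#cs" for f
  using wrap_split[of z "(X,f,Y)" cs a] a(2) by(simp add:Nil bs acomp_def)
  have o: "tgt a:obj D" "mor(hact z a):hom D X(tgt a)" using a by(auto simp:arr_def)
  show ?thesis
  unfolding w
  proof(rule clin_compose[OF Psi_slot cbilD1[OF D_comp_bilin[OF X(2,1) o(1)] o(2)]])
  show "wclosed([]@(tgt a,comp D Y X(tgt a)(mor(hact z a))f,Y)#cs)"
  using wclosed_wrap[OF c',of z] a(2) by(simp add:acomp_def)
  show "length([]@(tgt a,comp D Y X(tgt a)(mor(hact z a))f,Y)#cs) = Suc k" using l by(simp add:Nil bs)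
  qed(rule D_comp[OF X(2,1) o])
 next
  case(Cons b us)
  show ?thesis
  proof(cases bs rule: rev_cases)
  case Nil
  have c': "wclosed(b#us@[(X,f,Y)])" using c by(simp add:Cons Nil)
  hence b: "arr b" "Y = tgt b" by(auto simp:wclosed_Cons_snoc)
  have w: "wrap z(as@(X,f,Y)#bs) = []@(X,comp D(src b)Y X(act D Y X z f)(mor b),src b)#us" for f
  using wrap_split[of z b us "(X,f,Y)"] by(simp add:Cons Nil acomp_def hact_def)
  have o: "src b:obj D" "mor b:hom D(src b)Y" using b by(auto simp:arr_def)
  have cl: "clin(hom D Y X)(%f. comp D(src b)Y X(act D Y X z f)(mor b))"
  by(rule clin_compose[OF cbilD2[OF D_comp_bilin[OF o(1) X(2,1)] o(2)] cbilD1[OF D_act_bilin[OF X(2,1)]]])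
  (simp_all add: D_act[OF X(2,1)])
  show ?thesis
  unfolding w
  proof(rule clin_compose[OF Psi_slot cl])
  show "wclosed([]@(X,comp D(src b)Y X(act D Y X z f)(mor b),src b)#us)"
  using wclosed_wrap[OF c',of z] by(simp add:acomp_def hact_def)
  show "length([]@(X,comp D(src b)Y X(act D Y X z f)(mor b),src b)#us) = Suc k" using l by(simp add:Cons Nil)
  qed(intro D_comp[OF o(1) X(2,1) _ o(2)] D_act[OF X(2,1)])
  next
  case(snoc vs a)
  have c': "wclosed(b#(us@(X,f,Y)#vs)@[a])" using c by(simp add:Cons snoc)
  have w: "wrap z(as@(X,f,Y)#bs) = (acomp(hact z a)b#us)@(X,f,Y)#vs" for f
  using wrap_split[of z b "us@(X,f,Y)#vs" a] by(simp add:Cons snoc)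
  show ?thesis
  unfolding w by(rule Psi_slot[of _ _ f]) (use wclosed_wrap[OF c',of z] l in \<open>simp_all add: Cons snoc\<close>)
  qed
 qed
qed

lemma Psi_wrap_lin:
 assumes c: "wclosed(b#cs@[a])" and l: "length cs = k"
 shows "lin(%z. Psi m(acomp(hact z a)b#cs))"
proof -
 have a: "tgt a:obj D" "src a:obj D" "src b:obj D" "mor a:hom D(src a)(tgt a)" "mor b:hom D(src b)(src a)"
  using c by(auto simp:wclosed_Cons_snoc arr_def)
 have f: "lin(%z. comp D(src b)(src a)(tgt a)(act D(src a)(tgt a)z(mor a))(mor b))"
  by(rule clin_compose[OF cbilD2[OF D_comp_bilin[OF a(3,2,1)] a(5)] D_act_lin[OF a(2,1,4)] D_act[OF a(2,1,4)]])
 have "clin(hom D(src b)(tgt a))(%f. Psi m([]@(tgt a,f,src b)#cs))"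
  by(rule Psi_slot[of _ _ "mor(acomp(hact 1 a)b)"]) (use wclosed_wrap[OF c,of 1] l in \<open>simp_all add: acomp_def\<close>)
 from clin_compose[OF this f] show ?thesis
  using D_comp[OF a(3,2,1) D_act[OF a(2,1,4)] a(5)] by(simp add:acomp_def hact_def)
qed

lemma tau_bilin:
 assumes c: "wclosed(b#cs@[a])" and l: "length cs = k"
 shows "bilin(%x m0. Psi m0(acomp(hact(S' x)a)b#cs))"
proof(rule bilinI)
 show "lin(%m0. Psi m0(acomp(hact(S' x)a)b#cs))" for x
  by(rule Psi_lin_m[OF wclosed_wrap[OF c]]) (simp add:l)
 show "lin(%x. Psi m0(acomp(hact(S' x)a)b#cs))" for m0
  by(rule lin_comp[OF Psi_wrap_lin[OF c l] lin_S'])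
qed

text \<open>The last face of \<open>\<psi>\<close>, written on closed paths.\<close>

definition tau :: "'v =>('o,'m)arrow list => complex" where
 "tau m es = tlift(%x m0. Psi m0(wrap(S' x)es))(coact M m)"

lemma tau_slot:
 assumes c: "wclosed(as@(X,f,Y)#bs)" and l: "length(as@(X,f,Y)#bs) = Suc(Suc k)"
 shows "clin(hom D Y X)(%f. tau m(as@(X,f,Y)#bs))"
 unfolding tau_def
proof(rule clin_tensor_lift_fun[OF _ Psi_wrap_slot[OF c l]])
 show "csub(hom D Y X)" using c by(intro D_subspace) (auto simp:wclosed_def wpath_split arr_def)
 fix f' assume f': "f':hom D Y X"
 have "length(as@(X,f',Y)#bs) = Suc(Suc k)" using l by simp
 then obtain b cs a where es: "as@(X,f',Y)#bs = b#cs@[a]" "length cs = k" by(rule split_ends)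
 show "bilin(%x m0. Psi m0(wrap(S' x)(as@(X,f',Y)#bs)))"
  using tau_bilin[of b cs a] wclosed_slot[OF c f'] es by(simp add:wrap_split)
qed

text \<open>Here the anti-Yetter-Drinfeld condition is decisive. It turns \<open>S' m(-1)\<close>
  into \<open>S' h1 S' m(-1) h3\<close>; the remaining \<open>h2\<close> moves from the module to
  the word by \<open>Psi_act\<close>, its first part cancels \<open>S' h1\<close>, and
  \<open>h3\<close> is left on the last arrow.\<close>

lemma tau_act:
 assumes c: "wclosed(b#cs@[a])" and l: "length cs = k"
 shows "tau(ract M m h)(b#cs@[a]) = sw(Suc k)(%ks. tau m(hacts ks(b#cs@[a])))h"
proof -
 let ?es = "b#cs@[a]" and ?tl = "tlift"
 \<comment> \<open>\<open>z\<close> collects all that acts on the last arrow, \<open>ls\<close> what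
   acts on the others.\<close>
 define P where "P m0 z ls = Psi m0(wrap z(hacts(ls@[1]) ?es))" for m0 z ls
 define G where "G m0 z v = sw k(P m0 z)v" for m0 z v
 have ab: "arr a" "arr b" "src a = tgt b" using c by(simp_all add: wclosed_Cons_snoc)
 have le: "length ?es = Suc(Suc k)" using l by simp
 have hs: "hacts(ls@[q]) ?es = hacts ls(b#cs)@[hact q a]" if "length ls = Suc k" for ls q
  using hacts_split[of "ls@[q]" "b#cs" "[]" a] that l by(simp add:nth_append)
 have cl: "wclosed(hact q b#hacts qs cs@[hact r a])" if "length qs = k" for q qs r
  using wclosed_hacts[OF c,of "q#qs@[r]"] hs[of "q#qs" r] that l by simp
 have P_Cons: "P m0 z(q#qs) = Psi m0(acomp(hact z a)(hact q b)#hacts qs cs)" if "length qs = k" for m0 z q qs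
  using hs[of "q#qs" 1] that wrap_split[of z "hact q b" "hacts qs cs" a] hact_one[OF ab(1)] by(simp add:P_def)
 have P_mlin: "mlin k(P m0 z)" for m0 z
 proof -
  have "mlin(Suc k)(%ks. Psi m0(wrap z(hacts ks ?es)))"
  by(rule mlin_closed[where g = "%es. Psi m0(wrap z es)",OF _ c le]) (rule Psi_wrap_slot)
  thus ?thesis
  using mlin_append_right[of k 0 "%ks. Psi m0(wrap z(hacts ks ?es))" "[1]"] by(simp add:P_def[abs_def] del:mlin.simps)
 qed
 have P_z: "lin(%z. P m0 z ls)" if len: "length ls = Suc k" for m0 ls
 proof -
  obtain q qs where ls: "ls = q#qs" "length qs = k" using len by(auto simp:length_Suc_conv)
  show ?thesis using Psi_wrap_lin[OF cl[OF ls(2),of q 1]] ls l by(simp add:P_Cons hact_one[OF ab(1)])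
 qed
 have P_m: "lin(%m0. P m0 z ls)" if len: "length ls = Suc k" for z ls
 proof -
  obtain q qs where ls: "ls = q#qs" "length qs = k" using len by(auto simp:length_Suc_conv)
  show ?thesis using Psi_lin_m[OF wclosed_wrap[OF cl[OF ls(2),of q 1]],of z] ls l by(simp add:P_Cons hact_one[OF ab(1)])
 qed
 have G_v: "lin(G m0 z)" for m0 z unfolding G_def by(rule lin_sw[OF P_mlin])
 have G_z: "lin(%z. G m0 z v)" for m0 v unfolding G_def by(rule lin_sw_fun[OF P_mlin P_z])
 have G_m: "lin(%m0. G m0 z v)" for z v unfolding G_def by(rule lin_sw_fun[OF P_mlin P_m])
 \<comment> \<open>The first arrow of the wrapped path is a composite, so its slot is split in two:
   \<open>u\<close> reaches the arrow that was moved to the front, \<open>v\<close> the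
   rest.\<close>
 have A: "Psi(ract M m0 q)(acomp(hact y a)b#cs) = ?tl(%u v. G m0(u * y)v)(\<Delta> q)" for m0 q y
 proof -
  let ?F = "%ks. P m0(hd ks * y)(tl ks)"
  have mF: "mlin(Suc k) ?F"
  proof -
  have "lin(%h. P m0(h * y)ks)" if "length ks = Suc k" for ks
  by(rule lin_comp[OF P_z[OF that]]) (intro li)
  thus ?thesis by(simp add:P_mlin)
  qed
  have "?tl(%u v. G m0(u * y)v)(\<Delta> q) = sw(Suc k) ?F q" by(simp add:G_def)
  also have "... = sw k(%ks. ?tl(%p r. ?F(take 0 ks@p#r#drop(Suc 0)ks))(\<Delta>(ks!0)))q"
  by(rule sw_insert[OF mF]) simp
  also have "... = sw k(%ks. Psi m0(hacts ks(acomp(hact y a)b#cs)))q"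
  proof(rule sw_cong)
  fix ks :: "'h list" assume "length ks = Suc k"
  then obtain r rs where ks: "ks = r#rs" "length rs = k" by(auto simp:length_Suc_conv)
  have "?tl(%p q. P m0(p * y)(q#rs))(\<Delta> r) = ?tl(%p q. Psi m0(acomp(hact p(hact y a))(hact q b)#hacts rs cs))(\<Delta> r)"
  by(simp add:P_Cons[OF ks(2)] hact_mult[OF ab(1)])
  also have "... = Psi m0(hact r(acomp(hact y a)b)#hacts rs cs)"
  proof(rule hact_acomp(2)[symmetric,where \<phi> = "%e. Psi m0(e#hacts rs cs)"])
  have "clin(hom D(src b)(tgt a))(%f. Psi m0([]@(tgt a,f,src b)#hacts rs cs))"
  by(rule Psi_slot[of _ _ "mor(acomp(hact 1(hact 1 a))(hact 1 b))"])
  (use wclosed_wrap[OF cl[OF ks(2),of 1 1],of 1] ks l in \<open>simp_all add: acomp_def\<close>)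
  thus "clin(hom D(src b)(tgt(hact y a)))(%f. Psi m0((tgt(hact y a),f,src b)#hacts rs cs))" by simp
  qed(simp_all add: ab arr_hact)
  finally show "?tl(%p r. ?F(take 0 ks@p#r#drop(Suc 0)ks))(\<Delta>(ks!0)) = Psi m0(hacts ks(acomp(hact y a)b#cs))"
  by(simp add:ks)
  qed
  also have "... = Psi(ract M m0 q)(acomp(hact y a)b#cs)"
  by(rule Psi_act[OF wclosed_wrap[OF c],symmetric]) (simp add:l)
  finally show ?thesis by simp
 qed
 define K where "K p v h3 = ?tl(%x m0. G m0(p*(S' x * h3))v)(coact M m)" for p v h3
 have bK: "bilin(%x m0. G m0(p*(S' x * h3))v)" for p v h3
  by(rule bilinI) (rule G_m lin_comp[OF G_z],(intro li lin_S')?)+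
 have K_p: "lin(%p. K p v h3)" for v h3
  unfolding K_def by(rule lin_tensor_lift_fun[OF bK]) (rule lin_comp[OF G_z],intro li)
 have K_v: "lin(%v. K p v h3)" for p h3
  unfolding K_def by(rule lin_tensor_lift_fun[OF bK]) (rule G_v)
 have "tau(ract M m h) ?es = ?tl(%x m0. Psi m0(acomp(hact(S' x)a)b#cs))(coact M(ract M m h))"
  by(simp add:tau_def wrap_split)
 also have "... = ?tl(%h12 h3. ?tl(%h1 h2. ?tl(%x m0. Psi(ract M m0 h2)(acomp(hact(S'(S h3 * x * h1))a)b#cs))(coact M m))(\<Delta> h12))(\<Delta> h)"
  by(rule coact_ract[OF tau_bilin[OF c l]])
 \<comment> \<open>\<open>S'\<close> reverses the product \<open>S h3 * x * h1\<close>, and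
   \<open>S'(S h3)\<close> is \<open>h3\<close>.\<close>
 also have "... = ?tl(%h12 h3. ?tl(%h1 h2. ?tl(%u v. K(u * S' h1)v h3)(\<Delta> h2))(\<Delta> h12))(\<Delta> h)"
 proof -
  have "?tl(%x m0. ?tl(%u v. G m0(u * S'(S h3 * x * h1))v)(\<Delta> h2))(coact M m) = ?tl(%u v. K(u * S' h1)v h3)(\<Delta> h2)" for h1 h2 h3
  unfolding K_def antipode_inv_mult S'_S
  proof(subst tlift_swap)
  show "bilin(%u v. G m0(u*(S' h1*(S' x * h3)))v)" for x m0
  by(rule bilinI) (rule G_v lin_comp[OF G_z],(intro li)?)+
  show "bilin(%x m0. G m0(u*(S' h1*(S' x * h3)))v)" for u v
  using bK[of "u * S' h1" h3 v] by(simp add:mult.assoc)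
  qed(simp add:mult.assoc)
  thus ?thesis unfolding A by simp
 qed
 \<comment> \<open>After reassociation \<open>u\<close> and \<open>h1\<close> are neighbours, and
   \<open>u * S' h1\<close> contracts to the counit by \<open>antipode_inv1\<close>.\<close>
 also have "... = ?tl(%h12 h3. K 1 h12 h3)(\<Delta> h)"
 proof(rule arg_cong[where f = "%F. ?tl F(\<Delta> h)"],intro ext)
  fix h12 h3
  have "?tl(%h1 h2. ?tl(%u v. K(u * S' h1)v h3)(\<Delta> h2))(\<Delta> h12) = ?tl(%y v. ?tl(%h1 u. K(u * S' h1)v h3)(\<Delta> y))(\<Delta> h12)"
  proof(rule coassoc[symmetric])
  show "lin(%v. K(u * S' h1)v h3)" for h1 u by(rule K_v)
  show "lin(%u. K(u * S' h1)v h3)" for h1 v by(rule lin_comp[OF K_p]) (intro li)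
  show "lin(%h1. K(u * S' h1)v h3)" for u v by(rule lin_comp[OF K_p]) (intro li lin_S')
  qed
  also have "... = ?tl(%y v. \<epsilon> y*.K 1 v h3)(\<Delta> h12)" unfolding antipode_inv1[OF K_p] ..
  also have "... = K 1 h12 h3" by(rule counit1[OF K_v])
  finally show "?tl(%h1 h2. ?tl(%u v. K(u * S' h1)v h3)(\<Delta> h2))(\<Delta> h12) = K 1 h12 h3" .
 qed
 also have "... = ?tl(%h1 h2. sw k(%ls. tau m(hacts(ls@[h2]) ?es))h1)(\<Delta> h)"
 proof(rule arg_cong[where f = "%F. ?tl F(\<Delta> h)"],intro ext)
  fix h1 h2
  have "K 1 h1 h2 = ?tl(%x m0. sw k(P m0(S' x * h2))h1)(coact M m)" by(simp add:K_def G_def)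
  also have "... = sw k(%ls. ?tl(%x m0. P m0(S' x * h2)ls)(coact M m))h1"
  by(rule sw_tensor_lift[symmetric],rule P_mlin,rule bilinI,erule P_m)
  (rule lin_comp[OF P_z],assumption,intro li lin_S')
  also have "... = sw k(%ls. tau m(hacts(ls@[h2]) ?es))h1"
  proof(rule sw_cong)
  fix ls :: "'h list" assume ls: "length ls = Suc k"
  then obtain q qs where q: "ls = q#qs" "length qs = k" by(auto simp:length_Suc_conv)
  have "wrap z(hacts(ls@[h2]) ?es) = acomp(hact(z * h2)a)(hact q b)#hacts qs cs" for z
  using hs[OF ls,of h2] wrap_split[of z "hact q b" "hacts qs cs" "hact h2 a"] q by(simp add:hact_mult[OF ab(1)])
  thus "?tl(%x m0. P m0(S' x * h2)ls)(coact M m) = tau m(hacts(ls@[h2]) ?es)"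
  by(simp add:tau_def q(1) P_Cons[OF q(2)])
  qed
  finally show "K 1 h1 h2 = sw k(%ls. tau m(hacts(ls@[h2]) ?es))h1" .
 qed
 also have "... = sw(Suc k)(%ks. tau m(hacts ks ?es))h"
  by(rule sw_snoc[symmetric],rule mlin_closed[where g = "tau m",OF _ c le],rule tau_slot)
 finally show ?thesis .
qed

end

section \<open>The trace on words and its cyclicity\<close>

context cyclic_cochain_data
begin

text \<open>The sign is that of the last face in the codifferential: the character contains the full
  word with coefficient 1, and its trace has to be the last summand of \<open>b\<close>.\<close>

definition wtr :: "'v =>('o,'m)word_space => complex" where
 "wtr m = free_ext(%c es. if wclosed es&length es = Suc(Suc k)then mtr c*((- 1) ^ Suc k * tau m es)else 0)"

lemma lin_wtr: "lin(wtr m)"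
 unfolding wtr_def by(rule lin_free_ext)

lemma wtr_word: "wtr m(word c es) = (if wclosed es&length es = Suc(Suc k)then mtr c*((- 1) ^ Suc k * tau m es)else 0)"
 unfolding wtr_def
proof(rule free_ext_word)
 show "multi(%c es. if wclosed es&length es = Suc(Suc k)then mtr c*((- 1) ^ Suc k * tau m es)else 0)"
  by(rule multi_closed) (rule clin_mult_right,rule tau_slot)
qed

lemma lin_tau_m:
 assumes "wclosed es" "length es = Suc(Suc k)"
 shows "lin(%m. tau m es)"
proof -
 obtain b cs a where es: "es = b#cs@[a]" "length cs = k" by(rule split_ends[OF assms(2)])
 show ?thesis
  using lin_comp[OF lin_tensor_lift[OF tau_bilin[of b cs a]] lin_coact_M] assms(1) es
  by(simp add:tau_def wrap_split)
qed

lemma lin_wtr_m: "lin(%m. wtr m x)"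
 unfolding wtr_def
proof(rule clin_free_ext_fun)
 fix c es
 show "lin(%m. if wclosed es&length es = Suc(Suc k)then mtr c*((- 1) ^ Suc k * tau m es)else 0)"
  by(intro clin_if clin_mult_right lin_tau_m clin_const_zero) auto
qed

lemma bilin_wtr: "bilin wtr"
 by(rule bilinI[OF lin_wtr lin_wtr_m])

lemma wtr_act:
 assumes "x:wghom X X(Suc k)"
 shows "wtr(ract M m h)x = wtr m(wact h x)"
proof(rule span_lin_eq[OF assms lin_wtr lin_comp[OF lin_wtr lin_wact]])
 fix w assume "w:words X X(Suc k)"
 then obtain c es where w: "w = word c es" and v: "wvalid c es" and l: "length es = Suc(Suc k)" and e: "tgt(hd es) = X" "src(last es) = X"
  by(auto simp:words_def)
 have cl: "wclosed es" using v e by(simp add:wclosed_def wvalid_def)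
 let ?z = "mtr c*(- 1) ^ Suc k"
 obtain b cs a where es: "es = b#cs@[a]" "length cs = k" by(rule split_ends[OF l])
 have mt: "mlin(Suc k)(%ks. tau m(hacts ks es))"
  by(rule mlin_closed[where g = "tau m",OF _ cl l]) (rule tau_slot)
 have "wtr m(wact h w) = sw(Suc k)(%ks. wtr m(word c(hacts ks es)))h"
  unfolding w wact_word[OF v l] by(rule sw_lin[OF mlin_multi_hacts[OF multi_word v l] lin_wtr])
 also have "... = sw(Suc k)(%ks. ?z*.tau m(hacts ks es))h"
  by(rule sw_cong) (simp add:wtr_word wclosed_hacts[OF cl] l scaleC_complex_def)
 also have "... = ?z*.sw(Suc k)(%ks. tau m(hacts ks es))h" by(rule sw_scale[OF mt])
 also have "... = ?z*.tau(ract M m h)es" using tau_act[of b cs a m h] cl es by simp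
 also have "... = wtr(ract M m h)w" using cl l by(simp add:w wtr_word scaleC_complex_def)
 finally show "wtr(ract M m h)w = wtr m(wact h w)" by simp
qed

text \<open>The trace property for a fixed right factor. Isolating it lets the property be passed on
  to products and sums and be checked on generators.\<close>

definition tracial :: "nat =>('o,'m)word_space => 'o => 'o => bool" where
 "tracial i g X Y \<longleftrightarrow>(\<forall>j g' m. i+j = Suc k-->g':wghom Y X j-->wtr m(wmul g' g) = (- 1) ^ (i * j) * tlift(%x m0. wtr m0(wmul(wact(S' x)g)g'))(coact M m))"

lemma tracialD: "tracial i g X Y ==> i+j = Suc k ==> g':wghom Y X j ==> wtr m(wmul g' g) = (- 1) ^ (i * j) * tlift(%x m0. wtr m0(wmul(wact(S' x)g)g'))(coact M m)"
 unfolding tracial_def by blast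

lemma lin_wact_left: "lin(%h. wact h g)"
 by(rule bilinD2[OF bilin_wact])

lemma twist_bilin: "bilin(%x m0. wtr m0(wmul(wact(S' x)g)g'))"
 by(rule bilinI[OF lin_wtr_m lin_comp[OF lin_wtr lin_comp[OF lin_wmul_left lin_comp[OF lin_wact_left lin_S']]]])

lemma lin_twist_left: "lin(%g. tlift(%x m0. wtr m0(wmul(wact(S' x)g)g'))(coact M m))"
 and lin_twist_right: "lin(%g'. tlift(%x m0. wtr m0(wmul(wact(S' x)g)g'))(coact M m))"
 by(rule lin_tensor_lift_fun[OF twist_bilin lin_comp[OF lin_wtr lin_comp[OF lin_wmul_left lin_wact]]],
  rule lin_tensor_lift_fun[OF twist_bilin lin_comp[OF lin_wtr lin_wmul_right]])

lemma tracial_span: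
 assumes "g:cspan B" "!!w. w:B ==> tracial i w X Y"
 shows "tracial i g X Y"
 unfolding tracial_def
proof(intro allI impI)
 fix j g' m assume j: "i+j = Suc k" and g': "g':wghom Y X j"
 show "wtr m(wmul g' g) = (- 1) ^ (i * j) * tlift(%x m0. wtr m0(wmul(wact(S' x)g)g'))(coact M m)"
  by(rule span_lin_eq[OF assms(1) lin_comp[OF lin_wtr lin_wmul_right] clin_mult_right[OF lin_twist_left]])
  (rule tracialD[OF assms(2) j g'])
qed

text \<open>Rotate \<open>g2\<close> first and then \<open>g1\<close>; by \<open>coact_rot\<close>
  the two twists combine into the twist of the product.\<close>

lemma tracial_mult:
 assumes g1: "g1:wghom Y Z i1" "tracial i1 g1 Y Z" and g2: "g2:wghom X Y i2" "tracial i2 g2 X Y"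
 shows "tracial(i1+i2)(wmul g1 g2)X Z"
 unfolding tracial_def
proof(intro allI impI)
 fix j g' m assume j: "i1+i2+j = Suc k" and g': "g':wghom Z X j"
 note h1 = subsetD[OF wghom_whom g1(1)] and h2 = subsetD[OF wghom_whom g2(1)] and h' = subsetD[OF wghom_whom g']
 let ?F = "%p q d. wtr d(wmul(wact p g1)(wmul(wact q g2)g'))"
 have F: "lin(?F p q)" "lin(%q. ?F p q d)" "lin(%p. ?F p q d)" for p q d
  by(rule lin_wtr_m,rule lin_comp[OF lin_wtr lin_comp[OF lin_wmul_right lin_comp[OF lin_wmul_left lin_wact_left]]],
  rule lin_comp[OF lin_wtr lin_comp[OF lin_wmul_left lin_wact_left]])
 have bF: "bilin(%y d. ?F(S' y)q d)" for q by(rule bilinI[OF F(1) lin_comp[OF F(3) lin_S']])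
 have bb: "bilin(%x m0. tlift(%y d. ?F(S' y)(S' x)d)(coact M m0))"
  by(rule bilinI[OF lin_comp[OF lin_tensor_lift[OF bF] lin_coact_M] lin_tensor_lift_fun[OF bF lin_comp[OF F(2) lin_S']]])
 have in1: "wmul g' g1:wghom Y X(j+i1)" by(rule wmul_wghom[OF g' g1(1)])
 have inner: "wtr m0(wmul(wact(S' x)g2)(wmul g' g1)) = (- 1) ^ (i1*(i2+j)) * tlift(%y d. ?F(S' y)(S' x)d)(coact M m0)" for x m0
 proof -
  note a2 = wact_wghom[OF g2(1),of "S' x"]
  have "wmul(wact(S' x)g2)(wmul g' g1) = wmul(wmul(wact(S' x)g2)g')g1"
  by(rule wmul_assoc[OF subsetD[OF wghom_whom a2] h' h1,symmetric])
  thus ?thesis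
  using tracialD[OF g1(2) _ wmul_wghom[OF a2 g'],of m0] j by simp
 qed
 have "wtr m(wmul g'(wmul g1 g2)) = wtr m(wmul(wmul g' g1)g2)"
  by(simp only: wmul_assoc[OF h' h1 h2])
 also have "... = (- 1) ^ (i2*(j+i1)) * tlift(%x m0. wtr m0(wmul(wact(S' x)g2)(wmul g' g1)))(coact M m)"
  by(rule tracialD[OF g2(2) _ in1]) (use j in simp)
 also have "... = (- 1) ^ (i2*(j+i1))*((- 1) ^ (i1*(i2+j)) * tlift(%x m0. tlift(%y d. ?F(S' y)(S' x)d)(coact M m0))(coact M m))"
  unfolding inner tlift_mult_fun[OF bb] ..
 \<comment> \<open>The exponents agree modulo 2, because \<open>i1 * i2\<close> occurs
   twice.\<close>
 also have "... = (- 1) ^ ((i1+i2) * j) * tlift(%x m0. tlift(%y d. ?F(S' y)(S' x)d)(coact M m0))(coact M m)"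
  by(simp add:minus_one_power_iff)
 also have "tlift(%x m0. tlift(%y d. ?F(S' y)(S' x)d)(coact M m0))(coact M m) = tlift(%x m0. tlift(%p q. ?F p q m0)(\<Delta>(S' x)))(coact M m)"
  by(rule coact_rot[of ?F,OF F])
 also have "... = tlift(%x m0. wtr m0(wmul(wact(S' x)(wmul g1 g2))g'))(coact M m)"
 proof -
  have "?F p q m0 = wtr m0(wmul(wmul(wact p g1)(wact q g2))g')" for p q m0
  by(simp only: wmul_assoc[OF wact_whom[OF h1] wact_whom[OF h2] h'])
  hence "tlift(%p q. ?F p q m0)(\<Delta> z) = wtr m0(wmul(wact z(wmul g1 g2))g')" for z m0
  unfolding wact_wmul[OF h1 h2]
  by(simp only: tlift_lin[OF bilin_wmul_act lin_comp[OF lin_wtr lin_wmul_left],symmetric])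
  thus ?thesis by simp
 qed
 finally show "wtr m(wmul g'(wmul g1 g2)) = (- 1) ^ ((i1+i2) * j) * tlift(%x m0. wtr m0(wmul(wact(S' x)(wmul g1 g2))g'))(coact M m)" .
qed

lemma mtr_wvalid_commute:
 assumes "wvalid c es" "wvalid c' es'" "length es+length es' > 2"
 shows "mtr(mm c c') = mtr(mm c' c)"
proof -
 obtain i j where "length es = Suc i" "length es' = Suc j" using wvalid_length assms(1,2) by metis
 thus ?thesis using mtr_wcoeffs_commute[of c i c' j] assms by(simp add:wvalid_def)
qed

text \<open>In the wrapped path the twist acts on the composite of \<open>a\<close> and
  \<open>e\<close> and splits by the coproduct; \<open>coact_rot\<close> turns this into two
  successive twists, of \<open>e\<close> and then of \<open>a\<close>.\<close>

lemma tau_rotate: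
 assumes c: "wclosed(b#cs@[acomp a e])" and ab: "arr a" "arr e" "src a = tgt e" and l: "length cs = k"
 shows "tau m(b#cs@[acomp a e]) = tlift(%x m0. tau m0(acomp(hact(S' x)e)b#cs@[a]))(coact M m)"
proof -
 have b: "arr b" "src e = tgt b" using c by(auto simp:wclosed_Cons_snoc)
 have o: "src b:obj D" "src e:obj D" "tgt a:obj D" "mor b:hom D(src b)(src e)"
  using b ab by(auto simp:arr_def)
 let ?\<phi> = "%d u. Psi d(acomp u b#cs)"
 let ?F = "%p q d. ?\<phi> d(acomp(hact p a)(hact q e))"
 have \<phi>: "clin(hom D(src e)(tgt a))(%f. ?\<phi> d(tgt a,f,src e))" for d
 proof -
  have "clin(hom D(src b)(tgt a))(%f. Psi d([]@(tgt a,f,src b)#cs))"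
  by(rule Psi_slot[of _ _ "mor(acomp(hact 1(acomp a e))b)"]) (use wclosed_wrap[OF c,of 1] l in \<open>simp_all add: acomp_def\<close>)
  from clin_compose[OF this cbilD2[OF D_comp_bilin[OF o(1,2,3)] o(4)] D_comp[OF o(1,2,3) _ o(4)]]
  show ?thesis by(simp add:acomp_def)
 qed
 note H = hact_acomp[where \<phi> = "?\<phi> _",OF \<phi> ab]
 have cl: "wclosed(acomp(acomp(hact p a)(hact q e))b#cs)" for p q
  using wclosed_wrap[OF c,of 1] arr_acomp[OF arr_acomp[OF arr_hact[OF ab(1)] arr_hact[OF ab(2)]] b(1),of p q] ab b
  by(cases "cs = []") (simp_all add: wclosed_Cons)
 have "tau m(b#cs@[acomp a e]) = tlift(%x m0. ?\<phi> m0(hact(S' x)(acomp a e)))(coact M m)"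
  by(simp add:tau_def wrap_split)
 also have "... = tlift(%x m0. tlift(%p q. ?F p q m0)(\<Delta>(S' x)))(coact M m)"
  by(simp only: H(2))
 also have "... = tlift(%x m0. tlift(%y d. ?F(S' y)(S' x)d)(coact M m0))(coact M m)"
 proof(rule coact_rot[symmetric,of ?F])
  show "lin(%d. ?F p q d)" for p q by(rule Psi_lin_m[OF cl]) (simp add:l)
  show "lin(%q. ?F p q d)" for p d by(rule bilinD1[OF H(1)])
  show "lin(%p. ?F p q d)" for q d by(rule bilinD2[OF H(1)])
 qed
 also have "... = tlift(%x m0. tau m0(acomp(hact(S' x)e)b#cs@[a]))(coact M m)"
 proof -
  have "acomp(acomp(hact p a)(hact q e))b = acomp(hact p a)(acomp(hact q e)b)" for p q
  by(rule acomp_assoc) (use ab b in \<open>simp_all add: arr_hact\<close>)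
  thus ?thesis by(simp add:tau_def wrap_split)
 qed
 finally show ?thesis .
qed

text \<open>A factor of degree zero changes only one arrow of the other word, at its end or at its
  beginning; \<open>tau_rotate\<close> compares the two, and the coefficients commute under
  \<open>mtr\<close>.\<close>

lemma tracial_zero:
 assumes "w:words X Y 0"
 shows "tracial 0 w X Y"
 unfolding tracial_def
proof(intro allI impI)
 fix j g' m assume j: "0+j = Suc k" and g': "g':wghom Y X j"
 obtain c e where w: "w = word c [e]" "arr e" "rowfin c" "tgt e = Y" "src e = X" by(rule words_zeroE[OF assms])
 have "wtr m(wmul g' w) = tlift(%x m0. wtr m0(wmul(wact(S' x)w)g'))(coact M m)"
 proof(rule span_lin_eq[OF g' lin_comp[OF lin_wtr lin_wmul_left] lin_twist_right])
  fix u assume "u:words Y X j"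
  then obtain c' es where u: "u = word c' es" and v: "wvalid c' es" and l: "length es = Suc(Suc k)" and ends: "tgt(hd es) = X" "src(last es) = Y"
  using j by(auto simp:words_def)
  obtain b cs a where es: "es = b#cs@[a]" "length cs = k" by(rule split_ends[OF l])
  have ve: "wvalid c [e]" "wvalid c [hact z e]" for z using w by(simp_all add: wvalid_single arr_hact)
  have v': "wvalid c'((b#cs)@[a])" "wvalid c'(b#cs@[a])" using v es by simp_all
  have s: "src a = tgt e" "src e = tgt b" using ends es w by simp_all
  have a: "arr a" using v'(1) by(simp add:wvalid_def wpath_snoc[of "b#cs"] del:append_Cons)
  have p1: "wmul u w = word(mm c' c)(b#cs@[acomp a e])"
  using wmul_word_split[OF v'(1) ve(1) s(1)] by(simp add:u es w)
  have p2: "wmul(wact z w)u = word(mm c c')(acomp(hact z e)b#cs@[a])" for z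
  using wmul_word_split[of c "[]" "hact z e" c' b "cs@[a]"] ve(2)[of z] v'(2) s(2)
  by(simp add:u es w(1) wact_single[OF w(2,3)])
  have c1: "wclosed(b#cs@[acomp a e])"
  using wvalid_mul[OF v'(1) ve(1) s(1)] s by(simp add:wclosed_def wvalid_def)
  have c2: "wclosed(acomp(hact z e)b#cs@[a])" for z
  using wvalid_mul[of c "[]" "hact z e" c' b "cs@[a]"] ve(2)[of z] v'(2) s by(simp add:wclosed_def wvalid_def)
  have bt: "bilin(%x m0. tau m0(acomp(hact(S' x)e)b#cs@[a]))"
  proof(rule bilinI)
  show "lin(%m0. tau m0(acomp(hact(S' x)e)b#cs@[a]))" for x
  by(rule lin_tau_m[OF c2]) (simp add:es)
  have "arr b" using v'(2) by(simp add:wvalid_def wpath_Cons)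
  hence o: "src b:obj D" "src e:obj D" "tgt e:obj D" "mor e:hom D(src e)(tgt e)" "mor b:hom D(src b)(src e)"
  using w(2) s(2) by(auto simp:arr_def)
  have f: "lin(%z. comp D(src b)(src e)(tgt e)(act D(src e)(tgt e)z(mor e))(mor b))"
  by(rule clin_compose[OF cbilD2[OF D_comp_bilin[OF o(1,2,3)] o(5)] D_act_lin[OF o(2,3,4)] D_act[OF o(2,3,4)]])
  fix m0
  have "clin(hom D(src b)(tgt e))(%f. tau m0([]@(tgt e,f,src b)#cs@[a]))"
  by(rule tau_slot[of _ _ "mor(acomp(hact 1 e)b)"]) (use c2[of 1] es in \<open>simp_all add: acomp_def\<close>)
  from lin_comp[OF clin_compose[OF this f] lin_S']
  show "lin(%x. tau m0(acomp(hact(S' x)e)b#cs@[a]))"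
  using D_comp[OF o(1,2,3) D_act[OF o(2,3,4)] o(5)] by(simp add:acomp_def hact_def)
  qed
  have "wtr m(wmul u w) = mtr(mm c' c)*(- 1) ^ Suc k * tlift(%x m0. tau m0(acomp(hact(S' x)e)b#cs@[a]))(coact M m)"
  using c1 es(2) tau_rotate[OF c1 a w(2) s(1) es(2),of m] by(simp add:p1 wtr_word)
  also have "... = tlift(%x m0. mtr(mm c' c)*(- 1) ^ Suc k * tau m0(acomp(hact(S' x)e)b#cs@[a]))(coact M m)"
  by(rule tlift_mult_fun[OF bt,symmetric])
  also have "... = tlift(%x m0. wtr m0(wmul(wact(S' x)w)u))(coact M m)"
  using mtr_wvalid_commute[OF v ve(1)] l c2 es(2) by(simp add:p2 wtr_word mult.assoc)
  finally show "wtr m(wmul u w) = tlift(%x m0. wtr m0(wmul(wact(S' x)w)u))(coact M m)" .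
 qed
 thus "wtr m(wmul g' w) = (- 1) ^ (0 * j) * tlift(%x m0. wtr m0(wmul(wact(S' x)w)g'))(coact M m)" by simp
qed

lemma wclosed_aident:
 assumes "wclosed es" "src(last es) = X"
 shows "wclosed(es@[aident X])"
proof -
 have "X:obj D" using assms by(auto simp:wclosed_def wpath_def arr_def)
 moreover have "es~=[]" using assms by(auto simp:wclosed_def wpath_def)
 ultimately show ?thesis using assms by(simp add:wclosed_def wpath_snoc aident)
qed

text \<open>Wrapping an identity arrow round merely removes it, and the twist on it becomes a
  counit.\<close>

lemma tau_aident:
 assumes c: "wclosed es" and l: "length es = Suc k" and X: "src(last es) = X"
 shows "tau m(es@[aident X]) = Psi m es"
proof -
 obtain b bs where es: "es = b#bs" using l by(cases es) auto
 have b: "arr b" "tgt b = X" using c X by(auto simp:es wclosed_def wpath_Cons)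
 have o: "X:obj D" "src b:obj D" "mor b:hom D(src b)X" using b by(auto simp:arr_def)
 have i: "mor(aident X):hom D X X" using aident(1)[OF o(1)] by(simp add:arr_def)
 have "Psi m0(acomp(hact z(aident X))b#bs) = \<epsilon> z*.Psi m0 es" for m0 z
 proof -
  have "acomp(hact z(aident X))b = (X,\<epsilon> z*.mor b,src b)"
  using aident(4)[OF o(1) b] b(2) clin_scale[OF cbilD2[OF D_comp_bilin[OF o(2,1,1)] o(3)] i]
  by(simp add:aident(2)[OF o(1)] acomp_def prod_eq_iff)
  moreover have "clin(hom D(src b)X)(%f. Psi m0([]@(X,f,src b)#bs))"
  by(rule Psi_slot[of _ _ "mor b"]) (use c l b(2) es in auto)
  from clin_scale[OF this o(3),of "\<epsilon> z"] have "Psi m0((X,\<epsilon> z*.mor b,src b)#bs) = \<epsilon> z*.Psi m0((X,mor b,src b)#bs)"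
  by simp
  moreover have "(X,mor b,src b) = b" using b(2) by(simp add:prod_eq_iff)
  ultimately show ?thesis by(simp add:es)
 qed
 hence "tau m(es@[aident X]) = tlift(%x m0. \<epsilon> x*.Psi m0 es)(coact M m)"
  by(simp add:tau_def es wrap_def counit_antipode_inv)
 also have "... = Psi m es" by(rule coact_counit_M[OF Psi_lin_m[OF c l]])
 finally show ?thesis .
qed

text \<open>Multiplication by \<open>theta\<close> appends or prepends an identity arrow. Appended,
  it gives \<open>\<psi>\<close> itself by \<open>tau_aident\<close>; prepended, it gives the
  rotated \<open>\<psi>\<close>. The cyclicity of \<open>\<psi>\<close> relates the two with sign
  \<open>(- 1) ^ k\<close>.\<close>

lemma tracial_theta:
 assumes X: "X:obj D" and c: "c:wcoeffs 2"
 shows "tracial 1(theta c X)X X"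
 unfolding tracial_def
proof(intro allI impI)
 fix j g' m assume "1+j = Suc k" and g': "g':wghom X X j"
 hence j: "j = k" by simp
 let ?i = "aident X"
 have "wtr m(wmul g'(theta c X)) = (- 1) ^ k * wtr m(wmul(theta c X)g')"
 proof(rule span_lin_eq[OF g' lin_comp[OF lin_wtr lin_wmul_left] clin_mult_right[OF lin_comp[OF lin_wtr lin_wmul_right]]])
  fix u assume "u:words X X j"
  then obtain c' es where u: "u = word c' es" and v: "wvalid c' es" and l: "length es = Suc k" and ends: "tgt(hd es) = X" "src(last es) = X"
  using j by(auto simp:words_def)
  obtain as a where as: "es = as@[a]" "length as = k" using l by(cases es rule: rev_cases) auto
  obtain b bs where bs: "es = b#bs" using l by(cases es) auto
  have vt: "wvalid c([?i]@[?i])" "wvalid c(?i#[?i])" using wvalid_theta[OF X c] by simp_all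
  have p: "wpath es" using v by(simp add:wvalid_def)
  have a: "arr a" "src a = X" using p ends as by(auto simp:wpath_def)
  have b: "arr b" "tgt b = X" using p ends bs by(auto simp:wpath_def)
  have p1: "wmul u(theta c X) = word(mm c' c)(es@[?i])"
  using wmul_word_split[of c' as a c ?i "[?i]"] v vt a aident(3)[OF X a(1)] by(simp add:u as theta_def)
  have p2: "wmul(theta c X)u = word(mm c c')(?i#es)"
  using wmul_word_split[of c "[?i]" ?i c' b bs] v vt b aident(4)[OF X b(1)] by(simp add:u bs theta_def)
  have cl: "wclosed es" using p ends by(simp add:wclosed_def)
  have cl2: "wclosed(?i#es)" using p ends X by(auto simp:wclosed_def wpath_Cons aident bs)
  have cs: "acomp(hact z a) ?i = hact z a" for z by(rule aident(3)[OF X arr_hact[OF a(1)]]) (simp add:a)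
  have "tau m(?i#es) = tlift(%x m0. Psi m0(hact(S' x)a#as))(coact M m)"
  by(simp add:tau_def as wrap_split cs)
  hence t: "tau m(?i#es) = (- 1) ^ k * Psi m es"
  using Psi_cyc[of as a m] cl as by(simp add:minus_one_power_iff split: if_splits)
  have "mtr(mm c' c) = mtr(mm c c')"
  using mtr_wvalid_commute[OF v vt(2)] l by simp
  thus "wtr m(wmul u(theta c X)) = (- 1) ^ k * wtr m(wmul(theta c X)u)"
  using wclosed_aident[OF cl ends(2)] cl2 l tau_aident[OF cl l ends(2),of m] t
  by(simp add:p1 p2 wtr_word minus_one_power_iff)
 qed
 also have "wtr m(wmul(theta c X)g') = tlift(%x m0. \<epsilon> x*.wtr m0(wmul(theta c X)g'))(coact M m)"
  by(rule coact_counit_M[OF lin_wtr_m,symmetric])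
 also have "... = tlift(%x m0. wtr m0(wmul(wact(S' x)(theta c X))g'))(coact M m)"
  by(simp add:wact_theta[OF X c] clin_scale[OF lin_wmul_left] clin_scale[OF lin_wtr] counit_antipode_inv)
 finally show "wtr m(wmul g'(theta c X)) = (- 1) ^ (1 * j) * tlift(%x m0. wtr m0(wmul(wact(S' x)(theta c X))g'))(coact M m)"
  by(simp add:j)
qed

text \<open>The words are generated by those of length one and by the elements \<open>theta c X\<close>.\<close>

lemma tracial_words: "w:words X Y i ==> tracial i w X Y"
proof(induction i arbitrary: X Y w)
 case 0
 thus ?case by(rule tracial_zero)
next
 case(Suc i)
 obtain c e es where w: "w = word c(e#es)" "wvalid c(e#es)" "length es = Suc i" "tgt e = Y" "src(last(e#es)) = X"
  by(rule words_ConsE[OF Suc.prems])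
 obtain d ds where es: "es = d#ds" using w(3) by(cases es) auto
 let ?Z = "src e"
 have c: "c:wcoeffs 2" using w(2,3) by(auto simp:wvalid_def wcoeffs_def)
 have rc: "rowfin c" using c by(simp add:wcoeffs_def)
 have p: "arr e" "wpath es" "src e = tgt d" using w(2) es by(auto simp:wvalid_def wpath_Cons)
 have Z: "?Z:obj D" using p(1) by(simp add:arr_def)
 obtain N where N: "!!i j. N<=j ==> c i j = 0" using c by(auto simp:wcoeffs_def colfin_def)
 have w0: "word mone [e]:words ?Z Y 0" by(rule wordsI) (use p w rowfin_mone in \<open>simp_all add: wvalid_single\<close>)
 \<comment> \<open>The whole coefficient \<open>c\<close> is put on the middle factor
   \<open>theta\<close>; the first arrow takes \<open>mone\<close>, and the tail takes a truncated
   identity that does not alter \<open>c\<close>.\<close>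
 have w1: "word(mcut N)es:words X ?Z i"
  by(rule wordsI) (use p w es mcut_wcoeffs in \<open>simp_all add: wvalid_def\<close>)
 have 1: "wmul(word mone [e])(theta c ?Z) = word c [e,aident ?Z]"
  using wmul_word_split[of mone "[]" e c "aident ?Z" "[aident ?Z]"] wvalid_theta[OF Z c] p(1) rowfin_mone aident(3)[OF Z p(1)]
  by(simp add:theta_def wvalid_single mm_mone_left)
 have v: "wvalid c([e]@[aident ?Z])"
  using c p(1) aident(1)[OF Z] by(simp add:wvalid_def wpath_Cons numeral_2_eq_2)
 have "arr d" using p(2) es by(auto simp:wpath_Cons)
 hence "acomp(aident ?Z)d = d" using aident(4)[OF Z,of d] p(3) by simp
 hence 2: "wmul(word c [e,aident ?Z])(word(mcut N)es) = w"
  using wmul_word_split[OF v,of "mcut N" d ds] p es mcut_wcoeffs mm_cut[OF N] by(simp add:w(1) wvalid_def)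
 have "tracial(0+1+i)(wmul(wmul(word mone [e])(theta c ?Z))(word(mcut N)es))X Y"
  by(rule tracial_mult[OF wmul_wghom[OF words_whom(1)[OF w0] words_whom(1)[OF theta_words[OF Z c]]]
  tracial_mult[OF words_whom(1)[OF w0] tracial_zero[OF w0] words_whom(1)[OF theta_words[OF Z c]] tracial_theta[OF Z c]]
  words_whom(1)[OF w1] Suc.IH[OF w1]])
 thus ?case unfolding 1 2 by simp
qed

theorem wsemicat_trace: "cgtrace H M wsemicat(Suc k)(%X. wtr)"
 unfolding cgtrace_def wsemicat_simps
proof(intro conjI ballI allI impI,goal_cases)
 case(1 X)
 show ?case by(rule bilin_subset[OF bilin_wtr])
next
 case(2 X m h f)
 have f: "f:whom X X" using 2(2) wghom_whom by blast
 have "wtr(ract M m h1)(wact(S h2)f) = wtr m(wact(h1 * S h2)f)" for h1 h2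
  by(simp only: wtr_act[OF wact_wghom[OF 2(2)]] wact_mult[OF f])
 hence "tlift(%h1 h2. wtr(ract M m h1)(wact(S h2)f))(\<Delta> h) = \<epsilon> h*.wtr m(wact 1 f)"
  using antipode2[of "%z. wtr m(wact z f)" h] lin_comp[OF lin_wtr lin_wact_left] by simp
 thus ?case by(simp add:wact_one[OF f] scaleC_complex_def)
next
 case(3 X m k' f)
 hence k': "k' = k" by simp
 have f: "f:wghom X X k" using 3 k' by simp
 \<comment> \<open>Closedness is an instance of the trace property, because the differential is the
   graded commutator with \<open>theta mr\<close>.\<close>
 have "wtr m(wmul f(theta mr X)) = (- 1) ^ k * tlift(%x m0. wtr m0(wmul(wact(S' x)(theta mr X))f))(coact M m)"
  using tracialD[OF tracial_theta[OF 3(1) mr_wcoeffs] _ f] by simp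
 also have "tlift(%x m0. wtr m0(wmul(wact(S' x)(theta mr X))f))(coact M m) = wtr m(wmul(theta mr X)f)"
  using coact_counit_M[OF lin_wtr_m[of "wmul(theta mr X)f"]]
  by(simp add:wact_theta[OF 3(1) mr_wcoeffs] clin_scale[OF lin_wmul_left] clin_scale[OF lin_wtr] counit_antipode_inv)
 finally have "wtr m(wmul f(theta mr X)) = (- 1) ^ k * wtr m(wmul(theta mr X)f)" .
 thus ?case
  unfolding k' wdiff_eq[OF f]
  by(simp add:clin_diff[OF lin_wtr] clin_scale[OF lin_wtr] scaleC_complex_def minus_one_power_iff)
next
 case(4 X Y m i j g g')
 thus ?case by(intro tracialD[OF tracial_span[OF _ tracial_words]])
qed

end

section \<open>Coboundaries are characters of vanishing cycles\<close>

context cochain_data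
begin

text \<open>Multiplicative because \<open>mp\<close> is idempotent; its trace 1 returns the values
  of \<open>\<psi>\<close> unchanged.\<close>

definition wrho :: "'o => 'o => 'm =>('o,'m)word_space" where
 "wrho X Y f = word mp [(Y,f,X)]"

lemma rowfin_mp: "rowfin mp"
 using mp_wcoeffs[of 0] by(simp add:wcoeffs_def)

lemma wrho_semifunctor: "Hfun D(deg0 wsemicat)(%X. X)wrho"
proof(rule semifunctor_degree_zeroI)
 have a: "arr(Y,f,X)" if "X:obj D" "Y:obj D" "f:hom D X Y" for X Y f using that by(simp add:arr_def)
 show "X:obj wsemicat" if "X:obj D" for X using that by simp
 fix X Y assume X: "X:obj D" "Y:obj D"
 show "clin(hom D X Y)(wrho X Y)"
 proof -
  have "clin(hom D X Y)(%f. word mp([]@(Y,f,X)#[]))"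
  by(rule multi_slot[OF multi_word,of _ _ _ 0])
  (use a[OF X csub_0[OF D_subspace[OF X]]] rowfin_mp in \<open>simp add: wvalid_single\<close>)
  thus ?thesis by(simp add:wrho_def[abs_def])
 qed
 fix f assume f: "f:hom D X Y"
 show "wrho X Y f:ghom wsemicat X Y 0"
  unfolding wsemicat_simps wrho_def
  by(rule words_whom(1),rule wordsI) (use a[OF X f] rowfin_mp in \<open>simp_all add: wvalid_single\<close>)
 show "wrho X Y(act D X Y h f) = act wsemicat X Y h(wrho X Y f)" for h
  using wact_single[OF a[OF X f] rowfin_mp] by(simp add:wrho_def hact_def)
next
 fix X Y Z g f assume X: "X:obj D" "Y:obj D" "Z:obj D" and g: "g:hom D Y Z" and f: "f:hom D X Y"
 show "wrho X Z(comp D X Y Z g f) = comp wsemicat X Y Z(wrho Y Z g)(wrho X Y f)"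
  using wmul_single[of "(Z,g,Y)" "(Y,f,X)" mp mp] X g f rowfin_mp by(simp add:wrho_def arr_def acomp_def mp_mr)
qed

lemma wvalid_mp:
 assumes "wpath es"
 shows "wvalid mp es" "wvalid mr es" "wvalid(mm mp mr)es" "wvalid(mm mr mp)es"
proof -
 obtain l where l: "length es = Suc l" using assms by(cases es) (auto simp:wpath_def)
 show "wvalid mp es" "wvalid mr es" "wvalid(mm mp mr)es" "wvalid(mm mr mp)es"
  using assms mm_wcoeffs[of mp 0 mr l] mm_wcoeffs[of mr 0 mp l] mp_wcoeffs mr_wcoeffs by(simp_all add: wvalid_def l)
qed

lemma word_zero: "wpath es ==> word 0 es = 0"
 by(rule clin_zero[OF multi_coeff[OF multi_word] sub_wcoeffs])

text \<open>The identity arrow of \<open>theta\<close> that meets \<open>e\<close> is absorbed, the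
  other one remains as a separate letter.\<close>

lemma wdiff_rho:
 assumes e: "arr e"
 shows "wdiff(src e)(tgt e)(word mp [e]) = word(mm mr mp)[aident(tgt e),e]-word(mm mp mr)[e,aident(src e)]"
proof -
 have o: "src e:obj D" "tgt e:obj D" using e by(simp_all add: arr_def)
 have ve: "wvalid mp [e]" using e rowfin_mp by(simp add:wvalid_single)
 have "word mp [e]:wghom(src e)(tgt e) 0" by(rule words_whom(1),rule wordsI) (use ve in simp_all)
 from wdiff_eq[OF this] show ?thesis
  using wmul_word_split[of mr "[aident(tgt e)]" "aident(tgt e)" mp e "[]"] wmul_word_split[of mp "[]" e mr "aident(src e)" "[aident(src e)]"]
  wvalid_theta[OF o(1) mr_wcoeffs] wvalid_theta[OF o(2) mr_wcoeffs] ve aident(3)[OF o(1) e] aident(4)[OF o(2) e]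
  by(simp add:theta_def scaleC_one)
qed

lemma wmul_wdiff_rho:
 assumes e: "arr e" and p: "wpath(us@[d])" "src d = tgt e" and c: "wvalid c(us@[d])"
 shows "wmul(word c(us@[d]))(wdiff(src e)(tgt e)(word mp [e])) = word(mm c(mm mr mp))(us@[d,e])-word(mm c(mm mp mr))(us@[acomp d e,aident(src e)])"
proof -
 have o: "src e:obj D" "tgt e:obj D" using e by(simp_all add: arr_def)
 have d: "arr d" using p(1) by(simp add:wpath_snoc)
 have v: "wvalid(mm mr mp)(aident(tgt e)#[e])" "wvalid(mm mp mr)(e#[aident(src e)])"
  by(rule wvalid_mp; use e o in \<open>simp add: wpath_Cons aident\<close>)+
 have "acomp d(aident(tgt e)) = d" by(rule aident(3)[OF o(2) d p(2)])
 hence "wmul(word c(us@[d]))(word(mm mr mp)[aident(tgt e),e]) = word(mm c(mm mr mp))(us@[d,e])"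
  using wmul_word_split[OF c v(1)] p(2) by simp
 moreover have "wmul(word c(us@[d]))(word(mm mp mr)[e,aident(src e)]) = word(mm c(mm mp mr))(us@[acomp d e,aident(src e)])"
  using wmul_word_split[OF c v(2) p(2)] by simp
 ultimately show ?thesis
  unfolding wdiff_rho[OF e] by(simp add:clin_diff[OF lin_wmul_right])
qed

section \<open>The character of the cycle of words\<close>

context
 fixes n :: nat and Xs :: "'o list" and fs :: "'m list"
 assumes cc: "cchain D n Xs fs"
begin

definition chain_arrow :: "nat =>('o,'m)arrow" where
 "chain_arrow i = (cnth Xs i,fs!i,cnth Xs(Suc i))"

abbreviation(input) EE :: "nat => nat =>('o,'m)arrow list" where
 "EE a b == map chain_arrow [a..<b]"

text \<open>The path in which the arrows \<open>j\<close> and \<open>j + 1\<close> have been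
  composed, among the first \<open>i + 1\<close> arrows after the initial one; it is the inner face
  of a chain when \<open>i\<close> is maximal.\<close>

definition face_path :: "nat => nat =>('o,'m)arrow list" where
 "face_path i j = EE 0 j@acomp(chain_arrow j)(chain_arrow(Suc j))#EE(Suc(Suc j))(Suc i)"

lemma chain_arrow_simps [simp]: "tgt(chain_arrow i) = cnth Xs i" "src(chain_arrow i) = cnth Xs(Suc i)" "mor(chain_arrow i) = fs!i"
 by(simp_all add: chain_arrow_def)

lemma arr_chain_arrow: "i<=n ==> arr(chain_arrow i)"
 using cchain_obj[OF cc] cchain_nth[OF cc] by(simp add:arr_def)

lemma wpath_EE: "a<b ==> b<=Suc n ==> wpath(EE a b)"
 by(rule wpathI) (auto simp:arr_chain_arrow)

lemma wpath_face_path: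
 assumes "j<i" "i<=n"
 shows "wpath(face_path i j)"
proof -
 have "src(last(EE 0 j)) = cnth Xs j" if "0<j" using that by(cases j) simp_all
 moreover have "tgt(hd(EE(Suc(Suc j))(Suc i))) = cnth Xs(Suc(Suc j))" if "Suc(Suc j)<Suc i"
  using that by(simp add:upt_conv_Cons del:upt_Suc)
 moreover have "arr(acomp(chain_arrow j)(chain_arrow(Suc j)))" using assms by(intro arr_acomp arr_chain_arrow) simp_all
 ultimately show ?thesis
  unfolding face_path_def wpath_split using assms wpath_EE[of 0 j] wpath_EE[of "Suc(Suc j)" "Suc i"]
  by(cases "j = 0"; cases "Suc(Suc j)<Suc i") (simp_all del:upt_Suc)
qed

lemma src_last_face_path: "j<i ==> src(last(face_path i j)) = cnth Xs(Suc i)"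
 by(cases "Suc j = i") (simp_all add: face_path_def)

lemma face_path_Suc: "j<i ==> face_path(Suc i)j = face_path i j@[chain_arrow(Suc i)]"
 by(simp add:face_path_def)

text \<open>Appending \<open>d\<rho>(f)\<close> to the full word continues it, since
  \<open>mp mr mp = mp\<close>, and creates one new face word. A face word is only prolonged,
  because \<open>(mp mr)(mr mp) = 0\<close> and \<open>mp mr\<close> is idempotent. Each
  prolongation contributes a sign.\<close>

lemma char_form_words:
 "i<=n ==> char_form wsemicat(%X. X)wrho Xs fs i = word mp(EE 0(Suc i))+(\<Sum>j<i.(- 1) ^ (i-j)*.word(mm mp mr)(face_path i j@[aident(cnth Xs(Suc i))]))"
proof(induction i)
 case 0
 have "length Xs = Suc n" using cchain_length[OF cc] by simp
 thus ?case by(simp add:wrho_def chain_arrow_def)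
next
 case(Suc i)
 let ?e = "chain_arrow(Suc i)" and ?Y = "cnth Xs(Suc i)" and ?X = "cnth Xs(Suc(Suc i))"
 have e: "arr ?e" using Suc.prems by(rule arr_chain_arrow)
 have i: "i<=n" "Suc i<=Suc n" using Suc.prems by simp_all
 have Y: "?Y:obj D" by(rule cchain_obj[OF cc])
 let ?d = "wdiff(src ?e)(tgt ?e)(word mp [?e])"
 have p0: "wpath(EE 0 i@[chain_arrow i])" using wpath_EE[of 0 "Suc i"] i by simp
 have 1: "wmul(word mp(EE 0(Suc i))) ?d = word mp(EE 0(Suc(Suc i)))-word(mm mp mr)(face_path(Suc i)i@[aident ?X])"
  using wmul_wdiff_rho[OF e p0 _ wvalid_mp(1)[OF p0]] by(simp add:mp_mr face_path_def)
 \<comment> \<open>The trailing identity arrow is absorbed by the new arrow, and a new identity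
   arrow takes its place.\<close>
 have 2: "wmul(word(mm mp mr)(face_path i j@[aident ?Y])) ?d = - word(mm mp mr)(face_path(Suc i)j@[aident ?X])"
  if j: "j<i" for j
 proof -
  have p: "wpath(face_path i j@[aident ?Y])"
  unfolding wpath_snoc using wpath_face_path[OF j i(1)] src_last_face_path[OF j] aident(1)[OF Y] by simp
  have p': "wpath(face_path i j@[aident ?Y,?e])"
  using p e unfolding wpath_split[of "face_path i j" "aident ?Y" "[?e]"] wpath_snoc by(simp add:wpath_Cons)
  have "acomp(aident ?Y) ?e = ?e" by(rule aident(4)[OF Y e]) simp
  thus ?thesis
  using wmul_wdiff_rho[OF e p _ wvalid_mp(3)[OF p]] word_zero[OF p'] by(simp add:mp_mr face_path_Suc[OF j])
 qed
 have "char_form wsemicat(%X. X)wrho Xs fs(Suc i) = wmul(char_form wsemicat(%X. X)wrho Xs fs i) ?d"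
  by(simp add:Let_def wrho_def chain_arrow_def)
 also have "... = word mp(EE 0(Suc(Suc i)))-word(mm mp mr)(face_path(Suc i)i@[aident ?X])+(\<Sum>j<i.(- 1) ^ (i-j) *.(- word(mm mp mr)(face_path(Suc i)j@[aident ?X])))"
  unfolding Suc.IH[OF i(1)] clin_add[OF lin_wmul_left UNIV_I UNIV_I] 1
  clin_sum[OF lin_wmul_left csub_UNIV UNIV_I] clin_scale[OF lin_wmul_left UNIV_I]
  by(rule arg_cong2[where f = "(+)",OF refl],rule sum.cong[OF refl],simp only: lessThan_iff 2)
 also have "(\<Sum>j<i.(- 1) ^ (i-j) *.(- word(mm mp mr)(face_path(Suc i)j@[aident ?X]))) = (\<Sum>j<i.(- 1) ^ (Suc i-j)*.word(mm mp mr)(face_path(Suc i)j@[aident ?X]))"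
  by(rule sum.cong) (simp_all add: Suc_diff_le scale_simps)
 finally show ?case by(simp add:scale_simps scaleC_one)
qed

lemma wclosed_chain_path: "wclosed(EE 0(Suc n))"
proof -
 have "cnth Xs(Suc n) = cnth Xs 0" using cchain_length[OF cc] by simp
 moreover have "hd(EE 0(Suc n)) = chain_arrow 0" by(simp add:upt_conv_Cons del:upt_Suc)
 moreover have "last(EE 0(Suc n)) = chain_arrow n" by simp
 ultimately show ?thesis using wpath_EE[of 0 "Suc n"] by(simp add:wclosed_def del:upt_Suc)
qed

lemma wclosed_face_path:
 assumes "j<n"
 shows "wclosed(face_path n j)"
proof -
 have "tgt(hd(face_path n j)) = cnth Xs 0" by(cases j) (simp_all add: face_path_def upt_conv_Cons del:upt_Suc)
 moreover have "cnth Xs(Suc n) = cnth Xs 0" using cchain_length[OF cc] by simp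
 ultimately show ?thesis
  using wpath_face_path[OF assms] src_last_face_path[OF assms] by(simp add:wclosed_def)
qed

lemma map_cyc_nth: "b<=length Xs ==> map(cnth Xs)[a..<b] = drop a(take b Xs)"
 by(rule nth_equalityI) auto

lemma map_nth_fs: "b<=length fs ==> map((!)fs)[a..<b] = drop a(take b fs)"
 by(rule nth_equalityI) auto

lemma map_EE: "b<=Suc n ==> map tgt(EE a b) = drop a(take b Xs)" "b<=Suc n ==> map mor(EE a b) = drop a(take b fs)"
 using map_cyc_nth[of b a] map_nth_fs[of b a] cchain_length[OF cc] by(simp_all add: o_def)

end

end

context cyclic_cochain_data
begin

text \<open>The full word accounts for the last face, the face words for the inner ones. The sign of
  the trace and the signs of \<open>char_form_words\<close> combine to
  \<open>(- 1) ^ j\<close>.\<close>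

theorem character_wsemicat: "character D(Suc k)wsemicat(%X. wtr)(%X. X)wrho = codiff H M D k \<psi>"
proof(intro ext)
 fix m Xs fs
 show "character D(Suc k)wsemicat(%X. wtr)(%X. X)wrho m Xs fs = codiff H M D k \<psi> m Xs fs"
 proof(cases "cchain D(Suc k)Xs fs")
  case False
  thus ?thesis by(simp add:character_def codiff_def face_def)
 next
  case cc: True
  note len = cchain_length[OF cc]
  let ?E = "chain_arrow Xs fs" and ?fp = "face_path Xs fs(Suc k)" and ?X = "cnth Xs(Suc(Suc k))"
  note tm = map_EE[OF cc]
  have last: "wtr m(word mp(map ?E [0..<Suc(Suc k)])) = (- 1) ^ Suc k * face H M D(Suc k)(Suc k) \<psi> m Xs fs"
  proof -
  have es: "map ?E [0..<Suc(Suc k)] = ?E 0#map ?E [Suc 0..<Suc k]@[?E(Suc k)]"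
  proof -
  have "[0..<Suc(Suc k)] = 0#[Suc 0..<Suc k]@[Suc k]"
  by(subst upt_conv_Cons,simp,subst upt_Suc_append,simp,rule refl)
  thus ?thesis by(simp del:upt_Suc)
  qed
  have "Psi m0(acomp(hact z(?E(Suc k)))(?E 0)#map ?E [Suc 0..<Suc k]) = \<psi> m0(Xs!Suc k#take k(tl Xs))(comp D(Xs!1)(Xs!0)(Xs!Suc k)(act D(Xs!0)(Xs!Suc k)z(fs!Suc k))(fs!0)#take k(tl fs))" for m0 z
  unfolding Psi_def list.map tm[OF le_SucI[OF order_refl]]
  using len by(simp add:acomp_def hact_def chain_arrow_def[OF cc] drop_Suc tl_take)
  hence "tau m(map ?E [0..<Suc(Suc k)]) = face H M D(Suc k)(Suc k) \<psi> m Xs fs"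
  unfolding es tau_def wrap_split face_def using cc by simp
  thus ?thesis using wclosed_chain_path[OF cc] by(simp add:wtr_word mtr_mp del:upt_Suc)
  qed
  \<comment> \<open>The face words end in an identity arrow, so \<open>tau_aident\<close> returns
    \<open>\<psi>\<close> at the face; the coefficient \<open>mp mr\<close> has trace 1.\<close>
  have faces: "wtr m(word(mm mp mr)(?fp j@[aident ?X])) = (- 1) ^ Suc k * face H M D(Suc k)j \<psi> m Xs fs" if j: "j<Suc k" for j
  proof -
  note cl = wclosed_face_path[OF cc j] and s = src_last_face_path[OF cc j]
  have l: "length(?fp j) = Suc k" using j by(simp add:face_path_def[OF cc] del:upt_Suc)
  have "take(Suc j)Xs = take j Xs@[Xs!j]" using j len by(simp add:take_Suc_conv_app_nth)
  hence "Psi m(?fp j) = face H M D(Suc k)j \<psi> m Xs fs"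
  unfolding Psi_def face_path_def[OF cc] map_append list.map tm[OF order_refl] tm[OF less_imp_le_nat[OF less_SucI[OF j]]] face_def
  using j len cc by(simp add:acomp_def chain_arrow_def[OF cc])
  thus ?thesis
  using wclosed_aident[OF cl s] tau_aident[OF cl l s] l by(simp add:wtr_word mtr_mp)
  qed
  have "character D(Suc k)wsemicat(%X. wtr)(%X. X)wrho m Xs fs = wtr m(word mp(map ?E [0..<Suc(Suc k)]))+(\<Sum>j<Suc k.(- 1) ^ (Suc k-j) * wtr m(word(mm mp mr)(?fp j@[aident ?X])))"
  unfolding character_def char_form_words[OF cc order_refl] using cc
  by(simp only: if_True clin_add[OF lin_wtr UNIV_I UNIV_I] clin_sum[OF lin_wtr csub_UNIV UNIV_I]
  clin_scale[OF lin_wtr UNIV_I] scaleC_complex_def)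
  also have "(\<Sum>j<Suc k.(- 1) ^ (Suc k-j) * wtr m(word(mm mp mr)(?fp j@[aident ?X]))) = (\<Sum>j<Suc k.(- 1) ^ j * face H M D(Suc k)j \<psi> m Xs fs)"
  proof(rule sum.cong[OF refl])
  fix j assume "j:{..<Suc k}"
  hence j: "j<Suc k" by simp
  have "(- 1) ^ (Suc k-j)*(- 1) ^ Suc k = ((- 1) ^ j :: complex)" using j by(auto simp:minus_one_power_iff)
  thus "(- 1) ^ (Suc k-j) * wtr m(word(mm mp mr)(?fp j@[aident ?X])) = (- 1) ^ j * face H M D(Suc k)j \<psi> m Xs fs"
  unfolding faces[OF j] by(metis mult.assoc)
  qed
  also have "wtr m(word mp(map ?E [0..<Suc(Suc k)])) + ... = (\<Sum>j\<le>Suc k.(- 1) ^ j * face H M D(Suc k)j \<psi> m Xs fs)"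
  unfolding last lessThan_Suc_atMost[symmetric] sum.lessThan_Suc[of _ "Suc k"] by(simp only: add.commute)
  finally show ?thesis by(simp add:codiff_def)
 qed
qed

end

context cochain_data
begin

theorem coboundary_vanishing_cycle_character:
 assumes "\<phi>:coboundaries H M D n"
 shows "vanishing_cycle_character TYPE('o)TYPE(('o,'m)word_space)H M D n \<phi>"
proof(cases n)
 case 0
 \<comment> \<open>The only coboundary in degree zero is 0, so the same semicategory with the zero
   trace serves.\<close>
 have "cgtrace H M wsemicat 0(%X m x. 0)"
  by(auto simp:cgtrace_def cbil_def clin_const_zero tlift_zero_fun)
 hence "is_cycle H M D 0 wsemicat(%X m x. 0)(%X. X)wrho"
  unfolding is_cycle_def using wsemicat_DGH wrho_semifunctor by blast
 moreover have "\<phi> = character D 0 wsemicat(%X m x. 0)(%X. X)wrho"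
  using assms 0 by(auto simp:character_def fun_eq_iff)
 ultimately show ?thesis
  unfolding vanishing_cycle_character_def 0 using wsemicat_vanishing by blast
next
 case(Suc k)
 then obtain \<psi> where \<psi>: "\<psi>:cyclic_cochains H M D k" "\<phi> = codiff H M D k \<psi>" using assms by auto
 interpret cyclic_cochain_data H M D k \<psi> by unfold_locales(rule \<psi>(1))
 have "is_cycle H M D(Suc k)wsemicat(%X. wtr)(%X. X)wrho"
  unfolding is_cycle_def using wsemicat_DGH wrho_semifunctor wsemicat_trace by blast
 thus ?thesis
  unfolding vanishing_cycle_character_def Suc \<psi>(2) character_wsemicat[symmetric] using wsemicat_vanishing by blast
qed

lemma vanishing_cycle_coboundary:
 assumes "vanishing_cycle_character TYPE('q)TYPE('d::complex_vector)H M D n \<phi>"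
 shows "\<phi>:coboundaries H M D n"
proof -
 obtain C :: "('q,'d,'h)dghsemicat" and T Fo \<rho> where
  c: "is_cycle H M D n C T Fo \<rho>" "vanishing H C" and \<phi>: "\<phi> = character D n C T Fo \<rho>"
  using assms unfolding vanishing_cycle_character_def by blast
 show ?thesis unfolding \<phi> by(rule vanishing_cycle_character_coboundary[OF c])
qed

end

text \<open>The first conjunct exhibits cycles in one fixed pair of types; the second admits cycles
  in arbitrary types. Together they express the equivalence for cycles of any kind.\<close>

theorem proposition7p11:
  fixes H :: "'h::complex_algebra_1 hopf"
    and M :: "('h, 'v::complex_vector) sayd"
    and D :: "('o, 'm::complex_vector, 'h) hsemicat"
    and n :: nat
    and \<phi> :: "('o, 'm, 'v) cochain"
  assumes "hopf_algebra H" and "bij (antipode H)"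
    and "sayd_module H M"
    and "left_H_category H D"
    and "\<phi> \<in> cochains H M D n"
  shows "(\<phi> \<in> coboundaries H M D n \<longleftrightarrow>
            vanishing_cycle_character TYPE('o) TYPE(('o, 'm) word_space) H M D n \<phi>) \<and>
         (vanishing_cycle_character TYPE('p) TYPE('c::complex_vector) H M D n \<phi> \<longrightarrow>
            \<phi> \<in> coboundaries H M D n)"
proof -
  interpret cochain_data H M D
    by unfold_locales (rule assms)+
  show ?thesis
    using coboundary_vanishing_cycle_character[of \<phi> n]
      vanishing_cycle_coboundary[where ?'q='o and ?'d="('o, 'm) word_space", of n \<phi>]
      vanishing_cycle_coboundary[where ?'q='p and ?'d='c, of n \<phi>]
    by blast
qed

end
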